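(* Let $d=4$, $0<T<\infty$, $\nu>0$, $\kappa>0$, and let $\Omega\subset\mathbb{R}^d$ be a bounded domain with boundary $\partial\Omega$ of class $C^2$. Let $$\frac{2d}{d+2}<p<\frac d2,\qquad\text{i.e. } \frac43<p<2,$$ and $p'=p/(p-1)$. Assume that $$\boldsymbol v_0\in\mathbf V\cap\mathbf V_p,\qquad \boldsymbol f\in L^{p'}(0,T;L^{p'}(\Omega)^d).$$ Then there exists at least one weak solution $\boldsymbol v\in C([0,T];\mathbf V)\cap L^p(0,T;\mathbf V_p)$ to the generalised Navier-Stokes-Voigt problem with data $\boldsymbol v_0$, $\boldsymbol f$ (problem and notion of weak solution as defined in the context).
   Context: Notation. $Q_T:=\Omega\times(0,T)$, $\Gamma_T:=\partial\Omega\times(0,T)$. $\mathbf D(\boldsymbol v):=\frac12(\nabla\boldsymbol v+(\nabla\boldsymbol v)^{\top})$. Let $\mathcal V:=\{\boldsymbol v\in C_0^\infty(\Omega)^d:\ \nabla\cdot\boldsymbol v=0\}$. $\mathbf V_p$ is the closure of $\mathcal V$ in $W^{1,p}(\Omega)^d$, and $\mathbf V:=\mathbf V_2$, endowed with the equivalent norm $\|\boldsymbol v\|_{\mathbf V}=\|\nabla\boldsymbol v\|_2$. Problem. The generalised Navier-Stokes-Voigt problem is: find a velocity $\boldsymbol v$ and pressure $\pi$ with $$\partial_t(\boldsymbol v-\kappa\Delta\boldsymbol v)+\operatorname{\mathbf{div}}(\boldsymbol v\otimes\boldsymbol v)+\nabla\pi-\nu\operatorname{\mathbf{div}}\big(|\mathbf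 D(\boldsymbol v)|^{p-2}\mathbf D(\boldsymbol v)\big)=\boldsymbol f\ \text{ in }Q_T,\qquad \operatorname{div}\boldsymbol v=0\ \text{ in }Q_T,$$ $$\boldsymbol v=\boldsymbol v_0\ \text{ in }\Omega\times\{0\},\qquad \boldsymbol v=\boldsymbol 0\ \text{ on }\Gamma_T.$$ Weak solution. For $\boldsymbol f\in L^1(Q_T)^d$, $\boldsymbol v_0\in\mathbf V$, $p>1$, a function $\boldsymbol v$ is a weak solution of this problem if: (1) $\boldsymbol v\in L^\infty(0,T;\mathbf V)\cap L^p(0,T;\mathbf V_p)$; (2) $\partial_t\boldsymbol v\in L^2(0,T;\mathbf V)$; (3) $\boldsymbol v(0)=\boldsymbol v_0$, in the sense that $\lim_{t\to0^+}\int_\Omega\boldsymbol v(t)\cdot\boldsymbol\psi\,dx=\int_\Omega\boldsymbol v_0\cdot\boldsymbol\psi\,dx$ for all $\boldsymbol\psi\in\mathcal V$; (4) for every smooth vector field $\boldsymbol\varphi$ with $\operatorname{div}\boldsymbol\varphi=0$ and $\operatorname{supp}\boldsymbol\varphi$ compactly contained in $\Omega\times[0,T)$, $$-\int_0^T\!\!\int_\Omega\boldsymbol v\cdot\partial_t\boldsymbol\varphi\,dx\,dt-\kappa\int_0^T\!\!\int_\Omega\nabla\boldsymbol v:\nabla\partial_t\boldsymbol\varphi\,dx\,dt+\nu\int_0^T\!\!\int_\Omega|\mathbf D(\boldsymbol v)|^{p-2}\mathbf D(\boldsymbol v):\mathbf D(\boldsymbol\varphi)\,dx\,dt$$ $$=\int_\Omega\boldsymbol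 v_0\cdot\boldsymbol\varphi(0)\,dx+\kappa\int_\Omega\nabla\boldsymbol v_0:\nabla\boldsymbol\varphi(0)\,dx+\int_0^T\!\!\int_\Omega\boldsymbol f\cdot\boldsymbol\varphi\,dx\,dt+\int_0^T\!\!\int_\Omega\boldsymbol v\otimes\boldsymbol v:\nabla\boldsymbol\varphi\,dx\,dt.$$ *)

theory Defs
  imports "HOL-Analysis.Analysis"
begin

text \<open>
  Elements of Lebesgue and Sobolev spaces over a set \<open>\<Omega>\<close> are represented by functions on the
  whole space.  Their values off \<open>\<Omega>\<close> are irrelevant, and functions that agree almost everywhere
  on \<open>\<Omega>\<close> represent the same element, so that the norms below are seminorms on representatives.
\<close>

section \<open>Differentiable functions and domains\<close>

primrec Ck :: "nat \<Rightarrow> ('a::euclidean_space \<Rightarrow> 'b::real_normed_vector) \<Rightarrow> bool" where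
  "Ck 0 f \<longleftrightarrow> continuous_on UNIV f"
| "Ck (Suc k) f \<longleftrightarrow>
     (\<forall>x. f differentiable (at x)) \<and> (\<forall>u. Ck k (\<lambda>x. frechet_derivative f (at x) u))"

definition smooth :: "('a::euclidean_space \<Rightarrow> 'b::real_normed_vector) \<Rightarrow> bool" where
  "smooth f \<longleftrightarrow> (\<forall>k. Ck k f)"

definition test_function :: "'a::euclidean_space set \<Rightarrow> ('a \<Rightarrow> 'b::real_normed_vector) \<Rightarrow> bool" where
  "test_function S f \<longleftrightarrow>
     smooth f \<and> compact (closure {x. f x \<noteq> 0}) \<and> closure {x. f x \<noteq> 0} \<subseteq> S"

text \<open>
  Near each boundary point, \<open>\<Omega>\<close> is the set of points strictly above the graph of a \<open>C\<^sup>2\<close> function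
  over the hyperplane orthogonal to a unit vector \<open>e\<close>; the choice of \<open>e\<close> replaces the
  rotation of the coordinate axes.  Only the values of \<open>\<gamma>\<close> on that hyperplane matter.
\<close>

definition C2_boundary :: "'a::euclidean_space set \<Rightarrow> bool" where
  "C2_boundary \<Omega> \<longleftrightarrow>
     (\<forall>x0\<in>frontier \<Omega>. \<exists>r>0. \<exists>e. \<exists>\<gamma>::'a \<Rightarrow> real.
        norm e = 1 \<and> Ck 2 \<gamma> \<and>
        \<Omega> \<inter> ball x0 r = {x \<in> ball x0 r. \<gamma> (x - (x \<bullet> e) *\<^sub>R e) < x \<bullet> e})"

definition bounded_C2_domain :: "'a::euclidean_space set \<Rightarrow> bool" where
  "bounded_C2_domain \<Omega> \<longleftrightarrow>
     \<Omega> \<noteq> {} \<and> open \<Omega> \<and> connected \<Omega> \<and> bounded \<Omega> \<and> C2_boundary \<Omega>"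

definition divergence :: "(real^'n \<Rightarrow> real^'n) \<Rightarrow> real^'n \<Rightarrow> real" where
  "divergence u x = trace (jacobian u (at x))"

definition sym_part :: "real^'n^'n \<Rightarrow> real^'n^'n" where
  "sym_part A = (1/2) *\<^sub>R (A + transpose A)"

definition tensor :: "real^'n \<Rightarrow> real^'n \<Rightarrow> real^'n^'n" where
  "tensor a b = (\<chi> i j. a $ i * b $ j)"

section \<open>Lebesgue and Sobolev spaces\<close>

definition Lp_space :: "real \<Rightarrow> 'a::euclidean_space set \<Rightarrow> ('a \<Rightarrow> 'b::euclidean_space) set" where
  "Lp_space p \<Omega> =
     {f. f \<in> borel_measurable (lebesgue_on \<Omega>) \<and>
         integrable (lebesgue_on \<Omega>) (\<lambda>x. norm (f x) powr p)}"

definition Lp_norm :: "real \<Rightarrow> 'a::euclidean_space set \<Rightarrow> ('a \<Rightarrow> 'b::euclidean_space) \<Rightarrow> real" where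
  "Lp_norm p \<Omega> f = (LINT x|lebesgue_on \<Omega>. norm (f x) powr p) powr (1 / p)"

definition is_weak_gradient ::
    "(real^'n) set \<Rightarrow> (real^'n \<Rightarrow> real^'n) \<Rightarrow> (real^'n \<Rightarrow> real^'n^'n) \<Rightarrow> bool" where
  "is_weak_gradient \<Omega> u G \<longleftrightarrow>
     (\<forall>K. compact K \<and> K \<subseteq> \<Omega> \<longrightarrow> u absolutely_integrable_on K \<and> G absolutely_integrable_on K) \<and>
     (\<forall>\<eta>::real^'n \<Rightarrow> real. test_function \<Omega> \<eta> \<longrightarrow>
        (\<forall>i j. (LINT x|lebesgue_on \<Omega>. u x $ i * frechet_derivative \<eta> (at x) (axis j 1)) =
               - (LINT x|lebesgue_on \<Omega>. G x $ i $ j * \<eta> x)))"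

text \<open>Weak gradients are unique up to null sets; an arbitrary representative is chosen.\<close>

definition weak_gradient ::
    "(real^'n) set \<Rightarrow> (real^'n \<Rightarrow> real^'n) \<Rightarrow> real^'n \<Rightarrow> real^'n^'n" where
  "weak_gradient \<Omega> u = (SOME G. is_weak_gradient \<Omega> u G)"

definition W1p_space :: "real \<Rightarrow> (real^'n) set \<Rightarrow> (real^'n \<Rightarrow> real^'n) set" where
  "W1p_space p \<Omega> =
     {u. u \<in> Lp_space p \<Omega> \<and> (\<exists>G. is_weak_gradient \<Omega> u G \<and> G \<in> Lp_space p \<Omega>)}"

definition W1p_norm :: "real \<Rightarrow> (real^'n) set \<Rightarrow> (real^'n \<Rightarrow> real^'n) \<Rightarrow> real" where
  "W1p_norm p \<Omega> u =
     (Lp_norm p \<Omega> u powr p + Lp_norm p \<Omega> (weak_gradient \<Omega> u) powr p) powr (1 / p)"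

definition solenoidal_test :: "(real^'n) set \<Rightarrow> (real^'n \<Rightarrow> real^'n) set" where
  "solenoidal_test \<Omega> = {\<psi>. test_function \<Omega> \<psi> \<and> (\<forall>x\<in>\<Omega>. divergence \<psi> x = 0)}"

definition Vp_space :: "real \<Rightarrow> (real^'n) set \<Rightarrow> (real^'n \<Rightarrow> real^'n) set" where
  "Vp_space p \<Omega> =
     {u \<in> W1p_space p \<Omega>.
        \<forall>\<epsilon>>0. \<exists>\<psi>\<in>solenoidal_test \<Omega>. W1p_norm p \<Omega> (\<lambda>x. u x - \<psi> x) < \<epsilon>}"

abbreviation V_space :: "(real^'n) set \<Rightarrow> (real^'n \<Rightarrow> real^'n) set" where
  "V_space \<equiv> Vp_space 2"

definition V_norm :: "(real^'n) set \<Rightarrow> (real^'n \<Rightarrow> real^'n) \<Rightarrow> real" where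
  "V_norm \<Omega> u = Lp_norm 2 \<Omega> (weak_gradient \<Omega> u)"

section \<open>Bochner spaces over a time interval\<close>

text \<open>
  The Banach space is a set \<open>X\<close> of functions with seminorm \<open>N\<close>.  Since \<open>X\<close> is not a type,
  measurability and integrals are built from \<open>X\<close>-valued simple functions in the same way as in
  the library.  The measure \<open>M\<close> is always Lebesgue measure on a bounded interval, so simple
  functions need no condition on the measure of their support.
\<close>

definition simple_into :: "'t measure \<Rightarrow> ('a \<Rightarrow> 'b) set \<Rightarrow> ('t \<Rightarrow> 'a \<Rightarrow> 'b) \<Rightarrow> bool" where
  "simple_into M X s \<longleftrightarrow> simple_function M s \<and> s ` space M \<subseteq> X"

definition simple_integral_into ::
    "'t measure \<Rightarrow> ('t \<Rightarrow> 'a \<Rightarrow> 'b::real_vector) \<Rightarrow> 'a \<Rightarrow> 'b" where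
  "simple_integral_into M s =
     (\<lambda>x. \<Sum>y\<in>s ` space M. measure M {t \<in> space M. s t = y} *\<^sub>R y x)"

definition strongly_measurable ::
    "'t measure \<Rightarrow> ('a \<Rightarrow> 'b::real_vector) set \<Rightarrow> (('a \<Rightarrow> 'b) \<Rightarrow> real) \<Rightarrow> ('t \<Rightarrow> 'a \<Rightarrow> 'b) \<Rightarrow> bool" where
  "strongly_measurable M X N g \<longleftrightarrow>
     (AE t in M. g t \<in> X) \<and>
     (\<exists>s. (\<forall>n. simple_into M X (s n)) \<and>
          (AE t in M. (\<lambda>n. N (\<lambda>x. s n t x - g t x)) \<longlonglongrightarrow> 0))"

definition has_integral_into ::
    "'t measure \<Rightarrow> ('a \<Rightarrow> 'b::real_vector) set \<Rightarrow> (('a \<Rightarrow> 'b) \<Rightarrow> real) \<Rightarrow>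
     ('t \<Rightarrow> 'a \<Rightarrow> 'b) \<Rightarrow> ('a \<Rightarrow> 'b) \<Rightarrow> bool" where
  "has_integral_into M X N g I \<longleftrightarrow>
     strongly_measurable M X N g \<and> I \<in> X \<and>
     (\<exists>s. (\<forall>n. simple_into M X (s n)) \<and>
          (\<lambda>n. \<integral>\<^sup>+t. ennreal (N (\<lambda>x. s n t x - g t x)) \<partial>M) \<longlonglongrightarrow> 0 \<and>
          (\<lambda>n. N (\<lambda>x. simple_integral_into M (s n) x - I x)) \<longlonglongrightarrow> 0)"

definition Bochner_Lp ::
    "real \<Rightarrow> real \<Rightarrow> ('a \<Rightarrow> 'b::real_vector) set \<Rightarrow> (('a \<Rightarrow> 'b) \<Rightarrow> real) \<Rightarrow> (real \<Rightarrow> 'a \<Rightarrow> 'b) set" where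
  "Bochner_Lp q T X N =
     {g. strongly_measurable (lebesgue_on {0<..<T}) X N g \<and>
         integrable (lebesgue_on {0<..<T}) (\<lambda>t. N (g t) powr q)}"

definition Bochner_Linf ::
    "real \<Rightarrow> ('a \<Rightarrow> 'b::real_vector) set \<Rightarrow> (('a \<Rightarrow> 'b) \<Rightarrow> real) \<Rightarrow> (real \<Rightarrow> 'a \<Rightarrow> 'b) set" where
  "Bochner_Linf T X N =
     {g. strongly_measurable (lebesgue_on {0<..<T}) X N g \<and>
         (\<exists>C. AE t in lebesgue_on {0<..<T}. N (g t) \<le> C)}"

definition continuous_into ::
    "real \<Rightarrow> ('a \<Rightarrow> 'b::real_vector) set \<Rightarrow> (('a \<Rightarrow> 'b) \<Rightarrow> real) \<Rightarrow> (real \<Rightarrow> 'a \<Rightarrow> 'b) set" where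
  "continuous_into T X N =
     {g. \<forall>t\<in>{0..T}. g t \<in> X \<and>
           ((\<lambda>s. N (\<lambda>x. g s x - g t x)) \<longlongrightarrow> 0) (at t within {0..T})}"

definition is_weak_time_derivative ::
    "real \<Rightarrow> ('a \<Rightarrow> 'b::real_vector) set \<Rightarrow> (('a \<Rightarrow> 'b) \<Rightarrow> real) \<Rightarrow>
     (real \<Rightarrow> 'a \<Rightarrow> 'b) \<Rightarrow> (real \<Rightarrow> 'a \<Rightarrow> 'b) \<Rightarrow> bool" where
  "is_weak_time_derivative T X N g h \<longleftrightarrow>
     (\<forall>\<eta>::real \<Rightarrow> real. test_function {0<..<T} \<eta> \<longrightarrow>
        (\<exists>I. has_integral_into (lebesgue_on {0<..<T}) X N (\<lambda>t x. deriv \<eta> t *\<^sub>R g t x) I \<and>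
             has_integral_into (lebesgue_on {0<..<T}) X N (\<lambda>t x. - (\<eta> t *\<^sub>R h t x)) I))"

section \<open>Weak solutions\<close>

definition time_deriv :: "(real \<Rightarrow> real^'n \<Rightarrow> real^'n) \<Rightarrow> real \<Rightarrow> real^'n \<Rightarrow> real^'n" where
  "time_deriv \<phi> t x = vector_derivative (\<lambda>s. \<phi> s x) (at t)"

text \<open>
  Smoothness up to the initial time is expressed by a smooth extension to all of space-time; the
  values at negative times play no role elsewhere, in particular not for the support.
\<close>

definition spacetime_test :: "(real^'n) set \<Rightarrow> real \<Rightarrow> (real \<Rightarrow> real^'n \<Rightarrow> real^'n) set" where
  "spacetime_test \<Omega> T =
     {\<phi>. smooth (\<lambda>(t, x). \<phi> t x) \<and>
         (\<forall>t\<in>{0..<T}. \<forall>x\<in>\<Omega>. divergence (\<phi> t) x = 0) \<and>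
         compact (closure {(t, x). 0 \<le> t \<and> \<phi> t x \<noteq> 0}) \<and>
         closure {(t, x). 0 \<le> t \<and> \<phi> t x \<noteq> 0} \<subseteq> {0..<T} \<times> \<Omega>}"

text \<open>
  The inner product of \<^typ>\<open>real^'n^'n\<close> is the contraction \<open>A : B\<close> and its norm is the Frobenius
  norm.  At \<open>A = 0\<close> the term \<open>norm A powr (p - 2) *\<^sub>R A\<close> is \<open>0\<close>, the usual convention for \<open>p < 2\<close>.
\<close>

definition stress :: "real \<Rightarrow> real^'n^'n \<Rightarrow> real^'n^'n" where
  "stress p A = norm A powr (p - 2) *\<^sub>R A"

definition weak_solution ::
    "(real^'n) set \<Rightarrow> real \<Rightarrow> real \<Rightarrow> real \<Rightarrow> real \<Rightarrow> (real \<Rightarrow> real^'n \<Rightarrow> real^'n) \<Rightarrow>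
     (real^'n \<Rightarrow> real^'n) \<Rightarrow> (real \<Rightarrow> real^'n \<Rightarrow> real^'n) \<Rightarrow> bool" where
  "weak_solution \<Omega> T \<nu> \<kappa> p f v0 v \<longleftrightarrow>
     v \<in> Bochner_Linf T (V_space \<Omega>) (V_norm \<Omega>) \<and>
     v \<in> Bochner_Lp p T (Vp_space p \<Omega>) (W1p_norm p \<Omega>) \<and>
     (\<exists>w\<in>Bochner_Lp 2 T (V_space \<Omega>) (V_norm \<Omega>).
        is_weak_time_derivative T (V_space \<Omega>) (V_norm \<Omega>) v w) \<and>
     (\<forall>\<psi>\<in>solenoidal_test \<Omega>.
        ((\<lambda>t. LINT x|lebesgue_on \<Omega>. v t x \<bullet> \<psi> x) \<longlongrightarrow>
         (LINT x|lebesgue_on \<Omega>. v0 x \<bullet> \<psi> x)) (at_right 0)) \<and>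
     (\<forall>\<phi>\<in>spacetime_test \<Omega> T.
        - (LINT t|lebesgue_on {0<..<T}. LINT x|lebesgue_on \<Omega>. v t x \<bullet> time_deriv \<phi> t x)
        - \<kappa> * (LINT t|lebesgue_on {0<..<T}. LINT x|lebesgue_on \<Omega>.
                 weak_gradient \<Omega> (v t) x \<bullet> jacobian (time_deriv \<phi> t) (at x))
        + \<nu> * (LINT t|lebesgue_on {0<..<T}. LINT x|lebesgue_on \<Omega>.
                 stress p (sym_part (weak_gradient \<Omega> (v t) x)) \<bullet> sym_part (jacobian (\<phi> t) (at x)))
        = (LINT x|lebesgue_on \<Omega>. v0 x \<bullet> \<phi> 0 x)
        + \<kappa> * (LINT x|lebesgue_on \<Omega>. weak_gradient \<Omega> v0 x \<bullet> jacobian (\<phi> 0) (at x))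
        + (LINT t|lebesgue_on {0<..<T}. LINT x|lebesgue_on \<Omega>. f t x \<bullet> \<phi> t x)
        + (LINT t|lebesgue_on {0<..<T}. LINT x|lebesgue_on \<Omega>.
             tensor (v t x) (v t x) \<bullet> jacobian (\<phi> t) (at x)))"

end

theory Submission
 imports Defs
begin

text \<open>
 The Voigt term turns the problem into an ordinary differential equation.  Let \<open>V\<close> be the closure of
 the solenoidal test fields for the inner product \<open>(u, w) + \<kappa> (\<nabla>u, \<nabla>w)\<close>.  In this Hilbert space
 \<open>\<partial>\<^sub>t (v - \<kappa> \<Delta>v)\<close> is represented by the derivative \<open>v'\<close> of the curve \<open>v\<close>, and the equation reads
 \<open>v' = F(v) + g\<close>, where the vectors \<open>F(v)\<close> and \<open>g(t)\<close> represent the functionals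
 \<open>\<phi> \<mapsto> \<integral> (v \<otimes> v - \<nu> |D(v)|\<^sup>p\<^sup>-\<^sup>2 D(v)) : \<nabla>\<phi>\<close> and \<open>\<phi> \<mapsto> \<integral> f(t) \<bullet> \<phi>\<close>.  As \<open>p' \<ge> 2\<close>, the force is square
 integrable in space and time.

 It remains to see that \<open>F\<close> is a good map of \<open>V\<close>.  In dimension four \<open>V\<close> is contained in \<open>L\<^sup>4\<close>
 (\<open>sobolev4\<close>, by Gagliardo's argument), so that convection is a bounded quadratic map; it is orthogonal
 to its argument.  For \<open>1 < p < 2\<close> the stress is Hoelder continuous with exponent \<open>p - 1\<close> and
 monotone.  Hence \<open>F\<close> is uniformly continuous and one-sided Lipschitz on bounded sets and satisfies
 \<open>F(v) \<bullet> v \<le> 0\<close>.  For such maps \<open>ode_dissipative\<close> solves the integrated equation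
 \<open>v(t) = v\<^sub>0 + \<integral>\<^sub>0\<^sup>t g + \<integral>\<^sub>0\<^sup>t F(v)\<close>: equations with a time delay are solved by iteration, the one-sided
 Lipschitz condition makes their solutions converge as the delay tends to zero, and the sign condition
 gives a bound that allows \<open>F\<close> to be truncated.

 The space \<open>V\<close> is realised as the closed subspace \<open>Vhat\<close> of \<open>L\<^sup>2\<close>, with elements \<open>(u, \<surd>\<kappa> \<nabla>u)\<close>; the maps
 \<open>emb\<close> and \<open>vel\<close> translate between functions and vectors.  Curves in \<open>Vhat\<close> that are dominated limits
 of simple ones yield the Bochner spaces of the statement.  The weak time derivative and the weak
 formulation both follow from integration by parts in time (\<open>curve_by_parts\<close>), the latter against the
 curve of a space-time test field, which is continuously differentiable in \<open>L\<^sup>2\<close>.  The space \<open>V\<^sub>p\<close> takes no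
 extra work, because \<open>p < 2\<close> and \<open>\<Omega>\<close> is bounded.
\<close>

section \<open>The Hilbert space of square-integrable functions\<close>

definition sq_int :: "('a::euclidean_space \<Rightarrow> 'b::euclidean_space) \<Rightarrow> bool" where
 "sq_int f \<longleftrightarrow> f \<in> borel_measurable lebesgue \<and> integrable lebesgue (\<lambda>x. (norm (f x))\<^sup>2)"

lemma sq_int_measurable [measurable_dest]: "sq_int f \<Longrightarrow> f \<in> borel_measurable lebesgue"
 by (simp add: sq_int_def)

lemma sq_intD: "sq_int f \<Longrightarrow> integrable lebesgue (\<lambda>x. (norm (f x))\<^sup>2)"
 by (simp add: sq_int_def)

lemma sq_int_bound:
 assumes "f \<in> borel_measurable lebesgue" "integrable lebesgue g"
  "AE x in lebesgue. (norm (f x))\<^sup>2 \<le> g x"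
 shows "sq_int f"
 unfolding sq_int_def
proof (intro conjI assms(1))
 show "integrable lebesgue (\<lambda>x. (norm (f x))\<^sup>2)"
  by (rule Bochner_Integration.integrable_bound[OF assms(2)])
    (use assms in \<open>auto elim!: eventually_mono\<close>)
qed

lemma norm_sum_sq_le: "(norm (x + y :: 'b::real_normed_vector))\<^sup>2 \<le> 2 * ((norm x)\<^sup>2 + (norm y)\<^sup>2)"
proof -
 have "(norm (x + y))\<^sup>2 \<le> (norm x + norm y)\<^sup>2"
  by (simp add: norm_triangle_ineq power_mono)
 also have "\<dots> \<le> 2 * ((norm x)\<^sup>2 + (norm y)\<^sup>2)"
  using sum_squares_bound[of "norm x" "norm y"] by (simp add: power2_sum)
 finally show ?thesis .
qed

lemma sq_int_zero [simp]: "sq_int (\<lambda>x. 0)"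
 by (simp add: sq_int_def)

lemma sq_int_add:
 assumes "sq_int f" "sq_int g" shows "sq_int (\<lambda>x. f x + g x)"
 by (rule sq_int_bound[where g="\<lambda>x. 2 * ((norm (f x))\<^sup>2 + (norm (g x))\<^sup>2)"])
   (use assms norm_sum_sq_le in \<open>auto simp: sq_int_def simp del: distrib_left_numeral\<close>)

lemma sq_int_scaleR:
 assumes "sq_int f" shows "sq_int (\<lambda>x. c *\<^sub>R f x)"
 by (rule sq_int_bound[where g="\<lambda>x. c\<^sup>2 * (norm (f x))\<^sup>2"])
   (use assms in \<open>auto simp: sq_int_def power_mult_distrib\<close>)

lemma sq_int_minus: "sq_int f \<Longrightarrow> sq_int (\<lambda>x. - f x)"
 using sq_int_scaleR[of f "-1"] by simp

lemma sq_int_diff: "sq_int f \<Longrightarrow> sq_int g \<Longrightarrow> sq_int (\<lambda>x. f x - g x)"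
 using sq_int_add[OF _ sq_int_minus, of f g] by simp

lemma integrable_inner_sq_int:
 assumes "sq_int f" "sq_int g" shows "integrable lebesgue (\<lambda>x. f x \<bullet> g x)"
proof (rule Bochner_Integration.integrable_bound[where f="\<lambda>x. (norm (f x))\<^sup>2 + (norm (g x))\<^sup>2"])
 show "integrable lebesgue (\<lambda>x. (norm (f x))\<^sup>2 + (norm (g x))\<^sup>2)"
  using assms by (auto simp: sq_int_def)
 show "(\<lambda>x. f x \<bullet> g x) \<in> borel_measurable lebesgue"
  using assms by (auto simp: sq_int_def)
 have "\<bar>f x \<bullet> g x\<bar> \<le> (norm (f x))\<^sup>2 + (norm (g x))\<^sup>2" for x
 proof -
  have "\<bar>f x \<bullet> g x\<bar> \<le> norm (f x) * norm (g x)" by (rule Cauchy_Schwarz_ineq2)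
  moreover have "2 * (norm (f x) * norm (g x)) \<le> (norm (f x))\<^sup>2 + (norm (g x))\<^sup>2"
   using sum_squares_bound[of "norm (f x)" "norm (g x)"] by simp
  moreover have "0 \<le> norm (f x) * norm (g x)" by simp
  ultimately show ?thesis by linarith
 qed
 then show "AE x in lebesgue. norm (f x \<bullet> g x) \<le> norm ((norm (f x))\<^sup>2 + (norm (g x))\<^sup>2)"
  by auto
qed

text \<open>
 Square-integrable functions on the whole space modulo equality almost everywhere.  Functions on
 \<open>\<Omega>\<close> enter through their extension by zero.
\<close>

quotient_type (overloaded) ('a, 'b) L2 = "'a::euclidean_space \<Rightarrow> 'b::euclidean_space" /
 partial: "\<lambda>f g. sq_int f \<and> sq_int g \<and> (AE x in lebesgue. f x = g x)"
proof (rule part_equivpI)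
 show "\<exists>x::'a\<Rightarrow>'b. sq_int x \<and> sq_int x \<and> (AE t in lebesgue. x t = x t)"
  by (rule exI[of _ "\<lambda>x. 0"]) simp
 show "symp (\<lambda>f g::'a\<Rightarrow>'b. sq_int f \<and> sq_int g \<and> (AE x in lebesgue. f x = g x))"
  by (auto simp: symp_def elim!: eventually_mono)
 show "transp (\<lambda>f g::'a\<Rightarrow>'b. sq_int f \<and> sq_int g \<and> (AE x in lebesgue. f x = g x))"
  unfolding transp_def
 proof (intro allI impI conjI; elim conjE)
  fix x y z :: "'a \<Rightarrow> 'b"
  assume "AE t in lebesgue. x t = y t" "AE t in lebesgue. y t = z t"
  then show "AE t in lebesgue. x t = z t" by eventually_elim simp
 qed
qed

instantiation L2 :: (euclidean_space, euclidean_space) real_vector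
begin

lift_definition zero_L2 :: "('a, 'b) L2" is "\<lambda>x. 0" by simp
lift_definition plus_L2 :: "('a, 'b) L2 \<Rightarrow> ('a, 'b) L2 \<Rightarrow> ('a, 'b) L2" is "\<lambda>f g x. f x + g x"
 by (auto intro!: sq_int_add elim!: eventually_elim2)
lift_definition minus_L2 :: "('a, 'b) L2 \<Rightarrow> ('a, 'b) L2 \<Rightarrow> ('a, 'b) L2" is "\<lambda>f g x. f x - g x"
 by (auto intro!: sq_int_diff elim!: eventually_elim2)
lift_definition uminus_L2 :: "('a, 'b) L2 \<Rightarrow> ('a, 'b) L2" is "\<lambda>f x. - f x"
 by (auto intro!: sq_int_minus elim!: eventually_mono)
lift_definition scaleR_L2 :: "real \<Rightarrow> ('a, 'b) L2 \<Rightarrow> ('a, 'b) L2" is "\<lambda>c f x. c *\<^sub>R f x"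
 by (auto intro!: sq_int_scaleR elim!: eventually_mono)

instance
 by (standard; transfer)
   (auto intro!: sq_int_add sq_int_diff sq_int_minus sq_int_scaleR
      simp: algebra_simps scaleR_add_left scaleR_add_right)

end

instantiation L2 :: (euclidean_space, euclidean_space) real_inner
begin

lift_definition inner_L2 :: "('a, 'b) L2 \<Rightarrow> ('a, 'b) L2 \<Rightarrow> real" is
 "\<lambda>f g. LINT x|lebesgue. f x \<bullet> g x"
 by (auto intro!: integral_cong_AE elim!: eventually_elim2 simp: sq_int_def)

definition norm_L2 :: "('a, 'b) L2 \<Rightarrow> real" where "norm_L2 x = sqrt (x \<bullet> x)"
definition dist_L2 :: "('a, 'b) L2 \<Rightarrow> ('a, 'b) L2 \<Rightarrow> real" where "dist_L2 x y = norm (x - y)"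
definition sgn_L2 :: "('a, 'b) L2 \<Rightarrow> ('a, 'b) L2" where "sgn_L2 x = x /\<^sub>R norm x"
definition uniformity_L2 :: "(('a, 'b) L2 \<times> ('a, 'b) L2) filter" where
 [code del]: "uniformity_L2 = (INF e\<in>{0 <..}. principal {(x, y). dist x y < e})"
definition open_L2 :: "('a, 'b) L2 set \<Rightarrow> bool" where
 [code del]: "open_L2 U \<longleftrightarrow> (\<forall>x\<in>U. eventually (\<lambda>(x', y). x' = x \<longrightarrow> y \<in> U) uniformity)"

instance
proof
 fix x y z :: "('a, 'b) L2" and r :: real and U :: "('a, 'b) L2 set"
 show "dist x y = norm (x - y)" by (rule dist_L2_def)
 show "uniformity = (INF e\<in>{0<..}. principal {(x::('a, 'b) L2, y). dist x y < e})"
  by (rule uniformity_L2_def)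
 show "open U = (\<forall>x\<in>U. \<forall>\<^sub>F (x', y) in uniformity. x' = x \<longrightarrow> y \<in> U)" by (rule open_L2_def)
 show "sgn x = x /\<^sub>R norm x" by (rule sgn_L2_def)
 show "x \<bullet> y = y \<bullet> x" by transfer (simp add: inner_commute)
 show "(x + y) \<bullet> z = x \<bullet> z + y \<bullet> z"
  by transfer (auto simp: inner_add_left integrable_inner_sq_int)
 show "(r *\<^sub>R x) \<bullet> y = r * (x \<bullet> y)" by transfer simp
 show "0 \<le> x \<bullet> x" by transfer simp
 show "(x \<bullet> x = 0) = (x = 0)"
 proof (transfer, safe, goal_cases)
  case (2 f)
  then have "AE x in lebesgue. f x \<bullet> f x = 0"
   by (subst (asm) integral_nonneg_eq_0_iff_AE) (auto intro: integrable_inner_sq_int)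
  then show ?case by simp
 next
  case (3 f)
  then have "(LINT x|lebesgue. f x \<bullet> f x) = (LINT x|(lebesgue::'a measure). 0)"
   by (intro integral_cong_AE) (auto simp: sq_int_def elim!: eventually_mono)
  then show ?case by simp
 qed simp
 show "norm x = sqrt (x \<bullet> x)" by (rule norm_L2_def)
qed

end

definition rep :: "('a::euclidean_space, 'b::euclidean_space) L2 \<Rightarrow> 'a \<Rightarrow> 'b" where
 "rep h = rep_L2 h"

definition L2_of :: "('a \<Rightarrow> 'b) \<Rightarrow> ('a::euclidean_space, 'b::euclidean_space) L2" where
 "L2_of f = abs_L2 f"

lemma sq_int_rep [simp, intro]: "sq_int (rep h)"
 unfolding rep_def using Quotient3_rep_reflp[OF Quotient3_L2, of h] by simp

lemma rep_measurable [measurable, simp]: "rep h \<in> borel_measurable lebesgue"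
 using sq_int_rep[of h] by (simp add: sq_int_def)

lemma rep_L2_of: "sq_int f \<Longrightarrow> AE x in lebesgue. rep (L2_of f) x = f x"
 unfolding rep_def L2_of_def using Quotient3_L2 Quotient3_rel_rep[OF Quotient3_L2]
 using rep_abs_rsp_left[OF Quotient3_L2, of f f] by simp

lemma L2_of_rep [simp]: "L2_of (rep h) = h"
 unfolding rep_def L2_of_def by (rule Quotient3_abs_rep[OF Quotient3_L2])

lemma L2_of_eqI:
 assumes "sq_int f" "sq_int g" "AE x in lebesgue. f x = g x" shows "L2_of f = L2_of g"
 unfolding L2_of_def using Quotient3_rel[OF Quotient3_L2, of f g] assms by auto

lemma L2_eqI: "(AE x in lebesgue. rep h x = rep k x) \<Longrightarrow> h = k"
 using L2_of_eqI[of "rep h" "rep k"] by simp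

lemma L2_of_add: "sq_int f \<Longrightarrow> sq_int g \<Longrightarrow> L2_of f + L2_of g = L2_of (\<lambda>x. f x + g x)"
 unfolding L2_of_def by (rule plus_L2.abs_eq) (auto simp: eq_onp_def)
lemma L2_of_diff: "sq_int f \<Longrightarrow> sq_int g \<Longrightarrow> L2_of f - L2_of g = L2_of (\<lambda>x. f x - g x)"
 unfolding L2_of_def by (rule minus_L2.abs_eq) (auto simp: eq_onp_def)
lemma L2_of_scaleR: "sq_int f \<Longrightarrow> c *\<^sub>R L2_of f = L2_of (\<lambda>x. c *\<^sub>R f x)"
 unfolding L2_of_def by (rule scaleR_L2.abs_eq) (auto simp: eq_onp_def)
lemma L2_of_inner: "sq_int f \<Longrightarrow> sq_int g \<Longrightarrow> L2_of f \<bullet> L2_of g = (LINT x|lebesgue. f x \<bullet> g x)"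
 unfolding L2_of_def by (rule inner_L2.abs_eq) (auto simp: eq_onp_def)
lemma L2_zero: "0 = L2_of (\<lambda>x. 0)"
 unfolding L2_of_def zero_L2_def by simp

lemma L2_inner: "h \<bullet> k = (LINT x|lebesgue. rep h x \<bullet> rep k x)"
 using L2_of_inner[of "rep h" "rep k"] by simp

lemma rep_add: "AE x in lebesgue. rep (h + k) x = rep h x + rep k x"
 using rep_L2_of[OF sq_int_add, of "rep h" "rep k"] L2_of_add[of "rep h" "rep k"] by simp
lemma rep_diff: "AE x in lebesgue. rep (h - k) x = rep h x - rep k x"
 using rep_L2_of[OF sq_int_diff, of "rep h" "rep k"] L2_of_diff[of "rep h" "rep k"] by simp
lemma rep_scaleR: "AE x in lebesgue. rep (c *\<^sub>R h) x = c *\<^sub>R rep h x"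
 using rep_L2_of[OF sq_int_scaleR, of "rep h" c] L2_of_scaleR[of "rep h" c] by simp

lemma L2_norm_sq: "(norm h)\<^sup>2 = (LINT x|lebesgue. (norm (rep h x))\<^sup>2)"
 unfolding power2_norm_eq_inner L2_inner ..

lemma L2_of_norm_sq: "sq_int f \<Longrightarrow> (norm (L2_of f))\<^sup>2 = (LINT x|lebesgue. (norm (f x))\<^sup>2)"
 unfolding power2_norm_eq_inner by (rule L2_of_inner)

lemma L2_norm_sq_nn: "(\<integral>\<^sup>+x. ennreal ((norm (rep h x))\<^sup>2) \<partial>lebesgue) = ennreal ((norm h)\<^sup>2)"
 unfolding L2_norm_sq by (rule nn_integral_eq_integral) (auto intro: sq_intD)

lemma L2_norm_diff_nn:
 "(\<integral>\<^sup>+x. ennreal ((norm (rep h x - rep k x))\<^sup>2) \<partial>lebesgue) = ennreal ((norm (h - k))\<^sup>2)"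
proof -
 have "(\<integral>\<^sup>+x. ennreal ((norm (rep h x - rep k x))\<^sup>2) \<partial>lebesgue) =
    (\<integral>\<^sup>+x. ennreal ((norm (rep (h - k) x))\<^sup>2) \<partial>lebesgue)"
  using rep_diff[of h k] by (intro nn_integral_cong_AE) (auto elim!: eventually_mono)
 then show ?thesis by (simp add: L2_norm_sq_nn)
qed

text \<open>
 Riesz--Fischer. If \<open>\<parallel>X (k+1) - X k\<parallel>\<^sup>2 \<le> 4\<^sup>-\<^sup>k\<close>, then \<open>\<Sum> 2\<^sup>k |X (k+1) - X k|\<^sup>2\<close> is
 integrable, hence finite almost everywhere, and this forces geometric decay of the pointwise
 increments.
\<close>

lemma L2_fast_Cauchy_AE_convergent:
 fixes X :: "nat \<Rightarrow> ('a::euclidean_space, 'b::euclidean_space) L2"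
 assumes "\<And>k. (norm (X (Suc k) - X k))\<^sup>2 \<le> (1/4)^k"
 shows "AE x in lebesgue. convergent (\<lambda>k. rep (X k) x)"
proof -
 let ?d = "\<lambda>k x. (norm (rep (X (Suc k)) x - rep (X k) x))\<^sup>2"
 have "(\<integral>\<^sup>+x. (\<Sum>k. ennreal (2^k * ?d k x)) \<partial>lebesgue)
   = (\<Sum>k. \<integral>\<^sup>+x. ennreal (2^k * ?d k x) \<partial>lebesgue)"
  by (rule nn_integral_suminf) measurable
 also have "\<dots> = (\<Sum>k. ennreal (2^k * (norm (X (Suc k) - X k))\<^sup>2))"
  by (simp add: ennreal_mult' nn_integral_cmult L2_norm_diff_nn)
 also have "\<dots> \<le> (\<Sum>k. ennreal ((1/2)^k))"
 proof (rule suminf_le, rule ennreal_leI)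
  fix k
  have "2^k * (norm (X (Suc k) - X k))\<^sup>2 \<le> 2^k * (1/4::real)^k"
   by (rule mult_left_mono[OF assms]) simp
  also have "\<dots> = (1/2)^k" by (simp flip: power_mult_distrib)
  finally show "2^k * (norm (X (Suc k) - X k))\<^sup>2 \<le> (1/2::real)^k" .
 qed auto
 also have "\<dots> = ennreal (\<Sum>k. (1/2)^k)"
  by (rule suminf_ennreal_eq) (auto simp: summable_geometric intro!: summable_sums)
 also have "\<dots> < \<infinity>" by simp
 finally have fin: "(\<integral>\<^sup>+x. (\<Sum>k. ennreal (2^k * ?d k x)) \<partial>lebesgue) \<noteq> \<infinity>"
  by (rule less_imp_neq)
 have "AE x in lebesgue. (\<Sum>k. ennreal (2^k * ?d k x)) \<noteq> \<infinity>"
 proof (rule nn_integral_PInf_AE[OF _ fin], rule borel_measurable_suminf_order)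
  fix k show "(\<lambda>x. ennreal (2^k * ?d k x)) \<in> borel_measurable lebesgue" by measurable
 qed
 then show ?thesis
 proof eventually_elim
  case (elim x)
  define a where "a = (\<lambda>k. ennreal (2^k * ?d k x))"
  have "suminf a \<noteq> top" using elim by (simp add: a_def)
  then obtain C where C: "suminf a = ennreal C" "0 \<le> C"
   by (cases "suminf a" rule: ennreal_cases) auto
  have dk: "norm (rep (X (Suc k)) x - rep (X k) x) \<le> sqrt C * (sqrt (1/2))^k" for k
  proof -
   have "sum a {k} \<le> suminf a" by (rule sum_le_suminf) auto
   then have "a k \<le> ennreal C" unfolding C by simp
   then have "2^k * ?d k x \<le> C" unfolding a_def using C(2) by (simp add: ennreal_le_iff)
   then have "?d k x \<le> C * (1/2)^k" by (simp add: field_simps power_divide)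
   then have "sqrt (?d k x) \<le> sqrt (C * (1/2)^k)" by (rule real_sqrt_le_mono)
   then show ?thesis by (simp add: real_sqrt_mult real_sqrt_power)
  qed
  have "summable (\<lambda>k. rep (X (Suc k)) x - rep (X k) x)"
  proof (rule summable_comparison_test'[where N=0 and g="\<lambda>k. sqrt C * (sqrt (1/2))^k"])
   have "sqrt (1/2::real) < 1" by simp
   then show "summable (\<lambda>k. sqrt C * (sqrt (1/2))^k)"
    by (intro summable_mult summable_geometric) auto
  qed (use dk in auto)
  then have "convergent (\<lambda>n. \<Sum>k<n. rep (X (Suc k)) x - rep (X k) x)"
   by (simp add: summable_iff_convergent)
  then have "convergent (\<lambda>n. rep (X n) x - rep (X 0) x)"
   by (simp add: sum_lessThan_telescope[of "\<lambda>k. rep (X k) x"])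
  from convergent_add[OF this convergent_const[of "rep (X 0) x"]]
  show ?case by simp
 qed
qed

text \<open>By Fatou's lemma the pointwise limit is also the limit in the mean.\<close>

lemma L2_fast_Cauchy_convergent:
 fixes X :: "nat \<Rightarrow> ('a::euclidean_space, 'b::euclidean_space) L2"
 assumes fast: "\<And>k. (norm (X (Suc k) - X k))\<^sup>2 \<le> (1/4)^k" and "Cauchy X"
 shows "convergent X"
proof -
 define f where "f x = lim (\<lambda>k. rep (X k) x)" for x
 have lim: "AE x in lebesgue. (\<lambda>k. rep (X k) x) \<longlonglongrightarrow> f x"
  using L2_fast_Cauchy_AE_convergent[of X, OF fast]
  by eventually_elim (simp add: f_def convergent_LIMSEQ_iff)
 have [measurable]: "f \<in> borel_measurable lebesgue"
  unfolding f_def by (rule borel_measurable_lim_metric) simp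
 have fatou: "(\<integral>\<^sup>+x. ennreal ((norm (rep (X k) x - f x))\<^sup>2) \<partial>lebesgue) \<le> ennreal (e\<^sup>2)"
  if "e > 0" "\<And>m. m \<ge> N \<Longrightarrow> norm (X k - X m) \<le> e" for k N e
 proof -
  have "(\<integral>\<^sup>+x. ennreal ((norm (rep (X k) x - f x))\<^sup>2) \<partial>lebesgue)
    = (\<integral>\<^sup>+x. liminf (\<lambda>m. ennreal ((norm (rep (X k) x - rep (X m) x))\<^sup>2)) \<partial>lebesgue)"
  proof (rule nn_integral_cong_AE)
   show "AE x in lebesgue. ennreal ((norm (rep (X k) x - f x))\<^sup>2) =
       liminf (\<lambda>m. ennreal ((norm (rep (X k) x - rep (X m) x))\<^sup>2))"
    using lim
   proof eventually_elim
    case (elim x)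
    have "(\<lambda>m. ennreal ((norm (rep (X k) x - rep (X m) x))\<^sup>2)) \<longlonglongrightarrow>
        ennreal ((norm (rep (X k) x - f x))\<^sup>2)"
     by (intro tendsto_ennrealI tendsto_intros elim)
    then show ?case by (rule lim_imp_Liminf[OF sequentially_bot, symmetric])
   qed
  qed
  also have "\<dots> \<le> liminf (\<lambda>m. \<integral>\<^sup>+x. ennreal ((norm (rep (X k) x - rep (X m) x))\<^sup>2) \<partial>lebesgue)"
   by (rule nn_integral_liminf) measurable
  also have "\<dots> = liminf (\<lambda>m. ennreal ((norm (X k - X m))\<^sup>2))" by (simp add: L2_norm_diff_nn)
  also have "\<dots> \<le> ennreal (e\<^sup>2)"
  proof (rule Liminf_le)
   show "\<forall>\<^sub>F m in sequentially. ennreal ((norm (X k - X m))\<^sup>2) \<le> ennreal (e\<^sup>2)"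
    unfolding eventually_sequentially using that by (auto intro!: exI[of _ N] ennreal_leI power_mono)
  qed simp
  finally show ?thesis .
 qed
 have CauchyE: "\<exists>N. \<forall>m\<ge>N. \<forall>n\<ge>N. norm (X m - X n) \<le> e" if "e > 0" for e
  using \<open>Cauchy X\<close> that unfolding Cauchy_iff by (meson less_imp_le)
 obtain N where N: "\<forall>m\<ge>N. \<forall>n\<ge>N. norm (X m - X n) \<le> 1" using CauchyE[of 1] by auto
 have "sq_int (\<lambda>x. rep (X N) x - f x)"
  unfolding sq_int_def integrable_iff_bounded
  using fatou[of 1 N N] N by (auto intro: le_less_trans)
 from sq_int_diff[OF sq_int_rep[of "X N"] this] have f: "sq_int f" by simp
 have "X \<longlonglongrightarrow> L2_of f"
 proof (rule metric_LIMSEQ_I)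
  fix r :: real assume "r > 0"
  then obtain N where N: "\<forall>m\<ge>N. \<forall>n\<ge>N. norm (X m - X n) \<le> r/2" using CauchyE[of "r/2"] by auto
  have "dist (X k) (L2_of f) < r" if "k \<ge> N" for k
  proof -
   have "ennreal ((norm (X k - L2_of f))\<^sup>2)
     = (\<integral>\<^sup>+x. ennreal ((norm (rep (X k) x - f x))\<^sup>2) \<partial>lebesgue)"
    unfolding L2_norm_diff_nn[symmetric]
    using rep_L2_of[OF f] by (intro nn_integral_cong_AE) (auto elim!: eventually_mono)
   also have "\<dots> \<le> ennreal ((r/2)\<^sup>2)"
    by (rule fatou[where N=N]) (use \<open>r > 0\<close> N that in auto)
   finally have "(norm (X k - L2_of f))\<^sup>2 \<le> (r/2)\<^sup>2"
    by (subst (asm) ennreal_le_iff) auto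
   then have "norm (X k - L2_of f) \<le> r/2"
    by (rule power2_le_imp_le) (use \<open>r > 0\<close> in simp)
   then show ?thesis using \<open>r > 0\<close> by (simp add: dist_norm)
  qed
  then show "\<exists>no. \<forall>n\<ge>no. dist (X n) (L2_of f) < r" by blast
 qed
 then show ?thesis by (rule convergentI)
qed

instance L2 :: (euclidean_space, euclidean_space) complete_space
proof
 fix X :: "nat \<Rightarrow> ('a, 'b) L2" assume X: "Cauchy X"
 have "\<exists>N. \<forall>m\<ge>N. \<forall>n\<ge>N. dist (X m) (X n) < (1/2)^k" for k
  using X unfolding Cauchy_def by simp
 then obtain N where N: "\<And>k m n. m \<ge> N k \<Longrightarrow> n \<ge> N k \<Longrightarrow> dist (X m) (X n) < (1/2)^k"
  by metis
 define r where "r = rec_nat (N 0) (\<lambda>k rk. max (Suc rk) (N (Suc k)))"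
 have r: "r k \<ge> N k" "r (Suc k) > r k" for k
  by (cases k) (auto simp: r_def)
 then have mono: "strict_mono r" by (simp add: strict_mono_Suc_iff)
 have "convergent (X \<circ> r)"
 proof (rule L2_fast_Cauchy_convergent)
  fix k
  have "dist (X (r (Suc k))) (X (r k)) < (1/2)^k"
   using r[of k] by (intro N) auto
  then have "(norm ((X \<circ> r) (Suc k) - (X \<circ> r) k))\<^sup>2 \<le> ((1/2)^k)\<^sup>2"
   by (intro power_mono) (auto simp: dist_norm)
  also have "\<dots> = (1/4)^k"
   unfolding power2_eq_square power_mult_distrib[symmetric] by simp
  finally show "(norm ((X \<circ> r) (Suc k) - (X \<circ> r) k))\<^sup>2 \<le> (1/4)^k" .
  show "Cauchy (X \<circ> r)" using X mono by (rule Cauchy_subseq_Cauchy)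
 qed
 then obtain l where "(X \<circ> r) \<longlonglongrightarrow> l" by (auto simp: convergent_def)
 then have "X \<longlonglongrightarrow> l" using X mono by (metis Cauchy_converges_subseq)
 then show "convergent X" by (rule convergentI)
qed

instance L2 :: (euclidean_space, euclidean_space) banach ..

lemma L2_tendsto_AE_subseq:
 fixes X :: "nat \<Rightarrow> ('a::euclidean_space, 'b::euclidean_space) L2"
 assumes "X \<longlonglongrightarrow> h"
 obtains r where "strict_mono r" "AE x in lebesgue. (\<lambda>k. rep (X (r k)) x) \<longlonglongrightarrow> rep h x"
proof -
 let ?u = "\<lambda>n x. (norm (rep (X n) x - rep h x))\<^sup>2"
 have int: "integrable lebesgue (?u n)" for n
  by (rule sq_intD[OF sq_int_diff]) auto
 have "(\<lambda>n. LINT x|lebesgue. norm (?u n x)) \<longlonglongrightarrow> 0"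
 proof -
  have "(LINT x|lebesgue. norm (?u n x)) = (norm (X n - h))\<^sup>2" for n
   using L2_norm_diff_nn[of "X n" h] nn_integral_eq_integral[OF int[of n]] by simp
  moreover have "(\<lambda>n. (norm (X n - h))\<^sup>2) \<longlonglongrightarrow> 0\<^sup>2"
   using assms by (intro tendsto_power) (simp add: tendsto_norm_zero_iff LIM_zero_iff)
  ultimately show ?thesis by simp
 qed
 from tendsto_L1_AE_subseq[OF int this] obtain r where
  r: "strict_mono r" "AE x in lebesgue. (\<lambda>n. ?u (r n) x) \<longlonglongrightarrow> 0" by blast
 from r(2) have "AE x in lebesgue. (\<lambda>k. rep (X (r k)) x) \<longlonglongrightarrow> rep h x"
 proof eventually_elim
  case (elim x)
  then have "(\<lambda>n. sqrt (?u (r n) x)) \<longlonglongrightarrow> sqrt 0" by (intro tendsto_real_sqrt)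
  then have "(\<lambda>n. norm (rep (X (r n)) x - rep h x)) \<longlonglongrightarrow> 0" by simp
  then show ?case by (simp add: tendsto_norm_zero_iff LIM_zero_iff)
 qed
 then show thesis using r(1) that by blast
qed

section \<open>Orthogonal projection onto a closed subspace\<close>

text \<open>
 A minimising sequence for the distance is Cauchy by the parallelogram law, and its limit is the
 foot of the perpendicular.
\<close>

lemma orthogonal_projection_exists:
 fixes S :: "'a::{real_inner,banach} set"
 assumes sub: "subspace S" and cl: "closed S"
 shows "\<exists>p\<in>S. \<forall>s\<in>S. (x - p) \<bullet> s = 0"
proof -
 define D where "D = (\<lambda>s. (norm (x - s))\<^sup>2) ` S"
 define d where "d = Inf D"
 have bdd: "bdd_below D" unfolding D_def by (rule bdd_belowI[of _ 0]) auto
 have ne: "D \<noteq> {}" unfolding D_def using subspace_0[OF sub] by auto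
 have d_le: "d \<le> (norm (x - s))\<^sup>2" if "s \<in> S" for s
  unfolding d_def by (rule cInf_lower[OF _ bdd]) (auto simp: D_def that)
 have "\<exists>s\<in>S. (norm (x - s))\<^sup>2 < d + 1 / Suc n" for n :: nat
 proof -
  have "Inf D < d + 1 / Suc n" unfolding d_def by simp
  then show ?thesis unfolding cInf_less_iff[OF ne bdd] by (auto simp: D_def)
 qed
 then obtain s where s: "\<And>n. s n \<in> S" "\<And>n. (norm (x - s n))\<^sup>2 < d + 1 / Suc n" by metis
 have close: "(norm (s m - s n))\<^sup>2 \<le> 2 * (1 / Suc m + 1 / Suc n)" for m n
 proof -
  \<comment> \<open>parallelogram identity around the midpoint of two almost minimisers\<close>
  have mid: "(1/2) *\<^sub>R (s m + s n) \<in> S" using s sub by (intro subspace_scale subspace_add) auto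
  let ?a = "x - s m" and ?b = "x - s n"
  have "?a + ?b = 2 *\<^sub>R (x - (1/2) *\<^sub>R (s m + s n))"
   by (simp add: algebra_simps scaleR_2)
  then have ab: "(norm (?a + ?b))\<^sup>2 \<ge> 4 * d" using d_le[OF mid] by (simp add: power_mult_distrib)
  have par: "(norm (?a - ?b))\<^sup>2 + (norm (?a + ?b))\<^sup>2 = 2 * (norm ?a)\<^sup>2 + 2 * (norm ?b)\<^sup>2"
   by (simp only: power2_norm_eq_inner) (simp add: inner_add_left inner_add_right
     inner_diff_left inner_diff_right inner_commute)
  have "norm (s m - s n) = norm (?a - ?b)" by (simp add: norm_minus_commute)
  then show ?thesis using par ab s(2)[of m] s(2)[of n] by simp
 qed
 have "Cauchy s"
 proof (rule metric_CauchyI)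
  fix e :: real assume e: "e > 0"
  obtain N :: nat where N: "1 / Suc N < e\<^sup>2 / 4" using nat_approx_posE[of "e\<^sup>2 / 4"] e by auto
  have "dist (s m) (s n) < e" if "m \<ge> N" "n \<ge> N" for m n
  proof -
   have "(norm (s m - s n))\<^sup>2 \<le> 2 * (1 / Suc m + 1 / Suc n)" by (rule close)
   also have "\<dots> \<le> 2 * (1 / Suc N + 1 / Suc N)"
    using that by (intro mult_left_mono add_mono) (auto simp: frac_le)
   also have "\<dots> = 4 * (1 / Suc N)" by simp
   also have "\<dots> < e\<^sup>2" using N by linarith
   finally have "(norm (s m - s n))\<^sup>2 < e\<^sup>2" .
   then show ?thesis using e by (simp add: dist_norm power2_less_imp_less)
  qed
  then show "\<exists>M. \<forall>m\<ge>M. \<forall>n\<ge>M. dist (s m) (s n) < e" by blast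
 qed
 then obtain p where p: "s \<longlonglongrightarrow> p" using Cauchy_convergent convergent_def by blast
 have pS: "p \<in> S" using closed_sequentially[OF cl] s(1) p by blast
 have p_min: "(norm (x - p))\<^sup>2 \<le> d"
 proof (rule LIMSEQ_le)
  show "(\<lambda>n. (norm (x - s n))\<^sup>2) \<longlonglongrightarrow> (norm (x - p))\<^sup>2" by (intro tendsto_intros p)
  show "(\<lambda>n. d + 1 / Suc n) \<longlonglongrightarrow> d"
   using tendsto_add[OF tendsto_const LIMSEQ_inverse_real_of_nat, of d]
   by (simp add: inverse_eq_divide)
  show "\<exists>N. \<forall>n\<ge>N. (norm (x - s n))\<^sup>2 \<le> d + 1 / Suc n" using s(2) less_imp_le by blast
 qed
 have "(x - p) \<bullet> u = 0" if u: "u \<in> S" for u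
 proof (cases "u = 0")
  case False
  let ?c = "(x - p) \<bullet> u / (u \<bullet> u)"
  have uu: "u \<bullet> u > 0" using False by simp
  have expand: "(norm (a - c *\<^sub>R u))\<^sup>2 = (norm a)\<^sup>2 - 2 * c * (a \<bullet> u) + c\<^sup>2 * (u \<bullet> u)" for a c
   unfolding power2_norm_eq_inner
   by (simp add: inner_diff_left inner_diff_right inner_commute[of u a] power2_eq_square algebra_simps)
  have "p + ?c *\<^sub>R u \<in> S" using pS u sub by (intro subspace_add subspace_scale)
  from order_trans[OF p_min d_le[OF this]] have "(norm (x - p))\<^sup>2 \<le> (norm (x - p - ?c *\<^sub>R u))\<^sup>2"
   by (simp only: diff_diff_eq)
  also have "\<dots> = (norm (x - p))\<^sup>2 - ((x - p) \<bullet> u)\<^sup>2 / (u \<bullet> u)"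
   unfolding expand using uu by (simp add: power2_eq_square field_simps)
  finally have "((x - p) \<bullet> u)\<^sup>2 \<le> 0" using uu by (simp add: divide_le_0_iff)
  then show ?thesis by simp
 qed simp
 with pS show ?thesis by blast
qed

definition proj :: "'a::{real_inner,banach} set \<Rightarrow> 'a \<Rightarrow> 'a" where
 "proj S x = (SOME p. p \<in> S \<and> (\<forall>s\<in>S. (x - p) \<bullet> s = 0))"

locale hilbert_subspace =
 fixes S :: "'a::{real_inner,banach} set"
 assumes sub: "subspace S" and cl: "closed S"
begin

lemma proj_in [simp]: "proj S x \<in> S" and proj_orth: "s \<in> S \<Longrightarrow> (x - proj S x) \<bullet> s = 0"
 using someI_ex[of "\<lambda>p. p \<in> S \<and> (\<forall>s\<in>S. (x - p) \<bullet> s = 0)"] orthogonal_projection_exists[OF sub cl, of x]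
 unfolding proj_def by blast+

lemma proj_inner: "s \<in> S \<Longrightarrow> proj S x \<bullet> s = x \<bullet> s"
 using proj_orth[of s x] by (simp add: inner_diff_left)

lemma proj_unique:
 assumes "p \<in> S" "\<And>s. s \<in> S \<Longrightarrow> p \<bullet> s = x \<bullet> s" shows "proj S x = p"
proof -
 have d: "proj S x - p \<in> S" using assms(1) sub by (intro subspace_diff) auto
 have "(proj S x - p) \<bullet> (proj S x - p) = 0"
  using proj_inner[OF d, of x] assms(2)[OF d] by (simp add: inner_diff_left)
 then show ?thesis by simp
qed

lemma proj_id: "x \<in> S \<Longrightarrow> proj S x = x"
 by (rule proj_unique) auto

lemma proj_linear: "linear (proj S)"
proof
 show "proj S (x + y) = proj S x + proj S y" for x y
  by (rule proj_unique) (auto simp: inner_add_left proj_inner intro!: subspace_add sub)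
 show "proj S (c *\<^sub>R x) = c *\<^sub>R proj S x" for c x
  by (rule proj_unique) (auto simp: proj_inner intro!: subspace_scale sub)
qed

lemma proj_norm_le: "norm (proj S x) \<le> norm x"
proof (cases "proj S x = 0")
 case False
 have "norm (proj S x) * norm (proj S x) = x \<bullet> proj S x"
  by (simp add: power2_norm_eq_inner[symmetric, unfolded power2_eq_square] proj_inner
    flip: proj_inner[OF proj_in])
 also have "\<dots> \<le> norm x * norm (proj S x)" by (rule norm_cauchy_schwarz)
 finally show ?thesis using False by simp
qed simp

lemma proj_bounded_linear: "bounded_linear (proj S)"
 by (rule bounded_linear_intro[where K=1])
   (use proj_linear proj_norm_le in \<open>auto simp: linear_add linear_scale\<close>)

end

section \<open>Ordinary differential equations in a Hilbert space\<close>

text \<open>The function \<open>exp (- c s) u(s) - d s\<close> has a nonpositive derivative.\<close>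

lemma gronwall:
 fixes u :: "real \<Rightarrow> real"
 assumes der: "\<And>t. t \<in> {0..T} \<Longrightarrow> (u has_vector_derivative u' t) (at t within {0..T})"
  and le: "\<And>t. t \<in> {0..T} \<Longrightarrow> u' t \<le> c * u t + d"
  and "c \<ge> 0" "d \<ge> 0" "u 0 = 0" and t: "t \<in> {0..T}"
 shows "u t \<le> d * T * exp (c * T)"
proof -
 define g where "g = (\<lambda>s. exp (- c * s) * u s - d * s)"
 define g' where "g' = (\<lambda>s. exp (- c * s) * (u' s - c * u s) - d)"
 have g_der: "(g has_derivative (\<lambda>h. h * g' s)) (at s within {0..t})" if "s \<in> {0..t}" for s
 proof -
  have "(u has_real_derivative u' s) (at s within {0..t})"
   using has_vector_derivative_within_subset[OF der[of s], of "{0..t}"] that t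
   by (auto simp: has_real_derivative_iff_has_vector_derivative)
  then have "(g has_real_derivative g' s) (at s within {0..t})"
   unfolding g_def g'_def by (auto intro!: derivative_eq_intros simp: algebra_simps)
  then show ?thesis by (simp add: has_field_derivative_def mult.commute[of _ "g' s"] mult_commute_abs)
 qed
 have "\<exists>x\<in>{0..t}. g t - g 0 = (\<lambda>h. h * g' x) (t - 0)"
  by (rule mvt_very_simple) (use t g_der in auto)
 then obtain x where x: "x \<in> {0..t}" "g t - g 0 = t * g' x" by auto
 have "exp (- c * x) * (u' x - c * u x) \<le> exp (- c * x) * d"
  using le[of x] x t by (intro mult_left_mono) auto
 also have "\<dots> \<le> 1 * d" using x \<open>c \<ge> 0\<close> \<open>d \<ge> 0\<close> by (intro mult_right_mono) auto
 finally have "g' x \<le> 0" by (simp add: g'_def)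
 then have "t * g' x \<le> 0" using t by (simp add: mult_nonneg_nonpos)
 then have "g t \<le> g 0" using x by linarith
 then have "exp (- c * t) * u t \<le> d * t" using \<open>u 0 = 0\<close> by (simp add: g_def)
 then have "exp (c * t) * (exp (- c * t) * u t) \<le> exp (c * t) * (d * t)" by (intro mult_left_mono) auto
 then have "u t \<le> d * t * exp (c * t)"
  by (simp add: exp_minus field_simps)
 also have "\<dots> \<le> d * T * exp (c * T)"
  using t \<open>c \<ge> 0\<close> \<open>d \<ge> 0\<close> by (intro mult_mono) (auto intro: mult_left_mono)
 finally show ?thesis .
qed

text \<open>
 The upper limit \<open>max 0 t\<close> makes sense of delayed solutions at negative times, where the
 integral is to vanish.
\<close>

lemma indefinite_integral_lipschitz:
 fixes f :: "real \<Rightarrow> 'a::banach"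
 assumes cont: "continuous_on UNIV f" and M: "\<And>s. norm (f s) \<le> M"
 shows "norm (integral {0..max 0 t} f - integral {0..max 0 s} f) \<le> M * \<bar>t - s\<bar>"
proof -
 have M0: "M \<ge> 0" by (rule order_trans[OF norm_ge_zero M[of 0]])
 have *: "norm (integral {0..b} f - integral {0..a} f) \<le> M * (b - a)" if "0 \<le> a" "a \<le> b" for a b
 proof -
  have "integral {0..a} f + integral {a..b} f = integral {0..b} f"
   by (rule Henstock_Kurzweil_Integration.integral_combine)
     (use that cont continuous_on_subset in \<open>auto intro!: integrable_continuous_real\<close>)
  then have "integral {0..b} f - integral {0..a} f = integral {a..b} f" by (simp add: algebra_simps)
  moreover have "norm (integral {a..b} f) \<le> M * (b - a)"
   by (rule integral_bound) (use that M in \<open>auto intro: continuous_on_subset[OF cont]\<close>)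
  ultimately show ?thesis by simp
 qed
 have "norm (integral {0..max 0 t} f - integral {0..max 0 s} f) \<le> M * \<bar>max 0 t - max 0 s\<bar>"
 proof (cases "s \<le> t")
  case True
  then show ?thesis using *[of "max 0 s" "max 0 t"] by (simp add: abs_if max_def split: if_splits)
 next
  case False
  then show ?thesis using *[of "max 0 t" "max 0 s"]
   by (subst norm_minus_commute) (simp add: abs_if max_def split: if_splits)
 qed
 also have "\<dots> \<le> M * \<bar>t - s\<bar>" using M0 by (intro mult_left_mono) auto
 finally show ?thesis .
qed

text \<open>
 The delayed equation can be solved by iteration: the \<open>k\<close>-th iterate is already exact up to
 time \<open>k h\<close>.
\<close>

lemma delay_equation_solvable:
 fixes F :: "'a::banach \<Rightarrow> 'a" and G :: "real \<Rightarrow> 'a"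
 assumes contF: "continuous_on UNIV F" and M: "\<And>x. norm (F x) \<le> M"
  and contG: "continuous_on UNIV G" and h: "h > 0"
 shows "\<exists>v. continuous_on UNIV v \<and>
  (\<forall>t\<le>T. v t = G t + integral {0..max 0 t} (\<lambda>s. F (v (s - h))))"
proof -
 define u where "u = rec_nat G (\<lambda>_ u t. G t + integral {0..max 0 t} (\<lambda>s. F (u (s - h))))"
 have u0: "u 0 = G" and uS: "u (Suc k) = (\<lambda>t. G t + integral {0..max 0 t} (\<lambda>s. F (u k (s - h))))" for k
  by (simp_all add: u_def)
 have lip: "continuous_on UNIV (\<lambda>t. integral {0..max 0 t} f)"
  if f: "continuous_on UNIV f" "\<And>s. norm (f s) \<le> M" for f :: "real \<Rightarrow> 'a"
 proof -
  have "M \<ge> 0" by (rule order_trans[OF norm_ge_zero f(2)[of 0]])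
  then have "M-lipschitz_on UNIV (\<lambda>t. integral {0..max 0 t} f)"
   by (intro lipschitz_onI) (auto simp: dist_norm intro!: indefinite_integral_lipschitz f)
  then show ?thesis by (rule lipschitz_on_continuous_on)
 qed
 have cont: "continuous_on UNIV (u k)" for k
 proof (induction k)
  case (Suc k)
  have "continuous_on UNIV (\<lambda>s. F (u k (s - h)))"
   by (rule continuous_on_compose2[OF contF])
     (auto intro!: continuous_on_compose2[OF Suc] continuous_intros)
  then show ?case unfolding uS by (intro continuous_intros contG lip M)
 qed (simp add: u0 contG)
 have stable: "u (Suc k) t = u k t" if "t \<le> k * h" for k t
  using that
 proof (induction k arbitrary: t)
  case 0
  then show ?case by (simp add: uS u0)
 next
  case (Suc k)
  have "integral {0..max 0 t} (\<lambda>s. F (u (Suc k) (s - h))) = integral {0..max 0 t} (\<lambda>s. F (u k (s - h)))"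
  proof (rule Henstock_Kurzweil_Integration.integral_cong)
   fix s assume "s \<in> {0..max 0 t}"
   then have "s - h \<le> k * h"
    using Suc.prems h by (auto simp: algebra_simps max_def split: if_splits)
   then show "F (u (Suc k) (s - h)) = F (u k (s - h))" using Suc.IH by simp
  qed
  then show ?case unfolding uS[of "Suc k"] by (simp add: uS[of k])
 qed
 obtain k :: nat where k: "T \<le> k * h" using real_arch_simple[of "T / h"] h by (auto simp: field_simps)
 have "u k t = G t + integral {0..max 0 t} (\<lambda>s. F (u k (s - h)))" if "t \<le> T" for t
  using stable[of t k] uS[of k] k that by simp
 then show ?thesis using cont by blast
qed

text \<open>
 The one-sided Lipschitz bound replaces compactness: two delayed solutions satisfy the same
 equation up to a small error, so their difference is controlled by Gronwall's inequality
 although \<open>F\<close> is only uniformly continuous.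
\<close>

lemma delay_solutions_close:
 fixes F :: "'a::{real_inner,banach} \<Rightarrow> 'a" and G v1 v2 :: "real \<Rightarrow> 'a"
 assumes contF: "continuous_on UNIV F"
  and one_sided: "\<And>x y. (F x - F y) \<bullet> (x - y) \<le> L * (norm (x - y))\<^sup>2" and L: "L \<ge> 0"
  and v1: "continuous_on UNIV v1" "\<And>t. t \<le> T \<Longrightarrow> v1 t = G t + integral {0..max 0 t} (\<lambda>s. F (v1 (s - h1)))"
  and v2: "continuous_on UNIV v2" "\<And>t. t \<le> T \<Longrightarrow> v2 t = G t + integral {0..max 0 t} (\<lambda>s. F (v2 (s - h2)))"
  and e1: "\<And>t. t \<in> {0..T} \<Longrightarrow> norm (F (v1 (t - h1)) - F (v1 t)) \<le> e"
  and e2: "\<And>t. t \<in> {0..T} \<Longrightarrow> norm (F (v2 (t - h2)) - F (v2 t)) \<le> e"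
  and e: "e \<ge> 0" and t: "t \<in> {0..T}"
 shows "(norm (v1 t - v2 t))\<^sup>2 \<le> 4 * e\<^sup>2 * T * exp ((2 * L + 1) * T)"
proof -
 define z where "z = (\<lambda>t. integral {0..t} (\<lambda>s. F (v1 (s - h1))) - integral {0..t} (\<lambda>s. F (v2 (s - h2))))"
 define z' where "z' = (\<lambda>t. F (v1 (t - h1)) - F (v2 (t - h2)))"
 have z_eq: "z t = v1 t - v2 t" if "t \<in> {0..T}" for t
  using that v1(2)[of t] v2(2)[of t] by (simp add: z_def max_def)
 have cont: "continuous_on UNIV (\<lambda>s. F (v (s - h)))" if "continuous_on UNIV v" for v :: "real \<Rightarrow> 'a" and h
  by (rule continuous_on_compose2[OF contF])
    (auto intro!: continuous_on_compose2[OF that] continuous_intros)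
 have z_der: "(z has_vector_derivative z' t) (at t within {0..T})" if "t \<in> {0..T}" for t
  unfolding z_def z'_def
  by (intro has_vector_derivative_diff integral_has_vector_derivative that)
    (auto intro: continuous_on_subset[OF cont] v1 v2)
 have "z t \<bullet> z t \<le> (4 * e\<^sup>2) * T * exp ((2 * L + 1) * T)"
 proof (rule gronwall[where u="\<lambda>t. z t \<bullet> z t" and u'="\<lambda>t. 2 * (z' t \<bullet> z t)"])
  fix t assume t: "t \<in> {0..T}"
  have "((\<lambda>t. z t \<bullet> z t) has_vector_derivative (z t \<bullet> z' t + z' t \<bullet> z t)) (at t within {0..T})"
   by (rule bounded_bilinear.has_vector_derivative[OF bounded_bilinear_inner z_der[OF t] z_der[OF t]])
  then show "((\<lambda>t. z t \<bullet> z t) has_vector_derivative 2 * (z' t \<bullet> z t)) (at t within {0..T})"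
   by (simp add: inner_commute)
  let ?n = "norm (z t)"
  have "z' t \<bullet> z t = (F (v1 (t - h1)) - F (v1 t)) \<bullet> z t + (F (v1 t) - F (v2 t)) \<bullet> z t
      - (F (v2 (t - h2)) - F (v2 t)) \<bullet> z t"
   unfolding z'_def by (simp add: inner_diff_left)
  moreover have "(F (v1 (t - h1)) - F (v1 t)) \<bullet> z t \<le> e * ?n"
   using norm_cauchy_schwarz mult_right_mono[OF e1[OF t] norm_ge_zero] order_trans by blast
  moreover have "- ((F (v2 (t - h2)) - F (v2 t)) \<bullet> z t) \<le> e * ?n"
   using Cauchy_Schwarz_ineq2[of "F (v2 (t - h2)) - F (v2 t)" "z t"]
    mult_right_mono[OF e2[OF t] norm_ge_zero[of "z t"]] by linarith
  moreover have "(F (v1 t) - F (v2 t)) \<bullet> z t \<le> L * ?n\<^sup>2"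
   unfolding z_eq[OF t] by (rule one_sided)
  ultimately have "2 * (z' t \<bullet> z t) \<le> 2 * L * ?n\<^sup>2 + 2 * (2 * e) * ?n" by simp
  also have "2 * (2 * e) * ?n \<le> (2 * e)\<^sup>2 + ?n\<^sup>2" by (rule sum_squares_bound)
  finally show "2 * (z' t \<bullet> z t) \<le> (2 * L + 1) * (z t \<bullet> z t) + 4 * e\<^sup>2"
   by (simp add: power2_norm_eq_inner power_mult_distrib algebra_simps)
 qed (use L t in \<open>auto simp: z_def\<close>)
 then show ?thesis using z_eq[OF t] by (simp add: power2_norm_eq_inner)
qed

text \<open>
 The solutions with delay \<open>1/(n+1)\<close> are a uniform Cauchy sequence.  The delay disappears in the
 limit because they are uniformly equicontinuous and \<open>F\<close> is uniformly continuous.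
\<close>

lemma ode_bounded_one_sided_lipschitz:
 fixes F :: "'a::{real_inner,banach} \<Rightarrow> 'a" and G :: "real \<Rightarrow> 'a"
 assumes ucF: "uniformly_continuous_on UNIV F" and M: "\<And>x. norm (F x) \<le> M"
  and one_sided: "\<And>x y. (F x - F y) \<bullet> (x - y) \<le> L * (norm (x - y))\<^sup>2" and L: "L \<ge> 0"
  and contG: "continuous_on {0..T} G" and T: "T > 0"
 shows "\<exists>v. continuous_on {0..T} v \<and> (\<forall>t\<in>{0..T}. v t = G t + integral {0..t} (\<lambda>s. F (v s)))"
proof -
 have M0: "M \<ge> 0" by (rule order_trans[OF norm_ge_zero M[of 0]])
 have contF: "continuous_on UNIV F" using ucF by (rule uniformly_continuous_imp_continuous)
 define Gc where "Gc = (\<lambda>t. G (max 0 (min T t)))"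
 have ucG: "\<exists>d>0. \<forall>s t. \<bar>s - t\<bar> < d \<longrightarrow> norm (Gc s - Gc t) < e" if e0: "e > 0" for e
 proof -
  have uc: "uniformly_continuous_on {0..T} G" by (rule compact_uniformly_continuous[OF contG]) simp
  then obtain d where d: "d > 0" "\<And>x y. x \<in> {0..T} \<Longrightarrow> y \<in> {0..T} \<Longrightarrow> dist y x < d \<Longrightarrow> dist (G y) (G x) < e"
   using uc[unfolded uniformly_continuous_on_def, rule_format, OF e0] by auto
  have "norm (Gc s - Gc t) < e" if "\<bar>s - t\<bar> < d" for s t
   unfolding Gc_def dist_norm[symmetric] by (rule d(2)) (use that T in \<open>auto simp: dist_real_def\<close>)
  with d(1) show ?thesis by blast
 qed
 have contGc: "continuous_on UNIV Gc"
  unfolding Gc_def by (rule continuous_on_compose2[OF contG]) (use T in \<open>auto intro!: continuous_intros\<close>)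
 define hh where "hh = (\<lambda>n::nat. 1 / real (Suc n))"
 have "\<forall>n. \<exists>v. continuous_on UNIV v \<and>
   (\<forall>t\<le>T. v t = Gc t + integral {0..max 0 t} (\<lambda>s. F (v (s - hh n))))"
  by (intro allI delay_equation_solvable[where M=M] contF M contGc) (simp add: hh_def)
 then obtain v where v: "\<And>n. continuous_on UNIV (v n)"
   "\<And>n t. t \<le> T \<Longrightarrow> v n t = Gc t + integral {0..max 0 t} (\<lambda>s. F (v n (s - hh n)))"
  by metis
 have cont: "continuous_on UNIV (\<lambda>s. F (v n (s - h)))" for n h
  by (rule continuous_on_compose2[OF contF])
    (auto intro!: continuous_on_compose2[OF v(1)] continuous_intros)
 have err: "\<exists>N. \<forall>n\<ge>N. \<forall>t\<in>{0..T}. norm (F (v n (t - hh n)) - F (v n t)) \<le> e" if e0: "e > 0" for e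
 proof -
  obtain d where d: "d > 0" "\<And>x y. dist y x < d \<Longrightarrow> dist (F y) (F x) < e"
   using ucF[unfolded uniformly_continuous_on_def, rule_format, OF e0] by auto
  obtain d' where d': "d' > 0" "\<And>s t. \<bar>s - t\<bar> < d' \<Longrightarrow> norm (Gc s - Gc t) < d/2"
   using ucG[of "d/2"] d by auto
  obtain N where N: "1 / real (Suc N) < min d' (d / (2 * (M + 1)))"
   using nat_approx_posE[of "min d' (d / (2 * (M + 1)))"] d d' M0 by auto
  have "norm (F (v n (t - hh n)) - F (v n t)) \<le> e" if "n \<ge> N" "t \<in> {0..T}" for n t
  proof -
   have hn: "0 < hh n" "hh n < d'" "hh n < d / (2 * (M + 1))"
    using N \<open>n \<ge> N\<close> unfolding hh_def
    by (auto intro: le_less_trans[of _ "1 / real (Suc N)"] simp: frac_le)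
   have "v n (t - hh n) - v n t = (Gc (t - hh n) - Gc t)
     + (integral {0..max 0 (t - hh n)} (\<lambda>s. F (v n (s - hh n)))
       - integral {0..max 0 t} (\<lambda>s. F (v n (s - hh n))))"
    using v(2)[of t n] v(2)[of "t - hh n" n] \<open>t \<in> {0..T}\<close> hn by simp
   moreover have "norm (integral {0..max 0 (t - hh n)} (\<lambda>s. F (v n (s - hh n)))
       - integral {0..max 0 t} (\<lambda>s. F (v n (s - hh n)))) \<le> M * \<bar>t - hh n - t\<bar>"
    by (rule indefinite_integral_lipschitz[OF cont M])
   moreover have "M * \<bar>t - hh n - t\<bar> \<le> d/2"
   proof -
    have "M * hh n \<le> (M + 1) * hh n" using hn by (intro mult_right_mono) auto
    also have "\<dots> \<le> d/2" using hn(3) M0 by (simp add: field_simps)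
    finally show ?thesis using hn by simp
   qed
   moreover have "norm (Gc (t - hh n) - Gc t) < d/2" by (rule d'(2)) (use hn in auto)
   ultimately have "norm (v n (t - hh n) - v n t) < d"
    by (smt (verit) norm_triangle_ineq field_sum_of_halves)
   then show ?thesis using d(2)[of "v n (t - hh n)" "v n t"] by (simp add: dist_norm)
  qed
  then show ?thesis by blast
 qed
 define K where "K = 4 * T * exp ((2 * L + 1) * T)"
 have K: "K > 0" using T by (simp add: K_def)
 have "uniformly_Cauchy_on {0..T} v"
 proof (rule uniformly_Cauchy_onI)
  fix e :: real assume e: "e > 0"
  define e' where "e' = e / (2 * sqrt K)"
  have e': "e' > 0" using e K by (simp add: e'_def)
  obtain N where N: "\<forall>n\<ge>N. \<forall>t\<in>{0..T}. norm (F (v n (t - hh n)) - F (v n t)) \<le> e'"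
   using err[OF e'] by blast
  have "dist (v m t) (v n t) < e" if t: "t \<in> {0..T}" and "m \<ge> N" "n \<ge> N" for m n t
  proof -
   have "(norm (v m t - v n t))\<^sup>2 \<le> 4 * e'\<^sup>2 * T * exp ((2 * L + 1) * T)"
    using N that e'
    by (intro delay_solutions_close[OF contF one_sided L v(1) v(2) v(1) v(2) _ _ _ t]) auto
   also have "\<dots> = (e' * sqrt K)\<^sup>2" using K by (simp add: power_mult_distrib K_def)
   also have "e' * sqrt K = e / 2" using K by (simp add: e'_def)
   finally have "norm (v m t - v n t) \<le> e / 2" by (rule power2_le_imp_le) (use e in simp)
   then show ?thesis using e by (simp add: dist_norm)
  qed
  then show "\<exists>N. \<forall>t\<in>{0..T}. \<forall>m\<ge>N. \<forall>n\<ge>N. dist (v m t) (v n t) < e" by blast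
 qed
 then have "uniformly_convergent_on {0..T} v" by (simp add: uniformly_convergent_eq_Cauchy)
 then obtain w where w: "uniform_limit {0..T} v w sequentially"
  by (auto simp: uniformly_convergent_on_def)
 have contw: "continuous_on {0..T} w"
  by (rule uniform_limit_theorem[OF _ w]) (auto intro!: always_eventually continuous_on_subset[OF v(1)])
 have w_eq: "w t = G t + integral {0..t} (\<lambda>s. F (w s))" if t: "t \<in> {0..T}" for t
 proof -
  have ul: "uniform_limit {0..t} (\<lambda>n s. F (v n (s - hh n))) (\<lambda>s. F (w s)) sequentially"
   unfolding uniform_limit_iff
  proof (intro allI impI)
   fix e :: real assume e: "e > 0"
   obtain d where d: "d > 0" "\<And>x y. dist y x < d \<Longrightarrow> dist (F y) (F x) < e/2"
    using ucF[unfolded uniformly_continuous_on_def, rule_format, of "e/2"] e by auto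
   obtain N where N: "\<forall>n\<ge>N. \<forall>t\<in>{0..T}. norm (F (v n (t - hh n)) - F (v n t)) \<le> e/4"
    using err[of "e/4"] e by auto
   have "\<forall>\<^sub>F n in sequentially. \<forall>x\<in>{0..T}. dist (v n x) (w x) < d"
    using w d(1) unfolding uniform_limit_iff by blast
   then show "\<forall>\<^sub>F n in sequentially. \<forall>s\<in>{0..t}. dist (F (v n (s - hh n))) (F (w s)) < e"
    using eventually_ge_at_top[of N]
   proof eventually_elim
    case (elim n)
    show ?case
    proof
     fix s assume s: "s \<in> {0..t}"
     then have s': "s \<in> {0..T}" using t by auto
     have "dist (F (v n (s - hh n))) (F (v n s)) \<le> e/4" using N elim s' by (simp add: dist_norm)
     moreover have "dist (F (v n s)) (F (w s)) < e/2" using elim s' by (intro d(2)) auto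
     ultimately show "dist (F (v n (s - hh n))) (F (w s)) < e"
      using dist_triangle[of "F (v n (s - hh n))" "F (w s)" "F (v n s)"] e by linarith
    qed
   qed
  qed
  obtain I J where IJ: "\<And>n. ((\<lambda>s. F (v n (s - hh n))) has_integral I n) {0..t}"
   "((\<lambda>s. F (w s)) has_integral J) {0..t}" "I \<longlonglongrightarrow> J"
   using uniform_limit_integral[OF ul] continuous_on_subset[OF cont] by (metis sequentially_bot subset_UNIV)
  have "(\<lambda>n. v n t) \<longlonglongrightarrow> w t" using tendsto_uniform_limitI[OF w] t by blast
  moreover have "v n t = G t + I n" for n
   using v(2)[of t n] t integral_unique[OF IJ(1)] by (simp add: Gc_def max_def)
  ultimately have "(\<lambda>n. G t + I n) \<longlonglongrightarrow> w t" by simp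
  moreover have "(\<lambda>n. G t + I n) \<longlonglongrightarrow> G t + J" by (intro tendsto_intros IJ)
  ultimately have "w t = G t + J" by (rule LIMSEQ_unique)
  then show ?thesis using integral_unique[OF IJ(2)] by simp
 qed
 show ?thesis using contw w_eq by blast
qed

text \<open>
 Growth and sign conditions give an a priori bound that does not see a truncation of \<open>F\<close> outside
 a large ball, so that a bounded, globally one-sided Lipschitz \<open>F\<close> may be assumed.  The bound is
 for \<open>w = v - G\<close> because \<open>v\<close> itself need not be differentiable in time.
\<close>

theorem ode_dissipative:
 fixes F :: "'a::{real_inner,banach} \<Rightarrow> 'a" and G :: "real \<Rightarrow> 'a"
 assumes ucF: "\<And>R. uniformly_continuous_on (cball 0 R) F"
  and growth: "\<And>x. norm (F x) \<le> C * (1 + (norm x)\<^sup>2)" and C: "C \<ge> 0"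
  and dissip: "\<And>x. F x \<bullet> x \<le> 0"
  and one_sided: "\<And>R. \<exists>L\<ge>0. \<forall>x\<in>cball 0 R. \<forall>y\<in>cball 0 R. (F x - F y) \<bullet> (x - y) \<le> L * (norm (x - y))\<^sup>2"
  and contG: "continuous_on {0..T} G" and T: "T > 0"
 shows "\<exists>v. continuous_on {0..T} v \<and> (\<forall>t\<in>{0..T}. v t = G t + integral {0..t} (\<lambda>s. F (v s)))"
proof -
 have "bounded (G ` {0..T})" by (rule compact_imp_bounded, rule compact_continuous_image[OF contG]) simp
 then obtain g where g: "g > 0" "\<And>t. t \<in> {0..T} \<Longrightarrow> norm (G t) \<le> g"
  unfolding bounded_pos by blast
 \<comment> \<open>\<open>(|w|\<^sup>2)' \<le> c |w|\<^sup>2 + d\<close> will hold, whence \<open>|w|\<^sup>2 \<le> K\<close> and \<open>|v| \<le> R\<close>\<close>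
 define c where "c = 4 * C * g"
 define d where "d = 2 * C * g * (1 + 2 * g\<^sup>2)"
 define K where "K = d * T * exp (c * T)"
 have cd: "c \<ge> 0" "d \<ge> 0" "K \<ge> 0" using C g T by (auto simp: c_def d_def K_def)
 define R where "R = sqrt K + g + 1"
 have R: "R > 0" using g cd by (simp add: R_def add_nonneg_pos)
 define M where "M = C * (1 + (2 * R)\<^sup>2)"
 have M0: "M \<ge> 0" using C by (simp add: M_def)
 have FM: "norm (F x) \<le> M" if "norm x \<le> 2 * R" for x
 proof -
  have "norm (F x) \<le> C * (1 + (norm x)\<^sup>2)" by (rule growth)
  also have "\<dots> \<le> M" unfolding M_def using that C by (intro mult_left_mono add_left_mono power_mono) auto
  finally show ?thesis .
 qed
 define cut where "cut = (\<lambda>x::'a. max 0 (min 1 (2 - norm x / R)))"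
 have chi01: "0 \<le> cut x" "cut x \<le> 1" for x by (auto simp: cut_def)
 have chi0: "cut x = 0" if "norm x \<ge> 2 * R" for x
  using that R by (simp add: cut_def max_def min_def field_simps)
 have chi1: "cut x = 1" if "norm x \<le> R" for x
  using that R by (simp add: cut_def max_def min_def field_simps)
 have chi_lip: "\<bar>cut x - cut y\<bar> \<le> norm (x - y) / R" for x y
 proof -
  have "\<bar>cut x - cut y\<bar> \<le> \<bar>norm x / R - norm y / R\<bar>" unfolding cut_def by linarith
  also have "\<dots> = \<bar>norm x - norm y\<bar> / R" using R by (simp add: diff_divide_distrib[symmetric])
  also have "\<dots> \<le> norm (x - y) / R" using R by (intro divide_right_mono norm_triangle_ineq3) auto
  finally show ?thesis .
 qed
 define H where "H = (\<lambda>x. cut x *\<^sub>R F x)"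
 have H0: "H x = 0" if "norm x \<ge> 2 * R" for x using chi0[OF that] by (simp add: H_def)
 have HM: "norm (H x) \<le> M" for x
 proof (cases "norm x \<le> 2 * R")
  case True
  have "norm (H x) \<le> 1 * norm (F x)" unfolding H_def using chi01[of x] by (simp add: mult_left_le_one_le)
  then show ?thesis using FM[OF True] by simp
 qed (use H0[of x] M0 in auto)
 have split: "H x - H y = cut x *\<^sub>R (F x - F y) + (cut x - cut y) *\<^sub>R F y" for x y
  by (simp add: H_def algebra_simps)
 have cut_term: "norm ((cut x - cut y) *\<^sub>R F y) \<le> norm (x - y) / R * M" if "norm y \<le> 2 * R" for x y
  using mult_mono[OF chi_lip[of x y] FM[OF that]] R by simp
 obtain L where L: "L \<ge> 0" "\<And>x y. norm x \<le> 2 * R \<Longrightarrow> norm y \<le> 2 * R \<Longrightarrow>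
   (F x - F y) \<bullet> (x - y) \<le> L * (norm (x - y))\<^sup>2"
  using one_sided[of "2 * R"] by auto
 have near: "(H x - H y) \<bullet> (x - y) \<le> (L + M / R) * (norm (x - y))\<^sup>2" if y: "norm y \<le> 2 * R" for x y
 proof -
  have "cut x * ((F x - F y) \<bullet> (x - y)) \<le> L * (norm (x - y))\<^sup>2"
  proof (cases "norm x \<le> 2 * R")
   case True
   have "cut x * ((F x - F y) \<bullet> (x - y)) \<le> cut x * (L * (norm (x - y))\<^sup>2)"
    by (intro mult_left_mono L(2) True y chi01)
   also have "\<dots> \<le> 1 * (L * (norm (x - y))\<^sup>2)" using L(1) chi01 by (intro mult_right_mono) auto
   finally show ?thesis by simp
  qed (use chi0[of x] L(1) in auto)
  moreover have "((cut x - cut y) *\<^sub>R F y) \<bullet> (x - y) \<le> (norm (x - y) / R * M) * norm (x - y)"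
   using norm_cauchy_schwarz mult_right_mono[OF cut_term[OF y] norm_ge_zero] by (rule order_trans)
  ultimately show ?thesis
   unfolding split inner_add_left by (simp add: power2_eq_square algebra_simps)
 qed
 have H_one_sided: "(H x - H y) \<bullet> (x - y) \<le> (L + M / R) * (norm (x - y))\<^sup>2" for x y
 proof (cases "norm y \<le> 2 * R \<or> norm x \<le> 2 * R")
  case True
  then show ?thesis
  proof
   assume "norm x \<le> 2 * R"
   from near[OF this, of y] show ?thesis
    by (simp add: norm_minus_commute inner_diff_left inner_diff_right algebra_simps)
  qed (rule near)
 qed (use H0[of x] H0[of y] L(1) M0 R in auto)
 have ucH: "uniformly_continuous_on UNIV H"
  unfolding uniformly_continuous_on_def
 proof (intro allI impI)
  fix e :: real assume e: "e > 0"
  obtain d1 where d1: "d1 > 0" "\<And>x y. norm x \<le> 2 * R \<Longrightarrow> norm y \<le> 2 * R \<Longrightarrow> dist y x < d1 \<Longrightarrow> dist (F y) (F x) < e/2"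
   using ucF[of "2 * R", unfolded uniformly_continuous_on_def, rule_format, of "e/2"] e by auto
  define d where "d = min d1 (e * R / (2 * (M + 1)))"
  have d: "d > 0" using d1 e R M0 by (simp add: d_def)
  have near: "dist (H x) (H y) < e" if y: "norm y \<le> 2 * R" and xy: "dist x y < d" for x y
  proof -
   have "norm (cut x *\<^sub>R (F x - F y)) < e/2"
   proof (cases "norm x \<le> 2 * R")
    case True
    have "norm (cut x *\<^sub>R (F x - F y)) \<le> 1 * norm (F x - F y)"
     using chi01[of x] by (simp add: mult_left_le_one_le)
    then show ?thesis using d1(2)[OF y True] xy by (simp add: d_def dist_norm)
   qed (use chi0[of x] e in auto)
   moreover have "norm ((cut x - cut y) *\<^sub>R F y) \<le> e/2"
   proof -
    have "norm (x - y) / R * M \<le> norm (x - y) / R * (M + 1)" using R by (intro mult_left_mono) auto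
    also have "\<dots> \<le> e/2" using xy R M0 unfolding d_def by (simp add: dist_norm field_simps)
    finally show ?thesis using cut_term[OF y, of x] by linarith
   qed
   ultimately show ?thesis
    unfolding dist_norm split using norm_triangle_ineq[of "cut x *\<^sub>R (F x - F y)" "(cut x - cut y) *\<^sub>R F y"] by linarith
  qed
  have "dist (H y) (H x) < e" if "dist y x < d" for x y
  proof (cases "norm y \<le> 2 * R \<or> norm x \<le> 2 * R")
   case True
   then show ?thesis using near[of y x] near[of x y] that by (auto simp: dist_commute)
  qed (use H0[of x] H0[of y] e in auto)
  with d show "\<exists>d>0. \<forall>x\<in>UNIV. \<forall>x'\<in>UNIV. dist x' x < d \<longrightarrow> dist (H x') (H x) < e" by blast
 qed
 obtain v where v: "continuous_on {0..T} v" "\<And>t. t \<in> {0..T} \<Longrightarrow> v t = G t + integral {0..t} (\<lambda>s. H (v s))"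
  using ode_bounded_one_sided_lipschitz[OF ucH HM H_one_sided _ contG T] L(1) M0 R by auto
 define w where "w = (\<lambda>t. integral {0..t} (\<lambda>s. H (v s)))"
 have contH: "continuous_on {0..T} (\<lambda>s. H (v s))"
  by (rule continuous_on_compose2[OF uniformly_continuous_imp_continuous[OF ucH] v(1)]) simp
 have w_der: "(w has_vector_derivative H (v t)) (at t within {0..T})" if "t \<in> {0..T}" for t
  unfolding w_def by (rule integral_has_vector_derivative[OF contH that])
 have wK: "w t \<bullet> w t \<le> K" if t: "t \<in> {0..T}" for t
  unfolding K_def
 proof (rule gronwall[OF _ _ cd(1,2) _ t, where u="\<lambda>t. w t \<bullet> w t" and u'="\<lambda>t. 2 * (H (v t) \<bullet> w t)"])
  fix t assume t: "t \<in> {0..T}"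
  have "((\<lambda>t. w t \<bullet> w t) has_vector_derivative (w t \<bullet> H (v t) + H (v t) \<bullet> w t)) (at t within {0..T})"
   by (rule bounded_bilinear.has_vector_derivative[OF bounded_bilinear_inner w_der[OF t] w_der[OF t]])
  then show "((\<lambda>t. w t \<bullet> w t) has_vector_derivative 2 * (H (v t) \<bullet> w t)) (at t within {0..T})"
   by (simp add: inner_commute)
  have vw: "v t = G t + w t" using v(2)[OF t] by (simp add: w_def)
  have "H (v t) \<bullet> w t = cut (v t) * (F (v t) \<bullet> v t) - cut (v t) * (F (v t) \<bullet> G t)"
   by (simp add: vw H_def inner_add_right algebra_simps)
  also have "\<dots> \<le> cut (v t) * (norm (F (v t)) * norm (G t))"
  proof -
   have "cut (v t) * (F (v t) \<bullet> v t) \<le> 0" using dissip chi01 by (simp add: mult_nonneg_nonpos)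
   moreover have "cut (v t) * - (F (v t) \<bullet> G t) \<le> cut (v t) * (norm (F (v t)) * norm (G t))"
    using Cauchy_Schwarz_ineq2[of "F (v t)" "G t"] chi01 by (intro mult_left_mono) auto
   ultimately show ?thesis by simp
  qed
  also have "\<dots> \<le> 1 * (norm (F (v t)) * norm (G t))" using chi01 by (intro mult_right_mono) auto
  also have "\<dots> \<le> C * (1 + (norm (v t))\<^sup>2) * g"
   using growth[of "v t"] g(2)[OF t] C by (simp add: mult_mono)
  also have "\<dots> \<le> C * (1 + 2 * (g\<^sup>2 + w t \<bullet> w t)) * g"
  proof -
   have "(norm (v t))\<^sup>2 \<le> 2 * ((norm (G t))\<^sup>2 + (norm (w t))\<^sup>2)" unfolding vw by (rule norm_sum_sq_le)
   also have "\<dots> \<le> 2 * (g\<^sup>2 + w t \<bullet> w t)"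
    using power_mono[OF g(2)[OF t], of 2] by (simp add: power2_norm_eq_inner)
   finally show ?thesis using C g(1) by (intro mult_right_mono mult_left_mono add_left_mono) auto
  qed
  finally show "2 * (H (v t) \<bullet> w t) \<le> c * (w t \<bullet> w t) + d"
   by (simp add: c_def d_def algebra_simps)
 qed (simp add: w_def)
 have vR: "norm (v t) \<le> R" if t: "t \<in> {0..T}" for t
 proof -
  have "norm (w t) \<le> sqrt K" using wK[OF t] by (simp add: norm_eq_sqrt_inner)
  moreover have "v t = G t + w t" using v(2)[OF t] by (simp add: w_def)
  ultimately show ?thesis using g(2)[OF t] norm_triangle_ineq[of "G t" "w t"] by (simp add: R_def)
 qed
 have "v t = G t + integral {0..t} (\<lambda>s. F (v s))" if t: "t \<in> {0..T}" for t
 proof -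
  have "integral {0..t} (\<lambda>s. H (v s)) = integral {0..t} (\<lambda>s. F (v s))"
   by (rule Henstock_Kurzweil_Integration.integral_cong) (use t chi1 vR in \<open>auto simp: H_def\<close>)
  then show ?thesis using v(2)[OF t] by simp
 qed
 with v(1) show ?thesis by blast
qed

section \<open>Smooth functions and the fundamental lemma of the calculus of variations\<close>

text \<open>Any derivative will do in place of the chosen one in the definition of \<open>Ck\<close>.\<close>

lemma Ck_SucI:
 assumes "\<And>x. (f has_derivative f' x) (at x)" "\<And>u. Ck k (\<lambda>x. f' x u)"
 shows "Ck (Suc k) f"
proof -
 have "frechet_derivative f (at x) = f' x" for x
  using frechet_derivative_at[OF assms(1)] by metis
 then show ?thesis using assms by (auto simp: differentiable_def)
qed

lemma Ck_has_derivative: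
 "Ck (Suc k) f \<Longrightarrow> (f has_derivative frechet_derivative f (at x)) (at x)"
 by (simp add: frechet_derivative_works[symmetric])

lemma Ck_derivative: "Ck (Suc k) f \<Longrightarrow> Ck k (\<lambda>x. frechet_derivative f (at x) u)"
 by simp

lemma Ck_SucD: "Ck (Suc k) f \<Longrightarrow> Ck k f"
proof (induction k arbitrary: f)
 case 0
 then show ?case by (auto intro!: continuous_at_imp_continuous_on differentiable_imp_continuous_within)
next
 case (Suc k)
 have "Ck k (\<lambda>x. frechet_derivative f (at x) u)" for u
  by (rule Suc.IH[OF Ck_derivative[OF Suc.prems]])
 then show ?case by (rule Ck_SucI[OF Ck_has_derivative[OF Suc.prems]])
qed

lemma Ck_continuous: "Ck k f \<Longrightarrow> continuous_on UNIV f"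
 by (induction k) (use Ck_SucD in \<open>auto simp del: Ck.simps(2)\<close>)

lemma Ck_const: "Ck k (\<lambda>x. c)"
proof (induction k arbitrary: c)
 case (Suc k)
 show ?case by (rule Ck_SucI[where f'="\<lambda>x u. 0"]) (auto intro: Suc)
qed simp

lemma Ck_add: "Ck k f \<Longrightarrow> Ck k g \<Longrightarrow> Ck k (\<lambda>x. f x + g x)"
proof (induction k arbitrary: f g)
 case (Suc k)
 show ?case
  by (rule Ck_SucI[OF has_derivative_add[OF Ck_has_derivative Ck_has_derivative]], fact, fact)
    (intro Suc.IH Ck_derivative Suc.prems)
qed (simp add: continuous_on_add)

lemma Ck_linear: "bounded_linear L \<Longrightarrow> Ck k f \<Longrightarrow> Ck k (\<lambda>x. L (f x))"
proof (induction k arbitrary: f)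
 case 0
 then show ?case by (simp add: bounded_linear.continuous_on)
next
 case (Suc k)
 show ?case
  by (rule Ck_SucI[OF bounded_linear.has_derivative[OF Suc.prems(1) Ck_has_derivative]], fact)
    (intro Suc.IH Ck_derivative Suc.prems)
qed

lemma Ck_mult: "Ck k f \<Longrightarrow> Ck k g \<Longrightarrow> Ck k (\<lambda>x. f x * g x)"
 for f g :: "'a::euclidean_space \<Rightarrow> real"
proof (induction k arbitrary: f g)
 case (Suc k)
 show ?case
  by (rule Ck_SucI[OF has_derivative_mult[OF Ck_has_derivative Ck_has_derivative]], fact, fact)
    (intro Ck_add Suc.IH Ck_derivative Suc.prems Ck_SucD)
qed (simp add: continuous_on_mult)

lemma Ck_prod: "finite I \<Longrightarrow> (\<And>i. i \<in> I \<Longrightarrow> Ck k (f i)) \<Longrightarrow> Ck k (\<lambda>x. \<Prod>i\<in>I. f i x)"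
 for f :: "'i \<Rightarrow> 'a::euclidean_space \<Rightarrow> real"
 by (induction rule: finite_induct) (auto intro: Ck_const Ck_mult)

lemma Ck_compose_linear:
 fixes f :: "'a::euclidean_space \<Rightarrow> 'b::real_normed_vector" and L :: "'c::euclidean_space \<Rightarrow> 'a"
 assumes L: "bounded_linear L"
 shows "Ck k f \<Longrightarrow> Ck k (\<lambda>x. f (L x + c))"
proof (induction k arbitrary: f)
 case 0
 have cL: "continuous_on UNIV L" by (rule linear_continuous_on[OF L])
 have "continuous_on UNIV (\<lambda>x. f (L x + c))"
  by (rule continuous_on_compose2[of UNIV f]) (use 0 in \<open>auto intro!: continuous_intros cL\<close>)
 then show ?case by simp
next
 case (Suc k)
 show ?case
 proof (rule Ck_SucI)
  fix x
  have "((\<lambda>x. L x + c) has_derivative L) (at x)"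
   using has_derivative_add[OF bounded_linear_imp_has_derivative[OF L] has_derivative_const[of c]] by simp
  from has_derivative_compose[OF this Ck_has_derivative[OF Suc.prems]]
  show "((\<lambda>x. f (L x + c)) has_derivative (\<lambda>u. frechet_derivative f (at (L x + c)) (L u))) (at x)" .
 next
  fix u show "Ck k (\<lambda>x. frechet_derivative f (at (L x + c)) (L u))"
   by (rule Suc.IH[OF Ck_derivative[OF Suc.prems]])
 qed
qed

lemma Ck_compose_affine: "Ck k h \<Longrightarrow> Ck k (\<lambda>x. h (x \<bullet> b + c))"
 for h :: "real \<Rightarrow> real" and b :: "'a::euclidean_space"
 by (rule Ck_compose_linear[OF bounded_linear_inner_left])

lemma smooth_add: "smooth f \<Longrightarrow> smooth g \<Longrightarrow> smooth (\<lambda>x. f x + g x)"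
 by (simp add: smooth_def Ck_add)

lemma smooth_scaleR: "smooth f \<Longrightarrow> smooth (\<lambda>x. c *\<^sub>R f x)"
 unfolding smooth_def by (auto intro: Ck_linear bounded_linear_scaleR_right)

lemma smooth_has_derivative: "smooth f \<Longrightarrow> (f has_derivative frechet_derivative f (at x)) (at x)"
 using Ck_has_derivative[of 0 f x] by (simp add: smooth_def del: Ck.simps)

lemma smooth_continuous_derivative:
 "smooth f \<Longrightarrow> continuous_on UNIV (\<lambda>x. frechet_derivative f (at x) u)"
 using Ck_derivative[of 0 f u] by (simp add: smooth_def del: Ck.simps) simp

lemma smooth_continuous: "smooth f \<Longrightarrow> continuous_on S f"
 using Ck_continuous[of 0 f] continuous_on_subset unfolding smooth_def by blast

lemma continuous_borel_measurable_lebesgue: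
 fixes f :: "'a::euclidean_space \<Rightarrow> 'b::real_normed_vector"
 assumes "continuous_on UNIV f" shows "f \<in> borel_measurable lebesgue"
proof -
 have "f \<in> borel_measurable lborel" using borel_measurable_continuous_onI[OF assms] by simp
 then show ?thesis by (rule measurable_completion)
qed

text \<open>
 The functions \<open>s\<^sup>-\<^sup>n exp (-1/s)\<close>, extended by zero, form a family that is closed under
 differentiation up to linear combinations; so all of them are smooth.
\<close>

definition flat :: "nat \<Rightarrow> real \<Rightarrow> real" where
 "flat n s = (if s > 0 then exp (- 1 / s) / s ^ n else 0)"

lemma flat_tendsto_0: "(flat n \<longlongrightarrow> 0) (at 0)"
proof -
 have "((\<lambda>s. (inverse s) ^ n / exp (inverse s)) \<longlongrightarrow> (0::real)) (at_right 0)"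
  by (rule filterlim_compose[OF tendsto_power_div_exp_0 filterlim_inverse_at_top_right])
 moreover have "\<forall>\<^sub>F s in at_right 0. (inverse s) ^ n / exp (inverse s) = flat n s"
  unfolding eventually_at_right_field
  by (intro exI[of _ 1]) (auto simp: flat_def exp_minus field_simps)
 ultimately have "(flat n \<longlongrightarrow> 0) (at_right 0)" by (rule Lim_transform_eventually)
 moreover have "(flat n \<longlongrightarrow> 0) (at_left 0)"
  by (rule Lim_transform_eventually[OF tendsto_const])
    (auto simp: eventually_at_left_field flat_def intro!: exI[of _ "-1"])
 ultimately show ?thesis by (simp add: filterlim_split_at)
qed

lemma flat_DERIV: "(flat n has_real_derivative (flat (n+2) s - real n * flat (n+1) s)) (at s)"
proof -
 consider "s > 0" | "s < 0" | "s = 0" by linarith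
 then show ?thesis
 proof cases
  case 1
  have "((\<lambda>s. exp (- 1 / s) / s ^ n) has_real_derivative (flat (n+2) s - real n * flat (n+1) s)) (at s)"
   using 1 by (auto intro!: derivative_eq_intros simp: flat_def field_simps power_add power2_eq_square)
    (cases n; simp add: field_simps)
  moreover have "\<forall>\<^sub>F x in nhds s. exp (- 1 / x) / x ^ n = flat n x"
   using eventually_nhds_in_open[of "{0<..}" s] 1 by (auto simp: flat_def elim!: eventually_mono)
  ultimately show ?thesis by (subst (asm) DERIV_cong_ev[OF refl _ refl]) auto
 next
  case 2
  have "((\<lambda>s. 0) has_real_derivative (flat (n+2) s - real n * flat (n+1) s)) (at s)"
   using 2 by (simp add: flat_def)
  moreover have "\<forall>\<^sub>F x in nhds s. 0 = flat n x"
   using eventually_nhds_in_open[of "{..<0}" s] 2 by (auto simp: flat_def elim!: eventually_mono)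
  ultimately show ?thesis by (subst (asm) DERIV_cong_ev[OF refl _ refl]) auto
 next
  case 3
  have "(\<lambda>h. (flat n (0 + h) - flat n 0) / h) = flat (Suc n)"
   by (auto simp: flat_def fun_eq_iff)
  then have "(flat n has_real_derivative 0) (at 0)" unfolding DERIV_def by (simp add: flat_tendsto_0)
  then show ?thesis using 3 by (simp add: flat_def)
 qed
qed

lemma Ck_flat: "Ck k (flat n)"
proof (induction k arbitrary: n)
 case 0
 have "isCont (flat n) x" for x using flat_DERIV by (rule DERIV_isCont)
 then show ?case by (simp add: continuous_at_imp_continuous_on)
next
 case (Suc k)
 show ?case
 proof (rule Ck_SucI)
  show "(flat n has_derivative (*) (flat (n+2) s + (- real n) * flat (n+1) s)) (at s)" for s
   using flat_DERIV[of n s] by (simp add: has_field_derivative_def)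
  show "Ck k (\<lambda>s. (flat (n+2) s + (- real n) * flat (n+1) s) * u)" for u
   by (intro Ck_mult Ck_add Ck_const Suc)
 qed
qed

text \<open>Test functions that tend to the indicator function of the box as \<open>m\<close> grows.\<close>

definition box_bump :: "'a::euclidean_space \<Rightarrow> 'a \<Rightarrow> real \<Rightarrow> 'a \<Rightarrow> real" where
 "box_bump a b m x = (\<Prod>i\<in>Basis. flat 0 (m * (x \<bullet> i - a \<bullet> i)) * flat 0 (m * (b \<bullet> i - x \<bullet> i)))"

lemma flat_range: "0 \<le> flat 0 s" "flat 0 s \<le> 1"
 by (auto simp: flat_def)

lemma box_bump_range: "0 \<le> box_bump a b m x" "box_bump a b m x \<le> 1"
 unfolding box_bump_def
 by (auto intro!: prod_nonneg prod_le_1 mult_le_one mult_nonneg_nonneg flat_range)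

lemma smooth_box_bump: "smooth (box_bump a b m)"
proof -
 have "Ck k (\<lambda>x. flat 0 (m * (x \<bullet> i - a \<bullet> i)) * flat 0 (m * (b \<bullet> i - x \<bullet> i)))" for k and i :: 'a
  using Ck_mult[OF Ck_compose_affine[OF Ck_flat[of k 0], of "m *\<^sub>R i" "- m * (a \<bullet> i)"]
    Ck_compose_affine[OF Ck_flat[of k 0], of "- m *\<^sub>R i" "m * (b \<bullet> i)"]]
  by (simp add: algebra_simps)
 then show ?thesis unfolding smooth_def box_bump_def[abs_def] by (auto intro!: Ck_prod)
qed

lemma box_bump_eq_0: "x \<notin> box a b \<Longrightarrow> m > 0 \<Longrightarrow> box_bump a b m x = 0"
proof -
 assume m: "m > 0" and "x \<notin> box a b"
 then obtain i where i: "i \<in> Basis" "x \<bullet> i \<le> a \<bullet> i \<or> b \<bullet> i \<le> x \<bullet> i"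
  unfolding mem_box by force
 then have "flat 0 (m * (x \<bullet> i - a \<bullet> i)) * flat 0 (m * (b \<bullet> i - x \<bullet> i)) = 0"
  using m by (auto simp: flat_def zero_less_mult_iff)
 then show ?thesis unfolding box_bump_def using i(1) by (intro prod_zero) auto
qed

lemma test_function_box_bump:
 assumes "cbox a b \<subseteq> \<Omega>" "m > 0" shows "test_function \<Omega> (box_bump a b m)"
proof -
 have "{x. box_bump a b m x \<noteq> 0} \<subseteq> cbox a b"
  using box_bump_eq_0[OF _ assms(2)] box_subset_cbox by blast
 then have "closure {x. box_bump a b m x \<noteq> 0} \<subseteq> cbox a b" by (rule closure_minimal) (rule closed_cbox)
 moreover from this have "compact (closure {x. box_bump a b m x \<noteq> 0})"
  by (auto simp: compact_eq_bounded_closed intro: bounded_subset[OF bounded_cbox])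
 ultimately show ?thesis using assms(1) by (auto simp: test_function_def smooth_box_bump)
qed

lemma box_bump_tendsto: "(\<lambda>n. box_bump a b (real (Suc n)) x) \<longlonglongrightarrow> indicator (box a b) x"
proof (cases "x \<in> box a b")
 case True
 have fl: "(\<lambda>n. flat 0 (real (Suc n) * s)) \<longlonglongrightarrow> 1" if "s > 0" for s
 proof -
  have "(\<lambda>n. exp (- (inverse (real (Suc n)) * (1 / s)))) \<longlonglongrightarrow> exp (- (0 * (1/s)))"
   by (intro tendsto_intros LIMSEQ_inverse_real_of_nat)
  moreover have "exp (- (inverse (real (Suc n)) * (1 / s))) = flat 0 (real (Suc n) * s)" for n
   using that by (simp add: flat_def field_simps add_pos_nonneg)
  ultimately show ?thesis by simp
 qed
 have "(\<lambda>n. box_bump a b (real (Suc n)) x) \<longlonglongrightarrow> (\<Prod>i\<in>(Basis::'a set). 1 * 1)"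
  unfolding box_bump_def
  by (intro tendsto_prod tendsto_mult fl) (use True in \<open>auto simp: mem_box\<close>)
 then show ?thesis using True by simp
next
 case False
 then show ?thesis by (simp add: box_bump_eq_0 del: of_nat_Suc)
qed

text \<open>
 Boxes generate the Borel sets and are closed under intersection, so that all integrals over Borel
 sets vanish; a Lebesgue set differs from a Borel set by a null set.
\<close>

lemma AE_zero_if_box_integrals_zero:
 fixes f :: "'a::euclidean_space \<Rightarrow> real"
 assumes int: "integrable lebesgue f"
  and zero: "\<And>a b. (LINT x|lebesgue. indicator (box a b) x * f x) = 0"
  and total: "(LINT x|lebesgue. f x) = 0"
 shows "AE x in lebesgue. f x = 0"
proof -
 let ?G = "range (\<lambda>(a, b). box a b :: 'a set)"
 have int_ind: "integrable lebesgue (\<lambda>x. indicator A x * f x)" if "A \<in> sets lebesgue" for A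
  using integrable_mult_indicator[OF that int] by simp
 have borel: "A \<in> sets lebesgue" if "A \<in> sigma_sets UNIV ?G" for A
  using that borel_eq_box[where 'a='a] by (metis sets_completionI_sets sets_lborel sets_measure_of top_greatest Pow_UNIV)
 have stable: "Int_stable ?G" by (auto simp: Int_stable_def box_Int_box)
 have sub: "?G \<subseteq> Pow UNIV" by simp
 have Borel: "(LINT x|lebesgue. indicator A x * f x) = 0" if "A \<in> sigma_sets UNIV ?G" for A
  using stable sub that
 proof (induction rule: sigma_sets_induct_disjoint)
  case (basic A)
  then show ?case using zero by auto
 next
  case empty
  then show ?case by simp
 next
  case (compl A)
  have "(LINT x|lebesgue. indicator (UNIV - A) x * f x) = (LINT x|lebesgue. f x - indicator A x * f x)"
   by (rule Bochner_Integration.integral_cong) (auto simp: indicator_def)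
  also have "\<dots> = (LINT x|lebesgue. f x) - (LINT x|lebesgue. indicator A x * f x)"
   by (rule Bochner_Integration.integral_diff[OF int int_ind[OF borel[OF compl(1)]]])
  finally show ?case using compl total by simp
 next
  case (union A)
  have A: "A i \<in> sets lebesgue" for i using union(2) borel by auto
  have "(LINT x:(\<Union>i. A i)|lebesgue. f x) = (\<Sum>i. LINT x:A i|lebesgue. f x)"
   by (rule lebesgue_integral_countable_add)
     (use A union(1) int_ind[OF sets.countable_UN[of A UNIV]] in
      \<open>auto simp: disjoint_family_on_def set_integrable_def\<close>)
  then show ?case using union(3) by (simp add: set_lebesgue_integral_def)
 qed
 have Leb: "(LINT x|lebesgue. indicator A x * f x) = 0" if A: "A \<in> sets lebesgue" for A
 proof -
  obtain B N where BN: "B \<in> sets borel" "negligible N" "B \<union> N = A"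
   using sets_lebesgue_almost_borel[OF A] by metis
  have "AE x in lebesgue. x \<notin> N" using BN(2) by (simp add: negligible_iff_null_sets AE_not_in)
  then have "AE x in lebesgue. indicator A x * f x = indicator B x * f x"
   by eventually_elim (use BN(3) in \<open>auto simp: indicator_def\<close>)
  then have "(LINT x|lebesgue. indicator A x * f x) = (LINT x|lebesgue. indicator B x * f x)"
   using int_ind[OF A] int_ind[of B] BN(1) by (intro integral_cong_AE) auto
  also have "\<dots> = 0"
   by (rule Borel) (use BN(1) in \<open>simp add: borel_eq_box\<close>)
  finally show ?thesis .
 qed
 show ?thesis
  by (rule density_unique_real[OF int integrable_zero]) (simp add: set_lebesgue_integral_def Leb)
qed

text \<open>
 Bump functions show that the integral over each box inside \<open>\<Omega>\<close> vanishes, and countably many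
 boxes cover \<open>\<Omega>\<close>.
\<close>

lemma fundamental_lemma:
 fixes f :: "'a::euclidean_space \<Rightarrow> real"
 assumes "open \<Omega>" and loc: "\<And>K. compact K \<Longrightarrow> K \<subseteq> \<Omega> \<Longrightarrow> f absolutely_integrable_on K"
  and zero: "\<And>\<eta>. test_function \<Omega> \<eta> \<Longrightarrow> (LINT x|lebesgue_on \<Omega>. f x * \<eta> x) = 0"
 shows "AE x in lebesgue_on \<Omega>. f x = 0"
proof -
 have \<Omega>[measurable]: "\<Omega> \<in> sets lebesgue" using \<open>open \<Omega>\<close> by simp
 have box0: "(LINT x|lebesgue. indicator (box a b) x * f x) = 0" if ab: "cbox a b \<subseteq> \<Omega>" for a b
 proof -
  have loc': "integrable lebesgue (\<lambda>x. indicator (cbox a b) x * f x)"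
   using loc[OF compact_cbox ab] by (simp add: set_integrable_def)
  have "(\<lambda>n. LINT x|lebesgue. (indicator (cbox a b) x * f x) * box_bump a b (real (Suc n)) x) \<longlonglongrightarrow>
     (LINT x|lebesgue. (indicator (cbox a b) x * f x) * indicator (box a b) x)"
  proof (rule integral_dominated_convergence)
   show "integrable lebesgue (\<lambda>x. norm (indicator (cbox a b) x * f x))" by (rule integrable_norm[OF loc'])
   show "(\<lambda>x. (indicator (cbox a b) x * f x) * box_bump a b (real (Suc n)) x) \<in> borel_measurable lebesgue" for n
   proof (rule borel_measurable_times)
    show "(\<lambda>x. indicator (cbox a b) x * f x) \<in> borel_measurable lebesgue" using loc' by simp
    show "box_bump a b (real (Suc n)) \<in> borel_measurable lebesgue"
     by (rule continuous_borel_measurable_lebesgue[OF smooth_continuous[OF smooth_box_bump]])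
   qed
   show "AE x in lebesgue. norm ((indicator (cbox a b) x * f x) * box_bump a b (real (Suc n)) x)
     \<le> norm (indicator (cbox a b) x * f x)" for n
    using box_bump_range[of a b "real (Suc n)"] by (auto simp: abs_mult intro!: mult_right_le_one_le)
   show "(\<lambda>x. (indicator (cbox a b) x * f x) * indicator (box a b) x) \<in> borel_measurable lebesgue"
    by (rule borel_measurable_times[OF borel_measurable_integrable[OF loc'] borel_measurable_indicator]) simp
   show "AE x in lebesgue. (\<lambda>n. (indicator (cbox a b) x * f x) * box_bump a b (real (Suc n)) x)
     \<longlonglongrightarrow> (indicator (cbox a b) x * f x) * indicator (box a b) x"
    by (intro AE_I2 tendsto_mult tendsto_const box_bump_tendsto)
  qed
  moreover have "(LINT x|lebesgue. (indicator (cbox a b) x * f x) * box_bump a b (real (Suc n)) x) = 0" for n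
  proof -
   have "(LINT x|lebesgue. (indicator (cbox a b) x * f x) * box_bump a b (real (Suc n)) x) =
      (LINT x|lebesgue. indicator \<Omega> x *\<^sub>R (f x * box_bump a b (real (Suc n)) x))"
   proof (rule Bochner_Integration.integral_cong[OF refl])
    fix x
    have "x \<in> cbox a b" if "box_bump a b (real (Suc n)) x \<noteq> 0"
     using box_bump_eq_0[of x a b "real (Suc n)"] that box_subset_cbox by auto
    then show "(indicator (cbox a b) x * f x) * box_bump a b (real (Suc n)) x =
      indicator \<Omega> x *\<^sub>R (f x * box_bump a b (real (Suc n)) x)"
     using ab by (auto simp: indicator_def)
   qed
   also have "\<dots> = (LINT x|lebesgue_on \<Omega>. f x * box_bump a b (real (Suc n)) x)"
    by (rule integral_restrict_space[symmetric]) simp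
   also have "\<dots> = 0" by (intro zero test_function_box_bump ab) simp
   finally show ?thesis .
  qed
  ultimately have "(LINT x|lebesgue. (indicator (cbox a b) x * f x) * indicator (box a b) x) = 0"
   by (simp only: LIMSEQ_const_iff)
  moreover have "(indicator (cbox a b) x * f x) * indicator (box a b) x = indicator (box a b) x * f x" for x
   using box_subset_cbox[of a b] by (auto simp: indicator_def)
  ultimately show ?thesis by simp
 qed
 have cbox_AE: "AE x in lebesgue. indicator (box a b) x * f x = 0" if ab: "cbox a b \<subseteq> \<Omega>" for a b
 proof (rule AE_zero_if_box_integrals_zero)
  have "integrable lebesgue (\<lambda>x. indicator (cbox a b) x * f x)"
   using loc[OF compact_cbox ab] by (simp add: set_integrable_def)
  from integrable_mult_indicator[OF _ this, of "box a b"]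
  have "integrable lebesgue (\<lambda>x. indicator (box a b) x *\<^sub>R (indicator (cbox a b) x * f x))" by simp
  moreover have "indicator (box a b) x *\<^sub>R (indicator (cbox a b) x * f x) = indicator (box a b) x * f x" for x
   using box_subset_cbox[of a b] by (auto simp: indicator_def)
  ultimately show "integrable lebesgue (\<lambda>x. indicator (box a b) x * f x)" by (simp only:)
  show "(LINT x|lebesgue. indicator (box c d) x * (indicator (box a b) x * f x)) = 0" for c d
  proof -
   obtain p q where pq: "box c d \<inter> box a b = box p q" "cbox p q \<subseteq> \<Omega>"
   proof (cases "box c d \<inter> box a b = {}")
    case True
    show thesis
    proof (cases "cbox a b = {}")
     case True
     then have "box a b = {}" using box_subset_cbox by blast
     then show thesis using that[of a b] ab by auto
    next
     case False
     then have "a \<in> cbox a b" by (auto simp: mem_box box_ne_empty)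
     then show thesis using that[of a a] ab True by auto
    qed
   next
    case False
    let ?p = "\<Sum>i\<in>Basis. max (c \<bullet> i) (a \<bullet> i) *\<^sub>R i" and ?q = "\<Sum>i\<in>Basis. min (d \<bullet> i) (b \<bullet> i) *\<^sub>R i"
    have "cbox ?p ?q \<subseteq> cbox a b" by (auto simp: mem_box)
    then show thesis using that[of ?p ?q] ab by (auto simp: box_Int_box)
   qed
   have eq: "indicator (box c d) x * (indicator (box a b) x * f x) = indicator (box p q) x * f x" for x
    unfolding pq(1)[symmetric] by (auto simp: indicator_def)
   show ?thesis unfolding eq by (rule box0[OF pq(2)])
  qed
 qed (rule box0[OF ab])
 obtain D where D: "countable D" "D \<subseteq> Pow \<Omega>" "\<And>X. X \<in> D \<Longrightarrow> \<exists>a b. X = cbox a b" "\<Union>D = \<Omega>"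
  using open_countable_Union_open_cbox[OF \<open>open \<Omega>\<close>] by metis
 have "AE x in lebesgue. \<forall>X\<in>D. x \<in> X \<longrightarrow> f x = 0"
  unfolding AE_ball_countable[OF D(1)]
 proof
  fix X assume X: "X \<in> D"
  then obtain a b where ab: "X = cbox a b" "cbox a b \<subseteq> \<Omega>" using D by blast
  have "cbox a b - box a b \<in> null_sets lebesgue"
   using negligible_frontier_interval[of a b] by (simp add: negligible_iff_null_sets)
  then have "AE x in lebesgue. x \<notin> cbox a b - box a b" by (rule AE_not_in)
  with cbox_AE[OF ab(2)] show "AE x in lebesgue. x \<in> X \<longrightarrow> f x = 0"
   by eventually_elim (auto simp: ab indicator_def split: if_splits)
 qed
 then have "AE x in lebesgue. x \<in> \<Omega> \<longrightarrow> f x = 0"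
  by eventually_elim (use D(4) in blast)
 then show ?thesis by (simp add: AE_restrict_space_iff)
qed

section \<open>The Sobolev inequality in dimension four\<close>

text \<open>
 Hoelder's inequality for three factors is stated with cube roots of extended nonnegative reals, so
 that it can be iterated without regard to finiteness.
\<close>

definition cbrt :: "ennreal \<Rightarrow> ennreal" where
 "cbrt x = (if x = \<infinity> then \<infinity> else ennreal (root 3 (enn2real x)))"

lemma cbrt_cube [simp]: "cbrt x ^ 3 = x"
 by (cases x) (auto simp: cbrt_def ennreal_power power_eq_top_ennreal)

lemma cbrt_measurable [measurable]: "cbrt \<in> borel_measurable borel"
 unfolding cbrt_def[abs_def] by measurable

lemma ennreal_power_le_imp_le:
 fixes x y :: ennreal
 assumes le: "x ^ n \<le> y ^ n" and n: "0 < n" shows "x \<le> y"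
proof (rule ccontr)
 assume "\<not> x \<le> y"
 then have yx: "y < x" by simp
 then obtain b where b: "y = ennreal b" "0 \<le> b" by (cases y) auto
 show False
 proof (cases x)
  case (real a)
  then have "b < a" using yx b by (simp add: ennreal_less_iff)
  then have "b ^ n < a ^ n" using b n by (intro power_strict_mono) auto
  moreover have "ennreal (a ^ n) \<le> ennreal (b ^ n)" using le real b by (simp add: ennreal_power)
  then have "a ^ n \<le> b ^ n" using b by (subst (asm) ennreal_le_iff) auto
  ultimately show False by simp
 next
  case top
  then show False using le b n by (auto simp: ennreal_power power_eq_top_ennreal top_unique)
 qed
qed

lemma ennreal_cube_mono: "x ^ 3 \<le> y ^ 3 \<Longrightarrow> x \<le> y" for x y :: ennreal
 by (rule ennreal_power_le_imp_le) auto

lemma amgm3: "0 \<le> a \<Longrightarrow> 0 \<le> b \<Longrightarrow> 0 \<le> c \<Longrightarrow> 3 * (a * b * c) \<le> a ^ 3 + b ^ 3 + c ^ 3" for a b c :: real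
proof -
 assume "0 \<le> a" "0 \<le> b" "0 \<le> c"
 then have "0 \<le> (a + b + c) * ((a - b)\<^sup>2 + (b - c)\<^sup>2 + (a - c)\<^sup>2)" by simp
 also have "\<dots> = 2 * (a ^ 3 + b ^ 3 + c ^ 3 - 3 * (a * b * c))"
  by (simp add: power2_eq_square power3_eq_cube algebra_simps)
 finally show ?thesis by simp
qed

lemma amgm3_ennreal: "3 * (a * b * c) \<le> a ^ 3 + b ^ 3 + c ^ 3" for a b c :: ennreal
proof (cases "a = \<infinity> \<or> b = \<infinity> \<or> c = \<infinity>")
 case True
 then have "a ^ 3 + b ^ 3 + c ^ 3 = \<infinity>" by (auto simp: power_eq_top_ennreal)
 then show ?thesis by (metis infinity_ennreal_def top_greatest)
next
 case False
 then obtain x y z where "a = ennreal x" "b = ennreal y" "c = ennreal z" "0 \<le> x" "0 \<le> y" "0 \<le> z"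
  by (cases a; cases b; cases c) auto
 then show ?thesis
  using amgm3[of x y z]
  by (simp add: ennreal_power ennreal_mult[symmetric] ennreal_plus[symmetric]
    ennreal_numeral[symmetric] del: ennreal_numeral ennreal_plus)
qed

text \<open>Hoelder's inequality for three factors, from the arithmetic-geometric mean inequality.\<close>

lemma nn_integral_holder3:
 assumes [measurable]: "f \<in> borel_measurable M" "g \<in> borel_measurable M" "h \<in> borel_measurable M"
 shows "(\<integral>\<^sup>+x. f x * g x * h x \<partial>M) \<le>
  cbrt (\<integral>\<^sup>+x. f x ^ 3 \<partial>M) * cbrt (\<integral>\<^sup>+x. g x ^ 3 \<partial>M) * cbrt (\<integral>\<^sup>+x. h x ^ 3 \<partial>M)"
proof -
 define F where "F = (\<integral>\<^sup>+x. f x ^ 3 \<partial>M)"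
 define G where "G = (\<integral>\<^sup>+x. g x ^ 3 \<partial>M)"
 define H where "H = (\<integral>\<^sup>+x. h x ^ 3 \<partial>M)"
 have z: "(\<integral>\<^sup>+x. f x * g x * h x \<partial>M) = 0" if "F = 0 \<or> G = 0 \<or> H = 0"
 proof -
  have "AE x in M. f x * g x * h x = 0"
   using that unfolding F_def G_def H_def
   by (auto simp: nn_integral_0_iff_AE elim!: eventually_mono)
  then show ?thesis by (simp add: nn_integral_0_iff_AE)
 qed
 consider "F = 0 \<or> G = 0 \<or> H = 0" | "F \<noteq> 0" "G \<noteq> 0" "H \<noteq> 0" "F = \<infinity> \<or> G = \<infinity> \<or> H = \<infinity>"
  | "F \<noteq> 0" "G \<noteq> 0" "H \<noteq> 0" "F \<noteq> \<infinity>" "G \<noteq> \<infinity>" "H \<noteq> \<infinity>" by blast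
 then have "(\<integral>\<^sup>+x. f x * g x * h x \<partial>M) \<le> cbrt F * cbrt G * cbrt H"
 proof cases
  case 1
  then show ?thesis using z by simp
 next
  case 2
  have nz: "cbrt X \<noteq> 0" if "X \<noteq> 0" for X using that cbrt_cube[of X] by (metis zero_power zero_less_numeral)
  have inf: "cbrt \<infinity> = \<infinity>" by (simp add: cbrt_def)
  have "cbrt F * cbrt G * cbrt H = \<infinity>"
   using 2 nz[of F] nz[of G] nz[of H] inf by (auto simp: ennreal_mult_eq_top_iff)
  then show ?thesis by simp
 next
  case 3
  obtain a b c where abc: "F = ennreal a" "G = ennreal b" "H = ennreal c" "0 < a" "0 < b" "0 < c"
   using 3 by (cases F; cases G; cases H) (auto simp: order_less_le)
  let ?a = "root 3 a" and ?b = "root 3 b" and ?c = "root 3 c"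
  have r: "0 < ?a" "0 < ?b" "0 < ?c" using abc by auto
  have cb: "cbrt F = ennreal ?a" "cbrt G = ennreal ?b" "cbrt H = ennreal ?c"
   using abc by (auto simp: cbrt_def)
  define k where "k X x = ennreal (1 / root 3 X) * x" for X x
  have k3: "k X x ^ 3 = ennreal (1 / X) * x ^ 3" if "0 < X" for X x
   using that by (simp add: k_def power_mult_distrib ennreal_power power_divide)
  have [measurable]: "k X \<in> borel_measurable borel" for X unfolding k_def[abs_def] by measurable
  have "3 * (\<integral>\<^sup>+x. k a (f x) * k b (g x) * k c (h x) \<partial>M) =
    (\<integral>\<^sup>+x. 3 * (k a (f x) * k b (g x) * k c (h x)) \<partial>M)"
   by (rule nn_integral_cmult[symmetric]) measurable
  also have "\<dots> \<le> (\<integral>\<^sup>+x. k a (f x) ^ 3 + k b (g x) ^ 3 + k c (h x) ^ 3 \<partial>M)"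
   by (intro nn_integral_mono amgm3_ennreal)
  also have "\<dots> = ennreal (1 / a) * F + ennreal (1 / b) * G + ennreal (1 / c) * H"
   using abc by (simp add: nn_integral_add k3 nn_integral_cmult F_def G_def H_def)
  also have "\<dots> = 1 + 1 + 1"
   using abc by (simp add: ennreal_mult[symmetric])
  also have "\<dots> = 3 * 1" by simp
  finally have "3 * (\<integral>\<^sup>+x. k a (f x) * k b (g x) * k c (h x) \<partial>M) \<le> 3 * 1" .
  then have le1: "(\<integral>\<^sup>+x. k a (f x) * k b (g x) * k c (h x) \<partial>M) \<le> 1"
   by (simp add: ennreal_mult_le_mult_iff del: mult_1_right)
  have unit: "ennreal r * ennreal (1 / r) = 1" if "0 < r" for r
   using that by (simp add: ennreal_mult[symmetric])
  have "f x * g x * h x = ennreal (?a * ?b * ?c) * (k a (f x) * k b (g x) * k c (h x))" for x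
  proof -
   have "ennreal (?a * ?b * ?c) * (k a (f x) * k b (g x) * k c (h x)) =
     (ennreal ?a * ennreal (1 / ?a)) * (ennreal ?b * ennreal (1 / ?b)) * (ennreal ?c * ennreal (1 / ?c))
      * (f x * g x * h x)"
    using r by (simp add: k_def ennreal_mult mult_ac)
   also have "\<dots> = f x * g x * h x" using unit[OF r(1)] unit[OF r(2)] unit[OF r(3)] by simp
   finally show ?thesis by (rule sym)
  qed
  then have "(\<integral>\<^sup>+x. f x * g x * h x \<partial>M) =
    ennreal (?a * ?b * ?c) * (\<integral>\<^sup>+x. k a (f x) * k b (g x) * k c (h x) \<partial>M)"
   by (simp add: nn_integral_cmult)
  also have "\<dots> \<le> ennreal (?a * ?b * ?c) * 1" by (intro mult_left_mono le1) simp
  also have "\<dots> = cbrt F * cbrt G * cbrt H" using r by (simp add: cb ennreal_mult)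
  finally show ?thesis .
 qed
 then show ?thesis by (simp add: F_def G_def H_def)
qed

abbreviation lborel3 :: "(real \<times> real \<times> real) measure" where
 "lborel3 \<equiv> lborel \<Otimes>\<^sub>M lborel \<Otimes>\<^sub>M lborel"

abbreviation lborel4 :: "(real \<times> real \<times> real \<times> real) measure" where
 "lborel4 \<equiv> lborel \<Otimes>\<^sub>M lborel \<Otimes>\<^sub>M lborel \<Otimes>\<^sub>M lborel"

text \<open>
 The Loomis--Whitney inequality in \<open>\<real>\<^sup>4\<close>: integrating in one variable after the other, one of the
 four factors is constant and Hoelder's inequality applies to the other three.
\<close>

lemma loomis_whitney4:
 fixes p1 p2 p3 p4 :: "real \<times> real \<times> real \<Rightarrow> ennreal"
 assumes [measurable]: "p1 \<in> borel_measurable lborel3"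
  "p2 \<in> borel_measurable lborel3"
  "p3 \<in> borel_measurable lborel3"
  "p4 \<in> borel_measurable lborel3"
 shows "(\<integral>\<^sup>+d. \<integral>\<^sup>+c. \<integral>\<^sup>+b. \<integral>\<^sup>+a. p1 (b,c,d) * p2 (a,c,d) * p3 (a,b,d) * p4 (a,b,c) \<partial>lborel \<partial>lborel \<partial>lborel \<partial>lborel) \<le>
  cbrt (\<integral>\<^sup>+d. \<integral>\<^sup>+c. \<integral>\<^sup>+b. p1 (b,c,d) ^ 3 \<partial>lborel \<partial>lborel \<partial>lborel) *
  cbrt (\<integral>\<^sup>+d. \<integral>\<^sup>+c. \<integral>\<^sup>+a. p2 (a,c,d) ^ 3 \<partial>lborel \<partial>lborel \<partial>lborel) *
  cbrt (\<integral>\<^sup>+d. \<integral>\<^sup>+b. \<integral>\<^sup>+a. p3 (a,b,d) ^ 3 \<partial>lborel \<partial>lborel \<partial>lborel) *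
  cbrt (\<integral>\<^sup>+c. \<integral>\<^sup>+b. \<integral>\<^sup>+a. p4 (a,b,c) ^ 3 \<partial>lborel \<partial>lborel \<partial>lborel)"
proof -
 define A2 where "A2 c d = (\<integral>\<^sup>+a. p2 (a,c,d) ^ 3 \<partial>lborel)" for c d
 define A3 where "A3 b d = (\<integral>\<^sup>+a. p3 (a,b,d) ^ 3 \<partial>lborel)" for b d
 define A4 where "A4 b c = (\<integral>\<^sup>+a. p4 (a,b,c) ^ 3 \<partial>lborel)" for b c
 have [measurable]: "(\<lambda>(c,d). A2 c d) \<in> borel_measurable (lborel \<Otimes>\<^sub>M lborel)"
  "(\<lambda>(c,d). A3 c d) \<in> borel_measurable (lborel \<Otimes>\<^sub>M lborel)"
  "(\<lambda>(c,d). A4 c d) \<in> borel_measurable (lborel \<Otimes>\<^sub>M lborel)"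
  unfolding A2_def A3_def A4_def by measurable
 define B1 where "B1 c d = (\<integral>\<^sup>+b. p1 (b,c,d) ^ 3 \<partial>lborel)" for c d
 define B3 where "B3 d = (\<integral>\<^sup>+b. A3 b d \<partial>lborel)" for d
 define B4 where "B4 c = (\<integral>\<^sup>+b. A4 b c \<partial>lborel)" for c
 have [measurable]: "(\<lambda>(c,d). B1 c d) \<in> borel_measurable (lborel \<Otimes>\<^sub>M lborel)"
  "B3 \<in> borel_measurable lborel" "B4 \<in> borel_measurable lborel"
  unfolding B1_def B3_def B4_def by measurable
 define C1 where "C1 d = (\<integral>\<^sup>+c. B1 c d \<partial>lborel)" for d
 define C2 where "C2 d = (\<integral>\<^sup>+c. A2 c d \<partial>lborel)" for d
 define C4 where "C4 = (\<integral>\<^sup>+c. B4 c \<partial>lborel)"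
 have [measurable]: "C1 \<in> borel_measurable lborel" "C2 \<in> borel_measurable lborel"
  unfolding C1_def C2_def by measurable
 have 1: "(\<integral>\<^sup>+a. p1 (b,c,d) * p2 (a,c,d) * p3 (a,b,d) * p4 (a,b,c) \<partial>lborel) \<le>
   p1 (b,c,d) * (cbrt (A2 c d) * cbrt (A3 b d) * cbrt (A4 b c))" for b c d
 proof -
  have "(\<integral>\<^sup>+a. p1 (b,c,d) * p2 (a,c,d) * p3 (a,b,d) * p4 (a,b,c) \<partial>lborel) =
    p1 (b,c,d) * (\<integral>\<^sup>+a. p2 (a,c,d) * p3 (a,b,d) * p4 (a,b,c) \<partial>lborel)"
   by (subst nn_integral_cmult[symmetric]) (auto simp: mult.assoc)
  also have "\<dots> \<le> p1 (b,c,d) * (cbrt (A2 c d) * cbrt (A3 b d) * cbrt (A4 b c))"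
   unfolding A2_def A3_def A4_def by (intro mult_left_mono nn_integral_holder3) auto
  finally show ?thesis .
 qed
 have 2: "(\<integral>\<^sup>+b. p1 (b,c,d) * (cbrt (A2 c d) * cbrt (A3 b d) * cbrt (A4 b c)) \<partial>lborel) \<le>
   cbrt (A2 c d) * (cbrt (B1 c d) * cbrt (B3 d) * cbrt (B4 c))" for c d
 proof -
  have "(\<integral>\<^sup>+b. p1 (b,c,d) * (cbrt (A2 c d) * cbrt (A3 b d) * cbrt (A4 b c)) \<partial>lborel) =
    cbrt (A2 c d) * (\<integral>\<^sup>+b. p1 (b,c,d) * cbrt (A3 b d) * cbrt (A4 b c) \<partial>lborel)"
   by (subst nn_integral_cmult[symmetric]) (auto simp: mult_ac)
  also have "\<dots> \<le> cbrt (A2 c d) * (cbrt (B1 c d) * cbrt (B3 d) * cbrt (B4 c))"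
   using nn_integral_holder3[of "\<lambda>b. p1 (b,c,d)" lborel "\<lambda>b. cbrt (A3 b d)" "\<lambda>b. cbrt (A4 b c)"]
   by (intro mult_left_mono) (auto simp: B1_def B3_def B4_def)
  finally show ?thesis .
 qed
 have 3: "(\<integral>\<^sup>+c. cbrt (A2 c d) * (cbrt (B1 c d) * cbrt (B3 d) * cbrt (B4 c)) \<partial>lborel) \<le>
   cbrt (B3 d) * (cbrt (C1 d) * cbrt (C2 d) * cbrt C4)" for d
 proof -
  have "(\<integral>\<^sup>+c. cbrt (A2 c d) * (cbrt (B1 c d) * cbrt (B3 d) * cbrt (B4 c)) \<partial>lborel) =
    cbrt (B3 d) * (\<integral>\<^sup>+c. cbrt (B1 c d) * cbrt (A2 c d) * cbrt (B4 c) \<partial>lborel)"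
   by (subst nn_integral_cmult[symmetric]) (auto simp: mult_ac)
  also have "\<dots> \<le> cbrt (B3 d) * (cbrt (C1 d) * cbrt (C2 d) * cbrt C4)"
   using nn_integral_holder3[of "\<lambda>c. cbrt (B1 c d)" lborel "\<lambda>c. cbrt (A2 c d)" "\<lambda>c. cbrt (B4 c)"]
   by (intro mult_left_mono) (auto simp: C1_def C2_def C4_def)
  finally show ?thesis .
 qed
 have "(\<integral>\<^sup>+d. \<integral>\<^sup>+c. \<integral>\<^sup>+b. \<integral>\<^sup>+a. p1 (b,c,d) * p2 (a,c,d) * p3 (a,b,d) * p4 (a,b,c) \<partial>lborel \<partial>lborel \<partial>lborel \<partial>lborel) \<le>
  (\<integral>\<^sup>+d. \<integral>\<^sup>+c. \<integral>\<^sup>+b. p1 (b,c,d) * (cbrt (A2 c d) * cbrt (A3 b d) * cbrt (A4 b c)) \<partial>lborel \<partial>lborel \<partial>lborel)"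
  by (intro nn_integral_mono 1)
 also have "\<dots> \<le> (\<integral>\<^sup>+d. \<integral>\<^sup>+c. cbrt (A2 c d) * (cbrt (B1 c d) * cbrt (B3 d) * cbrt (B4 c)) \<partial>lborel \<partial>lborel)"
  by (intro nn_integral_mono 2)
 also have "\<dots> \<le> (\<integral>\<^sup>+d. cbrt (B3 d) * (cbrt (C1 d) * cbrt (C2 d) * cbrt C4) \<partial>lborel)"
  by (intro nn_integral_mono 3)
 also have "\<dots> = cbrt C4 * (\<integral>\<^sup>+d. cbrt (C1 d) * cbrt (C2 d) * cbrt (B3 d) \<partial>lborel)"
  by (subst nn_integral_cmult[symmetric]) (auto simp: mult_ac)
 also have "\<dots> \<le> cbrt C4 * (cbrt (\<integral>\<^sup>+d. C1 d \<partial>lborel) * cbrt (\<integral>\<^sup>+d. C2 d \<partial>lborel) * cbrt (\<integral>\<^sup>+d. B3 d \<partial>lborel))"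
  using nn_integral_holder3[of "\<lambda>d. cbrt (C1 d)" lborel "\<lambda>d. cbrt (C2 d)" "\<lambda>d. cbrt (B3 d)"]
  by (intro mult_left_mono) auto
 finally show ?thesis
  by (simp add: C1_def C2_def C4_def B1_def B3_def B4_def A2_def A3_def A4_def mult_ac)
qed

definition vec4 :: "real \<Rightarrow> real \<Rightarrow> real \<Rightarrow> real \<Rightarrow> real^4" where
 "vec4 a b c d = (\<chi> i. if i = 1 then a else if i = 2 then b else if i = 3 then c else d)"

lemma vec4_nth [simp]: "vec4 a b c d $ 1 = a" "vec4 a b c d $ 2 = b" "vec4 a b c d $ 3 = c" "vec4 a b c d $ 4 = d"
 by (simp_all add: vec4_def)

lemma vec4_measurable [measurable]:
 "(\<lambda>(d, c, b, a). vec4 a b c d) \<in> borel_measurable lborel4"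
proof -
 have comp: "(\<lambda>(d, c, b, a). vec4 a b c d $ j) \<in> borel_measurable lborel4" for j
  using exhaust_4[of j] by (elim disjE) (simp_all only: vec4_nth, measurable)
 show ?thesis
  unfolding borel_measurable_euclidean_space[of "\<lambda>(d, c, b, a). vec4 a b c d"]
 proof
  fix i :: "real^4" assume "i \<in> Basis"
  then obtain j where "i = axis j 1" by (auto simp: Basis_vec_def)
  then have "(\<lambda>x. (case x of (d, c, b, a) \<Rightarrow> vec4 a b c d) \<bullet> i) = (\<lambda>(d, c, b, a). vec4 a b c d $ j)"
   by (auto simp: inner_axis fun_eq_iff)
  then show "(\<lambda>x. (case x of (d, c, b, a) \<Rightarrow> vec4 a b c d) \<bullet> i) \<in>
    borel_measurable lborel4"
   using comp[of j] by simp
 qed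
qed

lemma prod_UNIV_4: "(\<Prod>i\<in>UNIV. f i) = f 4 * (f 3 * (f 2 * f 1))" for f :: "4 \<Rightarrow> real"
proof -
 have "(1::4) \<noteq> 2" "(1::4) \<noteq> 3" "(1::4) \<noteq> 4" "(2::4) \<noteq> 3" "(2::4) \<noteq> 4" "(3::4) \<noteq> 4" by simp_all
 then have "(\<Prod>i\<in>UNIV. f i) = f 1 * (f 2 * (f 3 * f 4))" unfolding UNIV_4 by simp
 then show ?thesis by (simp only: mult_ac)
qed

lemma emeasure_lborel_Times:
 fixes A :: "'a::euclidean_space set" and B :: "'b::euclidean_space set"
 assumes "A \<in> sets borel" "B \<in> sets borel"
 shows "emeasure lborel (A \<times> B) = emeasure lborel A * emeasure lborel B"
 by (subst lborel_prod[symmetric], subst lborel.emeasure_pair_measure_Times) (use assms in auto)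

text \<open>
 The coordinates are listed from the last to the first, so that the first one is integrated first.
 The two measures agree on boxes.
\<close>

lemma lborel_vec4:
 "distr lborel4 borel (\<lambda>(d, c, b, a). vec4 a b c d) = lborel"
proof (rule lborel_eqI[symmetric])
 fix l u :: "real^4"
 assume lu: "\<And>b. b \<in> Basis \<Longrightarrow> l \<bullet> b \<le> u \<bullet> b"
 have le: "l $ i \<le> u $ i" for i
  using lu[of "axis i 1"] by (simp add: inner_axis axis_in_Basis_iff)
 let ?I = "\<lambda>i. {l $ i <..< u $ i}"
 have pre: "(\<lambda>(d, c, b, a). vec4 a b c d) -` box l u \<inter> space lborel4
   = ?I 4 \<times> ?I 3 \<times> ?I 2 \<times> ?I 1"
  by (auto simp: mem_box_cart forall_4 space_pair_measure)
 have "emeasure (distr lborel4 borel (\<lambda>(d, c, b, a). vec4 a b c d)) (box l u)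
   = emeasure lborel4 (?I 4 \<times> ?I 3 \<times> ?I 2 \<times> ?I 1)"
  by (subst emeasure_distr) (auto simp: pre)
 also have "\<dots> = ennreal ((u $ 4 - l $ 4) * ((u $ 3 - l $ 3) * ((u $ 2 - l $ 2) * (u $ 1 - l $ 1))))"
 proof -
  show ?thesis
   unfolding lborel_prod
   using le by (simp add: emeasure_lborel_Times borel_Times ennreal_mult)
 qed
 also have "(u $ 4 - l $ 4) * ((u $ 3 - l $ 3) * ((u $ 2 - l $ 2) * (u $ 1 - l $ 1))) = (\<Prod>i\<in>UNIV. u $ i - l $ i)"
  by (rule prod_UNIV_4[symmetric])
 also have "\<dots> = (\<Prod>b\<in>Basis. (u - l) \<bullet> b)"
 proof -
  have B: "(Basis :: (real^4) set) = (\<lambda>i. axis i 1) ` UNIV" by (auto simp: Basis_vec_def)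
  have inj: "inj (\<lambda>i::4. axis i (1::real))" by (auto simp: inj_on_def axis_eq_axis)
  show ?thesis unfolding B prod.reindex[OF inj] by (simp add: inner_axis)
 qed
 finally show "emeasure (distr lborel4 borel (\<lambda>(d, c, b, a). vec4 a b c d)) (box l u)
   = ennreal (\<Prod>b\<in>Basis. (u - l) \<bullet> b)" .
qed simp

lemma nn_integral_vec4:
 assumes [measurable]: "F \<in> borel_measurable borel"
 shows "(\<integral>\<^sup>+x. F x \<partial>(lborel :: (real^4) measure)) =
  (\<integral>\<^sup>+d. \<integral>\<^sup>+c. \<integral>\<^sup>+b. \<integral>\<^sup>+a. F (vec4 a b c d) \<partial>lborel \<partial>lborel \<partial>lborel \<partial>lborel)"
proof -
 let ?f = "\<lambda>(d, c, b, a). F (vec4 a b c d)"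
 have m: "?f \<in> borel_measurable lborel4"
  using measurable_compose[OF vec4_measurable assms] by (simp add: split_def)
 have m2: "(\<lambda>y. ?f (d, y)) \<in> borel_measurable lborel3" for d
  by (rule measurable_compose[OF _ m]) measurable
 have m3: "(\<lambda>y. ?f (d, c, y)) \<in> borel_measurable (lborel \<Otimes>\<^sub>M lborel)" for d c
  by (rule measurable_compose[OF _ m]) measurable
 have "(\<integral>\<^sup>+x. F x \<partial>(lborel :: (real^4) measure)) =
   (\<integral>\<^sup>+x. F ((\<lambda>(d, c, b, a). vec4 a b c d) x) \<partial>lborel4)"
  unfolding lborel_vec4[symmetric] by (rule nn_integral_distr) (use lborel_vec4 in simp_all)
 also have "\<dots> = (\<integral>\<^sup>+x. ?f x \<partial>(lborel \<Otimes>\<^sub>M lborel3))"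
  by (rule nn_integral_cong) auto
 also have "\<dots> = (\<integral>\<^sup>+x. ?f x \<partial>(lborel \<Otimes>\<^sub>M (lborel :: (real \<times> real \<times> real) measure)))"
  by (simp add: lborel_prod)
 also have "\<dots> = (\<integral>\<^sup>+d. \<integral>\<^sup>+y. ?f (d, y) \<partial>lborel \<partial>lborel)"
  by (rule lborel.nn_integral_fst[symmetric]) (use m in \<open>simp add: lborel_prod\<close>)
 also have "\<dots> = (\<integral>\<^sup>+d. \<integral>\<^sup>+y. ?f (d, y) \<partial>(lborel \<Otimes>\<^sub>M (lborel :: (real \<times> real) measure)) \<partial>lborel)"
  by (simp add: lborel_prod)
 also have "\<dots> = (\<integral>\<^sup>+d. \<integral>\<^sup>+c. \<integral>\<^sup>+y. ?f (d, c, y) \<partial>lborel \<partial>lborel \<partial>lborel)"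
  by (intro nn_integral_cong lborel.nn_integral_fst[symmetric]) (use m2 in \<open>simp add: lborel_prod\<close>)
 also have "\<dots> = (\<integral>\<^sup>+d. \<integral>\<^sup>+c. \<integral>\<^sup>+y. ?f (d, c, y) \<partial>(lborel \<Otimes>\<^sub>M lborel) \<partial>lborel \<partial>lborel)"
  by (simp add: lborel_prod)
 also have "\<dots> = (\<integral>\<^sup>+d. \<integral>\<^sup>+c. \<integral>\<^sup>+b. \<integral>\<^sup>+a. ?f (d, c, b, a) \<partial>lborel \<partial>lborel \<partial>lborel \<partial>lborel)"
  by (intro nn_integral_cong lborel.nn_integral_fst[symmetric]) (use m3 in simp)
 finally show ?thesis by simp
qed

lemma abs_le_nn_integral_derivative:
 fixes k k' :: "real \<Rightarrow> real"
 assumes der: "\<And>s. (k has_real_derivative k' s) (at s)" and cont: "continuous_on UNIV k'"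
  and zero: "\<And>s. s \<le> s0 \<Longrightarrow> k s = 0"
 shows "ennreal \<bar>k t\<bar> \<le> (\<integral>\<^sup>+s. ennreal \<bar>k' s\<bar> \<partial>lborel)"
proof -
 define s1 where "s1 = min s0 t"
 have s1: "k s1 = 0" "s1 \<le> t" using zero by (auto simp: s1_def)
 have c: "continuous_on {s1..t} k'" using cont continuous_on_subset by blast
 have "(LBINT s. indicator {s1..t} s *\<^sub>R k' s) = k t - k s1"
  by (rule integral_FTC_Icc[OF s1(2) _ c])
    (use der in \<open>auto simp: has_real_derivative_iff_has_vector_derivative[symmetric] intro: has_field_derivative_at_within\<close>)
 moreover have "integrable lborel (\<lambda>s. indicator {s1..t} s *\<^sub>R k' s)"
  by (rule borel_integrable_compact[OF _ c]) simp
 ultimately have "ennreal \<bar>k t\<bar> \<le> (\<integral>\<^sup>+s. ennreal (norm (indicator {s1..t} s *\<^sub>R k' s)) \<partial>lborel)"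
  using integral_norm_bound_ennreal[of lborel "\<lambda>s. indicator {s1..t} s *\<^sub>R k' s"] s1 by simp
 also have "\<dots> \<le> (\<integral>\<^sup>+s. ennreal \<bar>k' s\<bar> \<partial>lborel)"
  by (intro nn_integral_mono ennreal_leI) (auto simp: indicator_def)
 finally show ?thesis .
qed

lemma nn_integral_swap:
 assumes "(\<lambda>(x, y). f x y) \<in> borel_measurable (lborel \<Otimes>\<^sub>M lborel)"
 shows "(\<integral>\<^sup>+x. \<integral>\<^sup>+y. f x y \<partial>lborel \<partial>lborel) = (\<integral>\<^sup>+y. \<integral>\<^sup>+x. f x y \<partial>(lborel::real measure) \<partial>(lborel::real measure))"
 by (rule lborel_pair.Fubini'[OF assms, symmetric])

text \<open>
 Gagliardo's argument: along each coordinate line \<open>|u|\<^sup>3\<close> is at most the integral of \<open>3 u\<^sup>2 |\<nabla>u|\<close>,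
 so \<open>|u|\<^sup>4\<close> is a product of four functions to which the Loomis--Whitney inequality applies.
\<close>

lemma gagliardo4:
 fixes u :: "real^4 \<Rightarrow> real"
 assumes der: "\<And>x. (u has_derivative u' x) (at x)"
  and cont: "\<And>i. continuous_on UNIV (\<lambda>x. u' x (axis i 1))"
  and K: "\<And>x. u x \<noteq> 0 \<Longrightarrow> norm x \<le> R"
  and phi_def: "\<And>x. \<phi> x = ennreal (3 * (u x)\<^sup>2 * sqrt (\<Sum>i\<in>UNIV. (u' x (axis i 1))\<^sup>2))"
 shows "(\<integral>\<^sup>+x. ennreal ((u x) ^ 4) \<partial>lborel) \<le> cbrt (\<integral>\<^sup>+x. \<phi> x \<partial>lborel) ^ 4"
proof -
 have contu: "continuous_on UNIV u"
  using der by (intro continuous_at_imp_continuous_on ballI has_derivative_continuous)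
 have u_meas[measurable]: "u \<in> borel_measurable borel" by (rule borel_measurable_continuous_onI[OF contu])
 have "continuous_on UNIV (\<lambda>x. 3 * (u x)\<^sup>2 * sqrt (\<Sum>i\<in>UNIV. (u' x (axis i 1))\<^sup>2))"
  by (intro continuous_intros contu cont)
 then have phi_meas: "\<phi> \<in> borel_measurable borel"
  unfolding phi_def[abs_def] by (intro measurable_compose[OF borel_measurable_continuous_onI measurable_ennreal])
 define F where "F = (\<lambda>(d, c, b, a). \<phi> (vec4 a b c d))"
 have Fm[measurable]: "F \<in> borel_measurable lborel4"
  using measurable_compose[OF vec4_measurable phi_meas] by (simp add: F_def split_def)
 \<comment> \<open>along a coordinate line through \<open>x\<close>\<close>
 have line: "ennreal \<bar>u x\<bar> ^ 3 \<le> (\<integral>\<^sup>+s. \<phi> (x + (s - x $ j) *\<^sub>R axis j 1) \<partial>lborel)" for x and j :: 4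
 proof -
  define \<gamma> where "\<gamma> s = x + (s - x $ j) *\<^sub>R axis j 1" for s
  have g: "(\<gamma> has_derivative (\<lambda>r. r *\<^sub>R axis j 1)) (at s)" for s
   unfolding \<gamma>_def by (auto intro!: derivative_eq_intros)
  have cg: "continuous_on UNIV \<gamma>" unfolding \<gamma>_def by (intro continuous_intros)
  have "((\<lambda>s. u (\<gamma> s)) has_real_derivative u' (\<gamma> s) (axis j 1)) (at s)" for s
  proof -
   have "((\<lambda>s. u (\<gamma> s)) has_derivative (\<lambda>r. u' (\<gamma> s) (r *\<^sub>R axis j 1))) (at s)"
    by (rule has_derivative_compose[OF g der])
   moreover have "(\<lambda>r. u' (\<gamma> s) (r *\<^sub>R axis j 1)) = (*) (u' (\<gamma> s) (axis j 1))"
    using linear_scale[OF has_derivative_linear[OF der[of "\<gamma> s"]]] by (auto simp: fun_eq_iff)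
   ultimately show ?thesis unfolding has_field_derivative_def by (simp only:)
  qed
  then have d: "((\<lambda>s. (u (\<gamma> s)) ^ 3) has_real_derivative 3 * (u (\<gamma> s))\<^sup>2 * u' (\<gamma> s) (axis j 1)) (at s)" for s
   by (auto intro!: derivative_eq_intros)
  have c: "continuous_on UNIV (\<lambda>s. 3 * (u (\<gamma> s))\<^sup>2 * u' (\<gamma> s) (axis j 1))"
   by (intro continuous_intros continuous_on_compose2[OF contu cg] continuous_on_compose2[OF cont cg]) auto
  have z: "(u (\<gamma> s)) ^ 3 = 0" if "s \<le> - \<bar>R\<bar> - 1" for s
  proof -
   have "\<gamma> s $ j = s" by (simp add: \<gamma>_def)
   then have "norm (\<gamma> s) > R" using component_le_norm_cart[of "\<gamma> s" j] that by auto
   then show ?thesis using K[of "\<gamma> s"] by auto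
  qed
  have "\<gamma> (x $ j) = x" by (simp add: \<gamma>_def)
  then have "ennreal \<bar>u x\<bar> ^ 3 = ennreal \<bar>(u (\<gamma> (x $ j))) ^ 3\<bar>" by (simp add: ennreal_power power_abs)
  also have "\<dots> \<le> (\<integral>\<^sup>+s. ennreal \<bar>3 * (u (\<gamma> s))\<^sup>2 * u' (\<gamma> s) (axis j 1)\<bar> \<partial>lborel)"
   by (rule abs_le_nn_integral_derivative[OF d c z])
  also have "\<dots> \<le> (\<integral>\<^sup>+s. \<phi> (\<gamma> s) \<partial>lborel)"
  proof (rule nn_integral_mono)
   fix s
   have "\<bar>u' (\<gamma> s) (axis j 1)\<bar> \<le> sqrt (\<Sum>i\<in>UNIV. (u' (\<gamma> s) (axis i 1))\<^sup>2)"
    using member_le_sum[of j UNIV "\<lambda>i. (u' (\<gamma> s) (axis i 1))\<^sup>2"] by (intro real_le_rsqrt) simp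
   then show "ennreal \<bar>3 * (u (\<gamma> s))\<^sup>2 * u' (\<gamma> s) (axis j 1)\<bar> \<le> \<phi> (\<gamma> s)"
    unfolding phi_def by (intro ennreal_leI) (auto simp: abs_mult intro!: mult_left_mono)
  qed
  finally show ?thesis unfolding \<gamma>_def .
 qed
 define p1 where "p1 = (\<lambda>(b,c,d). cbrt (\<integral>\<^sup>+a. F (d,c,b,a) \<partial>lborel))"
 define p2 where "p2 = (\<lambda>(a,c,d). cbrt (\<integral>\<^sup>+b. F (d,c,b,a) \<partial>lborel))"
 define p3 where "p3 = (\<lambda>(a,b,d). cbrt (\<integral>\<^sup>+c. F (d,c,b,a) \<partial>lborel))"
 define p4 where "p4 = (\<lambda>(a,b,c). cbrt (\<integral>\<^sup>+d. F (d,c,b,a) \<partial>lborel))"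
 have pm: "p1 \<in> borel_measurable lborel3"
  "p2 \<in> borel_measurable lborel3"
  "p3 \<in> borel_measurable lborel3"
  "p4 \<in> borel_measurable lborel3"
  unfolding p1_def p2_def p3_def p4_def by measurable
 have v4: "vec4 a b c d + (s - vec4 a b c d $ 1) *\<^sub>R axis 1 1 = vec4 s b c d"
   "vec4 a b c d + (s - vec4 a b c d $ 2) *\<^sub>R axis 2 1 = vec4 a s c d"
   "vec4 a b c d + (s - vec4 a b c d $ 3) *\<^sub>R axis 3 1 = vec4 a b s d"
   "vec4 a b c d + (s - vec4 a b c d $ 4) *\<^sub>R axis 4 1 = vec4 a b c s" for a b c d s
  by (simp_all add: vec_eq_iff forall_4 axis_def)
 have up: "ennreal ((u (vec4 a b c d)) ^ 4) \<le> p1 (b,c,d) * p2 (a,c,d) * p3 (a,b,d) * p4 (a,b,c)" for a b c d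
 proof -
  let ?x = "vec4 a b c d"
  have p: "ennreal \<bar>u ?x\<bar> \<le> p1 (b,c,d)" "ennreal \<bar>u ?x\<bar> \<le> p2 (a,c,d)"
   "ennreal \<bar>u ?x\<bar> \<le> p3 (a,b,d)" "ennreal \<bar>u ?x\<bar> \<le> p4 (a,b,c)"
   by (rule ennreal_cube_mono, use line[of ?x 1, unfolded v4] in \<open>simp add: p1_def F_def\<close>)
     (rule ennreal_cube_mono, use line[of ?x 2, unfolded v4] in \<open>simp add: p2_def F_def\<close>,
     rule ennreal_cube_mono, use line[of ?x 3, unfolded v4] in \<open>simp add: p3_def F_def\<close>,
     rule ennreal_cube_mono, use line[of ?x 4, unfolded v4] in \<open>simp add: p4_def F_def\<close>)
  have "(u ?x) ^ 4 = \<bar>u ?x\<bar> * \<bar>u ?x\<bar> * \<bar>u ?x\<bar> * \<bar>u ?x\<bar>"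
   by (cases "u ?x \<ge> 0") (simp_all add: power4_eq_xxxx)
  then have "ennreal ((u ?x) ^ 4) = ennreal \<bar>u ?x\<bar> * ennreal \<bar>u ?x\<bar> * ennreal \<bar>u ?x\<bar> * ennreal \<bar>u ?x\<bar>"
   by (simp only: ennreal_mult abs_ge_zero mult_nonneg_nonneg)
  also have "\<dots> \<le> p1 (b,c,d) * p2 (a,c,d) * p3 (a,b,d) * p4 (a,b,c)"
   by (intro mult_mono p) auto
  finally show ?thesis .
 qed
 define X where "X = (\<integral>\<^sup>+x. \<phi> x \<partial>lborel)"
 have X: "X = (\<integral>\<^sup>+d. \<integral>\<^sup>+c. \<integral>\<^sup>+b. \<integral>\<^sup>+a. F (d,c,b,a) \<partial>lborel \<partial>lborel \<partial>lborel \<partial>lborel)"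
  unfolding X_def using nn_integral_vec4[OF phi_meas] by (simp add: F_def)
 have X1: "(\<integral>\<^sup>+d. \<integral>\<^sup>+c. \<integral>\<^sup>+b. p1 (b,c,d) ^ 3 \<partial>lborel \<partial>lborel \<partial>lborel) = X"
  unfolding X p1_def by simp
 have X2: "(\<integral>\<^sup>+d. \<integral>\<^sup>+c. \<integral>\<^sup>+a. p2 (a,c,d) ^ 3 \<partial>lborel \<partial>lborel \<partial>lborel) = X"
  unfolding X p2_def by (auto intro!: nn_integral_cong nn_integral_swap)
 have X3: "(\<integral>\<^sup>+d. \<integral>\<^sup>+b. \<integral>\<^sup>+a. p3 (a,b,d) ^ 3 \<partial>lborel \<partial>lborel \<partial>lborel) = X"
 proof -
  have "(\<integral>\<^sup>+d. \<integral>\<^sup>+b. \<integral>\<^sup>+a. p3 (a,b,d) ^ 3 \<partial>lborel \<partial>lborel \<partial>lborel) =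
    (\<integral>\<^sup>+d. \<integral>\<^sup>+b. \<integral>\<^sup>+c. \<integral>\<^sup>+a. F (d,c,b,a) \<partial>lborel \<partial>lborel \<partial>lborel \<partial>lborel)"
   unfolding p3_def by (auto intro!: nn_integral_cong nn_integral_swap)
  also have "\<dots> = X" unfolding X by (intro nn_integral_cong nn_integral_swap) measurable
  finally show ?thesis .
 qed
 have X4: "(\<integral>\<^sup>+c. \<integral>\<^sup>+b. \<integral>\<^sup>+a. p4 (a,b,c) ^ 3 \<partial>lborel \<partial>lborel \<partial>lborel) = X"
 proof -
  have "(\<integral>\<^sup>+c. \<integral>\<^sup>+b. \<integral>\<^sup>+a. p4 (a,b,c) ^ 3 \<partial>lborel \<partial>lborel \<partial>lborel) =
    (\<integral>\<^sup>+c. \<integral>\<^sup>+b. \<integral>\<^sup>+d. \<integral>\<^sup>+a. F (d,c,b,a) \<partial>lborel \<partial>lborel \<partial>lborel \<partial>lborel)"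
   unfolding p4_def by (auto intro!: nn_integral_cong nn_integral_swap)
  also have "\<dots> = (\<integral>\<^sup>+c. \<integral>\<^sup>+d. \<integral>\<^sup>+b. \<integral>\<^sup>+a. F (d,c,b,a) \<partial>lborel \<partial>lborel \<partial>lborel \<partial>lborel)"
   by (intro nn_integral_cong nn_integral_swap) measurable
  also have "\<dots> = X" unfolding X by (intro nn_integral_swap) measurable
  finally show ?thesis .
 qed
 have "(\<integral>\<^sup>+x. ennreal ((u x) ^ 4) \<partial>lborel) =
  (\<integral>\<^sup>+d. \<integral>\<^sup>+c. \<integral>\<^sup>+b. \<integral>\<^sup>+a. ennreal ((u (vec4 a b c d)) ^ 4) \<partial>lborel \<partial>lborel \<partial>lborel \<partial>lborel)"
  by (rule nn_integral_vec4) measurable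
 also have "\<dots> \<le> (\<integral>\<^sup>+d. \<integral>\<^sup>+c. \<integral>\<^sup>+b. \<integral>\<^sup>+a. p1 (b,c,d) * p2 (a,c,d) * p3 (a,b,d) * p4 (a,b,c) \<partial>lborel \<partial>lborel \<partial>lborel \<partial>lborel)"
  by (intro nn_integral_mono up)
 also have "\<dots> \<le> cbrt X * cbrt X * cbrt X * cbrt X"
  using loomis_whitney4[OF pm] unfolding X1 X2 X3 X4 .
 also have "\<dots> = cbrt X ^ 4" by (simp add: power4_eq_xxxx)
 finally show ?thesis unfolding X_def .
qed

text \<open>
 Let \<open>X\<close> and \<open>Y\<close> be the two integrals and \<open>N\<close> that of \<open>3 u\<^sup>2 |\<nabla>u|\<close>.  Gagliardo's bound and the
 Cauchy--Schwarz inequality give \<open>X\<^sup>3 \<le> N\<^sup>4 \<le> 81 X\<^sup>2 Y\<^sup>2\<close>, and \<open>X\<close> is finite.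
\<close>

theorem sobolev4:
 fixes u :: "real^4 \<Rightarrow> real"
 assumes der: "\<And>x. (u has_derivative u' x) (at x)"
  and cont: "\<And>i. continuous_on UNIV (\<lambda>x. u' x (axis i 1))"
  and K: "\<And>x. u x \<noteq> 0 \<Longrightarrow> norm x \<le> R"
 shows "(\<integral>\<^sup>+x. ennreal ((u x) ^ 4) \<partial>lborel) \<le>
  81 * (\<integral>\<^sup>+x. ennreal (\<Sum>i\<in>UNIV. (u' x (axis i 1))\<^sup>2) \<partial>lborel)\<^sup>2"
proof -
 define y where "y x = (\<Sum>i\<in>UNIV. (u' x (axis i 1))\<^sup>2)" for x
 have y0: "0 \<le> y x" for x by (auto simp: y_def intro: sum_nonneg)
 have contu: "continuous_on UNIV u"
  using der by (intro continuous_at_imp_continuous_on ballI has_derivative_continuous)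
 have [measurable]: "u \<in> borel_measurable borel" by (rule borel_measurable_continuous_onI[OF contu])
 have conty: "continuous_on UNIV y" unfolding y_def by (intro continuous_intros cont)
 have [measurable]: "y \<in> borel_measurable borel" by (rule borel_measurable_continuous_onI[OF conty])
 define N where "N = (\<integral>\<^sup>+x. ennreal (3 * (u x)\<^sup>2 * sqrt (y x)) \<partial>lborel)"
 define X where "X = (\<integral>\<^sup>+x. ennreal ((u x) ^ 4) \<partial>lborel)"
 define Y where "Y = (\<integral>\<^sup>+x. ennreal (y x) \<partial>lborel)"
 have "X \<le> cbrt N ^ 4"
  unfolding X_def N_def
  by (rule gagliardo4[OF der cont K]) (simp_all add: y_def)
 then have "X ^ 3 \<le> (cbrt N ^ 4) ^ 3" by (intro power_mono) auto
 also have "\<dots> = (cbrt N ^ 3) ^ 4" by (metis mult.commute power_mult)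
 finally have XN: "X ^ 3 \<le> N ^ 4" by simp
 have "N = 3 * (\<integral>\<^sup>+x. ennreal ((u x)\<^sup>2) * ennreal (sqrt (y x)) \<partial>lborel)"
  unfolding N_def by (subst nn_integral_cmult[symmetric]) (auto simp: ennreal_mult' mult.assoc y0)
 then have "N\<^sup>2 = 9 * (\<integral>\<^sup>+x. ennreal ((u x)\<^sup>2) * ennreal (sqrt (y x)) \<partial>lborel)\<^sup>2"
  by (simp add: power_mult_distrib)
 also have "\<dots> \<le> 9 * ((\<integral>\<^sup>+x. ennreal ((u x)\<^sup>2) ^ 2 \<partial>lborel) * (\<integral>\<^sup>+x. ennreal (sqrt (y x)) ^ 2 \<partial>lborel))"
  by (intro mult_left_mono Cauchy_Schwarz_nn_integral) auto
 also have "\<dots> = 9 * (X * Y)" unfolding X_def Y_def by (simp add: ennreal_power y0 flip: power_mult)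
 finally have N2: "N\<^sup>2 \<le> 9 * (X * Y)" .
 have "X ^ 3 \<le> (N\<^sup>2)\<^sup>2" using XN by (simp flip: power_mult)
 also have "\<dots> \<le> (9 * (X * Y))\<^sup>2" by (intro power_mono N2) auto
 finally have key: "X ^ 3 \<le> 81 * (X\<^sup>2 * Y\<^sup>2)" by (simp add: power_mult_distrib)
 have "integrable lborel (\<lambda>x. indicator (cball 0 R) x *\<^sub>R (u x) ^ 4)"
  by (intro borel_integrable_compact continuous_intros continuous_on_subset[OF contu]) auto
 moreover have "(\<lambda>x. indicator (cball 0 R) x *\<^sub>R (u x) ^ 4) = (\<lambda>x. (u x) ^ 4)"
  using K by (auto simp: fun_eq_iff indicator_def)
 ultimately have "integrable lborel (\<lambda>x. (u x) ^ 4)" by (simp only:)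
 then have Xfin: "X < \<infinity>" unfolding X_def by (simp add: integrable_iff_bounded)
 have "X \<le> 81 * Y\<^sup>2"
 proof (cases "X = 0 \<or> Y = \<infinity>")
  case True
  then show ?thesis by (auto simp: power_eq_top_ennreal ennreal_mult_eq_top_iff)
 next
  case False
  then obtain r s where rs: "X = ennreal r" "Y = ennreal s" "0 < r" "0 \<le> s"
   using Xfin by (cases X; cases Y) (auto simp: order_less_le)
  have "ennreal (r ^ 3) \<le> ennreal (81 * (r\<^sup>2 * s\<^sup>2))"
   using key rs by (simp add: ennreal_power ennreal_mult)
  then have "r ^ 3 \<le> 81 * (r\<^sup>2 * s\<^sup>2)" by (subst (asm) ennreal_le_iff) (use rs in auto)
  then have "r\<^sup>2 * r \<le> r\<^sup>2 * (81 * s\<^sup>2)" by (simp add: power2_eq_square power3_eq_cube mult_ac)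
  then have "r \<le> 81 * s\<^sup>2" using rs(3) by (simp add: mult_le_cancel_left)
  then have "ennreal r \<le> ennreal (81 * s\<^sup>2)" by (rule ennreal_leI)
  then show ?thesis using rs by (simp add: ennreal_power ennreal_mult)
 qed
 then show ?thesis unfolding X_def Y_def y_def .
qed

section \<open>Weak gradients and the energy space\<close>

definition zext :: "'a set \<Rightarrow> ('a \<Rightarrow> 'b::real_vector) \<Rightarrow> 'a \<Rightarrow> 'b" where
 "zext \<Omega> f = (\<lambda>x. indicator \<Omega> x *\<^sub>R f x)"

lemma zext_in [simp]: "x \<in> \<Omega> \<Longrightarrow> zext \<Omega> f x = f x" and zext_out [simp]: "x \<notin> \<Omega> \<Longrightarrow> zext \<Omega> f x = 0"
 by (auto simp: zext_def)

lemma zext_measurable_iff: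
 fixes f :: "'a::euclidean_space \<Rightarrow> 'b::euclidean_space"
 assumes "\<Omega> \<in> sets lebesgue"
 shows "zext \<Omega> f \<in> borel_measurable lebesgue \<longleftrightarrow> f \<in> borel_measurable (lebesgue_on \<Omega>)"
 unfolding zext_def by (rule borel_measurable_restrict_space_iff[symmetric]) (use assms in simp)

lemma integrable_zext_iff:
 fixes f :: "'a::euclidean_space \<Rightarrow> 'b::euclidean_space"
 assumes "\<Omega> \<in> sets lebesgue"
 shows "integrable lebesgue (zext \<Omega> f) \<longleftrightarrow> integrable (lebesgue_on \<Omega>) f"
 unfolding zext_def by (rule integrable_restrict_space[symmetric]) (use assms in simp)

lemma integral_zext:
 fixes f :: "'a::euclidean_space \<Rightarrow> 'b::euclidean_space"
 assumes "\<Omega> \<in> sets lebesgue"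
 shows "(LINT x|lebesgue. zext \<Omega> f x) = (LINT x|lebesgue_on \<Omega>. f x)"
 unfolding zext_def by (rule integral_restrict_space[symmetric]) (use assms in simp)

lemma AE_zext_iff:
 assumes "\<Omega> \<in> sets lebesgue"
 shows "(AE x in lebesgue. zext \<Omega> f x = zext \<Omega> g x) \<longleftrightarrow> (AE x in lebesgue_on \<Omega>. f x = g x)"
 by (subst AE_restrict_space_iff) (use assms in \<open>auto simp: zext_def indicator_def\<close>)

lemma powr_2_eq: "0 \<le> s \<Longrightarrow> s powr 2 = s\<^sup>2" for s :: real
 by (cases "s = 0") (auto simp: powr_numeral)

lemma sq_int_zext_iff:
 fixes f :: "'a::euclidean_space \<Rightarrow> 'b::euclidean_space"
 assumes "\<Omega> \<in> sets lebesgue"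
 shows "sq_int (zext \<Omega> f) \<longleftrightarrow> f \<in> Lp_space 2 \<Omega>"
proof -
 have eq: "(\<lambda>x. (norm (zext \<Omega> f x))\<^sup>2) = zext \<Omega> (\<lambda>x. norm (f x) powr 2)"
  by (auto simp: fun_eq_iff zext_def indicator_def powr_2_eq)
 show ?thesis
  unfolding sq_int_def Lp_space_def zext_measurable_iff[OF assms] eq integrable_zext_iff[OF assms] by simp
qed

lemma Lp_norm_2:
 fixes f :: "'a::euclidean_space \<Rightarrow> 'b::euclidean_space"
 assumes "\<Omega> \<in> sets lebesgue" "f \<in> Lp_space 2 \<Omega>"
 shows "Lp_norm 2 \<Omega> f = norm (L2_of (zext \<Omega> f))"
proof -
 have eq: "(\<lambda>x. (norm (zext \<Omega> f x))\<^sup>2) = zext \<Omega> (\<lambda>x. norm (f x) powr 2)"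
  by (auto simp: fun_eq_iff zext_def indicator_def powr_2_eq)
 have "(norm (L2_of (zext \<Omega> f)))\<^sup>2 = (LINT x|lebesgue_on \<Omega>. norm (f x) powr 2)"
  using L2_of_norm_sq[of "zext \<Omega> f"] assms
  by (simp add: sq_int_zext_iff eq integral_zext)
 then have "norm (L2_of (zext \<Omega> f)) = sqrt (LINT x|lebesgue_on \<Omega>. norm (f x) powr 2)"
  by (metis norm_ge_zero real_sqrt_unique)
 then show ?thesis by (simp add: Lp_norm_def powr_half_sqrt integral_nonneg_AE)
qed

lemma powr_le_one_add: "0 < q \<Longrightarrow> q \<le> r \<Longrightarrow> 0 \<le> s \<Longrightarrow> s powr q \<le> 1 + s powr r" for s :: real
proof (cases "s \<le> 1")
 case True
 assume "0 < q" "0 \<le> s"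
 then have "s powr q \<le> 1 powr q" using True by (intro powr_mono2) auto
 then show ?thesis by (simp add: add_increasing2)
next
 case False
 assume "q \<le> r"
 then have "s powr q \<le> s powr r" using False by (intro powr_mono) auto
 then show ?thesis by simp
qed

text \<open>On sets of finite measure the Lebesgue spaces are nested: normalise and use \<open>s\<^sup>q \<le> 1 + s\<^sup>r\<close>.\<close>

lemma Lp_space_nested:
 fixes f :: "'a::euclidean_space \<Rightarrow> 'b::euclidean_space"
 assumes \<Omega>: "\<Omega> \<in> lmeasurable" and q: "0 < q" "q \<le> r" and f: "f \<in> Lp_space r \<Omega>"
 shows "f \<in> Lp_space q \<Omega>"
  and "(LINT x|lebesgue_on \<Omega>. norm (f x) powr q) \<le> (measure lebesgue \<Omega> + 1) * Lp_norm r \<Omega> f powr q"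
proof -
 have m[measurable]: "f \<in> borel_measurable (lebesgue_on \<Omega>)"
  and int: "integrable (lebesgue_on \<Omega>) (\<lambda>x. norm (f x) powr r)"
  using f by (auto simp: Lp_space_def)
 have fin: "integrable (lebesgue_on \<Omega>) (\<lambda>x. c)" for c :: real
  by (rule finite_measure.integrable_const[OF finite_measure_lebesgue_on[OF \<Omega>]])
 have meas: "measure (lebesgue_on \<Omega>) (space (lebesgue_on \<Omega>)) = measure lebesgue \<Omega>"
  using \<Omega> by (simp add: measure_restrict_space fmeasurableD)
 have intq: "integrable (lebesgue_on \<Omega>) (\<lambda>x. norm (f x) powr q)"
 proof (rule Bochner_Integration.integrable_bound)
  show "integrable (lebesgue_on \<Omega>) (\<lambda>x. 1 + norm (f x) powr r)"
   by (intro Bochner_Integration.integrable_add fin int)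
  show "AE x in lebesgue_on \<Omega>. norm (norm (f x) powr q) \<le> norm (1 + norm (f x) powr r)"
   using powr_le_one_add[OF q] by (auto simp: abs_of_nonneg add_nonneg_nonneg)
 qed measurable
 show "f \<in> Lp_space q \<Omega>" using m intq by (simp add: Lp_space_def)
 define I where "I = (LINT x|lebesgue_on \<Omega>. norm (f x) powr r)"
 define N where "N = Lp_norm r \<Omega> f"
 have I0: "I \<ge> 0" by (simp add: I_def)
 have N: "N = I powr (1 / r)" by (simp add: N_def I_def Lp_norm_def)
 show "(LINT x|lebesgue_on \<Omega>. norm (f x) powr q) \<le> (measure lebesgue \<Omega> + 1) * Lp_norm r \<Omega> f powr q"
 proof (cases "I = 0")
  case True
  then have "AE x in lebesgue_on \<Omega>. norm (f x) powr r = 0"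
   unfolding I_def by (subst (asm) integral_nonneg_eq_0_iff_AE[OF int]) auto
  then have "(LINT x|lebesgue_on \<Omega>. norm (f x) powr q) = (LINT x|lebesgue_on \<Omega>. 0)"
   by (intro integral_cong_AE) (auto elim!: eventually_mono)
  then show ?thesis by simp
 next
  case False
  then have Np: "N > 0" using N I0 by simp
  have Nr: "N powr r = I" using N I0 False q by (simp add: powr_powr)
  have pt: "norm (f x) powr q \<le> N powr q * (1 + norm (f x) powr r / I)" for x
  proof -
   have "norm (f x) powr q = N powr q * (norm (f x) / N) powr q"
    using Np by (simp add: powr_divide)
   also have "\<dots> \<le> N powr q * (1 + (norm (f x) / N) powr r)"
    using Np by (intro mult_left_mono powr_le_one_add q) auto
   finally show ?thesis using Np by (simp add: powr_divide Nr)
  qed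
  have i1: "integrable (lebesgue_on \<Omega>) (\<lambda>x. N powr q * (1 + norm (f x) powr r / I))"
   by (intro integrable_mult_right Bochner_Integration.integrable_add fin integrable_divide int)
  have "(LINT x|lebesgue_on \<Omega>. norm (f x) powr q) \<le> (LINT x|lebesgue_on \<Omega>. N powr q * (1 + norm (f x) powr r / I))"
   by (rule integral_mono[OF intq i1 pt])
  also have "\<dots> = N powr q * (measure lebesgue \<Omega> + 1)"
   using fin[of 1] int False meas by (simp add: I_def[symmetric])
  finally show ?thesis by (simp add: N_def mult.commute)
 qed
qed

lemma sq_int_absolutely_integrable_on:
 fixes f :: "'a::euclidean_space \<Rightarrow> 'b::euclidean_space"
 assumes f: "sq_int (zext \<Omega> f)" and K: "compact K" "K \<subseteq> \<Omega>"
 shows "f absolutely_integrable_on K"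
proof -
 have Ks: "K \<in> sets lebesgue" using lmeasurable_compact[OF K(1)] by blast
 have eq: "(\<lambda>x. indicator K x *\<^sub>R zext \<Omega> f x) = (\<lambda>x. indicator K x *\<^sub>R f x)"
  using K(2) by (auto simp: zext_def indicator_def fun_eq_iff)
 have "integrable lebesgue (\<lambda>x. indicator K x *\<^sub>R zext \<Omega> f x)"
 proof (rule Bochner_Integration.integrable_bound)
  show "integrable lebesgue (\<lambda>x. indicator K x + (norm (zext \<Omega> f x))\<^sup>2)"
   using lmeasurable_compact[OF K(1)]
   by (intro Bochner_Integration.integrable_add integrable_real_indicator sq_intD[OF f]) (auto simp: fmeasurable_def)
  show "(\<lambda>x. indicator K x *\<^sub>R zext \<Omega> f x) \<in> borel_measurable lebesgue"
   using f Ks by (intro borel_measurable_scaleR borel_measurable_indicator) (auto simp: sq_int_def)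
  have "norm (zext \<Omega> f x) \<le> 1 + (norm (zext \<Omega> f x))\<^sup>2" for x
  proof -
   have "2 * norm (zext \<Omega> f x) \<le> 1 + (norm (zext \<Omega> f x))\<^sup>2"
    using sum_squares_bound[of 1 "norm (zext \<Omega> f x)"] by simp
   then show ?thesis using norm_ge_zero[of "zext \<Omega> f x"] by linarith
  qed
  then have "norm (indicator K x *\<^sub>R zext \<Omega> f x) \<le> norm (indicator K x + (norm (zext \<Omega> f x))\<^sup>2)" for x
   by (auto simp: indicator_def)
  then show "AE x in lebesgue. norm (indicator K x *\<^sub>R zext \<Omega> f x) \<le> norm (indicator K x + (norm (zext \<Omega> f x))\<^sup>2)"
   by simp
 qed
 then show ?thesis unfolding set_integrable_def eq .
qed

text \<open>The fundamental lemma, applied to each component of the difference.\<close>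

lemma is_weak_gradient_unique:
 fixes u :: "real^'n \<Rightarrow> real^'n"
 assumes "open \<Omega>" and G: "is_weak_gradient \<Omega> u G" and H: "is_weak_gradient \<Omega> u H"
 shows "AE x in lebesgue_on \<Omega>. G x = H x"
proof -
 have comp: "AE x in lebesgue_on \<Omega>. G x $ i $ j - H x $ i $ j = 0" for i j
 proof (rule fundamental_lemma[OF \<open>open \<Omega>\<close>])
  fix K assume K: "compact K" "K \<subseteq> \<Omega>"
  have L: "bounded_linear (\<lambda>A::real^'n^'n. A $ i $ j)"
   using bounded_linear_compose[OF bounded_linear_vec_nth[of j] bounded_linear_vec_nth[of i]] by simp
  have "(\<lambda>x. G x - H x) absolutely_integrable_on K"
   using G H K by (intro set_integral_diff) (auto simp: is_weak_gradient_def)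
  from absolutely_integrable_linear[OF this L]
  show "(\<lambda>x. G x $ i $ j - H x $ i $ j) absolutely_integrable_on K" by (simp add: o_def)
 next
  fix \<eta> :: "real^'n \<Rightarrow> real" assume \<eta>: "test_function \<Omega> \<eta>"
  let ?K = "closure {x. \<eta> x \<noteq> 0}"
  have K: "compact ?K" "?K \<subseteq> \<Omega>" and s: "smooth \<eta>" using \<eta> by (auto simp: test_function_def)
  have L: "bounded_linear (\<lambda>A::real^'n^'n. A $ i $ j)"
   using bounded_linear_compose[OF bounded_linear_vec_nth[of j] bounded_linear_vec_nth[of i]] by simp
  have \<Omega>: "\<Omega> \<in> sets lebesgue" using \<open>open \<Omega>\<close> by simp
  have \<eta>m: "\<eta> \<in> borel_measurable lebesgue"
   by (rule continuous_borel_measurable_lebesgue[OF smooth_continuous[OF s]])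
  obtain B where B: "\<And>x. \<bar>\<eta> x\<bar> \<le> B"
  proof -
   have "bounded (\<eta> ` ?K)" by (intro compact_imp_bounded compact_continuous_image smooth_continuous s K)
   then obtain B where B: "B > 0" "\<And>x. x \<in> ?K \<Longrightarrow> \<bar>\<eta> x\<bar> \<le> B" unfolding bounded_pos by auto
   have "\<bar>\<eta> x\<bar> \<le> B" for x
   proof (cases "\<eta> x = 0")
    case False
    then have "x \<in> ?K" using closure_subset[of "{x. \<eta> x \<noteq> 0}"] by blast
    then show ?thesis by (rule B)
   qed (use B in simp)
   then show thesis by (rule that)
  qed
  have int: "integrable (lebesgue_on \<Omega>) (\<lambda>x. A x $ i $ j * \<eta> x)" if A: "A absolutely_integrable_on ?K" for A :: "real^'n \<Rightarrow> real^'n^'n"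
  proof -
   have i0: "integrable lebesgue (\<lambda>x. indicator ?K x *\<^sub>R (A x $ i $ j))"
    using absolutely_integrable_linear[OF A L] by (simp add: o_def set_integrable_def)
   have "integrable lebesgue (\<lambda>x. \<eta> x * (indicator ?K x *\<^sub>R (A x $ i $ j)))"
   proof (rule Bochner_Integration.integrable_bound)
    show "integrable lebesgue (\<lambda>x. B * norm (indicator ?K x *\<^sub>R (A x $ i $ j)))"
     by (intro integrable_mult_right integrable_norm i0)
    show "(\<lambda>x. \<eta> x * (indicator ?K x *\<^sub>R (A x $ i $ j))) \<in> borel_measurable lebesgue"
     by (rule borel_measurable_times[OF \<eta>m borel_measurable_integrable[OF i0]])
    show "AE x in lebesgue. norm (\<eta> x * (indicator ?K x *\<^sub>R (A x $ i $ j))) \<le> norm (B * norm (indicator ?K x *\<^sub>R (A x $ i $ j)))"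
     using B by (auto simp: abs_mult intro!: mult_right_mono AE_I2) (meson abs_ge_self order_trans)
   qed
   moreover have "(\<lambda>x. \<eta> x * (indicator ?K x *\<^sub>R (A x $ i $ j))) = zext \<Omega> (\<lambda>x. A x $ i $ j * \<eta> x)"
   proof
    fix x
    have "x \<in> ?K" if "\<eta> x \<noteq> 0" using that closure_subset[of "{x. \<eta> x \<noteq> 0}"] by blast
    then show "\<eta> x * (indicator ?K x *\<^sub>R (A x $ i $ j)) = zext \<Omega> (\<lambda>x. A x $ i $ j * \<eta> x) x"
     using K(2) by (cases "\<eta> x = 0") (auto simp: zext_def indicator_def)
   qed
   ultimately show ?thesis using integrable_zext_iff[OF \<Omega>] by metis
  qed
  have iG: "integrable (lebesgue_on \<Omega>) (\<lambda>x. G x $ i $ j * \<eta> x)"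
   and iH: "integrable (lebesgue_on \<Omega>) (\<lambda>x. H x $ i $ j * \<eta> x)"
   using G H K by (auto intro!: int simp: is_weak_gradient_def)
  have "(LINT x|lebesgue_on \<Omega>. G x $ i $ j * \<eta> x) = (LINT x|lebesgue_on \<Omega>. H x $ i $ j * \<eta> x)"
  proof -
   have "(LINT x|lebesgue_on \<Omega>. u x $ i * frechet_derivative \<eta> (at x) (axis j 1)) = - (LINT x|lebesgue_on \<Omega>. G x $ i $ j * \<eta> x)"
    using G \<eta> unfolding is_weak_gradient_def by blast
   moreover have "(LINT x|lebesgue_on \<Omega>. u x $ i * frechet_derivative \<eta> (at x) (axis j 1)) = - (LINT x|lebesgue_on \<Omega>. H x $ i $ j * \<eta> x)"
    using H \<eta> unfolding is_weak_gradient_def by blast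
   ultimately show ?thesis by linarith
  qed
  then show "(LINT x|lebesgue_on \<Omega>. (G x $ i $ j - H x $ i $ j) * \<eta> x) = 0"
   using Bochner_Integration.integral_diff[OF iG iH] by (simp add: left_diff_distrib)
 qed
 have "AE x in lebesgue_on \<Omega>. \<forall>i\<in>UNIV. \<forall>j\<in>UNIV. G x $ i $ j - H x $ i $ j = 0"
  by (intro AE_finite_allI finite comp)
 then show ?thesis by eventually_elim (simp add: vec_eq_iff)
qed

lemma continuous_compact_support_sq_int:
 fixes f :: "'a::euclidean_space \<Rightarrow> 'b::euclidean_space"
 assumes "continuous_on UNIV f" "compact K" "\<And>x. x \<notin> K \<Longrightarrow> f x = 0"
 shows "sq_int f"
 unfolding sq_int_def
proof
 show "f \<in> borel_measurable lebesgue" by (rule continuous_borel_measurable_lebesgue) fact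
 have "integrable lborel (\<lambda>x. indicator K x *\<^sub>R (norm (f x))\<^sup>2)"
  by (intro borel_integrable_compact assms continuous_intros continuous_on_subset[OF assms(1)]) auto
 moreover have "(\<lambda>x. indicator K x *\<^sub>R (norm (f x))\<^sup>2) = (\<lambda>x. (norm (f x))\<^sup>2)"
  using assms(3) by (auto simp: fun_eq_iff indicator_def)
 ultimately have "integrable lborel (\<lambda>x. (norm (f x))\<^sup>2)" by (simp only:)
 then show "integrable lebesgue (\<lambda>x. (norm (f x))\<^sup>2)" by (rule integrable_completion[THEN iffD2, rotated])
   (use borel_measurable_continuous_onI[OF continuous_on_power[OF continuous_on_norm[OF assms(1)]]] in simp)
qed

lemma sq_int_indicator: "S \<in> lmeasurable \<Longrightarrow> sq_int (indicator S :: 'a::euclidean_space \<Rightarrow> real)"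
 by (auto intro!: integrable_real_indicator
   simp: sq_int_def fmeasurable_def power2_eq_square indicator_inter_arith[symmetric])

lemma norm_L2_of_le:
 fixes f :: "'a::euclidean_space \<Rightarrow> 'b::euclidean_space"
 assumes f: "sq_int f" and K: "compact K" "\<And>x. x \<notin> K \<Longrightarrow> f x = 0" and e: "\<And>x. norm (f x) \<le> e"
 shows "norm (L2_of f) \<le> e * sqrt (measure lebesgue K)"
proof -
 have e0: "0 \<le> e" using order_trans[OF norm_ge_zero e] .
 have Ki: "integrable lebesgue (indicator K :: 'a \<Rightarrow> real)"
  using lmeasurable_compact[OF K(1)] by (intro integrable_real_indicator) (auto simp: fmeasurable_def)
 have "(norm (L2_of f))\<^sup>2 = (LINT x|lebesgue. (norm (f x))\<^sup>2)" by (rule L2_of_norm_sq[OF f])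
 also have "\<dots> \<le> (LINT x|lebesgue. e\<^sup>2 * indicator K x)"
 proof (rule integral_mono)
  show "(norm (f x))\<^sup>2 \<le> e\<^sup>2 * indicator K x" for x
   by (cases "x \<in> K") (auto simp: K(2) intro!: power_mono e)
 qed (use sq_intD[OF f] Ki in auto)
 also have "\<dots> = (e * sqrt (measure lebesgue K))\<^sup>2" using e0 by (simp add: power_mult_distrib)
 finally show ?thesis by (rule power2_le_imp_le) (use e0 in simp)
qed

lemma uniformly_continuous_in_time:
 fixes b :: "real \<Rightarrow> 'a::euclidean_space \<Rightarrow> 'b::euclidean_space"
 assumes b: "continuous_on ({0..T} \<times> UNIV) (\<lambda>(t, x). b t x)"
  and K: "compact K" "\<And>t x. t \<in> {0..T} \<Longrightarrow> x \<notin> K \<Longrightarrow> b t x = 0" and e: "0 < e"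
 shows "\<exists>d>0. \<forall>s\<in>{0..T}. \<forall>t\<in>{0..T}. \<forall>x. \<bar>t - s\<bar> < d \<longrightarrow> norm (b t x - b s x) \<le> e"
proof -
 have "uniformly_continuous_on ({0..T} \<times> K) (\<lambda>(t, x). b t x)"
  by (rule compact_uniformly_continuous[OF continuous_on_subset[OF b]]) (auto intro: compact_Times K)
 then obtain d where d: "d > 0" "\<And>z z'. z \<in> {0..T} \<times> K \<Longrightarrow> z' \<in> {0..T} \<times> K \<Longrightarrow> dist z' z < d \<Longrightarrow>
   dist ((\<lambda>(t, x). b t x) z') ((\<lambda>(t, x). b t x) z) < e"
  using e unfolding uniformly_continuous_on_def by blast
 show ?thesis
 proof (intro exI[of _ d] conjI d(1) ballI allI impI)
  fix s t x assume st: "s \<in> {0..T}" "t \<in> {0..T}" "\<bar>t - s\<bar> < d"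
  show "norm (b t x - b s x) \<le> e"
  proof (cases "x \<in> K")
   case True
   then show ?thesis using d(2)[of "(s, x)" "(t, x)"] st by (auto simp: dist_Pair_Pair dist_norm)
  next
   case False
   then show ?thesis using K(2) st e by simp
  qed
 qed
qed

text \<open>
 Everything happens on one compact set, where uniform bounds in \<open>x\<close> are bounds in \<open>L\<^sup>2\<close>.  The mean
 value theorem bounds the error of the linearisation by the modulus of continuity of \<open>b\<close>.
\<close>

lemma L2_curve:
 fixes a b :: "real \<Rightarrow> 'a::euclidean_space \<Rightarrow> 'b::euclidean_space"
 assumes a: "continuous_on ({0..T} \<times> UNIV) (\<lambda>(t, x). a t x)" and b: "continuous_on ({0..T} \<times> UNIV) (\<lambda>(t, x). b t x)"
  and K: "compact K" "\<And>t x. t \<in> {0..T} \<Longrightarrow> x \<notin> K \<Longrightarrow> a t x = 0" "\<And>t x. t \<in> {0..T} \<Longrightarrow> x \<notin> K \<Longrightarrow> b t x = 0"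
 shows L2_curve_continuous: "continuous_on {0..T} (\<lambda>t. L2_of (b t))"
  and L2_curve_derivative:
   "(\<And>t x. t \<in> {0..T} \<Longrightarrow> ((\<lambda>t. a t x) has_vector_derivative b t x) (at t within {0..T})) \<Longrightarrow> t \<in> {0..T} \<Longrightarrow>
    ((\<lambda>t. L2_of (a t)) has_vector_derivative L2_of (b t)) (at t within {0..T})"
proof -
 define k where "k = sqrt (measure lebesgue K) + 1"
 have k: "k > 0" "sqrt (measure lebesgue K) \<le> k" unfolding k_def using real_sqrt_ge_zero[OF measure_nonneg[of lebesgue K]] by linarith+
 have sq: "sq_int (a t)" "sq_int (b t)" if t: "t \<in> {0..T}" for t
 proof -
  have "continuous_on UNIV (a t)"
   using continuous_on_compose2[OF a continuous_on_Pair[OF continuous_on_const[of UNIV t] continuous_on_id]] t by (auto simp: image_subset_iff)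
  then show "sq_int (a t)" by (rule continuous_compact_support_sq_int[OF _ K(1) K(2)[OF t]])
  have "continuous_on UNIV (b t)"
   using continuous_on_compose2[OF b continuous_on_Pair[OF continuous_on_const[of UNIV t] continuous_on_id]] t by (auto simp: image_subset_iff)
  then show "sq_int (b t)" by (rule continuous_compact_support_sq_int[OF _ K(1) K(3)[OF t]])
 qed
 show "continuous_on {0..T} (\<lambda>t. L2_of (b t))"
  unfolding continuous_on_iff
 proof (intro ballI allI impI)
  fix s and e :: real assume s: "s \<in> {0..T}" and e: "e > 0"
  have e': "e / (2 * k) > 0" using e k by simp
  obtain d where d: "d > 0" "\<And>s t x. s \<in> {0..T} \<Longrightarrow> t \<in> {0..T} \<Longrightarrow> \<bar>t - s\<bar> < d \<Longrightarrow> norm (b t x - b s x) \<le> e / (2 * k)"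
   using uniformly_continuous_in_time[OF b K(1,3) e'] by blast
  show "\<exists>d>0. \<forall>t\<in>{0..T}. dist t s < d \<longrightarrow> dist (L2_of (b t)) (L2_of (b s)) < e"
  proof (intro exI[of _ d] conjI d(1) ballI impI)
   fix t assume t: "t \<in> {0..T}" "dist t s < d"
   have "norm (L2_of (b t) - L2_of (b s)) \<le> e / (2 * k) * sqrt (measure lebesgue K)"
    unfolding L2_of_diff[OF sq(2)[OF t(1)] sq(2)[OF s]]
    by (rule norm_L2_of_le[OF sq_int_diff[OF sq(2)[OF t(1)] sq(2)[OF s]] K(1)])
      (use K(3) s t d(2)[OF s t(1)] in \<open>auto simp: dist_real_def\<close>)
   also have "\<dots> \<le> e / (2 * k) * k" using e' k by (intro mult_left_mono) auto
   also have "\<dots> < e" using e k by simp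
   finally show "dist (L2_of (b t)) (L2_of (b s)) < e" by (simp add: dist_norm)
  qed
 qed
 assume der: "\<And>t x. t \<in> {0..T} \<Longrightarrow> ((\<lambda>t. a t x) has_vector_derivative b t x) (at t within {0..T})" and s: "t \<in> {0..T}"
 show "((\<lambda>t. L2_of (a t)) has_vector_derivative L2_of (b t)) (at t within {0..T})"
  unfolding has_vector_derivative_def has_derivative_within_alt
 proof (intro conjI allI impI)
  show "bounded_linear (\<lambda>h. h *\<^sub>R L2_of (b t))" by (rule bounded_linear_scaleR_left)
  fix e :: real assume e: "e > 0"
  have e': "e / k > 0" using e k by simp
  obtain d where d: "d > 0" "\<And>s t x. s \<in> {0..T} \<Longrightarrow> t \<in> {0..T} \<Longrightarrow> \<bar>t - s\<bar> < d \<Longrightarrow> norm (b t x - b s x) \<le> e / k"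
   using uniformly_continuous_in_time[OF b K(1,3) e'] by blast
  show "\<exists>d>0. \<forall>r\<in>{0..T}. norm (r - t) < d \<longrightarrow>
    norm (L2_of (a r) - L2_of (a t) - (r - t) *\<^sub>R L2_of (b t)) \<le> e * norm (r - t)"
  proof (intro exI[of _ d] conjI d(1) ballI impI)
   fix r assume r: "r \<in> {0..T}" "norm (r - t) < d"
   note sd = sq_int_diff[OF sq(1)[OF r(1)] sq(1)[OF s]] and ss = sq_int_scaleR[OF sq(2)[OF s], of "r - t"]
   have pt: "norm (a r x - a t x - (r - t) *\<^sub>R b t x) \<le> norm (r - t) * (e / k)" for x
   proof (rule vector_differentiable_bound_linearization[where S="closed_segment t r"])
    have sub: "closed_segment t r \<subseteq> {0..T}" using s r by (auto simp: closed_segment_eq_real_ivl split: if_splits)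
    show "((\<lambda>t. a t x) has_vector_derivative b q x) (at q within closed_segment t r)" if "q \<in> closed_segment t r" for q
     using der[of q x] sub that has_vector_derivative_within_subset by blast
    show "norm (b q x - b t x) \<le> e / k" if "q \<in> closed_segment t r" for q
    proof (rule d(2)[OF s])
     show "q \<in> {0..T}" using sub that by blast
     show "\<bar>q - t\<bar> < d" using that r(2) by (auto simp: closed_segment_eq_real_ivl split: if_splits)
    qed
   qed auto
   have "norm (L2_of (a r) - L2_of (a t) - (r - t) *\<^sub>R L2_of (b t)) \<le> norm (r - t) * (e / k) * sqrt (measure lebesgue K)"
    unfolding L2_of_diff[OF sq(1)[OF r(1)] sq(1)[OF s]] L2_of_scaleR[OF sq(2)[OF s]] L2_of_diff[OF sd ss]
    by (rule norm_L2_of_le[OF sq_int_diff[OF sd ss] K(1) _ pt]) (use K s r in auto)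
   also have "\<dots> \<le> norm (r - t) * (e / k) * k" using k by (intro mult_left_mono mult_nonneg_nonneg less_imp_le[OF e']) auto
   also have "\<dots> = e * norm (r - t)" using k by simp
   finally show "norm (L2_of (a r) - L2_of (a t) - (r - t) *\<^sub>R L2_of (b t)) \<le> e * norm (r - t)" .
  qed
 qed
qed

text \<open>
 The translates of \<open>f\<close> along \<open>b\<close> form a differentiable curve in \<open>L\<^sup>2\<close>, whose inner product with
 the indicator function of a large ball is constant by translation invariance.
\<close>

lemma integral_directional_derivative_zero:
 fixes f :: "'a::euclidean_space \<Rightarrow> real"
 assumes der: "\<And>x. (f has_derivative f' x) (at x)" and cont: "continuous_on UNIV (\<lambda>x. f' x b)"
  and K: "compact K" "\<And>x. x \<notin> K \<Longrightarrow> f x = 0"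
 shows "(LINT x|lebesgue. f' x b) = 0"
proof -
 have contf: "continuous_on UNIV f"
  using der by (intro continuous_at_imp_continuous_on ballI has_derivative_continuous)
 obtain R where R: "\<And>x. x \<in> K \<Longrightarrow> norm x \<le> R" using compact_imp_bounded[OF K(1)] unfolding bounded_pos by blast
 define Q where "Q = cball (0::'a) (R + norm b)"
 have f'0: "f' x b = 0" if "x \<notin> K" for x
 proof -
  have "((\<lambda>x. 0) has_derivative f' x) (at x)"
   by (rule has_derivative_transform_within_open[OF der, of "- K"]) (use K that compact_imp_closed in auto)
  from fun_cong[OF has_derivative_unique[OF this has_derivative_const], of b] show ?thesis by simp
 qed
 have out: "x + t *\<^sub>R b \<notin> K" if t: "t \<in> {0..1}" and x: "x \<notin> Q" for x t
 proof
  assume "x + t *\<^sub>R b \<in> K"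
  moreover have "norm (t *\<^sub>R b) \<le> 1 * norm b" unfolding norm_scaleR using t by (intro mult_right_mono) auto
  ultimately show False using R[of "x + t *\<^sub>R b"] x norm_triangle_ineq4[of "x + t *\<^sub>R b" "t *\<^sub>R b"] by (simp add: Q_def)
 qed
 have cb: "continuous_on ({0..1} \<times> UNIV) (\<lambda>(t, x). g (x + t *\<^sub>R b))" if "continuous_on UNIV g" for g :: "'a \<Rightarrow> real"
  unfolding split_def by (rule continuous_on_compose2[OF that]) (auto intro!: continuous_intros)
 have pd: "((\<lambda>t. f (x + t *\<^sub>R b)) has_vector_derivative f' (x + t *\<^sub>R b) b) (at t within {0..1})" for t x
 proof -
  have "((\<lambda>t. x + t *\<^sub>R b) has_derivative (\<lambda>r. r *\<^sub>R b)) (at t within {0..1})" by (auto intro!: derivative_eq_intros)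
  from has_derivative_compose[OF this der] show ?thesis
   unfolding has_vector_derivative_def linear_scale[OF has_derivative_linear[OF der]] .
 qed
 have d: "((\<lambda>t. L2_of (\<lambda>x. f (x + t *\<^sub>R b))) has_vector_derivative L2_of (\<lambda>x. f' (x + t *\<^sub>R b) b)) (at t within {0..1})"
  if t: "t \<in> {0..1}" for t
  by (rule L2_curve_derivative[where K=Q and a="\<lambda>t x. f (x + t *\<^sub>R b)" and b="\<lambda>t x. f' (x + t *\<^sub>R b) b", OF cb[OF contf] cb[OF cont] _ _ _ pd t])
    (use out K f'0 in \<open>auto simp: Q_def\<close>)
 let ?o = "L2_of (indicator Q :: 'a \<Rightarrow> real)"
 have io: "L2_of g \<bullet> ?o = (LINT x|lebesgue. g x)" if "continuous_on UNIV g" "\<And>x. x \<notin> Q \<Longrightarrow> g x = 0" for g :: "'a \<Rightarrow> real"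
 proof -
  have "sq_int (indicator Q :: 'a \<Rightarrow> real)" unfolding Q_def by (rule sq_int_indicator[OF lmeasurable_cball])
  moreover have "sq_int g"
   by (rule continuous_compact_support_sq_int[where K=Q, OF that(1)]) (use that(2) in \<open>auto simp: Q_def\<close>)
  moreover have "(\<lambda>x. g x \<bullet> indicator Q x) = g" using that(2) by (auto simp: indicator_def fun_eq_iff)
  ultimately show ?thesis by (simp add: L2_of_inner)
 qed
 have "L2_of (\<lambda>x. f (x + t *\<^sub>R b)) \<bullet> ?o = (LINT x|lborel. f x)" if t: "t \<in> {0..1}" for t
 proof -
  have c: "continuous_on UNIV (\<lambda>x. f (x + t *\<^sub>R b))"
   by (rule continuous_on_compose2[OF contf]) (auto intro!: continuous_intros)
  have "L2_of (\<lambda>x. f (x + t *\<^sub>R b)) \<bullet> ?o = (LINT x|lebesgue. f (x + t *\<^sub>R b))"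
   by (rule io[OF c]) (use out[OF t] K in auto)
  also have "\<dots> = (LINT x|lborel. f (t *\<^sub>R b + x))"
   using borel_measurable_continuous_onI[OF c] by (subst integral_completion) (simp_all add: add.commute)
  also have "\<dots> = (LINT x|lborel. f x)"
   using integral_distr[of "(+) (t *\<^sub>R b)" lborel borel f] borel_measurable_continuous_onI[OF contf]
   by (simp add: lborel_distr_plus)
  finally show ?thesis .
 qed
 then have "((\<lambda>t. LINT x|lborel. f x) has_vector_derivative L2_of (\<lambda>x. f' (x + 0 *\<^sub>R b) b) \<bullet> ?o) (at 0 within {0..1})"
  by (intro has_vector_derivative_transform[OF _ _ bounded_linear.has_vector_derivative[OF bounded_linear_inner_left d]]) auto
 from vector_derivative_unique_within_closed_interval[OF _ _ this[folded box_real] has_vector_derivative_const]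
 have "L2_of (\<lambda>x. f' x b) \<bullet> ?o = 0" by simp
 moreover have "f' x b = 0" if "x \<notin> Q" for x using out[of 0 x] f'0 that by simp
 ultimately show ?thesis using io[OF cont] by simp
qed

lemma derivative_zero_outside_support:
 assumes "smooth f" "x \<notin> closure {x. f x \<noteq> 0}"
 shows "frechet_derivative f (at x) u = 0"
proof -
 have "((\<lambda>x. 0) has_derivative frechet_derivative f (at x)) (at x)"
 proof (rule has_derivative_transform_within_open[OF smooth_has_derivative[OF assms(1)]])
  show "open (- closure {x. f x \<noteq> 0})" by auto
  show "f y = 0" if "y \<in> - closure {x. f x \<noteq> 0}" for y
   using that closure_subset[of "{x. f x \<noteq> 0}"] by blast
 qed (use assms in auto)
 then have "frechet_derivative f (at x) = (\<lambda>u. 0)"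
  using has_derivative_unique has_derivative_const by blast
 then show ?thesis by simp
qed

lemma jacobian_nth: "jacobian f (at x) $ i $ j = frechet_derivative f (at x) (axis j 1) $ i"
 by (simp add: jacobian_def matrix_def)

lemma smooth_vec_nth: "smooth f \<Longrightarrow> smooth (\<lambda>x. f x $ i)"
 unfolding smooth_def by (auto intro: Ck_linear bounded_linear_vec_nth)

lemma continuous_on_jacobian: "smooth f \<Longrightarrow> continuous_on UNIV (\<lambda>x. jacobian f (at x))"
 for f :: "real^'n \<Rightarrow> real^'n"
proof -
 assume "smooth f"
 then have "continuous_on UNIV (\<lambda>x. \<chi> i j. frechet_derivative f (at x) (axis j 1) $ i)"
  by (intro continuous_on_vec_lambda bounded_linear.continuous_on[OF bounded_linear_vec_nth] smooth_continuous_derivative)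
 then show ?thesis by (simp add: jacobian_def matrix_def)
qed

text \<open>Integration by parts: directional derivatives of \<open>\<psi>\<^sub>i \<eta>\<close> have integral zero.\<close>

lemma is_weak_gradient_jacobian_test:
 fixes \<psi> :: "real^'n \<Rightarrow> real^'n" and \<eta> :: "real^'n \<Rightarrow> real"
 assumes \<Omega>: "\<Omega> \<in> sets lebesgue" and \<psi>: "smooth \<psi>" and \<eta>: "test_function \<Omega> \<eta>"
 shows "(LINT x|lebesgue_on \<Omega>. \<psi> x $ i * frechet_derivative \<eta> (at x) (axis j 1)) =
  - (LINT x|lebesgue_on \<Omega>. jacobian \<psi> (at x) $ i $ j * \<eta> x)"
proof -
 define K where "K = closure {x. \<eta> x \<noteq> 0}"
 have K: "compact K" "K \<subseteq> \<Omega>" and s: "smooth \<eta>" using \<eta> by (auto simp: test_function_def K_def)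
 have out: "\<eta> x = 0" if "x \<notin> K" for x using that closure_subset[of "{x. \<eta> x \<noteq> 0}"] unfolding K_def by blast
 have dout: "frechet_derivative \<eta> (at x) u = 0" if "x \<notin> K" for x u
  using derivative_zero_outside_support[OF s] that unfolding K_def by blast
 have s\<psi>: "smooth (\<lambda>x. \<psi> x $ i)" by (rule smooth_vec_nth[OF \<psi>])
 let ?a = "\<lambda>x. \<psi> x $ i * frechet_derivative \<eta> (at x) (axis j 1)"
 let ?b = "\<lambda>x. jacobian \<psi> (at x) $ i $ j * \<eta> x"
 have der: "((\<lambda>x. \<psi> x $ i * \<eta> x) has_derivative
   (\<lambda>h. \<psi> x $ i * frechet_derivative \<eta> (at x) h + frechet_derivative \<psi> (at x) h $ i * \<eta> x)) (at x)" for x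
  by (intro has_derivative_mult smooth_has_derivative s
    bounded_linear.has_derivative[OF bounded_linear_vec_nth smooth_has_derivative[OF \<psi>]])
 have ca: "continuous_on UNIV ?a" and cb: "continuous_on UNIV ?b"
  by (intro continuous_intros smooth_continuous_derivative smooth_continuous s\<psi> s continuous_on_jacobian \<psi>)+
 have "(LINT x|lebesgue. \<psi> x $ i * frechet_derivative \<eta> (at x) (axis j 1) + frechet_derivative \<psi> (at x) (axis j 1) $ i * \<eta> x) = 0"
 proof (rule integral_directional_derivative_zero[OF der _ K(1)])
  show "continuous_on UNIV (\<lambda>x. \<psi> x $ i * frechet_derivative \<eta> (at x) (axis j 1) + frechet_derivative \<psi> (at x) (axis j 1) $ i * \<eta> x)"
   using continuous_on_add[OF ca cb] unfolding jacobian_nth .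
  show "\<psi> x $ i * \<eta> x = 0" if "x \<notin> K" for x using out[OF that] by simp
 qed
 then have "(LINT x|lebesgue. ?a x + ?b x) = 0" unfolding jacobian_nth .
 moreover have int: "integrable lebesgue ?a" "integrable lebesgue ?b"
 proof -
  have *: "integrable lebesgue g" if "continuous_on UNIV g" "\<And>x. x \<notin> K \<Longrightarrow> g x = 0" for g :: "real^'n \<Rightarrow> real"
  proof -
   have "integrable lborel (\<lambda>x. indicator K x *\<^sub>R g x)"
    by (intro borel_integrable_compact K continuous_on_subset[OF that(1)]) auto
   moreover have "(\<lambda>x. indicator K x *\<^sub>R g x) = g" using that(2) by (auto simp: fun_eq_iff indicator_def)
   ultimately have "integrable lborel g" by (simp only:)
   then show ?thesis by (rule integrable_completion[THEN iffD2, rotated])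
    (use borel_measurable_continuous_onI[OF that(1)] in simp)
  qed
  show "integrable lebesgue ?a" by (rule *[OF ca]) (simp add: dout)
  show "integrable lebesgue ?b" by (rule *[OF cb]) (simp add: out)
 qed
 ultimately have sum0: "(LINT x|lebesgue. ?a x) + (LINT x|lebesgue. ?b x) = 0"
  by (simp only: Bochner_Integration.integral_add)
 have ze: "zext \<Omega> g = g" if "\<And>x. x \<notin> K \<Longrightarrow> g x = 0" for g :: "real^'n \<Rightarrow> real"
  using K(2) that by (auto simp: zext_def indicator_def fun_eq_iff)
 have "zext \<Omega> ?a = ?a" by (rule ze) (simp add: dout)
 moreover have "zext \<Omega> ?b = ?b" by (rule ze) (simp add: out)
 ultimately show ?thesis using sum0 unfolding integral_zext[OF \<Omega>, symmetric] by simp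
qed

lemma frechet_derivative_add:
 "smooth f \<Longrightarrow> smooth g \<Longrightarrow>
  frechet_derivative (\<lambda>x. f x + g x) (at x) = (\<lambda>u. frechet_derivative f (at x) u + frechet_derivative g (at x) u)"
 by (rule frechet_derivative_at[symmetric]) (intro has_derivative_add smooth_has_derivative)

lemma frechet_derivative_scaleR:
 "smooth f \<Longrightarrow> frechet_derivative (\<lambda>x. c *\<^sub>R f x) (at x) = (\<lambda>u. c *\<^sub>R frechet_derivative f (at x) u)"
 by (rule frechet_derivative_at[symmetric]) (intro has_derivative_scaleR_right smooth_has_derivative)

lemma jacobian_add: "smooth f \<Longrightarrow> smooth g \<Longrightarrow> jacobian (\<lambda>x. f x + g x) (at x) = jacobian f (at x) + jacobian g (at x)"
 for f g :: "real^'n \<Rightarrow> real^'n"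
 by (simp add: vec_eq_iff jacobian_nth frechet_derivative_add)

lemma jacobian_scaleR: "smooth f \<Longrightarrow> jacobian (\<lambda>x. c *\<^sub>R f x) (at x) = c *\<^sub>R jacobian f (at x)"
 for f :: "real^'n \<Rightarrow> real^'n"
 by (simp add: vec_eq_iff jacobian_nth frechet_derivative_scaleR)

lemma divergence_sum: "divergence f x = (\<Sum>i\<in>UNIV. jacobian f (at x) $ i $ i)"
 by (simp add: divergence_def trace_def)

lemma test_function_add:
 assumes "test_function S f" "test_function S g" shows "test_function S (\<lambda>x. f x + g x)"
proof -
 have "{x. f x + g x \<noteq> 0} \<subseteq> {x. f x \<noteq> 0} \<union> {x. g x \<noteq> 0}" by auto
 then have sub: "closure {x. f x + g x \<noteq> 0} \<subseteq> closure {x. f x \<noteq> 0} \<union> closure {x. g x \<noteq> 0}"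
  by (metis closure_Un closure_mono)
 moreover have "compact (closure {x. f x \<noteq> 0} \<union> closure {x. g x \<noteq> 0})"
  using assms by (auto simp: test_function_def)
 ultimately have "compact (closure {x. f x + g x \<noteq> 0})"
  by (meson bounded_subset closed_closure compact_eq_bounded_closed)
 then show ?thesis using assms sub by (auto simp: test_function_def smooth_add)
qed

lemma test_function_scaleR:
 assumes "test_function S f" shows "test_function S (\<lambda>x. c *\<^sub>R f x)"
proof -
 have "{x. c *\<^sub>R f x \<noteq> 0} \<subseteq> {x. f x \<noteq> 0}" by auto
 then have sub: "closure {x. c *\<^sub>R f x \<noteq> 0} \<subseteq> closure {x. f x \<noteq> 0}" by (rule closure_mono)
 then have "compact (closure {x. c *\<^sub>R f x \<noteq> 0})"
  using assms unfolding test_function_def by (meson bounded_subset closed_closure compact_eq_bounded_closed)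
 then show ?thesis using assms sub by (auto simp: test_function_def smooth_scaleR)
qed

lemma solenoidal_test_add:
 fixes f g :: "real^'n \<Rightarrow> real^'n"
 shows "f \<in> solenoidal_test \<Omega> \<Longrightarrow> g \<in> solenoidal_test \<Omega> \<Longrightarrow> (\<lambda>x. f x + g x) \<in> solenoidal_test \<Omega>"
 unfolding solenoidal_test_def
 by (auto intro!: test_function_add) (auto simp: divergence_sum jacobian_add sum.distrib test_function_def)

lemma solenoidal_test_scaleR:
 fixes f :: "real^'n \<Rightarrow> real^'n"
 shows "f \<in> solenoidal_test \<Omega> \<Longrightarrow> (\<lambda>x. c *\<^sub>R f x) \<in> solenoidal_test \<Omega>"
 unfolding solenoidal_test_def
 by (auto intro!: test_function_scaleR) (auto simp: divergence_sum jacobian_scaleR sum_distrib_left[symmetric] test_function_def)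

lemma smooth_zero: "smooth (\<lambda>x. 0)" by (simp add: smooth_def Ck_const)

lemma jacobian_zero: "jacobian (\<lambda>x::real^'n. 0 :: real^'n) (at x) = 0"
 using jacobian_scaleR[OF smooth_zero, of 0 x] by simp

lemma zero_solenoidal_test: "(\<lambda>x::real^'n. 0) \<in> solenoidal_test \<Omega>"
 by (auto simp: solenoidal_test_def test_function_def smooth_zero divergence_sum jacobian_zero)

lemma borel_measurable_lebesgue_AE:
 fixes f g :: "'a::euclidean_space \<Rightarrow> 'b::euclidean_space"
 assumes f: "f \<in> borel_measurable lebesgue" and ae: "AE x in lebesgue. g x = f x"
 shows "g \<in> borel_measurable lebesgue"
proof (rule measurableI)
 fix A :: "'b set" assume A: "A \<in> sets borel"
 have null: "{x. P x} \<in> sets lebesgue" if "AE x in lebesgue. \<not> P x" for P :: "'a \<Rightarrow> bool"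
  using sets_completion_AE[where M=lborel and P=P] that by (simp add: AE_completion_iff pred_def)
 have 1: "{x. g x \<noteq> f x \<and> g x \<in> A} \<in> sets lebesgue"
  by (rule null) (use ae in \<open>auto elim!: eventually_mono\<close>)
 have 2: "{x. g x \<noteq> f x} \<in> sets lebesgue"
  by (rule null) (use ae in \<open>auto elim!: eventually_mono\<close>)
 have 3: "f -` A \<inter> space lebesgue \<in> sets lebesgue" by (rule measurable_sets[OF f A])
 have "g -` A \<inter> space lebesgue = (f -` A \<inter> space lebesgue - {x. g x \<noteq> f x}) \<union> {x. g x \<noteq> f x \<and> g x \<in> A}"
  by auto
 then show "g -` A \<inter> space lebesgue \<in> sets lebesgue" using 1 2 3 by auto
qed simp

text \<open>
 The energy space is realised inside \<open>L\<^sup>2\<close> as the set of pairs \<open>(u, \<surd>\<kappa> \<nabla>u)\<close> extended by zero;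
 the factor \<open>\<surd>\<kappa>\<close> makes the inner product equal to \<open>(u,w) + \<kappa> (\<nabla>u,\<nabla>w)\<close>, so that the time
 derivative of the Voigt equation is the plain derivative in this Hilbert space.
\<close>

type_synonym 'n pair_L2 = "(real^'n, (real^'n) \<times> (real^'n^'n)) L2"

locale voigt_domain =
 fixes \<Omega> :: "(real^'n) set" and \<kappa> :: real
 assumes open_Omega: "open \<Omega>" and bounded_Omega: "bounded \<Omega>" and kappa_pos: "0 < \<kappa>"
begin

abbreviation (input) rk :: real where "rk \<equiv> sqrt \<kappa>"

lemma rk: "rk > 0" "rk * rk = \<kappa>" "rk\<^sup>2 = \<kappa>" using kappa_pos by auto

lemma Omega_sets: "\<Omega> \<in> sets lebesgue" using open_Omega by simp

lemma Omega_lmeasurable: "\<Omega> \<in> lmeasurable"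
 using bounded_set_imp_lmeasurable[OF bounded_Omega Omega_sets] .

definition pair_of :: "(real^'n \<Rightarrow> real^'n) \<Rightarrow> (real^'n \<Rightarrow> real^'n^'n) \<Rightarrow> 'n pair_L2" where
 "pair_of u A = L2_of (\<lambda>x. (zext \<Omega> u x, zext \<Omega> A x))"

lemma sq_int_pair:
 assumes "sq_int f" "sq_int g" shows "sq_int (\<lambda>x. (f x, g x))"
 by (rule sq_int_bound[where g="\<lambda>x. (norm (f x))\<^sup>2 + (norm (g x))\<^sup>2"])
   (use assms in \<open>auto simp: sq_int_def norm_Pair intro!: borel_measurable_Pair\<close>)

lemma sq_int_pair_of: "u \<in> Lp_space 2 \<Omega> \<Longrightarrow> A \<in> Lp_space 2 \<Omega> \<Longrightarrow> sq_int (\<lambda>x. (zext \<Omega> u x, zext \<Omega> A x))"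
 by (intro sq_int_pair) (simp_all add: sq_int_zext_iff Omega_sets)

lemma inner_pair_of:
 assumes "u \<in> Lp_space 2 \<Omega>" "A \<in> Lp_space 2 \<Omega>" "w \<in> Lp_space 2 \<Omega>" "B \<in> Lp_space 2 \<Omega>"
 shows "pair_of u A \<bullet> pair_of w B = (LINT x|lebesgue_on \<Omega>. u x \<bullet> w x) + (LINT x|lebesgue_on \<Omega>. A x \<bullet> B x)"
proof -
 have sq: "sq_int (zext \<Omega> u)" "sq_int (zext \<Omega> A)" "sq_int (zext \<Omega> w)" "sq_int (zext \<Omega> B)"
  using assms by (simp_all add: sq_int_zext_iff Omega_sets)
 have "pair_of u A \<bullet> pair_of w B = (LINT x|lebesgue. zext \<Omega> u x \<bullet> zext \<Omega> w x + zext \<Omega> A x \<bullet> zext \<Omega> B x)"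
  unfolding pair_of_def using assms by (simp add: L2_of_inner sq_int_pair_of inner_Pair)
 also have "\<dots> = (LINT x|lebesgue. zext \<Omega> u x \<bullet> zext \<Omega> w x) + (LINT x|lebesgue. zext \<Omega> A x \<bullet> zext \<Omega> B x)"
  by (intro Bochner_Integration.integral_add integrable_inner_sq_int sq)
 also have "(\<lambda>x. zext \<Omega> u x \<bullet> zext \<Omega> w x) = zext \<Omega> (\<lambda>x. u x \<bullet> w x)"
  by (auto simp: zext_def indicator_def fun_eq_iff)
 also have "(\<lambda>x. zext \<Omega> A x \<bullet> zext \<Omega> B x) = zext \<Omega> (\<lambda>x. A x \<bullet> B x)"
  by (auto simp: zext_def indicator_def fun_eq_iff)
 finally show ?thesis by (simp only: integral_zext[OF Omega_sets])
qed

lemma norm_pair_of_sq: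
 assumes "u \<in> Lp_space 2 \<Omega>" "A \<in> Lp_space 2 \<Omega>"
 shows "(norm (pair_of u A))\<^sup>2 = (Lp_norm 2 \<Omega> u)\<^sup>2 + (Lp_norm 2 \<Omega> A)\<^sup>2"
proof -
 have L: "(Lp_norm 2 \<Omega> f)\<^sup>2 = (LINT x|lebesgue_on \<Omega>. (norm (f x))\<^sup>2)" for f :: "real^'n \<Rightarrow> 'b::euclidean_space"
 proof -
  have "0 \<le> (LINT x|lebesgue_on \<Omega>. (norm (f x))\<^sup>2)" by simp
  then show ?thesis by (simp add: Lp_norm_def powr_half_sqrt powr_2_eq)
 qed
 show ?thesis
  unfolding power2_norm_eq_inner inner_pair_of[OF assms assms] L by (simp add: power2_norm_eq_inner)
qed

lemma Lp_space_add: "f \<in> Lp_space 2 \<Omega> \<Longrightarrow> g \<in> Lp_space 2 \<Omega> \<Longrightarrow> (\<lambda>x. f x + g x) \<in> Lp_space 2 \<Omega>"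
 for f g :: "real^'n \<Rightarrow> 'b::euclidean_space"
 using sq_int_add[of "zext \<Omega> f" "zext \<Omega> g"]
 by (simp add: sq_int_zext_iff[OF Omega_sets, symmetric]) (simp add: zext_def scaleR_add_right)

lemma Lp_space_scaleR: "f \<in> Lp_space 2 \<Omega> \<Longrightarrow> (\<lambda>x. c *\<^sub>R f x) \<in> Lp_space 2 \<Omega>"
 for f :: "real^'n \<Rightarrow> 'b::euclidean_space"
 using sq_int_scaleR[of "zext \<Omega> f" c]
 by (simp add: sq_int_zext_iff[OF Omega_sets, symmetric]) (simp add: zext_def mult.commute)

lemma Lp_space_zero: "(\<lambda>x. 0) \<in> Lp_space 2 \<Omega>"
 using sq_int_zext_iff[OF Omega_sets, of "\<lambda>x. 0"] by (simp add: zext_def)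

lemma pair_of_add:
 assumes "u \<in> Lp_space 2 \<Omega>" "A \<in> Lp_space 2 \<Omega>" "w \<in> Lp_space 2 \<Omega>" "B \<in> Lp_space 2 \<Omega>"
 shows "pair_of (\<lambda>x. u x + w x) (\<lambda>x. A x + B x) = pair_of u A + pair_of w B"
 unfolding pair_of_def using assms
 by (simp add: L2_of_add sq_int_pair_of) (simp add: zext_def scaleR_add_right)

lemma pair_of_scaleR:
 assumes "u \<in> Lp_space 2 \<Omega>" "A \<in> Lp_space 2 \<Omega>"
 shows "pair_of (\<lambda>x. c *\<^sub>R u x) (\<lambda>x. c *\<^sub>R A x) = c *\<^sub>R pair_of u A"
 unfolding pair_of_def using assms
 by (simp add: L2_of_scaleR sq_int_pair_of) (simp add: zext_def mult.commute)

lemma pair_of_cong: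
 assumes "u \<in> Lp_space 2 \<Omega>" "A \<in> Lp_space 2 \<Omega>" "w \<in> Lp_space 2 \<Omega>" "B \<in> Lp_space 2 \<Omega>"
  and "AE x in lebesgue_on \<Omega>. u x = w x" "AE x in lebesgue_on \<Omega>. A x = B x"
 shows "pair_of u A = pair_of w B"
proof -
 have "AE x in lebesgue. zext \<Omega> u x = zext \<Omega> w x" "AE x in lebesgue. zext \<Omega> A x = zext \<Omega> B x"
  using assms by (simp_all add: AE_zext_iff Omega_sets)
 then have "AE x in lebesgue. (zext \<Omega> u x, zext \<Omega> A x) = (zext \<Omega> w x, zext \<Omega> B x)"
  by eventually_elim simp
 then show ?thesis unfolding pair_of_def by (intro L2_of_eqI sq_int_pair_of assms)
qed

section \<open>Functions with square-integrable weak gradient\<close>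

lemma is_weak_gradientI:
 assumes u: "u \<in> Lp_space 2 \<Omega>" and G: "G \<in> Lp_space 2 \<Omega>"
  and eq: "\<And>\<eta> i j. test_function \<Omega> \<eta> \<Longrightarrow> (LINT x|lebesgue_on \<Omega>. u x $ i * frechet_derivative \<eta> (at x) (axis j 1)) =
        - (LINT x|lebesgue_on \<Omega>. G x $ i $ j * \<eta> x)"
 shows "is_weak_gradient \<Omega> u G"
 unfolding is_weak_gradient_def
 using u G eq by (auto intro!: sq_int_absolutely_integrable_on[of \<Omega>] simp: sq_int_zext_iff Omega_sets)

lemma test_function_Lp:
 fixes \<eta> :: "real^'n \<Rightarrow> 'b::euclidean_space"
 assumes "test_function \<Omega> \<eta>"
 shows "\<eta> \<in> Lp_space 2 \<Omega>" "(\<lambda>x. frechet_derivative \<eta> (at x) u) \<in> Lp_space 2 \<Omega>"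
proof -
 define K where "K = closure {x. \<eta> x \<noteq> 0}"
 have K: "compact K" "K \<subseteq> \<Omega>" and s: "smooth \<eta>" using assms by (auto simp: test_function_def K_def)
 have L: "f \<in> Lp_space 2 \<Omega>" if "continuous_on UNIV f" "\<And>x. x \<notin> K \<Longrightarrow> f x = 0" for f :: "real^'n \<Rightarrow> 'b"
 proof -
  have "zext \<Omega> f = f" using that(2) K(2) by (auto simp: zext_def indicator_def fun_eq_iff)
  then show ?thesis
   using continuous_compact_support_sq_int[OF that(1) K(1) that(2)] sq_int_zext_iff[OF Omega_sets, of f] by simp
 qed
 show "\<eta> \<in> Lp_space 2 \<Omega>"
  by (rule L[OF smooth_continuous[OF s]]) (use closure_subset[of "{x. \<eta> x \<noteq> 0}"] in \<open>unfold K_def, blast\<close>)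
 show "(\<lambda>x. frechet_derivative \<eta> (at x) u) \<in> Lp_space 2 \<Omega>"
  by (rule L[OF smooth_continuous_derivative[OF s]])
    (use derivative_zero_outside_support[OF s] in \<open>auto simp: K_def\<close>)
qed

lemma Lp_space_linear:
 fixes f :: "real^'n \<Rightarrow> 'b::euclidean_space" and L :: "'b \<Rightarrow> 'c::euclidean_space"
 assumes f: "f \<in> Lp_space 2 \<Omega>" and L: "bounded_linear L" shows "(\<lambda>x. L (f x)) \<in> Lp_space 2 \<Omega>"
proof -
 interpret bounded_linear L by fact
 obtain K where K: "\<And>x. norm (L x) \<le> norm x * K" using bounded by blast
 have f': "sq_int (zext \<Omega> f)" using f by (simp add: sq_int_zext_iff Omega_sets)
 have eq: "zext \<Omega> (\<lambda>x. L (f x)) = (\<lambda>x. L (zext \<Omega> f x))" by (auto simp: zext_def scaleR)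
 have "sq_int (\<lambda>x. L (zext \<Omega> f x))"
 proof (rule sq_int_bound)
  show "(\<lambda>x. L (zext \<Omega> f x)) \<in> borel_measurable lebesgue"
   using f' borel_measurable_continuous_onI[OF linear_continuous_on[OF L]]
   by (auto simp: sq_int_def intro: measurable_compose)
  show "integrable lebesgue (\<lambda>x. K\<^sup>2 * (norm (zext \<Omega> f x))\<^sup>2)"
   by (intro integrable_mult_right sq_intD f')
  have "(norm (L y))\<^sup>2 \<le> K\<^sup>2 * (norm y)\<^sup>2" for y
   using power_mono[OF K[of y], of 2] by (simp add: power_mult_distrib mult.commute)
  then show "AE x in lebesgue. (norm (L (zext \<Omega> f x)))\<^sup>2 \<le> K\<^sup>2 * (norm (zext \<Omega> f x))\<^sup>2" by simp
 qed
 then show ?thesis unfolding eq[symmetric] sq_int_zext_iff[OF Omega_sets] .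
qed

definition emb :: "(real^'n \<Rightarrow> real^'n) \<Rightarrow> 'n pair_L2" where
 "emb u = pair_of u (\<lambda>x. rk *\<^sub>R weak_gradient \<Omega> u x)"

lemma weak_gradient_eq:
 assumes "is_weak_gradient \<Omega> u G"
 shows "AE x in lebesgue_on \<Omega>. weak_gradient \<Omega> u x = G x" "is_weak_gradient \<Omega> u (weak_gradient \<Omega> u)"
proof -
 show "is_weak_gradient \<Omega> u (weak_gradient \<Omega> u)"
  unfolding weak_gradient_def by (rule someI[of _ G]) fact
 then show "AE x in lebesgue_on \<Omega>. weak_gradient \<Omega> u x = G x"
  by (rule is_weak_gradient_unique[OF open_Omega _ assms])
qed

lemma Lp_space_cong:
 fixes f g :: "real^'n \<Rightarrow> 'b::euclidean_space"
 assumes "f \<in> Lp_space 2 \<Omega>" "AE x in lebesgue_on \<Omega>. g x = f x"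
 shows "g \<in> Lp_space 2 \<Omega>"
proof -
 have ae: "AE x in lebesgue. zext \<Omega> g x = zext \<Omega> f x" using assms by (simp add: AE_zext_iff Omega_sets)
 have f: "sq_int (zext \<Omega> f)" using assms by (simp add: sq_int_zext_iff Omega_sets)
 have m: "zext \<Omega> g \<in> borel_measurable lebesgue"
  by (rule borel_measurable_lebesgue_AE[OF _ ae]) (use f in \<open>simp add: sq_int_def\<close>)
 have "sq_int (zext \<Omega> g)"
  by (rule sq_int_bound[OF m sq_intD[OF f]]) (use ae in eventually_elim, simp)
 then show ?thesis by (simp add: sq_int_zext_iff Omega_sets)
qed

lemma Lp_norm_scaleR:
 fixes f :: "real^'n \<Rightarrow> 'b::euclidean_space"
 assumes "f \<in> Lp_space 2 \<Omega>" "0 \<le> c" shows "Lp_norm 2 \<Omega> (\<lambda>x. c *\<^sub>R f x) = c * Lp_norm 2 \<Omega> f"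
proof -
 have eq: "zext \<Omega> (\<lambda>x. c *\<^sub>R f x) = (\<lambda>x. c *\<^sub>R zext \<Omega> f x)" by (auto simp: zext_def)
 have "L2_of (zext \<Omega> (\<lambda>x. c *\<^sub>R f x)) = c *\<^sub>R L2_of (zext \<Omega> f)"
  unfolding eq using assms by (simp add: L2_of_scaleR sq_int_zext_iff Omega_sets)
 then show ?thesis using assms by (simp add: Lp_norm_2 Omega_sets Lp_space_scaleR)
qed

lemma rep_pair_of:
 assumes "u \<in> Lp_space 2 \<Omega>" "A \<in> Lp_space 2 \<Omega>"
 shows "AE x in lebesgue. rep (pair_of u A) x = (zext \<Omega> u x, zext \<Omega> A x)"
 unfolding pair_of_def by (rule rep_L2_of[OF sq_int_pair_of[OF assms]])

definition vel :: "'n pair_L2 \<Rightarrow> real^'n \<Rightarrow> real^'n" where "vel h x = fst (rep h x)"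
definition grd :: "'n pair_L2 \<Rightarrow> real^'n \<Rightarrow> real^'n^'n" where "grd h x = (1 / rk) *\<^sub>R snd (rep h x)"

definition supported :: "'n pair_L2 \<Rightarrow> bool" where
 "supported h \<longleftrightarrow> (AE x in lebesgue. x \<notin> \<Omega> \<longrightarrow> rep h x = 0)"

lemma supported_pair_of:
 "u \<in> Lp_space 2 \<Omega> \<Longrightarrow> A \<in> Lp_space 2 \<Omega> \<Longrightarrow> supported (pair_of u A)"
 unfolding supported_def by (drule (1) rep_pair_of, erule eventually_mono) (auto simp: zero_prod_def)

lemma vel_Lp: "vel h \<in> Lp_space 2 \<Omega>" and snd_Lp: "(\<lambda>x. snd (rep h x)) \<in> Lp_space 2 \<Omega>"
proof -
 have m: "rep h \<in> borel_measurable lebesgue" by simp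
 have i: "integrable lebesgue (\<lambda>x. (norm (rep h x))\<^sup>2)" by (rule sq_intD) simp
 have Lp: "(\<lambda>x. L (rep h x)) \<in> Lp_space 2 \<Omega>" if L: "bounded_linear L" "\<And>y. norm (L y) \<le> norm y"
  for L :: "(real^'n) \<times> (real^'n^'n) \<Rightarrow> 'c::euclidean_space"
 proof -
  have mL: "(\<lambda>x. L (rep h x)) \<in> borel_measurable lebesgue"
   using borel_measurable_continuous_onI[OF linear_continuous_on[OF L(1)]] by (rule measurable_compose[OF m])
  have "sq_int (zext \<Omega> (\<lambda>x. L (rep h x)))"
  proof (rule sq_int_bound[OF _ i])
   show "zext \<Omega> (\<lambda>x. L (rep h x)) \<in> borel_measurable lebesgue"
    unfolding zext_def using mL Omega_sets by (intro borel_measurable_scaleR borel_measurable_indicator) auto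
   show "AE x in lebesgue. (norm (zext \<Omega> (\<lambda>x. L (rep h x)) x))\<^sup>2 \<le> (norm (rep h x))\<^sup>2"
    using L(2) by (auto simp: zext_def indicator_def power_mono)
  qed
  then show ?thesis by (simp add: sq_int_zext_iff Omega_sets)
 qed
 have nf: "norm (fst y) \<le> norm y" and ns: "norm (snd y) \<le> norm y" for y :: "(real^'n) \<times> (real^'n^'n)"
  by (cases y; simp add: norm_fst_le norm_snd_le)+
 show "vel h \<in> Lp_space 2 \<Omega>"
  using Lp[OF bounded_linear_fst nf] by (simp add: vel_def[abs_def])
 show "(\<lambda>x. snd (rep h x)) \<in> Lp_space 2 \<Omega>"
  by (rule Lp[OF bounded_linear_snd ns])
qed

lemma grd_Lp: "grd h \<in> Lp_space 2 \<Omega>"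
 using Lp_space_scaleR[OF snd_Lp, of "1 / rk"] by (simp add: grd_def[abs_def])

lemma pair_of_vel_grd:
 assumes "supported h" shows "pair_of (vel h) (\<lambda>x. rk *\<^sub>R grd h x) = h"
proof (rule L2_eqI)
 have eq: "rk *\<^sub>R grd h x = snd (rep h x)" for x using rk by (simp add: grd_def)
 have "AE x in lebesgue. x \<notin> \<Omega> \<longrightarrow> rep h x = 0" using assms by (simp add: supported_def)
 with rep_pair_of[OF vel_Lp[of h] snd_Lp[of h]]
 show "AE x in lebesgue. rep (pair_of (vel h) (\<lambda>x. rk *\<^sub>R grd h x)) x = rep h x"
  unfolding eq by eventually_elim (auto simp: zext_def indicator_def vel_def prod_eq_iff)
qed

lemma vel_pair_of:
 assumes "u \<in> Lp_space 2 \<Omega>" "A \<in> Lp_space 2 \<Omega>"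
 shows "AE x in lebesgue_on \<Omega>. vel (pair_of u A) x = u x" "AE x in lebesgue_on \<Omega>. rk *\<^sub>R grd (pair_of u A) x = A x"
proof -
 have ae: "AE x in lebesgue_on \<Omega>. rep (pair_of u A) x = (u x, A x)"
  using rep_pair_of[OF assms] Omega_sets
  by (subst AE_restrict_space_iff) (auto elim!: eventually_mono)
 then show "AE x in lebesgue_on \<Omega>. vel (pair_of u A) x = u x"
  by eventually_elim (simp add: vel_def)
 show "AE x in lebesgue_on \<Omega>. rk *\<^sub>R grd (pair_of u A) x = A x"
  using ae by eventually_elim (use rk in \<open>simp add: grd_def\<close>)
qed

text \<open>
 Orthogonality of \<open>(u, \<surd>\<kappa> G)\<close> to this pair is the identity \<open>\<integral> u\<^sub>i \<partial>\<^sub>j\<eta> + \<integral> G\<^sub>i\<^sub>j \<eta> = 0\<close> that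
 defines the weak gradient.
\<close>

definition grad_test :: "(real^'n \<Rightarrow> real) \<Rightarrow> 'n \<Rightarrow> 'n \<Rightarrow> 'n pair_L2" where
 "grad_test \<eta> i j = pair_of (\<lambda>x. frechet_derivative \<eta> (at x) (axis j 1) *\<^sub>R (rk *\<^sub>R axis i 1))
   (\<lambda>x. \<eta> x *\<^sub>R axis i (axis j 1))"

text \<open>
 Whether the second component is the weak gradient of the first is a family of orthogonality
 conditions, hence closed.
\<close>

definition grad_space :: "'n pair_L2 set" where
 "grad_space = {h. supported h \<and> (\<forall>\<eta> i j. test_function \<Omega> \<eta> \<longrightarrow> h \<bullet> grad_test \<eta> i j = 0)}"

lemma inner_grad_test:
 fixes \<eta> :: "real^'n \<Rightarrow> real"
 assumes u: "u \<in> Lp_space 2 \<Omega>" and G: "G \<in> Lp_space 2 \<Omega>" and \<eta>: "test_function \<Omega> \<eta>"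
 shows "pair_of u (\<lambda>x. rk *\<^sub>R G x) \<bullet> grad_test \<eta> i j =
  rk * ((LINT x|lebesgue_on \<Omega>. u x $ i * frechet_derivative \<eta> (at x) (axis j 1)) + (LINT x|lebesgue_on \<Omega>. G x $ i $ j * \<eta> x))"
proof -
 have L: "(\<lambda>x. frechet_derivative \<eta> (at x) (axis j 1) *\<^sub>R (rk *\<^sub>R axis i 1 :: real^'n)) \<in> Lp_space 2 \<Omega>"
  "(\<lambda>x. \<eta> x *\<^sub>R (axis i (axis j 1) :: real^'n^'n)) \<in> Lp_space 2 \<Omega>"
  by (rule Lp_space_linear[OF test_function_Lp(2)[OF \<eta>] bounded_linear_scaleR_left])
    (rule Lp_space_linear[OF test_function_Lp(1)[OF \<eta>] bounded_linear_scaleR_left])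
 have "pair_of u (\<lambda>x. rk *\<^sub>R G x) \<bullet> grad_test \<eta> i j =
   (LINT x|lebesgue_on \<Omega>. u x \<bullet> (frechet_derivative \<eta> (at x) (axis j 1) *\<^sub>R (rk *\<^sub>R axis i 1)))
   + (LINT x|lebesgue_on \<Omega>. (rk *\<^sub>R G x) \<bullet> (\<eta> x *\<^sub>R axis i (axis j 1)))"
  unfolding grad_test_def by (rule inner_pair_of[OF u Lp_space_scaleR[OF G] L])
 also have "(\<lambda>x. u x \<bullet> (frechet_derivative \<eta> (at x) (axis j 1) *\<^sub>R (rk *\<^sub>R axis i 1))) =
   (\<lambda>x. rk * (u x $ i * frechet_derivative \<eta> (at x) (axis j 1)))"
  by (auto simp: fun_eq_iff inner_axis)
 also have "(\<lambda>x. (rk *\<^sub>R G x) \<bullet> (\<eta> x *\<^sub>R axis i (axis j 1))) = (\<lambda>x. rk * (G x $ i $ j * \<eta> x))"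
  by (auto simp: fun_eq_iff inner_axis)
 finally show ?thesis by (simp add: distrib_left)
qed

lemma is_weak_gradient_vel: "h \<in> grad_space \<Longrightarrow> is_weak_gradient \<Omega> (vel h) (grd h)"
proof (rule is_weak_gradientI[OF vel_Lp grd_Lp])
 fix \<eta> :: "real^'n \<Rightarrow> real" and i j
 assume h: "h \<in> grad_space" and \<eta>: "test_function \<Omega> \<eta>"
 have "pair_of (vel h) (\<lambda>x. rk *\<^sub>R grd h x) \<bullet> grad_test \<eta> i j = 0"
  using h \<eta> by (simp add: grad_space_def pair_of_vel_grd)
 then show "(LINT x|lebesgue_on \<Omega>. vel h x $ i * frechet_derivative \<eta> (at x) (axis j 1)) =
       - (LINT x|lebesgue_on \<Omega>. grd h x $ i $ j * \<eta> x)"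
  using rk unfolding inner_grad_test[OF vel_Lp grd_Lp \<eta>] by simp
qed

lemma pair_of_in_grad_space:
 assumes "u \<in> Lp_space 2 \<Omega>" "G \<in> Lp_space 2 \<Omega>" "is_weak_gradient \<Omega> u G"
 shows "pair_of u (\<lambda>x. rk *\<^sub>R G x) \<in> grad_space"
 unfolding grad_space_def
 using assms by (auto simp: supported_pair_of Lp_space_scaleR inner_grad_test is_weak_gradient_def)

lemma grad_space_subspace: "subspace grad_space"
proof (rule subspaceI)
 have s0: "supported 0"
  unfolding supported_def using rep_L2_of[of "\<lambda>x::real^'n. 0 :: (real^'n) \<times> (real^'n^'n)"]
  by (simp add: L2_zero[symmetric]) (auto elim: eventually_mono)
 then show "0 \<in> grad_space" by (simp add: grad_space_def)
 show "x + y \<in> grad_space" if xy: "x \<in> grad_space" "y \<in> grad_space" for x y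
 proof -
  have "supported x" "supported y" using xy by (auto simp: grad_space_def)
  then have "supported (x + y)"
   using rep_add[of x y] unfolding supported_def by eventually_elim simp
  then show ?thesis using xy by (simp add: grad_space_def inner_add_left)
 qed
 show "c *\<^sub>R x \<in> grad_space" if x: "x \<in> grad_space" for c x
 proof -
  have "supported x" using x by (auto simp: grad_space_def)
  then have "supported (c *\<^sub>R x)"
   using rep_scaleR[where h=x and c=c] unfolding supported_def by eventually_elim simp
  then show ?thesis using x by (simp add: grad_space_def)
 qed
qed

lemma grad_space_closed: "closed grad_space"
 unfolding closed_sequential_limits
proof (intro allI impI, elim conjE)
 fix X h assume X: "\<forall>n. X n \<in> grad_space" and lim: "X \<longlonglongrightarrow> h"
 obtain r where r: "strict_mono r" "AE x in lebesgue. (\<lambda>k. rep (X (r k)) x) \<longlonglongrightarrow> rep h x"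
  using L2_tendsto_AE_subseq[OF lim] by blast
 have "AE x in lebesgue. \<forall>k. x \<notin> \<Omega> \<longrightarrow> rep (X (r k)) x = 0"
  unfolding AE_all_countable using X by (auto simp: grad_space_def supported_def)
 with r(2) have "AE x in lebesgue. x \<notin> \<Omega> \<longrightarrow> rep h x = 0"
  by eventually_elim (auto simp: LIMSEQ_const_iff)
 moreover have "h \<bullet> grad_test \<eta> i j = 0" if "test_function \<Omega> \<eta>" for \<eta> i j
 proof (rule LIMSEQ_unique)
  show "(\<lambda>n. X n \<bullet> grad_test \<eta> i j) \<longlonglongrightarrow> h \<bullet> grad_test \<eta> i j" by (intro tendsto_intros lim)
  show "(\<lambda>n. X n \<bullet> grad_test \<eta> i j) \<longlonglongrightarrow> 0" using X that by (simp add: grad_space_def)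
 qed
 ultimately show "h \<in> grad_space" by (simp add: grad_space_def supported_def)
qed

lemma W1pD:
 assumes "u \<in> W1p_space 2 \<Omega>"
 shows "u \<in> Lp_space 2 \<Omega>" "weak_gradient \<Omega> u \<in> Lp_space 2 \<Omega>" "is_weak_gradient \<Omega> u (weak_gradient \<Omega> u)"
proof -
 obtain G where G: "is_weak_gradient \<Omega> u G" "G \<in> Lp_space 2 \<Omega>" and u: "u \<in> Lp_space 2 \<Omega>"
  using assms by (auto simp: W1p_space_def)
 show "u \<in> Lp_space 2 \<Omega>" by fact
 show "weak_gradient \<Omega> u \<in> Lp_space 2 \<Omega>" by (rule Lp_space_cong[OF G(2) weak_gradient_eq(1)[OF G(1)]])
 show "is_weak_gradient \<Omega> u (weak_gradient \<Omega> u)" by (rule weak_gradient_eq(2)[OF G(1)])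
qed

lemma W1pI: "u \<in> Lp_space 2 \<Omega> \<Longrightarrow> G \<in> Lp_space 2 \<Omega> \<Longrightarrow> is_weak_gradient \<Omega> u G \<Longrightarrow> u \<in> W1p_space 2 \<Omega>"
 by (auto simp: W1p_space_def)

lemma emb_eq:
 assumes "u \<in> Lp_space 2 \<Omega>" "G \<in> Lp_space 2 \<Omega>" "is_weak_gradient \<Omega> u G"
 shows "emb u = pair_of u (\<lambda>x. rk *\<^sub>R G x)"
 unfolding emb_def
proof (rule pair_of_cong)
 show "AE x in lebesgue_on \<Omega>. rk *\<^sub>R weak_gradient \<Omega> u x = rk *\<^sub>R G x"
  using weak_gradient_eq(1)[OF assms(3)] by eventually_elim simp
qed (use assms W1pD[OF W1pI[OF assms]] in \<open>auto intro: Lp_space_scaleR\<close>)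

lemma emb_in_grad_space: "u \<in> W1p_space 2 \<Omega> \<Longrightarrow> emb u \<in> grad_space"
 unfolding emb_def by (intro pair_of_in_grad_space W1pD)

lemma vel_W1p: "h \<in> grad_space \<Longrightarrow> vel h \<in> W1p_space 2 \<Omega>"
 by (rule W1pI[OF vel_Lp grd_Lp is_weak_gradient_vel])

lemma emb_vel: "h \<in> grad_space \<Longrightarrow> emb (vel h) = h"
 using emb_eq[OF vel_Lp grd_Lp is_weak_gradient_vel, of h] pair_of_vel_grd[of h] by (simp add: grad_space_def)

lemma weak_gradient_vel: "h \<in> grad_space \<Longrightarrow> AE x in lebesgue_on \<Omega>. weak_gradient \<Omega> (vel h) x = grd h x"
 by (rule weak_gradient_eq[OF is_weak_gradient_vel])

lemma is_weak_gradient_lincomb: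
 assumes "u \<in> W1p_space 2 \<Omega>" "w \<in> W1p_space 2 \<Omega>"
 shows "is_weak_gradient \<Omega> (\<lambda>x. a *\<^sub>R u x + b *\<^sub>R w x)
   (\<lambda>x. a *\<^sub>R weak_gradient \<Omega> u x + b *\<^sub>R weak_gradient \<Omega> w x)"
proof -
 note u = W1pD[OF assms(1)] and w = W1pD[OF assms(2)]
 let ?h = "a *\<^sub>R emb u + b *\<^sub>R emb w"
 have h: "?h \<in> grad_space"
  by (intro subspace_add subspace_scale grad_space_subspace emb_in_grad_space assms)
 have eq: "?h = pair_of (\<lambda>x. a *\<^sub>R u x + b *\<^sub>R w x) (\<lambda>x. rk *\<^sub>R (a *\<^sub>R weak_gradient \<Omega> u x + b *\<^sub>R weak_gradient \<Omega> w x))"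
  unfolding emb_def using u w
  by (simp add: pair_of_add[symmetric] pair_of_scaleR[symmetric] Lp_space_scaleR scaleR_add_right scaleR_left_commute mult.commute)
 show ?thesis
 proof (rule is_weak_gradientI)
  fix \<eta> :: "real^'n \<Rightarrow> real" and i j assume \<eta>: "test_function \<Omega> \<eta>"
  have "?h \<bullet> grad_test \<eta> i j = 0" using h \<eta> by (simp add: grad_space_def)
  then show "(LINT x|lebesgue_on \<Omega>. (a *\<^sub>R u x + b *\<^sub>R w x) $ i * frechet_derivative \<eta> (at x) (axis j 1)) =
    - (LINT x|lebesgue_on \<Omega>. (a *\<^sub>R weak_gradient \<Omega> u x + b *\<^sub>R weak_gradient \<Omega> w x) $ i $ j * \<eta> x)"
   unfolding eq using rk u w \<eta>
   by (subst (asm) inner_grad_test) (auto intro!: Lp_space_add Lp_space_scaleR)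
 qed (use u w in \<open>auto intro!: Lp_space_add Lp_space_scaleR\<close>)
qed

lemma W1p_lincomb:
 assumes "u \<in> W1p_space 2 \<Omega>" "w \<in> W1p_space 2 \<Omega>"
 shows "(\<lambda>x. a *\<^sub>R u x + b *\<^sub>R w x) \<in> W1p_space 2 \<Omega>"
  and "emb (\<lambda>x. a *\<^sub>R u x + b *\<^sub>R w x) = a *\<^sub>R emb u + b *\<^sub>R emb w"
proof -
 note u = W1pD[OF assms(1)] and w = W1pD[OF assms(2)]
 have L: "(\<lambda>x. a *\<^sub>R u x + b *\<^sub>R w x) \<in> Lp_space 2 \<Omega>"
  "(\<lambda>x. a *\<^sub>R weak_gradient \<Omega> u x + b *\<^sub>R weak_gradient \<Omega> w x) \<in> Lp_space 2 \<Omega>"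
  using u w by (auto intro!: Lp_space_add Lp_space_scaleR)
 show "(\<lambda>x. a *\<^sub>R u x + b *\<^sub>R w x) \<in> W1p_space 2 \<Omega>"
  by (rule W1pI[OF L is_weak_gradient_lincomb[OF assms]])
 show "emb (\<lambda>x. a *\<^sub>R u x + b *\<^sub>R w x) = a *\<^sub>R emb u + b *\<^sub>R emb w"
  unfolding emb_eq[OF L is_weak_gradient_lincomb[OF assms]] unfolding emb_def using u w
  by (simp add: pair_of_add[symmetric] pair_of_scaleR[symmetric] Lp_space_scaleR scaleR_add_right scaleR_left_commute mult.commute)
qed

lemma W1p_diff:
 assumes "u \<in> W1p_space 2 \<Omega>" "w \<in> W1p_space 2 \<Omega>"
 shows "(\<lambda>x. u x - w x) \<in> W1p_space 2 \<Omega>" "emb (\<lambda>x. u x - w x) = emb u - emb w"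
 using W1p_lincomb[OF assms, of 1 "-1"] by simp_all

lemma W1p_scaleR:
 assumes "u \<in> W1p_space 2 \<Omega>"
 shows "(\<lambda>x. c *\<^sub>R u x) \<in> W1p_space 2 \<Omega>" "emb (\<lambda>x. c *\<^sub>R u x) = c *\<^sub>R emb u"
 using W1p_lincomb[OF assms assms, of c 0] by simp_all

lemma emb_norm_sq:
 assumes "u \<in> W1p_space 2 \<Omega>"
 shows "(norm (emb u))\<^sup>2 = (Lp_norm 2 \<Omega> u)\<^sup>2 + \<kappa> * (V_norm \<Omega> u)\<^sup>2"
 unfolding emb_def V_norm_def using W1pD[OF assms] rk
 by (subst norm_pair_of_sq) (auto simp: Lp_space_scaleR Lp_norm_scaleR power_mult_distrib)

lemma Lp_norm_nonneg: "0 \<le> Lp_norm q \<Omega> g" by (simp add: Lp_norm_def)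

lemma norm_bounds:
 assumes "u \<in> W1p_space 2 \<Omega>"
 shows "Lp_norm 2 \<Omega> u \<le> norm (emb u)" "V_norm \<Omega> u \<le> norm (emb u) / rk"
proof -
 have V0: "0 \<le> V_norm \<Omega> u" by (simp add: V_norm_def Lp_norm_nonneg)
 have "(Lp_norm 2 \<Omega> u)\<^sup>2 \<le> (norm (emb u))\<^sup>2"
  unfolding emb_norm_sq[OF assms] using kappa_pos by simp
 then show "Lp_norm 2 \<Omega> u \<le> norm (emb u)" by (rule power2_le_imp_le) simp
 have "(rk * V_norm \<Omega> u)\<^sup>2 \<le> (norm (emb u))\<^sup>2"
  unfolding emb_norm_sq[OF assms] power_mult_distrib using rk by simp
 then have "rk * V_norm \<Omega> u \<le> norm (emb u)" by (rule power2_le_imp_le) simp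
 then show "V_norm \<Omega> u \<le> norm (emb u) / rk" using rk by (simp add: field_simps)
qed

lemma emb_norm_le_W1p_norm:
 assumes "u \<in> W1p_space 2 \<Omega>" shows "norm (emb u) \<le> (1 + rk) * W1p_norm 2 \<Omega> u"
proof (rule power2_le_imp_le)
 let ?a = "Lp_norm 2 \<Omega> u" and ?b = "V_norm \<Omega> u"
 have b0: "0 \<le> ?b" by (simp add: V_norm_def Lp_norm_nonneg)
 have W: "(W1p_norm 2 \<Omega> u)\<^sup>2 = ?a\<^sup>2 + ?b\<^sup>2"
  unfolding W1p_norm_def V_norm_def by (simp add: powr_half_sqrt powr_2_eq Lp_norm_nonneg)
 have "(norm (emb u))\<^sup>2 = ?a\<^sup>2 + rk\<^sup>2 * ?b\<^sup>2" unfolding emb_norm_sq[OF assms] using rk by simp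
 also have "\<dots> \<le> (1 + rk)\<^sup>2 * ?a\<^sup>2 + (1 + rk)\<^sup>2 * ?b\<^sup>2"
 proof (intro add_mono mult_right_mono)
  have "1 * ?a\<^sup>2 \<le> (1 + rk)\<^sup>2 * ?a\<^sup>2" using rk by (intro mult_right_mono) (auto simp: one_le_power)
  then show "?a\<^sup>2 \<le> (1 + rk)\<^sup>2 * ?a\<^sup>2" by simp
  show "rk\<^sup>2 \<le> (1 + rk)\<^sup>2" using rk by (intro power_mono) auto
 qed simp
 also have "\<dots> = ((1 + rk) * W1p_norm 2 \<Omega> u)\<^sup>2" by (simp add: power_mult_distrib W distrib_left)
 finally show "(norm (emb u))\<^sup>2 \<le> ((1 + rk) * W1p_norm 2 \<Omega> u)\<^sup>2" .
qed (use rk in \<open>simp add: W1p_norm_def\<close>)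

definition W1p_const :: "real \<Rightarrow> real" where
 "W1p_const p = ((measure lebesgue \<Omega> + 1) * (1 + (1 / rk) powr p)) powr (1 / p)"

text \<open>
 For \<open>p \<le> 2\<close> the energy norm controls that of \<open>W\<^sup>1\<^sup>,\<^sup>p\<close>, because \<open>\<Omega>\<close> has finite measure.
\<close>

lemma W1p_norm_le_emb:
 assumes u: "u \<in> W1p_space 2 \<Omega>" and p: "0 < p" "p \<le> 2"
 shows "u \<in> W1p_space p \<Omega>" "W1p_norm p \<Omega> u \<le> W1p_const p * norm (emb u)"
proof -
 note U = W1pD[OF u]
 note L1 = Lp_space_nested[OF Omega_lmeasurable p U(1)] and L2 = Lp_space_nested[OF Omega_lmeasurable p U(2)]
 show "u \<in> W1p_space p \<Omega>" using L1(1) L2(1) U(3) by (auto simp: W1p_space_def)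
 have pw: "Lp_norm p \<Omega> g powr p = (LINT x|lebesgue_on \<Omega>. norm (g x) powr p)" for g :: "real^'n \<Rightarrow> 'b::euclidean_space"
  using p by (simp add: Lp_norm_def powr_powr)
 let ?N = "norm (emb u)" and ?m = "measure lebesgue \<Omega> + 1"
 have m0: "?m \<ge> 0" by simp
 have "Lp_norm p \<Omega> u powr p + Lp_norm p \<Omega> (weak_gradient \<Omega> u) powr p
   \<le> ?m * Lp_norm 2 \<Omega> u powr p + ?m * V_norm \<Omega> u powr p"
  unfolding pw using L1(2) L2(2) by (simp add: V_norm_def)
 also have "\<dots> \<le> ?m * ?N powr p + ?m * (?N / rk) powr p"
  using norm_bounds[OF u] p m0
  by (intro add_mono mult_left_mono powr_mono2) (auto simp: V_norm_def Lp_norm_nonneg)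
 also have "\<dots> = (?m * (1 + (1 / rk) powr p)) * ?N powr p"
  using rk by (simp add: powr_divide powr_one_eq_one algebra_simps)
 finally have "W1p_norm p \<Omega> u \<le> ((?m * (1 + (1 / rk) powr p)) * ?N powr p) powr (1 / p)"
  unfolding W1p_norm_def using p by (intro powr_mono2) auto
 also have "\<dots> = W1p_const p * ?N"
  using p by (simp add: W1p_const_def powr_mult powr_powr)
 finally show "W1p_norm p \<Omega> u \<le> W1p_const p * ?N" .
qed

section \<open>The solenoidal energy space as a Hilbert space\<close>

lemma test_is_weak_gradient:
 fixes \<psi> :: "real^'n \<Rightarrow> real^'n"
 assumes "test_function \<Omega> \<psi>"
 shows "\<psi> \<in> Lp_space 2 \<Omega>" "(\<lambda>x. jacobian \<psi> (at x)) \<in> Lp_space 2 \<Omega>"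
  "is_weak_gradient \<Omega> \<psi> (\<lambda>x. jacobian \<psi> (at x))"
proof -
 define K where "K = closure {x. \<psi> x \<noteq> 0}"
 have K: "compact K" "K \<subseteq> \<Omega>" and s: "smooth \<psi>" using assms by (auto simp: test_function_def K_def)
 have out: "jacobian \<psi> (at x) = 0" if "x \<notin> K" for x
  using derivative_zero_outside_support[OF s] that unfolding K_def by (simp add: vec_eq_iff jacobian_nth)
 have "zext \<Omega> (\<lambda>x. jacobian \<psi> (at x)) = (\<lambda>x. jacobian \<psi> (at x))"
  using out K(2) by (auto simp: zext_def indicator_def fun_eq_iff)
 then show J: "(\<lambda>x. jacobian \<psi> (at x)) \<in> Lp_space 2 \<Omega>"
  using continuous_compact_support_sq_int[OF continuous_on_jacobian[OF s] K(1) out]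
   sq_int_zext_iff[OF Omega_sets, of "\<lambda>x. jacobian \<psi> (at x)"] by simp
 show P: "\<psi> \<in> Lp_space 2 \<Omega>" by (rule test_function_Lp[OF assms])
 show "is_weak_gradient \<Omega> \<psi> (\<lambda>x. jacobian \<psi> (at x))"
  by (rule is_weak_gradientI[OF P J]) (rule is_weak_gradient_jacobian_test[OF Omega_sets s])
qed

lemma test_W1p: "test_function \<Omega> \<psi> \<Longrightarrow> \<psi> \<in> W1p_space 2 \<Omega>" for \<psi> :: "real^'n \<Rightarrow> real^'n"
 by (rule W1pI) (rule test_is_weak_gradient, assumption)+

lemma emb_test: "test_function \<Omega> \<psi> \<Longrightarrow> emb \<psi> = pair_of \<psi> (\<lambda>x. rk *\<^sub>R jacobian \<psi> (at x))"
 for \<psi> :: "real^'n \<Rightarrow> real^'n"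
 by (rule emb_eq) (rule test_is_weak_gradient, assumption)+

lemma solenoidal_testD: "\<psi> \<in> solenoidal_test \<Omega> \<Longrightarrow> test_function \<Omega> \<psi>"
 for \<psi> :: "real^'n \<Rightarrow> real^'n" by (simp add: solenoidal_test_def)

definition Vhat :: "'n pair_L2 set" where "Vhat = closure (emb ` solenoidal_test \<Omega>)"

lemma subspace_tests: "subspace (emb ` solenoidal_test \<Omega>)"
proof (rule subspaceI)
 note W = test_W1p[OF solenoidal_testD]
 have "emb (\<lambda>x. 0) = 0" using W1p_scaleR(2)[OF W[OF zero_solenoidal_test], of 0] by simp
 then show "0 \<in> emb ` solenoidal_test \<Omega>" using zero_solenoidal_test by force
 show "x + y \<in> emb ` solenoidal_test \<Omega>" if xy: "x \<in> emb ` solenoidal_test \<Omega>" "y \<in> emb ` solenoidal_test \<Omega>" for x y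
 proof -
  obtain f g where fg: "x = emb f" "y = emb g" "f \<in> solenoidal_test \<Omega>" "g \<in> solenoidal_test \<Omega>" using xy by auto
  then have "x + y = emb (\<lambda>x. f x + g x)" using W1p_lincomb(2)[OF W W, of f g 1 1] by simp
  then show ?thesis using solenoidal_test_add fg by blast
 qed
 show "c *\<^sub>R x \<in> emb ` solenoidal_test \<Omega>" if x: "x \<in> emb ` solenoidal_test \<Omega>" for c x
 proof -
  obtain f where f: "x = emb f" "f \<in> solenoidal_test \<Omega>" using x by auto
  then have "c *\<^sub>R x = emb (\<lambda>x. c *\<^sub>R f x)" using W1p_scaleR(2)[OF W, of f c] by simp
  then show ?thesis using solenoidal_test_scaleR f by blast
 qed
qed

lemma subspace_Vhat: "subspace Vhat"
proof (rule subspaceI)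
 show "0 \<in> Vhat" unfolding Vhat_def by (rule subsetD[OF closure_subset subspace_0[OF subspace_tests]])
 have seq: "\<exists>f. (\<forall>n. f n \<in> emb ` solenoidal_test \<Omega>) \<and> f \<longlonglongrightarrow> x" if "x \<in> Vhat" for x
  using that unfolding Vhat_def closure_sequential .
 have lim: "x \<in> Vhat" if "\<And>n. f n \<in> emb ` solenoidal_test \<Omega>" "f \<longlonglongrightarrow> x" for f x
  unfolding Vhat_def closure_sequential using that by blast
 show "x + y \<in> Vhat" if xy: "x \<in> Vhat" "y \<in> Vhat" for x y
 proof -
  obtain f where f: "\<forall>n. f n \<in> emb ` solenoidal_test \<Omega>" "f \<longlonglongrightarrow> x" using seq[OF xy(1)] by blast
  obtain g where g: "\<forall>n. g n \<in> emb ` solenoidal_test \<Omega>" "g \<longlonglongrightarrow> y" using seq[OF xy(2)] by blast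
  show ?thesis by (rule lim[OF subspace_add[OF subspace_tests] tendsto_add[OF f(2) g(2)]]) (use f g in blast)+
 qed
 show "c *\<^sub>R x \<in> Vhat" if x: "x \<in> Vhat" for c x
 proof -
  obtain f where f: "\<forall>n. f n \<in> emb ` solenoidal_test \<Omega>" "f \<longlonglongrightarrow> x" using seq[OF x] by blast
  show ?thesis
   by (rule lim[OF subspace_scale[OF subspace_tests] tendsto_scaleR[OF tendsto_const f(2)]]) (use f in blast)
 qed
qed

sublocale V: hilbert_subspace Vhat
proof
 show "subspace Vhat" by (rule subspace_Vhat)
 show "closed Vhat" by (simp add: Vhat_def)
qed

lemma Vhat_subset_grad_space: "Vhat \<subseteq> grad_space"
 unfolding Vhat_def
 by (rule closure_minimal[OF _ grad_space_closed]) (auto intro!: emb_in_grad_space test_W1p solenoidal_testD)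

lemma Vhat_grad: "h \<in> Vhat \<Longrightarrow> h \<in> grad_space" using Vhat_subset_grad_space by blast

text \<open>
 The norm of \<open>emb u\<close> is equivalent to the norm of \<open>W\<^sup>1\<^sup>,\<^sup>2\<close>, so that closures of the solenoidal test
 fields in the two norms correspond to each other.
\<close>

lemma emb_V_space:
 assumes "u \<in> V_space \<Omega>" shows "u \<in> W1p_space 2 \<Omega>" "emb u \<in> Vhat"
proof -
 show u: "u \<in> W1p_space 2 \<Omega>" using assms by (simp add: Vp_space_def)
 show "emb u \<in> Vhat"
  unfolding Vhat_def closure_approachable
 proof (intro allI impI)
  fix e :: real assume e: "e > 0"
  have rk1: "1 + rk > 0" using rk by linarith
  then have "e / (1 + rk) > 0" using e by simp
  then obtain \<psi> where \<psi>: "\<psi> \<in> solenoidal_test \<Omega>" "W1p_norm 2 \<Omega> (\<lambda>x. u x - \<psi> x) < e / (1 + rk)"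
   using assms unfolding Vp_space_def by blast
  note W = W1p_diff[OF u test_W1p[OF solenoidal_testD[OF \<psi>(1)]]]
  have "norm (emb u - emb \<psi>) \<le> (1 + rk) * W1p_norm 2 \<Omega> (\<lambda>x. u x - \<psi> x)"
   using emb_norm_le_W1p_norm[OF W(1)] unfolding W(2) .
  also have "\<dots> < e" using \<psi>(2) rk1 by (simp add: pos_less_divide_eq mult.commute)
  finally show "\<exists>y\<in>emb ` solenoidal_test \<Omega>. dist y (emb u) < e"
   using \<psi>(1) by (auto simp: dist_norm norm_minus_commute)
 qed
qed

lemma Vp_space_of_emb:
 assumes u: "u \<in> W1p_space 2 \<Omega>" and h: "emb u \<in> Vhat" and p: "0 < p" "p \<le> 2"
 shows "u \<in> Vp_space p \<Omega>"
proof -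
 have C: "W1p_const p \<ge> 0" by (simp add: W1p_const_def)
 show ?thesis
  unfolding Vp_space_def mem_Collect_eq
 proof (intro conjI allI impI)
  show "u \<in> W1p_space p \<Omega>" by (rule W1p_norm_le_emb[OF u p])
  fix e :: real assume e: "e > 0"
  have "e / (W1p_const p + 1) > 0" using e C by simp
  then obtain \<psi> where \<psi>: "\<psi> \<in> solenoidal_test \<Omega>" "dist (emb \<psi>) (emb u) < e / (W1p_const p + 1)"
   using h unfolding Vhat_def closure_approachable by (metis imageE)
  note W = W1p_diff[OF u test_W1p[OF solenoidal_testD[OF \<psi>(1)]]]
  have "W1p_norm p \<Omega> (\<lambda>x. u x - \<psi> x) \<le> W1p_const p * norm (emb u - emb \<psi>)"
   using W1p_norm_le_emb(2)[OF W(1) p] unfolding W(2) .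
  also have "\<dots> \<le> (W1p_const p + 1) * norm (emb u - emb \<psi>)" by (intro mult_right_mono) auto
  also have "\<dots> < e" using \<psi>(2) C by (simp add: dist_norm norm_minus_commute field_simps)
  finally show "\<exists>\<psi>\<in>solenoidal_test \<Omega>. W1p_norm p \<Omega> (\<lambda>x. u x - \<psi> x) < e" using \<psi>(1) by blast
 qed
qed

lemma vel_Vp_space: "h \<in> Vhat \<Longrightarrow> 0 < p \<Longrightarrow> p \<le> 2 \<Longrightarrow> vel h \<in> Vp_space p \<Omega>"
 by (rule Vp_space_of_emb) (auto intro: vel_W1p Vhat_grad simp: emb_vel Vhat_grad)

end

section \<open>The viscous stress and the convective tensor\<close>

lemma powr_mult_self: "0 < s \<Longrightarrow> s powr (p - 2) * s = s powr (p - 1)" for s :: real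
 using powr_add[of s "p - 2" 1] by simp

lemma norm_stress: "norm (stress p A) = norm A powr (p - 1)" if "1 < p" for A :: "real^'n^'n"
proof (cases "A = 0")
 case False
 then show ?thesis by (simp add: stress_def powr_mult_self)
qed (use that in \<open>simp add: stress_def\<close>)

text \<open>
 Let \<open>|B| \<le> |A|\<close>.  If \<open>|A| < |A - B|\<close>, each term is small enough.  Otherwise split the difference as
 \<open>|A|\<^sup>p\<^sup>-\<^sup>2 (A - B) + (|A|\<^sup>p\<^sup>-\<^sup>2 - |B|\<^sup>p\<^sup>-\<^sup>2) B\<close> and use that the exponent \<open>p - 2\<close> is negative.
\<close>

lemma stress_holder:
 fixes A B :: "real^'n^'n"
 assumes p: "1 < p" "p < 2"
 shows "norm (stress p A - stress p B) \<le> 2 * norm (A - B) powr (p - 1)"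
proof -
 have *: "norm (stress p A - stress p B) \<le> 2 * norm (A - B) powr (p - 1)" if BA: "norm B \<le> norm A" for A B :: "real^'n^'n"
 proof (cases "norm A < norm (A - B)")
  case True
  have "norm (stress p A - stress p B) \<le> norm A powr (p - 1) + norm B powr (p - 1)"
   using norm_triangle_ineq4[of "stress p A" "stress p B"] by (simp add: norm_stress p)
  also have "\<dots> \<le> norm (A - B) powr (p - 1) + norm (A - B) powr (p - 1)"
   using True BA p by (intro add_mono powr_mono2) auto
  finally show ?thesis by simp
 next
  case False
  show ?thesis
  proof (cases "A = B")
   case True then show ?thesis by simp
  next
   case ne: False
   then have d: "norm (A - B) > 0" by simp
   then have a: "norm A > 0" using False by linarith
   let ?a = "norm A powr (p - 2)"
   have "norm (stress p A - stress p B) = norm (?a *\<^sub>R (A - B) + (?a *\<^sub>R B - stress p B))"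
    by (simp add: stress_def scaleR_diff_right)
   also have "\<dots> \<le> norm (?a *\<^sub>R (A - B)) + norm (?a *\<^sub>R B - stress p B)" by (rule norm_triangle_ineq)
   also have "norm (?a *\<^sub>R B - stress p B) \<le> ?a * norm (A - B)"
   proof (cases "B = 0")
    case False
    then have b: "norm B > 0" by simp
    have le: "?a \<le> norm B powr (p - 2)" using BA b p by (intro powr_mono2') auto
    have "norm (?a *\<^sub>R B - stress p B) = (norm B powr (p - 2) - ?a) * norm B"
     using le by (simp add: stress_def scaleR_diff_left[symmetric])
    also have "\<dots> = norm B powr (p - 1) - ?a * norm B"
     using b by (simp add: left_diff_distrib powr_mult_self)
    also have "norm B powr (p - 1) \<le> norm A powr (p - 1)" using BA p by (intro powr_mono2) auto
    also have "norm A powr (p - 1) = ?a * norm A"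
     using a by (simp add: powr_mult_self)
    finally have "norm (?a *\<^sub>R B - stress p B) \<le> ?a * (norm A - norm B)" by (simp add: right_diff_distrib)
    also have "\<dots> \<le> ?a * norm (A - B)" by (intro mult_left_mono norm_triangle_ineq2) auto
    finally show ?thesis .
   qed (simp add: stress_def)
   finally have "norm (stress p A - stress p B) \<le> 2 * (?a * norm (A - B))" by (simp add: mult.commute)
   also have "?a * norm (A - B) \<le> norm (A - B) powr (p - 2) * norm (A - B)"
    using False d p by (intro mult_right_mono powr_mono2') auto
   also have "norm (A - B) powr (p - 2) * norm (A - B) = norm (A - B) powr (p - 1)"
    using d by (simp add: powr_mult_self)
   finally show ?thesis by (simp add: mult.commute)
  qed
 qed
 show ?thesis
 proof (cases "norm B \<le> norm A")
  case True then show ?thesis by (rule *)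
 next
  case False
  then show ?thesis using *[of A B] by (simp add: norm_minus_commute)
 qed
qed

text \<open>
 By the Cauchy--Schwarz inequality the product is at least
 \<open>(|A|\<^sup>p\<^sup>-\<^sup>1 - |B|\<^sup>p\<^sup>-\<^sup>1) (|A| - |B|)\<close>.
\<close>

lemma stress_monotone:
 fixes A B :: "real^'n^'n"
 assumes p: "1 < p"
 shows "0 \<le> (stress p A - stress p B) \<bullet> (A - B)"
proof -
 have s: "norm C powr (p - 2) * norm C = norm C powr (p - 1)" for C :: "real^'n^'n"
  using norm_stress[OF p, of C] by (simp add: stress_def)
 have AB: "A \<bullet> B \<le> norm A * norm B" by (rule norm_cauchy_schwarz)
 have "(stress p A - stress p B) \<bullet> (A - B) =
   norm A powr (p - 2) * (norm A)\<^sup>2 + norm B powr (p - 2) * (norm B)\<^sup>2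
   - (norm A powr (p - 2) + norm B powr (p - 2)) * (A \<bullet> B)"
  by (simp add: stress_def inner_diff_left inner_diff_right power2_norm_eq_inner inner_commute algebra_simps)
 also have "\<dots> \<ge> norm A powr (p - 2) * (norm A)\<^sup>2 + norm B powr (p - 2) * (norm B)\<^sup>2
   - (norm A powr (p - 2) + norm B powr (p - 2)) * (norm A * norm B)"
  using AB by (intro diff_left_mono mult_left_mono) auto
 moreover have "norm A powr (p - 2) * (norm A)\<^sup>2 + norm B powr (p - 2) * (norm B)\<^sup>2
   - (norm A powr (p - 2) + norm B powr (p - 2)) * (norm A * norm B)
   = (norm A powr (p - 1) - norm B powr (p - 1)) * (norm A - norm B)"
  unfolding s[symmetric] by (simp add: power2_eq_square algebra_simps)
 moreover have "0 \<le> (norm A powr (p - 1) - norm B powr (p - 1)) * (norm A - norm B)"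
 proof (cases "norm A \<le> norm B")
  case True
  then have "norm A powr (p - 1) \<le> norm B powr (p - 1)" using p by (intro powr_mono2) auto
  then show ?thesis using True by (intro mult_nonpos_nonpos) auto
 next
  case False
  then have "norm B powr (p - 1) \<le> norm A powr (p - 1)" using p by (intro powr_mono2) auto
  then show ?thesis using False by (intro mult_nonneg_nonneg) auto
 qed
 ultimately show ?thesis by linarith
qed

lemma inner_transpose: "transpose A \<bullet> B = A \<bullet> transpose B" for A B :: "real^'n^'n"
 unfolding inner_vec_def transpose_def by simp (rule sum.swap)

lemma norm_transpose: "norm (transpose A) = norm A" for A :: "real^'n^'n"
 by (simp add: norm_eq_sqrt_inner inner_transpose)

lemma linear_transpose: "linear (transpose :: real^'n^'n \<Rightarrow> real^'n^'n)"
 by (rule linearI) (auto simp: transpose_def vec_eq_iff)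

lemma bounded_linear_sym_part: "bounded_linear (sym_part :: real^'n^'n \<Rightarrow> real^'n^'n)"
proof -
 have "linear (sym_part :: real^'n^'n \<Rightarrow> real^'n^'n)"
  by (rule linearI)
    (simp_all add: sym_part_def linear_add[OF linear_transpose] linear_scale[OF linear_transpose] algebra_simps)
 then show ?thesis by (simp add: linear_conv_bounded_linear)
qed

lemma norm_sym_part_le: "norm (sym_part A) \<le> norm A" for A :: "real^'n^'n"
proof -
 have "norm (sym_part A) = norm (A + transpose A) / 2" by (simp add: sym_part_def)
 also have "\<dots> \<le> (norm A + norm A) / 2"
  using norm_triangle_ineq[of A "transpose A"] by (simp add: norm_transpose)
 finally show ?thesis by simp
qed

lemma inner_sym_part: "transpose S = S \<Longrightarrow> S \<bullet> sym_part B = S \<bullet> B" for S B :: "real^'n^'n"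
 using inner_transpose[of S B] by (simp add: sym_part_def inner_add_right)

lemma transpose_stress_sym_part: "transpose (stress p (sym_part A)) = stress p (sym_part A)" for A :: "real^'n^'n"
proof -
 have "transpose (sym_part A) = sym_part A"
  by (simp add: sym_part_def linear_add[OF linear_transpose] linear_scale[OF linear_transpose] add.commute)
 then show ?thesis by (simp add: stress_def linear_scale[OF linear_transpose])
qed

lemma stress_inner_sym_part: "stress p (sym_part A) \<bullet> sym_part B = stress p (sym_part A) \<bullet> B" for A B :: "real^'n^'n"
 by (rule inner_sym_part[OF transpose_stress_sym_part])

lemma continuous_on_stress:
 assumes p: "1 < p" "p < 2" shows "continuous_on UNIV (stress p :: real^'n^'n \<Rightarrow> real^'n^'n)"
 unfolding continuous_on_def
proof (intro ballI)
 fix A :: "real^'n^'n"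
 have "((\<lambda>B. 2 * norm (B - A) powr (p - 1)) \<longlongrightarrow> 2 * norm (A - A) powr (p - 1)) (at A)"
  by (intro tendsto_intros tendsto_powr2) (use p in auto)
 then have "((\<lambda>B. 2 * norm (B - A) powr (p - 1)) \<longlongrightarrow> 0) (at A)" using p by simp
 then have "((\<lambda>B. norm (stress p B - stress p A)) \<longlongrightarrow> 0) (at A)"
  by (rule tendsto_sandwich[OF _ _ tendsto_const, rotated 2]) (auto intro!: always_eventually stress_holder p)
 then show "(stress p \<longlongrightarrow> stress p A) (at A within UNIV)"
  by (simp add: tendsto_norm_zero_iff LIM_zero_iff)
qed

lemma norm_tensor: "norm (tensor a b) = norm a * norm b" for a b :: "real^'n"
proof -
 have "tensor a b \<bullet> tensor a b = (a \<bullet> a) * (b \<bullet> b)"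
  by (simp add: inner_vec_def tensor_def sum_product mult_ac)
 then show ?thesis by (simp add: norm_eq_sqrt_inner real_sqrt_mult)
qed

lemma tensor_diff: "tensor a a - tensor b b = tensor (a - b) a + tensor b (a - b)" for a b :: "real^'n"
 by (simp add: vec_eq_iff tensor_def algebra_simps)

lemma continuous_on_tensor: "continuous_on UNIV (\<lambda>x. tensor (fst x) (snd x))"
 unfolding tensor_def by (intro continuous_on_vec_lambda continuous_intros)

text \<open>Integrating by parts, \<open>\<integral> (\<psi> \<otimes> \<psi>) : \<nabla>\<psi> = - \<integral> |\<psi>|\<^sup>2 div \<psi> / 2\<close>: convection does no work.\<close>

lemma convection_test_zero:
 fixes \<psi> :: "real^'n \<Rightarrow> real^'n"
 assumes \<Omega>: "\<Omega> \<in> sets lebesgue" and \<psi>: "\<psi> \<in> solenoidal_test \<Omega>"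
 shows "(LINT x|lebesgue_on \<Omega>. tensor (\<psi> x) (\<psi> x) \<bullet> jacobian \<psi> (at x)) = 0"
proof -
 define K where "K = closure {x. \<psi> x \<noteq> 0}"
 have K: "compact K" "K \<subseteq> \<Omega>" and s: "smooth \<psi>" and div: "\<And>x. x \<in> \<Omega> \<Longrightarrow> divergence \<psi> x = 0"
  using \<psi> by (auto simp: solenoidal_test_def test_function_def K_def)
 have out: "\<psi> x = 0" if "x \<notin> K" for x using that closure_subset[of "{x. \<psi> x \<noteq> 0}"] unfolding K_def by blast
 let ?D = "\<lambda>x j. frechet_derivative \<psi> (at x) (axis j 1)"
 have d: "(\<psi> has_derivative frechet_derivative \<psi> (at x)) (at x)" for x by (rule smooth_has_derivative[OF s])
 have cD: "continuous_on UNIV (\<lambda>x. ?D x j)" for j by (rule smooth_continuous_derivative[OF s])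
 have c: "continuous_on UNIV \<psi>" by (rule smooth_continuous[OF s])
 have zero: "(LINT x|lebesgue. ?D x j $ j * (\<psi> x \<bullet> \<psi> x) + \<psi> x $ j * (2 * (\<psi> x \<bullet> ?D x j))) = 0" for j
 proof -
  have "((\<lambda>x. \<psi> x $ j * (\<psi> x \<bullet> \<psi> x)) has_derivative
   (\<lambda>h. \<psi> x $ j * (\<psi> x \<bullet> frechet_derivative \<psi> (at x) h + frechet_derivative \<psi> (at x) h \<bullet> \<psi> x)
    + frechet_derivative \<psi> (at x) h $ j * (\<psi> x \<bullet> \<psi> x))) (at x)" for x
   by (intro has_derivative_mult has_derivative_inner bounded_linear.has_derivative[OF bounded_linear_vec_nth] d)
  note der = this
  have cont: "continuous_on UNIV (\<lambda>x. \<psi> x $ j * (\<psi> x \<bullet> ?D x j + ?D x j \<bullet> \<psi> x) + ?D x j $ j * (\<psi> x \<bullet> \<psi> x))"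
   by (intro continuous_intros c cD)
  have "(LINT x|lebesgue. \<psi> x $ j * (\<psi> x \<bullet> ?D x j + ?D x j \<bullet> \<psi> x) + ?D x j $ j * (\<psi> x \<bullet> \<psi> x)) = 0"
   by (rule integral_directional_derivative_zero[OF der cont K(1)]) (simp add: out)
  moreover have "\<psi> x $ j * (\<psi> x \<bullet> ?D x j + ?D x j \<bullet> \<psi> x) + ?D x j $ j * (\<psi> x \<bullet> \<psi> x) =
    ?D x j $ j * (\<psi> x \<bullet> \<psi> x) + \<psi> x $ j * (2 * (\<psi> x \<bullet> ?D x j))" for x
   by (simp add: inner_commute)
  ultimately show ?thesis by simp
 qed
 have int: "integrable lebesgue (\<lambda>x. ?D x j $ j * (\<psi> x \<bullet> \<psi> x) + \<psi> x $ j * (2 * (\<psi> x \<bullet> ?D x j)))" for j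
 proof -
  let ?g = "\<lambda>x. ?D x j $ j * (\<psi> x \<bullet> \<psi> x) + \<psi> x $ j * (2 * (\<psi> x \<bullet> ?D x j))"
  have cg: "continuous_on UNIV ?g" by (intro continuous_intros c cD)
  have "integrable lborel (\<lambda>x. indicator K x *\<^sub>R ?g x)"
   by (intro borel_integrable_compact K continuous_on_subset[OF cg]) auto
  moreover have "(\<lambda>x. indicator K x *\<^sub>R ?g x) = ?g" using out by (auto simp: fun_eq_iff indicator_def)
  ultimately have "integrable lborel ?g" by (simp only:)
  then show ?thesis by (rule integrable_completion[THEN iffD2, rotated])
   (use borel_measurable_continuous_onI[OF cg] in simp)
 qed
 have "(LINT x|lebesgue. (\<Sum>j\<in>UNIV. ?D x j $ j * (\<psi> x \<bullet> \<psi> x) + \<psi> x $ j * (2 * (\<psi> x \<bullet> ?D x j)))) = 0"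
  using int by (subst Bochner_Integration.integral_sum) (auto simp: zero)
 moreover have "(\<Sum>j\<in>UNIV. ?D x j $ j * (\<psi> x \<bullet> \<psi> x) + \<psi> x $ j * (2 * (\<psi> x \<bullet> ?D x j)))
   = 2 * zext \<Omega> (\<lambda>x. tensor (\<psi> x) (\<psi> x) \<bullet> jacobian \<psi> (at x)) x" for x
 proof (cases "x \<in> \<Omega>")
  case True
  have "(\<Sum>j\<in>UNIV. ?D x j $ j * (\<psi> x \<bullet> \<psi> x)) = divergence \<psi> x * (\<psi> x \<bullet> \<psi> x)"
   by (simp add: divergence_sum jacobian_nth sum_distrib_right)
  also have "\<dots> = 0" using div[OF True] by simp
  finally have 1: "(\<Sum>j\<in>UNIV. ?D x j $ j * (\<psi> x \<bullet> \<psi> x)) = 0" .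
  have "(\<Sum>j\<in>UNIV. \<psi> x $ j * (2 * (\<psi> x \<bullet> ?D x j))) = 2 * (\<Sum>j\<in>UNIV. \<Sum>i\<in>UNIV. \<psi> x $ i * \<psi> x $ j * ?D x j $ i)"
   by (simp add: inner_vec_def sum_distrib_left mult_ac)
  also have "\<dots> = 2 * (tensor (\<psi> x) (\<psi> x) \<bullet> jacobian \<psi> (at x))"
   by (subst sum.swap) (simp add: inner_vec_def tensor_def jacobian_nth)
  finally show ?thesis using 1 True by (simp add: sum.distrib)
 next
  case False
  then have "\<psi> x = 0" using K(2) out by blast
  then show ?thesis using False by simp
 qed
 ultimately have "(LINT x|lebesgue. 2 * zext \<Omega> (\<lambda>x. tensor (\<psi> x) (\<psi> x) \<bullet> jacobian \<psi> (at x)) x) = 0"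
  by (simp only:)
 then have "(LINT x|lebesgue. zext \<Omega> (\<lambda>x. tensor (\<psi> x) (\<psi> x) \<bullet> jacobian \<psi> (at x)) x) = 0" by simp
 then show ?thesis by (simp only: integral_zext[OF \<Omega>])
qed

section \<open>The right-hand side of the equation as a map of the energy space\<close>

locale voigt4 = voigt_domain \<Omega> \<kappa> for \<Omega> :: "(real^4) set" and \<kappa> +
 fixes \<nu> p :: real
 assumes nu_pos: "0 < \<nu>" and p: "1 < p" "p < 2"
begin

definition C4 :: real where "C4 = 1296 / \<kappa>\<^sup>2"

lemma C4: "C4 > 0" using kappa_pos by (simp add: C4_def)

text \<open>The Sobolev inequality for each of the four components.\<close>

lemma L4_test:
 assumes \<psi>: "\<psi> \<in> solenoidal_test \<Omega>"
 shows "(\<integral>\<^sup>+x. ennreal (norm (\<psi> x) ^ 4) \<partial>lebesgue) \<le> ennreal (C4 * norm (emb \<psi>) ^ 4)"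
proof -
 have t: "test_function \<Omega> \<psi>" and s: "smooth \<psi>" using \<psi> by (auto simp: solenoidal_test_def test_function_def)
 define K where "K = closure {x. \<psi> x \<noteq> 0}"
 have K: "compact K" "K \<subseteq> \<Omega>" using t by (auto simp: test_function_def K_def)
 have out: "\<psi> x = 0" if "x \<notin> K" for x using that closure_subset[of "{x. \<psi> x \<noteq> 0}"] unfolding K_def by blast
 have jout: "jacobian \<psi> (at x) = 0" if "x \<notin> K" for x
  using derivative_zero_outside_support[OF s] that unfolding K_def by (simp add: vec_eq_iff jacobian_nth)
 obtain R where R: "\<And>x. x \<in> K \<Longrightarrow> norm x \<le> R" using compact_imp_bounded[OF K(1)] unfolding bounded_iff by blast
 have cj: "continuous_on UNIV (\<lambda>x. jacobian \<psi> (at x))" by (rule continuous_on_jacobian[OF s])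
 have c: "continuous_on UNIV \<psi>" by (rule smooth_continuous[OF s])
 have [measurable]: "\<psi> \<in> borel_measurable borel" by (rule borel_measurable_continuous_onI[OF c])
 have [measurable]: "(\<lambda>x. jacobian \<psi> (at x)) \<in> borel_measurable borel" by (rule borel_measurable_continuous_onI[OF cj])
 have [measurable]: "(\<lambda>x. \<psi> x $ i) \<in> borel_measurable borel" for i
  by (rule borel_measurable_continuous_onI[OF bounded_linear.continuous_on[OF bounded_linear_vec_nth c]])
 define Y where "Y = (\<integral>\<^sup>+x. ennreal ((norm (jacobian \<psi> (at x)))\<^sup>2) \<partial>lborel)"
 have comp: "(\<integral>\<^sup>+x. ennreal ((\<psi> x $ i) ^ 4) \<partial>lborel) \<le> 81 * Y\<^sup>2" for i
 proof -
  have "(\<integral>\<^sup>+x. ennreal ((\<psi> x $ i) ^ 4) \<partial>lborel) \<le>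
   81 * (\<integral>\<^sup>+x. ennreal (\<Sum>j\<in>UNIV. (frechet_derivative \<psi> (at x) (axis j 1) $ i)\<^sup>2) \<partial>lborel)\<^sup>2"
  proof (rule sobolev4)
   show "((\<lambda>x. \<psi> x $ i) has_derivative (\<lambda>h. frechet_derivative \<psi> (at x) h $ i)) (at x)" for x
    by (rule bounded_linear.has_derivative[OF bounded_linear_vec_nth smooth_has_derivative[OF s]])
   show "continuous_on UNIV (\<lambda>x. frechet_derivative \<psi> (at x) (axis j 1) $ i)" for j
    by (intro bounded_linear.continuous_on[OF bounded_linear_vec_nth] smooth_continuous_derivative s)
   show "norm x \<le> R" if "\<psi> x $ i \<noteq> 0" for x
   proof -
    have "x \<in> K" using that out[of x] by (cases "x \<in> K") auto
    then show ?thesis by (rule R)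
   qed
  qed
  also have "\<dots> \<le> 81 * Y\<^sup>2"
   unfolding Y_def
  proof (intro mult_left_mono power_mono nn_integral_mono ennreal_leI)
   fix x
   have "(norm (jacobian \<psi> (at x)))\<^sup>2 = (\<Sum>k\<in>UNIV. \<Sum>j\<in>UNIV. (frechet_derivative \<psi> (at x) (axis j 1) $ k)\<^sup>2)"
    unfolding power2_norm_eq_inner by (simp add: inner_vec_def jacobian_nth power2_eq_square)
   then show "(\<Sum>j\<in>UNIV. (frechet_derivative \<psi> (at x) (axis j 1) $ i)\<^sup>2) \<le> (norm (jacobian \<psi> (at x)))\<^sup>2"
    using member_le_sum[of i UNIV "\<lambda>k. \<Sum>j\<in>UNIV. (frechet_derivative \<psi> (at x) (axis j 1) $ k)\<^sup>2"]
    by (simp add: sum_nonneg)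
  qed auto
  finally show ?thesis .
 qed
 have "(\<integral>\<^sup>+x. ennreal (norm (\<psi> x) ^ 4) \<partial>lebesgue) = (\<integral>\<^sup>+x. ennreal (norm (\<psi> x) ^ 4) \<partial>lborel)"
  by (rule nn_integral_completion)
 also have "\<dots> \<le> (\<integral>\<^sup>+x. (\<Sum>i\<in>UNIV. 4 * ennreal ((\<psi> x $ i) ^ 4)) \<partial>lborel)"
 proof (rule nn_integral_mono)
  fix x
  have "norm (\<psi> x) ^ 4 = ((norm (\<psi> x))\<^sup>2)\<^sup>2" by simp
  also have "(norm (\<psi> x))\<^sup>2 = (\<Sum>i\<in>UNIV. 1 * (\<psi> x $ i)\<^sup>2)"
   unfolding power2_norm_eq_inner by (simp add: inner_vec_def power2_eq_square)
  also have "(\<Sum>i\<in>UNIV. 1 * (\<psi> x $ i)\<^sup>2)\<^sup>2 \<le> (\<Sum>i\<in>(UNIV::4 set). 1\<^sup>2) * (\<Sum>i\<in>UNIV. ((\<psi> x $ i)\<^sup>2)\<^sup>2)"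
   by (rule Cauchy_Schwarz_ineq_sum)
  also have "\<dots> = (\<Sum>i\<in>UNIV. 4 * (\<psi> x $ i) ^ 4)" by (simp add: sum_distrib_left)
  finally have "ennreal (norm (\<psi> x) ^ 4) \<le> ennreal (\<Sum>i\<in>UNIV. 4 * (\<psi> x $ i) ^ 4)" by (rule ennreal_leI)
  also have "\<dots> = (\<Sum>i\<in>UNIV. 4 * ennreal ((\<psi> x $ i) ^ 4))"
   by (subst sum_ennreal[symmetric]) (auto simp: ennreal_mult')
  finally show "ennreal (norm (\<psi> x) ^ 4) \<le> (\<Sum>i\<in>UNIV. 4 * ennreal ((\<psi> x $ i) ^ 4))" .
 qed
 also have "\<dots> = (\<Sum>i\<in>UNIV. 4 * (\<integral>\<^sup>+x. ennreal ((\<psi> x $ i) ^ 4) \<partial>lborel))"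
  by (subst nn_integral_sum) (auto simp: nn_integral_cmult)
 also have "\<dots> \<le> (\<Sum>i\<in>(UNIV::4 set). 4 * (81 * Y\<^sup>2))"
  by (intro sum_mono mult_left_mono comp) auto
 also have "\<dots> = 1296 * Y\<^sup>2" by (simp add: mult.assoc[symmetric])
 also have "Y \<le> ennreal ((norm (emb \<psi>))\<^sup>2 / \<kappa>)"
 proof -
  have J: "sq_int (\<lambda>x. jacobian \<psi> (at x))"
   by (rule continuous_compact_support_sq_int[OF cj K(1) jout])
  have "Y = (\<integral>\<^sup>+x. ennreal ((norm (jacobian \<psi> (at x)))\<^sup>2) \<partial>lebesgue)"
   unfolding Y_def by (rule nn_integral_completion[symmetric])
  also have "\<dots> = ennreal (LINT x|lebesgue. (norm (jacobian \<psi> (at x)))\<^sup>2)"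
   by (rule nn_integral_eq_integral[OF sq_intD[OF J]]) simp
  also have "(LINT x|lebesgue. (norm (jacobian \<psi> (at x)))\<^sup>2) = (Lp_norm 2 \<Omega> (\<lambda>x. jacobian \<psi> (at x)))\<^sup>2"
  proof -
   have "zext \<Omega> (\<lambda>x. jacobian \<psi> (at x)) = (\<lambda>x. jacobian \<psi> (at x))"
    using jout K(2) by (auto simp: zext_def indicator_def fun_eq_iff)
   then show ?thesis
    using Lp_norm_2[OF Omega_sets test_is_weak_gradient(2)[OF t]] L2_of_norm_sq[OF J] by simp
  qed
  also have "\<dots> \<le> (norm (emb \<psi>))\<^sup>2 / \<kappa>"
  proof -
   have "(norm (emb \<psi>))\<^sup>2 = (Lp_norm 2 \<Omega> \<psi>)\<^sup>2 + \<kappa> * (Lp_norm 2 \<Omega> (\<lambda>x. jacobian \<psi> (at x)))\<^sup>2"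
    unfolding emb_test[OF t] using test_is_weak_gradient[OF t] rk
    by (subst norm_pair_of_sq) (auto simp: Lp_space_scaleR Lp_norm_scaleR power_mult_distrib)
   then show ?thesis using kappa_pos by (simp add: field_simps)
  qed
  finally show ?thesis by (simp add: ennreal_leI)
 qed
 then have "1296 * Y\<^sup>2 \<le> 1296 * (ennreal ((norm (emb \<psi>))\<^sup>2 / \<kappa>))\<^sup>2"
  by (intro mult_left_mono power_mono) auto
 also have "\<dots> = ennreal (C4 * norm (emb \<psi>) ^ 4)"
  using kappa_pos by (simp add: C4_def ennreal_power ennreal_mult[symmetric] power_divide ennreal_numeral[symmetric] del: ennreal_numeral)
 finally show ?thesis .
qed

text \<open>Fatou's lemma along an almost everywhere convergent sequence of test fields.\<close>

lemma L4_Vhat: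
 assumes h: "h \<in> Vhat"
 shows "(\<integral>\<^sup>+x. ennreal (norm (fst (rep h x)) ^ 4) \<partial>lebesgue) \<le> ennreal (C4 * norm h ^ 4)"
proof -
 obtain X where X: "\<And>n. X n \<in> emb ` solenoidal_test \<Omega>" "X \<longlonglongrightarrow> h"
  using h unfolding Vhat_def closure_sequential by blast
 obtain r where r: "strict_mono r" "AE x in lebesgue. (\<lambda>k. rep (X (r k)) x) \<longlonglongrightarrow> rep h x"
  using L2_tendsto_AE_subseq[OF X(2)] by blast
 have fm: "(\<lambda>x. fst (rep k x)) \<in> borel_measurable lebesgue" for k :: "4 pair_L2"
  by (intro borel_measurable_continuous_on[OF continuous_on_fst[OF continuous_on_id]]) simp
 have bound: "(\<integral>\<^sup>+x. ennreal (norm (fst (rep (X n) x)) ^ 4) \<partial>lebesgue) \<le> ennreal (C4 * norm (X n) ^ 4)" for n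
 proof -
  obtain \<psi> where \<psi>: "X n = emb \<psi>" "\<psi> \<in> solenoidal_test \<Omega>" using X(1)[of n] by auto
  note t = solenoidal_testD[OF \<psi>(2)]
  have "AE x in lebesgue. rep (X n) x = (zext \<Omega> \<psi> x, zext \<Omega> (\<lambda>x. rk *\<^sub>R jacobian \<psi> (at x)) x)"
   unfolding \<psi>(1) emb_test[OF t]
   by (rule rep_pair_of) (use test_is_weak_gradient[OF t] in \<open>auto intro: Lp_space_scaleR\<close>)
  then have "(\<integral>\<^sup>+x. ennreal (norm (fst (rep (X n) x)) ^ 4) \<partial>lebesgue) = (\<integral>\<^sup>+x. ennreal (norm (zext \<Omega> \<psi> x) ^ 4) \<partial>lebesgue)"
   by (intro nn_integral_cong_AE) (auto elim!: eventually_mono)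
  also have "\<dots> \<le> (\<integral>\<^sup>+x. ennreal (norm (\<psi> x) ^ 4) \<partial>lebesgue)"
   by (intro nn_integral_mono) (auto simp: zext_def indicator_def)
  also have "\<dots> \<le> ennreal (C4 * norm (X n) ^ 4)" unfolding \<psi>(1) by (rule L4_test[OF \<psi>(2)])
  finally show ?thesis .
 qed
 have "(\<integral>\<^sup>+x. ennreal (norm (fst (rep h x)) ^ 4) \<partial>lebesgue) =
   (\<integral>\<^sup>+x. liminf (\<lambda>k. ennreal (norm (fst (rep (X (r k)) x)) ^ 4)) \<partial>lebesgue)"
 proof (rule nn_integral_cong_AE)
  show "AE x in lebesgue. ennreal (norm (fst (rep h x)) ^ 4) = liminf (\<lambda>k. ennreal (norm (fst (rep (X (r k)) x)) ^ 4))"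
   using r(2)
  proof eventually_elim
   case (elim x)
   have "(\<lambda>k. ennreal (norm (fst (rep (X (r k)) x)) ^ 4)) \<longlonglongrightarrow> ennreal (norm (fst (rep h x)) ^ 4)"
    by (intro tendsto_ennrealI tendsto_intros elim)
   then show ?case by (rule lim_imp_Liminf[OF sequentially_bot, symmetric])
  qed
 qed
 also have "\<dots> \<le> liminf (\<lambda>k. \<integral>\<^sup>+x. ennreal (norm (fst (rep (X (r k)) x)) ^ 4) \<partial>lebesgue)"
  by (rule nn_integral_liminf) (use fm in measurable)
 also have "\<dots> \<le> liminf (\<lambda>k. ennreal (C4 * norm (X (r k)) ^ 4))"
  by (intro Liminf_mono always_eventually allI bound)
 also have "\<dots> = ennreal (C4 * norm h ^ 4)"
  using LIMSEQ_subseq_LIMSEQ[OF X(2) r(1)]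
  by (intro lim_imp_Liminf tendsto_ennrealI tendsto_intros) (auto simp: o_def)
 finally show ?thesis .
qed

lemma L4_product:
 assumes "h \<in> Vhat" "k \<in> Vhat"
 shows "(\<integral>\<^sup>+x. ennreal ((norm (vel h x) * norm (vel k x))\<^sup>2) \<partial>lebesgue) \<le> ennreal (C4 * (norm h * norm k)\<^sup>2)"
proof -
 have fm: "(\<lambda>x. fst (rep k x)) \<in> borel_measurable lebesgue" for k :: "4 pair_L2"
  by (intro borel_measurable_continuous_on[OF continuous_on_fst[OF continuous_on_id]]) simp
 have m: "(\<lambda>x. ennreal ((norm (vel k x))\<^sup>2)) \<in> borel_measurable lebesgue" for k
  using fm[of k] unfolding vel_def by measurable
 let ?I = "\<integral>\<^sup>+x. ennreal ((norm (vel h x) * norm (vel k x))\<^sup>2) \<partial>lebesgue"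
 have L: "(\<integral>\<^sup>+x. (ennreal ((norm (vel k x))\<^sup>2))\<^sup>2 \<partial>lebesgue) \<le> ennreal (C4 * norm k ^ 4)" if "k \<in> Vhat" for k
  using L4_Vhat[OF that] by (simp add: vel_def ennreal_power flip: power_mult)
 have "?I\<^sup>2 = (\<integral>\<^sup>+x. ennreal ((norm (vel h x))\<^sup>2) * ennreal ((norm (vel k x))\<^sup>2) \<partial>lebesgue)\<^sup>2"
  by (simp add: power_mult_distrib ennreal_mult)
 also have "\<dots> \<le> (\<integral>\<^sup>+x. (ennreal ((norm (vel h x))\<^sup>2))\<^sup>2 \<partial>lebesgue) * (\<integral>\<^sup>+x. (ennreal ((norm (vel k x))\<^sup>2))\<^sup>2 \<partial>lebesgue)"
  by (intro Cauchy_Schwarz_nn_integral m)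
 also have "\<dots> \<le> ennreal (C4 * norm h ^ 4) * ennreal (C4 * norm k ^ 4)"
  by (intro mult_mono L assms) auto
 also have "\<dots> = (ennreal (C4 * (norm h * norm k)\<^sup>2))\<^sup>2"
 proof -
  have "C4 * norm h ^ 4 * (C4 * norm k ^ 4) = (C4 * (norm h * norm k)\<^sup>2)\<^sup>2"
   by (simp add: power2_eq_square power4_eq_xxxx)
  then show ?thesis using C4 by (simp add: ennreal_mult[symmetric] ennreal_power)
 qed
 finally have "?I\<^sup>2 \<le> (ennreal (C4 * (norm h * norm k)\<^sup>2))\<^sup>2" .
 then show ?thesis by (rule ennreal_power_le_imp_le) simp
qed

lemma vel_measurable: "vel h \<in> borel_measurable lebesgue" and snd_measurable: "(\<lambda>x. snd (rep h x)) \<in> borel_measurable lebesgue"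
proof -
 have "(\<lambda>x. fst (rep h x)) \<in> borel_measurable lebesgue"
  by (intro borel_measurable_continuous_on[OF continuous_on_fst[OF continuous_on_id]]) simp
 then show "vel h \<in> borel_measurable lebesgue" by (simp add: vel_def[abs_def])
 show "(\<lambda>x. snd (rep h x)) \<in> borel_measurable lebesgue"
  by (intro borel_measurable_continuous_on[OF continuous_on_snd[OF continuous_on_id]]) simp
qed

lemma grd_measurable: "grd h \<in> borel_measurable lebesgue"
 unfolding grd_def[abs_def] by (intro borel_measurable_scaleR borel_measurable_const snd_measurable)

lemma Lp2_of_nn_bound:
 fixes A :: "real^4 \<Rightarrow> 'b::euclidean_space"
 assumes m: "A \<in> borel_measurable lebesgue"
  and bound: "(\<integral>\<^sup>+x. ennreal ((norm (A x))\<^sup>2) \<partial>lebesgue) \<le> ennreal (c\<^sup>2)" and c: "0 \<le> c"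
 shows "A \<in> Lp_space 2 \<Omega>" "Lp_norm 2 \<Omega> A \<le> c"
proof -
 have mz: "zext \<Omega> A \<in> borel_measurable lebesgue"
  unfolding zext_def using m Omega_sets by (intro borel_measurable_scaleR borel_measurable_indicator) auto
 have "(\<integral>\<^sup>+x. ennreal ((norm (zext \<Omega> A x))\<^sup>2) \<partial>lebesgue) \<le> (\<integral>\<^sup>+x. ennreal ((norm (A x))\<^sup>2) \<partial>lebesgue)"
  by (intro nn_integral_mono) (auto simp: zext_def indicator_def)
 then have b: "(\<integral>\<^sup>+x. ennreal ((norm (zext \<Omega> A x))\<^sup>2) \<partial>lebesgue) \<le> ennreal (c\<^sup>2)" using bound by (rule order_trans)
 have sq: "sq_int (zext \<Omega> A)"
  unfolding sq_int_def integrable_iff_bounded using mz b by (auto intro: le_less_trans)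
 then show L: "A \<in> Lp_space 2 \<Omega>" by (simp add: sq_int_zext_iff Omega_sets)
 have "ennreal ((Lp_norm 2 \<Omega> A)\<^sup>2) \<le> ennreal (c\<^sup>2)"
  using b nn_integral_eq_integral[OF sq_intD[OF sq]] by (simp add: Lp_norm_2[OF Omega_sets L] L2_of_norm_sq[OF sq])
 then have "(Lp_norm 2 \<Omega> A)\<^sup>2 \<le> c\<^sup>2" by (subst (asm) ennreal_le_iff) auto
 then show "Lp_norm 2 \<Omega> A \<le> c" by (rule power2_le_imp_le[OF _ c])
qed

lemma nn_rep: "(\<integral>\<^sup>+x. ennreal ((norm (rep h x))\<^sup>2) \<partial>lebesgue) = ennreal ((norm h)\<^sup>2)"
 by (rule L2_norm_sq_nn)

lemma Lp_norm_grd_le: "Lp_norm 2 \<Omega> (\<lambda>x. sym_part (grd h x)) \<le> norm h / rk" "(\<lambda>x. sym_part (grd h x)) \<in> Lp_space 2 \<Omega>"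
proof -
 have pt: "(norm (sym_part (grd h x)))\<^sup>2 \<le> (1 / rk)\<^sup>2 * (norm (rep h x))\<^sup>2" for x
 proof -
  have "norm (sym_part (grd h x)) \<le> norm (grd h x)" by (rule norm_sym_part_le)
  also have "\<dots> = (1 / rk) * norm (snd (rep h x))" using rk by (simp add: grd_def)
  also have "\<dots> \<le> (1 / rk) * norm (rep h x)"
   using rk by (intro mult_left_mono) (cases "rep h x", auto simp: norm_snd_le)
  finally have "(norm (sym_part (grd h x)))\<^sup>2 \<le> ((1 / rk) * norm (rep h x))\<^sup>2" by (intro power_mono) auto
  then show ?thesis by (simp only: power_mult_distrib)
 qed
 have m: "(\<lambda>x. sym_part (grd h x)) \<in> borel_measurable lebesgue"
  by (rule borel_measurable_continuous_on[OF linear_continuous_on[OF bounded_linear_sym_part] grd_measurable])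
 have "(\<integral>\<^sup>+x. ennreal ((norm (sym_part (grd h x)))\<^sup>2) \<partial>lebesgue) \<le> (\<integral>\<^sup>+x. ennreal ((1 / rk)\<^sup>2) * ennreal ((norm (rep h x))\<^sup>2) \<partial>lebesgue)"
  using pt by (intro nn_integral_mono) (simp add: ennreal_mult[symmetric] ennreal_leI)
 also have "\<dots> = ennreal ((1 / rk)\<^sup>2) * ennreal ((norm h)\<^sup>2)"
  by (subst nn_integral_cmult) (auto simp: nn_rep)
 also have "\<dots> = ennreal ((norm h / rk)\<^sup>2)" by (simp add: ennreal_mult[symmetric] power_divide)
 finally have b: "(\<integral>\<^sup>+x. ennreal ((norm (sym_part (grd h x)))\<^sup>2) \<partial>lebesgue) \<le> ennreal ((norm h / rk)\<^sup>2)" .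
 have c: "0 \<le> norm h / rk" using rk by simp
 show "Lp_norm 2 \<Omega> (\<lambda>x. sym_part (grd h x)) \<le> norm h / rk" "(\<lambda>x. sym_part (grd h x)) \<in> Lp_space 2 \<Omega>"
  by (rule Lp2_of_nn_bound[OF m b c])+
qed

text \<open>
 The vector that represents the functional \<open>\<phi> \<mapsto> \<integral> A : \<nabla>\<phi>\<close> on pairs of functions.
\<close>

definition flux :: "(real^4 \<Rightarrow> real^4^4) \<Rightarrow> 4 pair_L2" where
 "flux A = pair_of (\<lambda>x. 0) (\<lambda>x. (1 / rk) *\<^sub>R A x)"

lemma norm_flux: "A \<in> Lp_space 2 \<Omega> \<Longrightarrow> norm (flux A) = Lp_norm 2 \<Omega> A / rk"
proof -
 assume A: "A \<in> Lp_space 2 \<Omega>"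
 have "Lp_norm 2 \<Omega> (\<lambda>x. 0 :: real^4) = 0" by (simp add: Lp_norm_def)
 then have "(norm (flux A))\<^sup>2 = (Lp_norm 2 \<Omega> A / rk)\<^sup>2"
  unfolding flux_def using A rk Lp_norm_scaleR[OF A, of "1 / rk"]
  by (subst norm_pair_of_sq) (auto simp: Lp_space_zero Lp_space_scaleR)
 then show ?thesis by (rule power2_eq_imp_eq) (use rk in \<open>auto simp: Lp_norm_nonneg\<close>)
qed

lemma flux_add:
 assumes "A \<in> Lp_space 2 \<Omega>" "B \<in> Lp_space 2 \<Omega>"
 shows "flux A + flux B = flux (\<lambda>x. A x + B x)"
 unfolding flux_def using assms
 by (simp add: pair_of_add[symmetric] Lp_space_zero Lp_space_scaleR scaleR_add_right)

lemma flux_scaleR: "A \<in> Lp_space 2 \<Omega> \<Longrightarrow> flux (\<lambda>x. c *\<^sub>R A x) = c *\<^sub>R flux A"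
 unfolding flux_def
 by (subst pair_of_scaleR[symmetric]) (auto simp: Lp_space_zero Lp_space_scaleR mult.commute)

lemma flux_diff:
 assumes "A \<in> Lp_space 2 \<Omega>" "B \<in> Lp_space 2 \<Omega>"
 shows "(\<lambda>x. A x - B x) \<in> Lp_space 2 \<Omega>" "flux A - flux B = flux (\<lambda>x. A x - B x)"
proof -
 have B: "(\<lambda>x. -1 *\<^sub>R B x) \<in> Lp_space 2 \<Omega>" by (rule Lp_space_scaleR[OF assms(2)])
 show "(\<lambda>x. A x - B x) \<in> Lp_space 2 \<Omega>" using Lp_space_add[OF assms(1) B] by simp
 show "flux A - flux B = flux (\<lambda>x. A x - B x)"
  using flux_add[OF assms(1) B] flux_scaleR[OF assms(2), of "-1"] by simp
qed

lemma flux_cong: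
 assumes "A \<in> Lp_space 2 \<Omega>" "B \<in> Lp_space 2 \<Omega>" "AE x in lebesgue_on \<Omega>. A x = B x"
 shows "flux A = flux B"
 unfolding flux_def
 by (rule pair_of_cong) (use assms in \<open>auto intro: Lp_space_zero Lp_space_scaleR elim: eventually_mono\<close>)

lemma inner_flux:
 assumes A: "A \<in> Lp_space 2 \<Omega>" and g: "g \<in> grad_space"
 shows "flux A \<bullet> g = (LINT x|lebesgue_on \<Omega>. A x \<bullet> grd g x)"
proof -
 have "flux A \<bullet> pair_of (vel g) (\<lambda>x. rk *\<^sub>R grd g x) =
   (LINT x|lebesgue_on \<Omega>. 0 \<bullet> vel g x) + (LINT x|lebesgue_on \<Omega>. ((1 / rk) *\<^sub>R A x) \<bullet> (rk *\<^sub>R grd g x))"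
  unfolding flux_def by (intro inner_pair_of Lp_space_zero Lp_space_scaleR A vel_Lp grd_Lp)
 then show ?thesis using rk g by (simp add: pair_of_vel_grd grad_space_def)
qed

lemma rep_diff_Omega:
 "AE x in lebesgue_on \<Omega>. vel (h - k) x = vel h x - vel k x"
 "AE x in lebesgue_on \<Omega>. grd (h - k) x = grd h x - grd k x"
proof -
 have ae: "AE x in lebesgue_on \<Omega>. rep (h - k) x = rep h x - rep k x"
  using rep_diff[of h k] Omega_sets by (subst AE_restrict_space_iff) (auto elim!: eventually_mono)
 then show "AE x in lebesgue_on \<Omega>. vel (h - k) x = vel h x - vel k x"
  by eventually_elim (simp add: vel_def)
 show "AE x in lebesgue_on \<Omega>. grd (h - k) x = grd h x - grd k x"
  using ae by eventually_elim (simp add: grd_def scaleR_diff_right)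
qed

definition conv :: "4 pair_L2 \<Rightarrow> 4 pair_L2 \<Rightarrow> 4 pair_L2" where
 "conv h k = flux (\<lambda>x. tensor (vel h x) (vel k x))"

lemma conv_bound:
 assumes "h \<in> Vhat" "k \<in> Vhat"
 shows "(\<lambda>x. tensor (vel h x) (vel k x)) \<in> Lp_space 2 \<Omega>"
  and "norm (conv h k) \<le> sqrt C4 / rk * (norm h * norm k)"
proof -
 have m: "(\<lambda>x. tensor (vel h x) (vel k x)) \<in> borel_measurable lebesgue"
  using borel_measurable_continuous_on[OF continuous_on_tensor borel_measurable_Pair[OF vel_measurable[of h] vel_measurable[of k]]]
  by simp
 have b: "(\<integral>\<^sup>+x. ennreal ((norm (tensor (vel h x) (vel k x)))\<^sup>2) \<partial>lebesgue) \<le> ennreal ((sqrt C4 * (norm h * norm k))\<^sup>2)"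
  using L4_product[OF assms] C4 by (simp add: norm_tensor power_mult_distrib)
 have c: "0 \<le> sqrt C4 * (norm h * norm k)" using C4 by simp
 note L = Lp2_of_nn_bound[OF m b c]
 show "(\<lambda>x. tensor (vel h x) (vel k x)) \<in> Lp_space 2 \<Omega>" by (rule L(1))
 have "norm (conv h k) = Lp_norm 2 \<Omega> (\<lambda>x. tensor (vel h x) (vel k x)) / rk"
  unfolding conv_def by (rule norm_flux[OF L(1)])
 also have "\<dots> \<le> (sqrt C4 * (norm h * norm k)) / rk" using L(2) rk by (intro divide_right_mono) auto
 finally show "norm (conv h k) \<le> sqrt C4 / rk * (norm h * norm k)" by simp
qed

lemma conv_diff:
 assumes h: "h \<in> Vhat" and k: "k \<in> Vhat"
 shows "norm (conv h h - conv k k) \<le> sqrt C4 / rk * (norm h + norm k) * norm (h - k)"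
proof -
 have d: "h - k \<in> Vhat" by (rule subspace_diff[OF subspace_Vhat h k])
 note L = conv_bound(1)[OF h h] conv_bound(1)[OF k k] conv_bound(1)[OF d h] conv_bound(1)[OF k d]
 have "conv h h - conv k k = conv (h - k) h + conv k (h - k)"
  unfolding conv_def flux_diff(2)[OF L(1,2)] flux_add[OF L(3,4)]
 proof (rule flux_cong[OF flux_diff(1)[OF L(1,2)] Lp_space_add[OF L(3,4)]])
  show "AE x in lebesgue_on \<Omega>. tensor (vel h x) (vel h x) - tensor (vel k x) (vel k x) =
    tensor (vel (h - k) x) (vel h x) + tensor (vel k x) (vel (h - k) x)"
   using rep_diff_Omega(1)[of h k] by eventually_elim (simp add: tensor_diff)
 qed
 then have "norm (conv h h - conv k k) \<le> norm (conv (h - k) h) + norm (conv k (h - k))"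
  by (simp add: norm_triangle_ineq)
 also have "\<dots> \<le> sqrt C4 / rk * (norm (h - k) * norm h) + sqrt C4 / rk * (norm k * norm (h - k))"
  by (intro add_mono conv_bound h k d)
 also have "\<dots> = sqrt C4 / rk * (norm h + norm k) * norm (h - k)" by (simp add: algebra_simps add_divide_distrib)
 finally show ?thesis .
qed

lemma conv_continuous: "continuous_on Vhat (\<lambda>h. conv h h)"
 unfolding continuous_on_def
proof
 fix h assume h: "h \<in> Vhat"
 have "((\<lambda>k. sqrt C4 / rk * (norm k + norm h) * norm (k - h)) \<longlongrightarrow> sqrt C4 / rk * (norm h + norm h) * norm (h - h)) (at h within Vhat)"
  by (intro tendsto_intros)
 then have z: "((\<lambda>k. sqrt C4 / rk * (norm k + norm h) * norm (k - h)) \<longlongrightarrow> 0) (at h within Vhat)" by simp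
 have "((\<lambda>k. norm (conv k k - conv h h)) \<longlongrightarrow> 0) (at h within Vhat)"
 proof (rule tendsto_sandwich[OF _ _ tendsto_const z])
  show "\<forall>\<^sub>F k in at h within Vhat. norm (conv k k - conv h h) \<le> sqrt C4 / rk * (norm k + norm h) * norm (k - h)"
   unfolding eventually_at_filter using conv_diff[OF _ h] by (intro always_eventually) blast
 qed simp
 then show "((\<lambda>k. conv k k) \<longlongrightarrow> conv h h) (at h within Vhat)"
  by (simp add: tendsto_norm_zero_iff LIM_zero_iff)
qed

text \<open>Both sides are continuous, so that only test fields have to be considered.\<close>

lemma conv_orthogonal:
 assumes h: "h \<in> Vhat" shows "conv h h \<bullet> h = 0"
proof -
 have test: "conv (emb \<psi>) (emb \<psi>) \<bullet> emb \<psi> = 0" if \<psi>: "\<psi> \<in> solenoidal_test \<Omega>" for \<psi>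
 proof -
  note t = solenoidal_testD[OF \<psi>]
  have V: "emb \<psi> \<in> Vhat" unfolding Vhat_def using \<psi> by (intro subsetD[OF closure_subset]) auto
  have J: "(\<lambda>x. rk *\<^sub>R jacobian \<psi> (at x)) \<in> Lp_space 2 \<Omega>" by (intro Lp_space_scaleR test_is_weak_gradient t)
  have ae: "AE x in lebesgue_on \<Omega>. vel (emb \<psi>) x = \<psi> x" "AE x in lebesgue_on \<Omega>. rk *\<^sub>R grd (emb \<psi>) x = rk *\<^sub>R jacobian \<psi> (at x)"
   unfolding emb_test[OF t] using vel_pair_of[OF test_is_weak_gradient(1)[OF t] J] by auto
  have "conv (emb \<psi>) (emb \<psi>) \<bullet> emb \<psi> = (LINT x|lebesgue_on \<Omega>. tensor (vel (emb \<psi>) x) (vel (emb \<psi>) x) \<bullet> grd (emb \<psi>) x)"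
   unfolding conv_def by (rule inner_flux[OF conv_bound(1)[OF V V] Vhat_grad[OF V]])
  also have "\<dots> = (LINT x|lebesgue_on \<Omega>. tensor (\<psi> x) (\<psi> x) \<bullet> jacobian \<psi> (at x))"
  proof (rule integral_cong_AE)
   have s: "smooth \<psi>" using t by (simp add: test_function_def)
   have c: "continuous_on UNIV (\<lambda>x. tensor (\<psi> x) (\<psi> x) \<bullet> jacobian \<psi> (at x))"
    unfolding tensor_def
    by (intro continuous_intros continuous_on_vec_lambda continuous_on_jacobian smooth_continuous s)
   have "(\<lambda>x. tensor (\<psi> x) (\<psi> x) \<bullet> jacobian \<psi> (at x)) \<in> borel_measurable lebesgue"
    by (rule continuous_borel_measurable_lebesgue[OF c])
   then show "(\<lambda>x. tensor (\<psi> x) (\<psi> x) \<bullet> jacobian \<psi> (at x)) \<in> borel_measurable (lebesgue_on \<Omega>)"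
    by (rule measurable_restrict_space1)
   show "(\<lambda>x. tensor (vel (emb \<psi>) x) (vel (emb \<psi>) x) \<bullet> grd (emb \<psi>) x) \<in> borel_measurable (lebesgue_on \<Omega>)"
    using conv_bound(1)[OF V V] measurable_restrict_space1[OF grd_measurable[of "emb \<psi>"]]
    by (intro borel_measurable_inner) (auto simp: Lp_space_def)
   show "AE x in lebesgue_on \<Omega>. tensor (vel (emb \<psi>) x) (vel (emb \<psi>) x) \<bullet> grd (emb \<psi>) x = tensor (\<psi> x) (\<psi> x) \<bullet> jacobian \<psi> (at x)"
    using ae by eventually_elim (use rk in simp)
  qed
  also have "\<dots> = 0" by (rule convection_test_zero[OF Omega_sets \<psi>])
  finally show ?thesis .
 qed
 obtain X where X: "\<And>n. X n \<in> emb ` solenoidal_test \<Omega>" "X \<longlonglongrightarrow> h"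
  using h unfolding Vhat_def closure_sequential by blast
 have XV: "X n \<in> Vhat" for n unfolding Vhat_def using X(1) by (intro subsetD[OF closure_subset])
 have "(\<lambda>n. conv (X n) (X n)) \<longlonglongrightarrow> conv h h"
  using continuous_on_tendsto_compose[OF conv_continuous X(2) h] XV by simp
 then have "(\<lambda>n. conv (X n) (X n) \<bullet> X n) \<longlonglongrightarrow> conv h h \<bullet> h" by (intro tendsto_intros X(2))
 moreover have "conv (X n) (X n) \<bullet> X n = 0" for n using X(1)[of n] test by auto
 ultimately show ?thesis by (simp add: LIMSEQ_const_iff)
qed

definition visc :: "4 pair_L2 \<Rightarrow> 4 pair_L2" where
 "visc h = flux (\<lambda>x. stress p (sym_part (grd h x)))"

lemma stress_Lp: "(\<lambda>x. stress p (sym_part (grd h x))) \<in> Lp_space 2 \<Omega>"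
proof -
 have q: "0 < 2 * (p - 1)" "2 * (p - 1) \<le> 2" using p by auto
 note D = Lp_space_nested(1)[OF Omega_lmeasurable q Lp_norm_grd_le(2)[of h]]
 have "(\<lambda>x. stress p (sym_part (grd h x))) \<in> borel_measurable (lebesgue_on \<Omega>)"
  by (rule borel_measurable_continuous_on[OF continuous_on_stress[OF p]]) (use D in \<open>simp add: Lp_space_def\<close>)
 moreover have "norm (stress p (sym_part (grd h x))) powr 2 = norm (sym_part (grd h x)) powr (2 * (p - 1))" for x
  by (simp add: norm_stress[OF p(1)] powr_powr mult.commute)
 ultimately show ?thesis using D by (simp add: Lp_space_def)
qed

definition Cv :: real where
 "Cv = 2 * sqrt (measure lebesgue \<Omega> + 1) * (1 / rk) powr (p - 1) / rk"

lemma Cv: "Cv \<ge> 0" using rk by (simp add: Cv_def)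

text \<open>
 The stress is Hoelder continuous, and \<open>L\<^sup>2\<close> is contained in the Lebesgue space with exponent
 \<open>2 (p - 1)\<close>.
\<close>

lemma visc_diff: "norm (visc h - visc k) \<le> Cv * norm (h - k) powr (p - 1)"
proof -
 let ?S = "\<lambda>h x. stress p (sym_part (grd h x))"
 let ?m = "measure lebesgue \<Omega> + 1"
 let ?q = "2 * (p - 1)"
 have q: "0 < ?q" "?q \<le> 2" using p by auto
 note L = flux_diff[OF stress_Lp[of h] stress_Lp[of k]]
 note D = Lp_space_nested[OF Omega_lmeasurable q Lp_norm_grd_le(2)[of "h - k"]]
 have i1: "integrable (lebesgue_on \<Omega>) (\<lambda>x. norm (?S h x - ?S k x) powr 2)" using L(1) by (simp add: Lp_space_def)
 have i2: "integrable (lebesgue_on \<Omega>) (\<lambda>x. 4 * norm (sym_part (grd (h - k) x)) powr ?q)" using D(1) by (simp add: Lp_space_def)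
 have "(LINT x|lebesgue_on \<Omega>. norm (?S h x - ?S k x) powr 2) \<le> (LINT x|lebesgue_on \<Omega>. 4 * norm (sym_part (grd (h - k) x)) powr ?q)"
 proof (rule integral_mono_AE[OF i1 i2])
  show "AE x in lebesgue_on \<Omega>. norm (?S h x - ?S k x) powr 2 \<le> 4 * norm (sym_part (grd (h - k) x)) powr ?q"
   using rep_diff_Omega(2)[of h k]
  proof eventually_elim
   case (elim x)
   have "norm (?S h x - ?S k x) \<le> 2 * norm (sym_part (grd h x) - sym_part (grd k x)) powr (p - 1)"
    by (rule stress_holder[OF p])
   also have "sym_part (grd h x) - sym_part (grd k x) = sym_part (grd (h - k) x)"
    unfolding elim by (rule linear_diff[OF bounded_linear.linear[OF bounded_linear_sym_part], symmetric])
   finally have "norm (?S h x - ?S k x) powr 2 \<le> (2 * norm (sym_part (grd (h - k) x)) powr (p - 1)) powr 2"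
    by (intro powr_mono2) auto
   also have "\<dots> = 4 * norm (sym_part (grd (h - k) x)) powr ?q"
    by (simp add: powr_mult powr_powr mult.commute)
   finally show ?case .
  qed
 qed
 also have "\<dots> \<le> 4 * (?m * Lp_norm 2 \<Omega> (\<lambda>x. sym_part (grd (h - k) x)) powr ?q)" using D(2) by simp
 also have "\<dots> \<le> 4 * (?m * (norm (h - k) / rk) powr ?q)"
  using Lp_norm_grd_le(1)[of "h - k"] q by (intro mult_left_mono powr_mono2) (auto simp: Lp_norm_nonneg)
 finally have b: "(LINT x|lebesgue_on \<Omega>. norm (?S h x - ?S k x) powr 2) \<le> 4 * (?m * (norm (h - k) / rk) powr ?q)" .
 have "Lp_norm 2 \<Omega> (\<lambda>x. ?S h x - ?S k x) \<le> sqrt (4 * (?m * (norm (h - k) / rk) powr ?q))"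
  using real_sqrt_le_mono[OF b] by (simp add: Lp_norm_def powr_half_sqrt)
 also have "\<dots> = 2 * sqrt ?m * (norm (h - k) / rk) powr (p - 1)"
 proof -
  have "(norm (h - k) / rk) powr ?q = ((norm (h - k) / rk) powr (p - 1))\<^sup>2"
   by (simp add: powr_2_eq[symmetric] powr_powr mult.commute)
  then show ?thesis by (simp add: real_sqrt_mult)
 qed
 also have "\<dots> = 2 * sqrt ?m * (1 / rk) powr (p - 1) * norm (h - k) powr (p - 1)"
  using rk by (simp add: powr_divide)
 finally have "Lp_norm 2 \<Omega> (\<lambda>x. ?S h x - ?S k x) / rk \<le> 2 * sqrt ?m * (1 / rk) powr (p - 1) * norm (h - k) powr (p - 1) / rk"
  using rk by (intro divide_right_mono) auto
 then show ?thesis unfolding visc_def L(2) norm_flux[OF L(1)] Cv_def by simp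
qed

lemma visc_zero: "visc 0 = 0"
proof -
 have "AE x in lebesgue. rep (0 :: 4 pair_L2) x = 0"
  using rep_L2_of[of "\<lambda>x::real^4. 0 :: (real^4) \<times> (real^4^4)"] by (simp add: L2_zero[symmetric])
 then have "AE x in lebesgue_on \<Omega>. rep (0 :: 4 pair_L2) x = 0"
  using Omega_sets by (subst AE_restrict_space_iff) (auto elim!: eventually_mono)
 then have "AE x in lebesgue_on \<Omega>. stress p (sym_part (grd 0 x)) = (\<lambda>x. 0) x"
 proof eventually_elim
  case (elim x)
  then have "grd 0 x = 0" by (simp add: grd_def)
  then show ?case by (simp add: stress_def linear_0[OF bounded_linear.linear[OF bounded_linear_sym_part]])
 qed
 then have "visc 0 = flux (\<lambda>x. 0)" unfolding visc_def by (intro flux_cong stress_Lp Lp_space_zero)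
 also have "\<dots> = 0" using norm_flux[OF Lp_space_zero] by (simp add: Lp_norm_def)
 finally show ?thesis .
qed

lemma visc_monotone:
 assumes "h \<in> grad_space" "k \<in> grad_space" shows "0 \<le> (visc h - visc k) \<bullet> (h - k)"
proof -
 note L = flux_diff[OF stress_Lp[of h] stress_Lp[of k]]
 have g: "h - k \<in> grad_space" by (rule subspace_diff[OF grad_space_subspace assms])
 have "(visc h - visc k) \<bullet> (h - k) =
   (LINT x|lebesgue_on \<Omega>. (stress p (sym_part (grd h x)) - stress p (sym_part (grd k x))) \<bullet> grd (h - k) x)"
  unfolding visc_def L(2) by (rule inner_flux[OF L(1) g])
 also have "\<dots> \<ge> 0"
 proof (rule integral_nonneg_AE)
  show "AE x in lebesgue_on \<Omega>. 0 \<le> (stress p (sym_part (grd h x)) - stress p (sym_part (grd k x))) \<bullet> grd (h - k) x"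
   using rep_diff_Omega(2)[of h k]
  proof eventually_elim
   case (elim x)
   let ?A = "grd h x" and ?B = "grd k x"
   have "(stress p (sym_part ?A) - stress p (sym_part ?B)) \<bullet> (?A - ?B) =
     (stress p (sym_part ?A) - stress p (sym_part ?B)) \<bullet> sym_part (?A - ?B)"
    by (simp add: inner_diff_left stress_inner_sym_part)
   also have "sym_part (?A - ?B) = sym_part ?A - sym_part ?B"
    by (rule linear_diff[OF bounded_linear.linear[OF bounded_linear_sym_part]])
   finally show ?case using stress_monotone[OF p(1), of "sym_part ?A" "sym_part ?B"] elim by simp
  qed
 qed
 finally show ?thesis .
qed

text \<open>
 The projection in the argument extends the map from \<open>Vhat\<close> to the whole Hilbert space with the
 same estimates.
\<close>

definition rhs :: "4 pair_L2 \<Rightarrow> 4 pair_L2" where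
 "rhs h = proj Vhat (conv (proj Vhat h) (proj Vhat h) - \<nu> *\<^sub>R visc (proj Vhat h))"

lemma rhs_in: "rhs h \<in> Vhat" by (simp add: rhs_def)

lemma rhs_inner: "rhs h \<bullet> k = (conv (proj Vhat h) (proj Vhat h) - \<nu> *\<^sub>R visc (proj Vhat h)) \<bullet> proj Vhat k"
 using V.proj_orth[OF rhs_in, of h k] unfolding rhs_def
 by (metis V.proj_in V.proj_inner inner_commute)

lemma rhs_diff_norm:
 "norm (rhs h - rhs k) \<le> sqrt C4 / rk * (norm h + norm k) * norm (h - k) + \<nu> * Cv * norm (h - k) powr (p - 1)"
proof -
 let ?h = "proj Vhat h" and ?k = "proj Vhat k"
 have lin: "proj Vhat (h - k) = ?h - ?k" by (rule linear_diff[OF V.proj_linear])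
 then have d: "norm (?h - ?k) \<le> norm (h - k)" using V.proj_norm_le[of "h - k"] by simp
 have "rhs h - rhs k = proj Vhat ((conv ?h ?h - conv ?k ?k) - \<nu> *\<^sub>R (visc ?h - visc ?k))"
  unfolding rhs_def linear_diff[OF V.proj_linear, symmetric] by (simp add: algebra_simps)
 then have "norm (rhs h - rhs k) \<le> norm ((conv ?h ?h - conv ?k ?k) - \<nu> *\<^sub>R (visc ?h - visc ?k))"
  using V.proj_norm_le by metis
 also have "\<dots> \<le> norm (conv ?h ?h - conv ?k ?k) + \<nu> * norm (visc ?h - visc ?k)"
  using norm_triangle_ineq4[of "conv ?h ?h - conv ?k ?k" "\<nu> *\<^sub>R (visc ?h - visc ?k)"] nu_pos by simp
 also have "\<dots> \<le> sqrt C4 / rk * (norm ?h + norm ?k) * norm (?h - ?k) + \<nu> * (Cv * norm (?h - ?k) powr (p - 1))"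
  using nu_pos by (intro add_mono mult_left_mono conv_diff visc_diff) auto
 also have "\<dots> \<le> sqrt C4 / rk * (norm h + norm k) * norm (h - k) + \<nu> * (Cv * norm (h - k) powr (p - 1))"
  using nu_pos Cv C4 rk p d V.proj_norm_le
  by (intro add_mono mult_mono mult_left_mono powr_mono2 add_nonneg_nonneg) auto
 finally show ?thesis by simp
qed

lemma rhs_uniformly_continuous: "uniformly_continuous_on (cball 0 R) rhs"
 unfolding uniformly_continuous_on_def
proof (intro allI impI)
 fix e :: real assume e: "e > 0"
 define R' where "R' = \<bar>R\<bar>"
 define b where "b s = sqrt C4 / rk * (R' + R') * s + \<nu> * Cv * s powr (p - 1)" for s
 have "(b \<longlongrightarrow> sqrt C4 / rk * (R' + R') * 0 + \<nu> * Cv * 0 powr (p - 1)) (at_right 0)"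
  unfolding b_def by (intro tendsto_intros tendsto_powr2) (use p in \<open>auto simp: eventually_at_filter\<close>)
 then have "(b \<longlongrightarrow> 0) (at_right 0)" by simp
 then have "\<forall>\<^sub>F s in at_right 0. b s < e" using e by (rule order_tendstoD)
 then obtain d where d: "d > 0" "\<And>s. 0 < s \<Longrightarrow> s < d \<Longrightarrow> b s < e"
  unfolding eventually_at_right_field by auto
 have "dist (rhs k) (rhs h) < e" if "h \<in> cball 0 R" "k \<in> cball 0 R" "dist k h < d" for h k
 proof (cases "k = h")
  case False
  have "norm (rhs k - rhs h) \<le> sqrt C4 / rk * (norm k + norm h) * norm (k - h) + \<nu> * Cv * norm (k - h) powr (p - 1)"
   by (rule rhs_diff_norm)
  also have "\<dots> \<le> b (norm (k - h))"
   unfolding b_def R'_def using that C4 rk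
   by (intro add_right_mono mult_right_mono mult_left_mono add_mono) (auto simp: dist_norm)
  also have "\<dots> < e" using False that by (intro d(2)) (auto simp: dist_norm)
  finally show ?thesis by (simp add: dist_norm)
 qed (use e in simp)
 with d(1) show "\<exists>d>0. \<forall>x\<in>cball 0 R. \<forall>x'\<in>cball 0 R. dist x' x < d \<longrightarrow> dist (rhs x') (rhs x) < e" by blast
qed

lemma rhs_growth: "norm (rhs h) \<le> (sqrt C4 / rk + \<nu> * Cv) * (1 + (norm h)\<^sup>2)"
proof -
 have z: "rhs 0 = 0"
  using conv_bound(2)[OF subspace_0[OF subspace_Vhat] subspace_0[OF subspace_Vhat]]
  by (simp add: rhs_def linear_0[OF V.proj_linear] visc_zero)
 have pw: "norm h powr (p - 1) \<le> 1 + (norm h)\<^sup>2"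
  using powr_le_one_add[of "p - 1" 2 "norm h"] p by (simp add: powr_2_eq)
 have "norm (rhs h) \<le> sqrt C4 / rk * (norm h * norm h) + \<nu> * Cv * norm h powr (p - 1)"
  using rhs_diff_norm[of h 0] by (simp add: z mult.assoc)
 also have "\<dots> \<le> sqrt C4 / rk * (1 + (norm h)\<^sup>2) + \<nu> * Cv * (1 + (norm h)\<^sup>2)"
  using C4 rk Cv nu_pos pw by (intro add_mono mult_left_mono) (auto simp: power2_eq_square)
 finally show ?thesis by (simp add: algebra_simps)
qed

lemma rhs_dissipative: "rhs h \<bullet> h \<le> 0"
proof -
 let ?h = "proj Vhat h"
 have "0 \<le> (visc ?h - visc 0) \<bullet> (?h - 0)"
  by (intro visc_monotone Vhat_grad subspace_0[OF subspace_Vhat]) auto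
 then have "0 \<le> \<nu> * (visc ?h \<bullet> ?h)" using nu_pos by (simp add: visc_zero)
 then show ?thesis unfolding rhs_inner by (simp add: inner_diff_left conv_orthogonal)
qed

text \<open>Convection is Lipschitz on bounded sets, and the monotone viscous term has a favourable sign.\<close>

lemma rhs_one_sided:
 "\<exists>L\<ge>0. \<forall>h\<in>cball 0 R. \<forall>k\<in>cball 0 R. (rhs h - rhs k) \<bullet> (h - k) \<le> L * (norm (h - k))\<^sup>2"
proof (intro exI[of _ "sqrt C4 / rk * (\<bar>R\<bar> + \<bar>R\<bar>)"] conjI ballI)
 show "0 \<le> sqrt C4 / rk * (\<bar>R\<bar> + \<bar>R\<bar>)" using C4 rk by simp
 fix h k :: "4 pair_L2" assume hk: "h \<in> cball 0 R" "k \<in> cball 0 R"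
 let ?h = "proj Vhat h" and ?k = "proj Vhat k"
 have lin: "proj Vhat (h - k) = ?h - ?k" by (rule linear_diff[OF V.proj_linear])
 then have d: "norm (?h - ?k) \<le> norm (h - k)" using V.proj_norm_le[of "h - k"] by simp
 have "(rhs h - rhs k) \<bullet> (h - k) = (conv ?h ?h - conv ?k ?k) \<bullet> (?h - ?k) - \<nu> * ((visc ?h - visc ?k) \<bullet> (?h - ?k))"
  unfolding inner_diff_left rhs_inner lin by (simp add: inner_diff_left algebra_simps)
 also have "\<dots> \<le> (conv ?h ?h - conv ?k ?k) \<bullet> (?h - ?k)"
  using visc_monotone[of ?h ?k] nu_pos by (simp add: Vhat_grad)
 also have "\<dots> \<le> norm (conv ?h ?h - conv ?k ?k) * norm (?h - ?k)" by (rule norm_cauchy_schwarz)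
 also have "\<dots> \<le> (sqrt C4 / rk * (norm ?h + norm ?k) * norm (?h - ?k)) * norm (?h - ?k)"
  by (intro mult_right_mono conv_diff) auto
 also have "\<dots> \<le> (sqrt C4 / rk * (\<bar>R\<bar> + \<bar>R\<bar>) * norm (h - k)) * norm (h - k)"
 proof -
  have "norm ?h \<le> \<bar>R\<bar>" "norm ?k \<le> \<bar>R\<bar>"
   using V.proj_norm_le[of h] V.proj_norm_le[of k] hk by auto
  then show ?thesis using C4 rk d by (intro mult_mono add_mono mult_left_mono mult_nonneg_nonneg) auto
 qed
 finally show "(rhs h - rhs k) \<bullet> (h - k) \<le> sqrt C4 / rk * (\<bar>R\<bar> + \<bar>R\<bar>) * (norm (h - k))\<^sup>2"
  by (simp add: power2_eq_square mult.assoc)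
qed

theorem voigt_ode:
 fixes G :: "real \<Rightarrow> 4 pair_L2"
 assumes "continuous_on {0..T} G" "T > 0"
 shows "\<exists>v. continuous_on {0..T} v \<and> (\<forall>t\<in>{0..T}. v t = G t + integral {0..t} (\<lambda>s. rhs (v s)))"
proof (rule ode_dissipative[where F=rhs])
 show "uniformly_continuous_on (cball 0 R) rhs" for R by (rule rhs_uniformly_continuous)
 show "norm (rhs x) \<le> (sqrt C4 / rk + \<nu> * Cv) * (1 + (norm x)\<^sup>2)" for x by (rule rhs_growth)
 show "0 \<le> sqrt C4 / rk + \<nu> * Cv" using C4 rk Cv nu_pos by simp
 show "rhs x \<bullet> x \<le> 0" for x by (rule rhs_dissipative)
qed (rule rhs_one_sided assms)+

end

section \<open>Strongly measurable curves in a Hilbert space\<close>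

abbreviation time_measure :: "real \<Rightarrow> real measure" where
 "time_measure T \<equiv> lebesgue_on {0<..<T}"

lemma time_measure_finite: "finite_measure (time_measure T)"
 by (rule finite_measure_lebesgue_on) simp

lemma borel_measurable_lebesgue_on_AE:
 fixes f g :: "'a::euclidean_space \<Rightarrow> 'b::euclidean_space"
 assumes S: "S \<in> sets lebesgue" and f: "f \<in> borel_measurable (lebesgue_on S)" and ae: "AE x in lebesgue_on S. g x = f x"
 shows "g \<in> borel_measurable (lebesgue_on S)"
proof -
 have "AE x in lebesgue. zext S g x = zext S f x" using ae by (simp add: AE_zext_iff S)
 moreover have "zext S f \<in> borel_measurable lebesgue" using f by (simp add: zext_measurable_iff S)
 ultimately have "zext S g \<in> borel_measurable lebesgue" by (rule borel_measurable_lebesgue_AE[rotated])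
 then show ?thesis by (simp add: zext_measurable_iff S)
qed

lemma AE_limit_measurable:
 fixes u :: "nat \<Rightarrow> real \<Rightarrow> real"
 assumes "\<And>n. u n \<in> borel_measurable (time_measure T)" "AE t in time_measure T. (\<lambda>n. u n t) \<longlonglongrightarrow> g t"
 shows "g \<in> borel_measurable (time_measure T)"
proof (rule borel_measurable_lebesgue_on_AE)
 show "(\<lambda>t. lim (\<lambda>n. u n t)) \<in> borel_measurable (time_measure T)"
  by (rule borel_measurable_lim_metric) (rule assms)
 show "AE t in time_measure T. g t = lim (\<lambda>n. u n t)"
  using assms(2) by eventually_elim (simp add: limI)
qed simp

text \<open>
 The approximants are dominated as well as convergent, so that they also converge in mean and
 their integrals converge.
\<close>

definition approximated ::
  "real \<Rightarrow> 'h::{real_inner,banach} set \<Rightarrow> (real \<Rightarrow> real) \<Rightarrow> (real \<Rightarrow> 'h) \<Rightarrow> (nat \<Rightarrow> real \<Rightarrow> 'h) \<Rightarrow> bool" where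
 "approximated T S B g s \<longleftrightarrow>
   (\<forall>n. simple_function (time_measure T) (s n) \<and> s n ` space (time_measure T) \<subseteq> S) \<and>
   (AE t in time_measure T. (\<lambda>n. s n t) \<longlonglongrightarrow> g t) \<and>
   (\<forall>n. \<forall>t\<in>{0<..<T}. norm (s n t) \<le> B t) \<and> integrable (time_measure T) B"

lemma approximatedD:
 assumes "approximated T S B g s"
 shows "simple_function (time_measure T) (s n)" "t \<in> {0<..<T} \<Longrightarrow> s n t \<in> S"
  "AE t in time_measure T. (\<lambda>n. s n t) \<longlonglongrightarrow> g t"
  "t \<in> {0<..<T} \<Longrightarrow> norm (s n t) \<le> B t" "integrable (time_measure T) B"
 using assms by (auto simp: approximated_def image_subset_iff)

lemma AE_timeI: "(\<And>t. t \<in> {0<..<T} \<Longrightarrow> P t) \<Longrightarrow> AE t in time_measure T. P t"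
 by (rule AE_I2) simp

lemma AE_time_space: "AE t in time_measure T. t \<in> {0<..<T}"
 by (rule AE_timeI)

lemma approximated_bound:
 assumes "approximated T S B g s" shows "AE t in time_measure T. norm (g t) \<le> B t"
 using approximatedD(3)[OF assms] AE_time_space
proof eventually_elim
 case (elim t)
 show ?case
  by (rule tendsto_upperbound[OF tendsto_norm[OF elim(1)]])
    (use approximatedD(4)[OF assms elim(2)] in auto)
qed

lemma approximated_closed:
 assumes "approximated T S B g s" "closed S" shows "AE t in time_measure T. g t \<in> S"
 using approximatedD(3)[OF assms(1)] AE_time_space
proof eventually_elim
 case (elim t)
 show ?case
  by (rule closed_sequentially[OF assms(2) _ elim(1)]) (rule approximatedD(2)[OF assms(1) elim(2)])
qed

lemma simple_measurable: "simple_function M f \<Longrightarrow> f \<in> borel_measurable M" for f :: "'a \<Rightarrow> real"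
 by (rule borel_measurable_simple_function)

lemma approximated_compose_measurable:
 fixes c :: "'h::{real_inner,banach} \<Rightarrow> real"
 assumes a: "approximated T S B g s" and S: "closed S" and c: "continuous_on S c"
 shows "(\<lambda>t. c (g t)) \<in> borel_measurable (time_measure T)"
proof (rule AE_limit_measurable)
 show "(\<lambda>t. c (s n t)) \<in> borel_measurable (time_measure T)" for n
  using simple_function_compose[OF approximatedD(1)[OF a, of n], of c] by (intro simple_measurable) (simp add: o_def)
 show "AE t in time_measure T. (\<lambda>n. c (s n t)) \<longlonglongrightarrow> c (g t)"
  using approximatedD(3)[OF a] approximated_closed[OF a S] AE_time_space
 proof eventually_elim
  case (elim t)
  show ?case by (rule continuous_on_tendsto_compose[OF c elim(1,2)]) (use approximatedD(2)[OF a elim(3)] in auto)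
 qed
qed

lemma simple_inner_measurable:
 fixes s \<phi> :: "real \<Rightarrow> 'h::{real_inner,banach}"
 assumes s: "simple_function (time_measure T) s" and \<phi>: "continuous_on {0..T} \<phi>"
 shows "(\<lambda>t. s t \<bullet> \<phi> t) \<in> borel_measurable (time_measure T)"
proof -
 let ?M = "time_measure T"
 have fin: "finite (s ` space ?M)" and m: "\<And>y. y \<in> s ` space ?M \<Longrightarrow> s -` {y} \<inter> space ?M \<in> sets ?M"
  using s by (auto simp: simple_function_def)
 have cm: "(\<lambda>t. y \<bullet> \<phi> t) \<in> borel_measurable ?M" for y
 proof -
  have "continuous_on {0<..<T} (\<lambda>t. y \<bullet> \<phi> t)"
   by (intro continuous_intros continuous_on_subset[OF \<phi>]) auto
  then show ?thesis by (rule continuous_imp_measurable_on_sets_lebesgue) simp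
 qed
 have "(\<lambda>t. \<Sum>y\<in>s ` space ?M. indicator (s -` {y} \<inter> space ?M) t * (y \<bullet> \<phi> t)) \<in> borel_measurable ?M"
  by (intro borel_measurable_sum borel_measurable_times borel_measurable_indicator m cm)
 moreover have "(\<Sum>y\<in>s ` space ?M. indicator (s -` {y} \<inter> space ?M) t * (y \<bullet> \<phi> t)) = s t \<bullet> \<phi> t" if "t \<in> space ?M" for t
 proof -
  have "(\<Sum>y\<in>s ` space ?M. indicator (s -` {y} \<inter> space ?M) t * (y \<bullet> \<phi> t)) =
    (\<Sum>y\<in>s ` space ?M. if y = s t then s t \<bullet> \<phi> t else 0)"
   by (rule sum.cong) (use that in \<open>auto simp: indicator_def\<close>)
  also have "\<dots> = s t \<bullet> \<phi> t" using fin that by simp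
  finally show ?thesis .
 qed
 ultimately show ?thesis by (subst measurable_cong[symmetric]) auto
qed

lemma approximated_inner:
 fixes \<phi> :: "real \<Rightarrow> 'h::{real_inner,banach}"
 assumes a: "approximated T S B g s" and \<phi>: "continuous_on {0..T} \<phi>"
 shows "integrable (time_measure T) (\<lambda>t. g t \<bullet> \<phi> t)" "integrable (time_measure T) (\<lambda>t. s n t \<bullet> \<phi> t)"
  "(\<lambda>n. LINT t|time_measure T. s n t \<bullet> \<phi> t) \<longlonglongrightarrow> (LINT t|time_measure T. g t \<bullet> \<phi> t)"
proof -
 obtain C where C: "\<forall>t\<in>{0..T}. norm (\<phi> t) \<le> C"
  using compact_imp_bounded[OF compact_continuous_image[OF \<phi> compact_Icc]] unfolding bounded_iff by auto
 have sm: "(\<lambda>t. s n t \<bullet> \<phi> t) \<in> borel_measurable (time_measure T)" for n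
  by (rule simple_inner_measurable[OF approximatedD(1)[OF a] \<phi>])
 have lim: "AE t in time_measure T. (\<lambda>n. s n t \<bullet> \<phi> t) \<longlonglongrightarrow> g t \<bullet> \<phi> t"
  using approximatedD(3)[OF a] by eventually_elim (intro tendsto_intros)
 have gm: "(\<lambda>t. g t \<bullet> \<phi> t) \<in> borel_measurable (time_measure T)" by (rule AE_limit_measurable[OF sm lim])
 have iB: "integrable (time_measure T) (\<lambda>t. B t * C)" using approximatedD(5)[OF a] by simp
 have bd: "AE t in time_measure T. norm (s n t \<bullet> \<phi> t) \<le> B t * C" for n
 proof (rule AE_timeI)
  fix t assume t: "t \<in> {0<..<T}"
  have "norm (s n t \<bullet> \<phi> t) \<le> norm (s n t) * norm (\<phi> t)" by (simp add: Cauchy_Schwarz_ineq2)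
  also have "\<dots> \<le> B t * C"
   using approximatedD(4)[OF a t, of n] C t order_trans[OF norm_ge_zero approximatedD(4)[OF a t]]
   by (intro mult_mono) (auto intro: order_trans)
  finally show "norm (s n t \<bullet> \<phi> t) \<le> B t * C" .
 qed
 show "integrable (time_measure T) (\<lambda>t. g t \<bullet> \<phi> t)"
  by (rule integrable_dominated_convergence[OF gm sm iB lim bd])
 show "integrable (time_measure T) (\<lambda>t. s n t \<bullet> \<phi> t)"
  by (rule integrable_dominated_convergence2[OF gm sm iB lim bd])
 show "(\<lambda>n. LINT t|time_measure T. s n t \<bullet> \<phi> t) \<longlonglongrightarrow> (LINT t|time_measure T. g t \<bullet> \<phi> t)"
  by (rule integral_dominated_convergence[OF gm sm iB lim bd])
qed

lemma approximated_mean: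
 assumes a: "approximated T S B g s"
 shows "(\<lambda>t. norm (s n t - g t)) \<in> borel_measurable (time_measure T)"
  and "integrable (time_measure T) (\<lambda>t. norm (s n t - g t))"
  and "(\<lambda>n. LINT t|time_measure T. norm (s n t - g t)) \<longlonglongrightarrow> 0"
proof -
 have m: "(\<lambda>t. norm (s n t - g t)) \<in> borel_measurable (time_measure T)" for n
 proof (rule AE_limit_measurable)
  show "(\<lambda>t. norm (s n t - s k t)) \<in> borel_measurable (time_measure T)" for k
   using simple_function_compose2[OF approximatedD(1)[OF a, of n] approximatedD(1)[OF a, of k], of "\<lambda>x y. norm (x - y)"]
   by (rule simple_measurable)
  show "AE t in time_measure T. (\<lambda>k. norm (s n t - s k t)) \<longlonglongrightarrow> norm (s n t - g t)"
   using approximatedD(3)[OF a] by eventually_elim (intro tendsto_intros)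
 qed
 then show "(\<lambda>t. norm (s n t - g t)) \<in> borel_measurable (time_measure T)" .
 have iB: "integrable (time_measure T) (\<lambda>t. B t + B t)" using approximatedD(5)[OF a] by simp
 have bd: "AE t in time_measure T. norm (norm (s n t - g t)) \<le> B t + B t" for n
  using approximated_bound[OF a] AE_time_space
 proof eventually_elim
  case (elim t)
  show ?case
   using norm_triangle_ineq4[of "s n t" "g t"] approximatedD(4)[OF a elim(2), of n] elim(1) by simp
 qed
 have lim: "AE t in time_measure T. (\<lambda>n. norm (s n t - g t)) \<longlonglongrightarrow> 0"
  using approximatedD(3)[OF a] by eventually_elim (simp add: tendsto_norm_zero_iff LIM_zero_iff)
 show "integrable (time_measure T) (\<lambda>t. norm (s n t - g t))"
  by (rule integrable_dominated_convergence2[OF _ m iB lim bd]) simp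
 show "(\<lambda>n. LINT t|time_measure T. norm (s n t - g t)) \<longlonglongrightarrow> 0"
  using integral_dominated_convergence[OF _ m iB lim bd] by simp
qed

definition simple_sum :: "real \<Rightarrow> (real \<Rightarrow> 'h::{real_inner,banach}) \<Rightarrow> 'h" where
 "simple_sum T s = (\<Sum>y\<in>s ` space (time_measure T). measure (time_measure T) {t \<in> space (time_measure T). s t = y} *\<^sub>R y)"

lemma simple_sum_inner:
 assumes s: "simple_function (time_measure T) s"
 shows "simple_sum T s \<bullet> \<psi> = (LINT t|time_measure T. s t \<bullet> \<psi>)"
proof -
 let ?M = "time_measure T"
 interpret finite_measure ?M by (rule time_measure_finite)
 let ?A = "\<lambda>y. {t \<in> space ?M. s t = y}"
 have fin: "finite (s ` space ?M)" and m: "\<And>y. y \<in> s ` space ?M \<Longrightarrow> ?A y \<in> sets ?M"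
  using s by (auto simp: simple_function_def vimage_def Int_def conj_commute)
 have "(LINT t|?M. s t \<bullet> \<psi>) = (LINT t|?M. (\<Sum>y\<in>s ` space ?M. indicator (?A y) t * (y \<bullet> \<psi>)))"
 proof (rule Bochner_Integration.integral_cong[OF refl])
  fix t assume t: "t \<in> space ?M"
  have "(\<Sum>y\<in>s ` space ?M. indicator (?A y) t * (y \<bullet> \<psi>)) = (\<Sum>y\<in>s ` space ?M. if y = s t then s t \<bullet> \<psi> else 0)"
   by (rule sum.cong) (use t in \<open>auto simp: indicator_def\<close>)
  also have "\<dots> = s t \<bullet> \<psi>" using fin t by simp
  finally show "s t \<bullet> \<psi> = (\<Sum>y\<in>s ` space ?M. indicator (?A y) t * (y \<bullet> \<psi>))" by simp
 qed
 also have "\<dots> = (\<Sum>y\<in>s ` space ?M. measure ?M (?A y) * (y \<bullet> \<psi>))"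
 proof (subst Bochner_Integration.integral_sum)
  fix y assume "y \<in> s ` space ?M"
  then show "integrable ?M (\<lambda>t. indicator (?A y) t * (y \<bullet> \<psi>))" using m by (intro integrable_mult_left integrable_real_indicator) (auto simp: less_top[symmetric])
 next
  show "(\<Sum>y\<in>s ` space ?M. LINT t|?M. indicator (?A y) t * (y \<bullet> \<psi>)) = (\<Sum>y\<in>s ` space ?M. measure ?M (?A y) * (y \<bullet> \<psi>))"
  proof (rule sum.cong[OF refl])
   fix y
   have eq: "?A y \<inter> space ?M = ?A y" by auto
   have "(LINT t|?M. indicator (?A y) t * (y \<bullet> \<psi>)) = measure ?M (?A y \<inter> space ?M) * (y \<bullet> \<psi>)" by simp
   then show "(LINT t|?M. indicator (?A y) t * (y \<bullet> \<psi>)) = measure ?M (?A y) * (y \<bullet> \<psi>)" unfolding eq .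
  qed
 qed
 finally show ?thesis by (simp add: simple_sum_def inner_sum_left)
qed

lemma norm_le_of_inner_bound: "(\<And>\<psi>. x \<bullet> \<psi> \<le> K * norm \<psi>) \<Longrightarrow> 0 \<le> K \<Longrightarrow> norm x \<le> K" for x :: "'h::real_inner"
proof (cases "x = 0")
 case False
 assume "\<And>\<psi>. x \<bullet> \<psi> \<le> K * norm \<psi>"
 then have "norm x * norm x \<le> K * norm x" by (metis dot_square_norm power2_eq_square)
 then show ?thesis using False by simp
qed simp

text \<open>
 The integral of a strongly measurable curve is characterised by its inner products; it is the
 limit of the integrals of any dominated sequence of simple approximants.
\<close>

lemma approximated_integral:
 fixes g :: "real \<Rightarrow> 'h::{real_inner,banach}"
 assumes a: "approximated T S B g s"
 obtains I where "\<And>\<psi>. I \<bullet> \<psi> = (LINT t|time_measure T. g t \<bullet> \<psi>)" "(\<lambda>n. simple_sum T (s n)) \<longlonglongrightarrow> I"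
  "norm I \<le> (LINT t|time_measure T. B t)"
proof -
 define e where "e n = (LINT t|time_measure T. norm (s n t - g t))" for n
 note M = approximated_mean[OF a]
 note inn = approximated_inner[OF a continuous_on_const]
 have e0: "0 \<le> e n" for n by (simp add: e_def)
 have close: "\<bar>simple_sum T (s n) \<bullet> \<psi> - (LINT t|time_measure T. g t \<bullet> \<psi>)\<bar> \<le> e n * norm \<psi>" for n \<psi>
 proof -
  have "simple_sum T (s n) \<bullet> \<psi> - (LINT t|time_measure T. g t \<bullet> \<psi>) = (LINT t|time_measure T. (s n t - g t) \<bullet> \<psi>)"
   unfolding simple_sum_inner[OF approximatedD(1)[OF a]] inner_diff_left
   by (rule Bochner_Integration.integral_diff[symmetric]) (rule inn)+
  also have "\<bar>\<dots>\<bar> \<le> (LINT t|time_measure T. \<bar>(s n t - g t) \<bullet> \<psi>\<bar>)" by (rule integral_abs_bound)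
  also have "\<dots> \<le> (LINT t|time_measure T. norm (s n t - g t) * norm \<psi>)"
  proof (rule integral_mono)
   show "integrable (time_measure T) (\<lambda>t. \<bar>(s n t - g t) \<bullet> \<psi>\<bar>)"
    unfolding inner_diff_left by (intro integrable_abs Bochner_Integration.integrable_diff inn)
   show "integrable (time_measure T) (\<lambda>t. norm (s n t - g t) * norm \<psi>)"
    by (intro integrable_mult_left M)
  qed (rule Cauchy_Schwarz_ineq2)
  also have "\<dots> = e n * norm \<psi>" by (simp add: e_def)
  finally show ?thesis .
 qed
 have "Cauchy (\<lambda>n. simple_sum T (s n))"
 proof (rule metric_CauchyI)
  fix r :: real assume r: "r > 0"
  have "\<forall>\<^sub>F n in sequentially. e n < r / 2"
   using M(3) r unfolding e_def[symmetric] by (intro order_tendstoD(2)) auto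
  then obtain N where N: "\<And>n. n \<ge> N \<Longrightarrow> e n < r / 2" unfolding eventually_sequentially by blast
  have "dist (simple_sum T (s m)) (simple_sum T (s n)) < r" if "m \<ge> N" "n \<ge> N" for m n
  proof -
   have "norm (simple_sum T (s m) - simple_sum T (s n)) \<le> e m + e n"
   proof (rule norm_le_of_inner_bound)
    fix \<psi> :: 'h
    show "(simple_sum T (s m) - simple_sum T (s n)) \<bullet> \<psi> \<le> (e m + e n) * norm \<psi>"
     using close[of m \<psi>] close[of n \<psi>] unfolding inner_diff_left distrib_right by linarith
   qed (simp add: e0)
   then show ?thesis using N[OF that(1)] N[OF that(2)] by (simp add: dist_norm)
  qed
  then show "\<exists>N. \<forall>m\<ge>N. \<forall>n\<ge>N. dist (simple_sum T (s m)) (simple_sum T (s n)) < r" by blast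
 qed
 then obtain I where I: "(\<lambda>n. simple_sum T (s n)) \<longlonglongrightarrow> I" using Cauchy_convergent convergent_def by blast
 have I_inner: "I \<bullet> \<psi> = (LINT t|time_measure T. g t \<bullet> \<psi>)" for \<psi>
 proof (rule LIMSEQ_unique)
  show "(\<lambda>n. simple_sum T (s n) \<bullet> \<psi>) \<longlonglongrightarrow> I \<bullet> \<psi>" by (intro tendsto_intros I)
  show "(\<lambda>n. simple_sum T (s n) \<bullet> \<psi>) \<longlonglongrightarrow> (LINT t|time_measure T. g t \<bullet> \<psi>)"
   unfolding simple_sum_inner[OF approximatedD(1)[OF a]] by (rule inn)
 qed
 have iB: "integrable (time_measure T) B" by (rule approximatedD(5)[OF a])
 have B0: "AE t in time_measure T. 0 \<le> B t"
  using approximated_bound[OF a] by eventually_elim (meson norm_ge_zero order_trans)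
 have "norm I \<le> (LINT t|time_measure T. B t)"
 proof (rule norm_le_of_inner_bound)
  fix \<psi> :: 'h
  have "I \<bullet> \<psi> \<le> (LINT t|time_measure T. B t * norm \<psi>)"
   unfolding I_inner
  proof (rule integral_mono_AE)
   show "AE t in time_measure T. g t \<bullet> \<psi> \<le> B t * norm \<psi>"
    using approximated_bound[OF a]
    by eventually_elim (meson norm_cauchy_schwarz mult_right_mono norm_ge_zero order_trans)
  qed (use inn iB in auto)
  then show "I \<bullet> \<psi> \<le> (LINT t|time_measure T. B t) * norm \<psi>" by simp
 qed (rule integral_nonneg_AE[OF B0])
 with that I I_inner show thesis by blast
qed

lemma simple_sum_tendsto:
 assumes a: "approximated T S B g s" and I: "\<And>\<psi>. I \<bullet> \<psi> = (LINT t|time_measure T. g t \<bullet> \<psi>)"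
 shows "(\<lambda>n. simple_sum T (s n)) \<longlonglongrightarrow> I"
proof -
 obtain J where J: "\<And>\<psi>. J \<bullet> \<psi> = (LINT t|time_measure T. g t \<bullet> \<psi>)" "(\<lambda>n. simple_sum T (s n)) \<longlonglongrightarrow> J"
  using approximated_integral[OF a] by metis
 have "(J - I) \<bullet> (J - I) = 0" using I J by (simp add: inner_diff_left)
 then have "J = I" by simp
 then show ?thesis using J by simp
qed

lemma simple_sum_in: "subspace S \<Longrightarrow> s ` space (time_measure T) \<subseteq> S \<Longrightarrow> simple_sum T s \<in> S"
 unfolding simple_sum_def by (intro subspace_sum subspace_scale) auto

definition time_integral :: "real \<Rightarrow> (real \<Rightarrow> 'h::real_inner) \<Rightarrow> 'h" where
 "time_integral T g = (SOME I. \<forall>\<psi>. I \<bullet> \<psi> = (LINT t|time_measure T. g t \<bullet> \<psi>))"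

lemma time_integral:
 fixes g :: "real \<Rightarrow> 'h::{real_inner,banach}"
 assumes a: "approximated T S B g s"
 shows "time_integral T g \<bullet> \<psi> = (LINT t|time_measure T. g t \<bullet> \<psi>)"
  and "(\<lambda>n. simple_sum T (s n)) \<longlonglongrightarrow> time_integral T g"
  and "norm (time_integral T g) \<le> (LINT t|time_measure T. B t)"
  and "subspace S \<Longrightarrow> closed S \<Longrightarrow> time_integral T g \<in> S"
proof -
 obtain I where I: "\<And>\<psi>. I \<bullet> \<psi> = (LINT t|time_measure T. g t \<bullet> \<psi>)" "(\<lambda>n. simple_sum T (s n)) \<longlonglongrightarrow> I"
  "norm I \<le> (LINT t|time_measure T. B t)"
  using approximated_integral[OF a] by metis
 have "\<forall>\<psi>. time_integral T g \<bullet> \<psi> = (LINT t|time_measure T. g t \<bullet> \<psi>)"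
  unfolding time_integral_def by (rule someI[of _ I]) (use I in blast)
 then show t: "time_integral T g \<bullet> \<psi> = (LINT t|time_measure T. g t \<bullet> \<psi>)" for \<psi> by blast
 have "(time_integral T g - I) \<bullet> (time_integral T g - I) = 0" by (simp add: inner_diff_left t I)
 then have eq: "time_integral T g = I" by simp
 show lim: "(\<lambda>n. simple_sum T (s n)) \<longlonglongrightarrow> time_integral T g" unfolding eq by (rule I)
 show "norm (time_integral T g) \<le> (LINT t|time_measure T. B t)" unfolding eq by (rule I)
 show "time_integral T g \<in> S" if "subspace S" "closed S"
  by (rule closed_sequentially[OF that(2) simple_sum_in[OF that(1)] lim])
    (use approximatedD(2)[OF a] in auto)
qed

lemma approximated_scale:
 fixes g :: "real \<Rightarrow> 'h::{real_inner,banach}"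
 assumes a: "approximated T S B g s" and S: "subspace S"
  and e: "\<And>n. simple_function (time_measure T) (e n)" "\<And>n t. t \<in> {0<..<T} \<Longrightarrow> \<bar>e n t\<bar> \<le> C"
  and lim: "\<And>t. t \<in> {0<..<T} \<Longrightarrow> (\<lambda>n. e n t) \<longlonglongrightarrow> \<eta> t"
 shows "approximated T S (\<lambda>t. C * B t) (\<lambda>t. \<eta> t *\<^sub>R g t) (\<lambda>n t. e n t *\<^sub>R s n t)"
 unfolding approximated_def
proof (intro conjI allI ballI)
 show "simple_function (time_measure T) (\<lambda>t. e n t *\<^sub>R s n t)" for n
  by (rule simple_function_compose2[OF e(1) approximatedD(1)[OF a]])
 show "(\<lambda>t. e n t *\<^sub>R s n t) ` space (time_measure T) \<subseteq> S" for n
  using approximatedD(2)[OF a] by (auto intro!: subspace_scale[OF S])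
 show "AE t in time_measure T. (\<lambda>n. e n t *\<^sub>R s n t) \<longlonglongrightarrow> \<eta> t *\<^sub>R g t"
  using approximatedD(3)[OF a] AE_time_space by eventually_elim (intro tendsto_intros lim)
 show "norm (e n t *\<^sub>R s n t) \<le> C * B t" if "t \<in> {0<..<T}" for n t
  unfolding norm_scaleR
  using e(2)[OF that, of n] approximatedD(4)[OF a that, of n] abs_ge_zero[of "e n t"]
  by (intro mult_mono) (auto intro: order_trans)
 show "integrable (time_measure T) (\<lambda>t. C * B t)" using approximatedD(5)[OF a] by simp
qed

lemma approximated_add:
 fixes g h :: "real \<Rightarrow> 'h::{real_inner,banach}"
 assumes a: "approximated T S B g s" and b: "approximated T S C h r" and S: "subspace S"
 shows "approximated T S (\<lambda>t. B t + C t) (\<lambda>t. g t + h t) (\<lambda>n t. s n t + r n t)"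
 unfolding approximated_def
proof (intro conjI allI ballI)
 show "simple_function (time_measure T) (\<lambda>t. s n t + r n t)" for n
  by (rule simple_function_compose2[OF approximatedD(1)[OF a] approximatedD(1)[OF b]])
 show "(\<lambda>t. s n t + r n t) ` space (time_measure T) \<subseteq> S" for n
  using approximatedD(2)[OF a] approximatedD(2)[OF b] by (auto intro!: subspace_add[OF S])
 show "AE t in time_measure T. (\<lambda>n. s n t + r n t) \<longlonglongrightarrow> g t + h t"
  using approximatedD(3)[OF a] approximatedD(3)[OF b] by eventually_elim (intro tendsto_intros)
 show "norm (s n t + r n t) \<le> B t + C t" if "t \<in> {0<..<T}" for n t
  using norm_triangle_mono approximatedD(4)[OF a that] approximatedD(4)[OF b that] by blast
 show "integrable (time_measure T) (\<lambda>t. B t + C t)" using approximatedD(5)[OF a] approximatedD(5)[OF b] by simp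
qed

text \<open>
 The left end point of the interval of length \<open>T/(n+1)\<close> that contains \<open>t\<close>: composition with it
 turns a continuous curve into a simple one.
\<close>

definition grid :: "real \<Rightarrow> nat \<Rightarrow> real \<Rightarrow> real" where
 "grid T n t = of_int \<lfloor>t * real (Suc n) / T\<rfloor> * (T / real (Suc n))"

lemma grid:
 assumes "0 < T" "t \<in> {0<..<T}"
 shows "grid T n t \<in> {0..T}" "\<bar>grid T n t - t\<bar> \<le> T / real (Suc n)"
proof -
 define N where "N = real (Suc n)"
 have N: "N > 0" by (simp add: N_def)
 define x where "x = t * N / T"
 have t: "t = x * (T / N)" using assms N by (simp add: x_def)
 have x: "0 \<le> x" "real_of_int \<lfloor>x\<rfloor> \<le> x" "x \<le> real_of_int \<lfloor>x\<rfloor> + 1" using assms N by (auto simp: x_def)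
 have g: "grid T n t = real_of_int \<lfloor>x\<rfloor> * (T / N)" by (simp add: grid_def x_def N_def)
 have TN: "T / N > 0" using assms N by simp
 have "real_of_int \<lfloor>x\<rfloor> * (T / N) \<le> x * (T / N)" using x TN by (intro mult_right_mono) auto
 then have le: "grid T n t \<le> t" using g t by linarith
 have "0 \<le> real_of_int \<lfloor>x\<rfloor>" using x(1) by simp
 then have "0 \<le> grid T n t" unfolding g using TN by (intro mult_nonneg_nonneg) auto
 then show "grid T n t \<in> {0..T}" using le assms by auto
 have "t - grid T n t = (x - real_of_int \<lfloor>x\<rfloor>) * (T / N)" by (simp only: left_diff_distrib g t[symmetric])
 also have "\<dots> \<le> 1 * (T / N)"
 proof (rule mult_right_mono)
  show "x - real_of_int \<lfloor>x\<rfloor> \<le> 1" using x(3) by linarith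
 qed (use TN in simp)
 finally show "\<bar>grid T n t - t\<bar> \<le> T / real (Suc n)" using le by (simp add: N_def)
qed

lemma grid_tendsto:
 assumes "0 < T" "t \<in> {0<..<T}" shows "(\<lambda>n. grid T n t) \<longlonglongrightarrow> t"
proof (rule LIM_zero_cancel, rule tendsto_rabs_zero_cancel, rule tendsto_sandwich[OF _ _ tendsto_const])
 show "(\<lambda>n. T / real (Suc n)) \<longlonglongrightarrow> 0"
  using tendsto_mult[OF tendsto_const LIMSEQ_inverse_real_of_nat, of T] by (simp add: divide_inverse)
qed (use grid[OF assms] in auto)

lemma simple_function_grid:
 assumes "0 < T" shows "simple_function (time_measure T) (grid T n)"
proof (rule simple_function_borel_measurable)
 have "grid T n \<in> borel_measurable borel" unfolding grid_def[abs_def] by measurable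
 then have "grid T n \<in> borel_measurable lborel" by simp
 then have "grid T n \<in> borel_measurable lebesgue" by (rule measurable_completion)
 then show "grid T n \<in> borel_measurable (time_measure T)" by (rule measurable_restrict_space1)
 have "grid T n ` space (time_measure T) \<subseteq> (\<lambda>k. of_int k * (T / real (Suc n))) ` {0..int (Suc n)}"
 proof
  fix y assume "y \<in> grid T n ` space (time_measure T)"
  then obtain t where t: "t \<in> {0<..<T}" "y = grid T n t" by auto
  have "0 \<le> t * real (Suc n) / T" using t assms by auto
  moreover have "t * real (Suc n) / T \<le> real (Suc n)" using t assms by (simp add: divide_le_eq)
  ultimately have "\<lfloor>t * real (Suc n) / T\<rfloor> \<in> {0..int (Suc n)}" by (auto simp: floor_le_iff le_floor_iff simp del: of_nat_Suc)
  then show "y \<in> (\<lambda>k. of_int k * (T / real (Suc n))) ` {0..int (Suc n)}" unfolding t(2) grid_def by blast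
 qed
 then show "finite (grid T n ` space (time_measure T))" by (rule finite_subset) auto
qed

lemma approximated_continuous:
 fixes g :: "real \<Rightarrow> 'h::{real_inner,banach}"
 assumes T: "0 < T" and g: "continuous_on {0..T} g" "\<And>t. t \<in> {0..T} \<Longrightarrow> g t \<in> S" "\<And>t. t \<in> {0..T} \<Longrightarrow> norm (g t) \<le> C"
 shows "approximated T S (\<lambda>t. C) g (\<lambda>n t. g (grid T n t))"
 unfolding approximated_def
proof (intro conjI allI ballI)
 show "simple_function (time_measure T) (\<lambda>t. g (grid T n t))" for n
  using simple_function_compose[OF simple_function_grid[OF T, of n], of g] by (simp add: o_def)
 show "(\<lambda>t. g (grid T n t)) ` space (time_measure T) \<subseteq> S" for n
  using grid(1)[OF T] g(2) by auto
 show "AE t in time_measure T. (\<lambda>n. g (grid T n t)) \<longlonglongrightarrow> g t"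
  by (rule AE_timeI, rule continuous_on_tendsto_compose[OF g(1) grid_tendsto[OF T]]) (use grid(1)[OF T] in auto)
 show "norm (g (grid T n t)) \<le> C" if "t \<in> {0<..<T}" for n t by (rule g(3)[OF grid(1)[OF T that]])
 show "integrable (time_measure T) (\<lambda>t. C)" by (rule finite_measure.integrable_const[OF time_measure_finite])
qed

lemma continuous_interval_bounded:
 fixes g :: "real \<Rightarrow> 'h::real_normed_vector"
 assumes "continuous_on {a..b} g" obtains C where "C > 0" "\<And>t. t \<in> {a..b} \<Longrightarrow> norm (g t) \<le> C"
proof -
 have "bounded (g ` {a..b})" by (rule compact_imp_bounded[OF compact_continuous_image[OF assms compact_Icc]])
 then obtain C where C: "C > 0" "\<forall>x\<in>g ` {a..b}. norm x \<le> C" unfolding bounded_pos by blast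
 show thesis by (rule that[OF C(1)]) (use C(2) in blast)
qed

lemma approximated_scale_continuous:
 fixes g :: "real \<Rightarrow> 'h::{real_inner,banach}"
 assumes T: "0 < T" and a: "approximated T S B g s" and S: "subspace S"
  and \<eta>: "continuous_on {0..T} \<eta>" "\<And>t. t \<in> {0..T} \<Longrightarrow> \<bar>\<eta> t\<bar> \<le> C"
 shows "approximated T S (\<lambda>t. C * B t) (\<lambda>t. \<eta> t *\<^sub>R g t) (\<lambda>n t. \<eta> (grid T n t) *\<^sub>R s n t)"
proof (rule approximated_scale[OF a S])
 show "simple_function (time_measure T) (\<lambda>t. \<eta> (grid T n t))" for n
  using simple_function_compose[OF simple_function_grid[OF T, of n], of \<eta>] by (simp add: o_def)
 show "\<bar>\<eta> (grid T n t)\<bar> \<le> C" if "t \<in> {0<..<T}" for n t by (rule \<eta>(2)[OF grid(1)[OF T that]])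
 show "(\<lambda>n. \<eta> (grid T n t)) \<longlonglongrightarrow> \<eta> t" if "t \<in> {0<..<T}" for t
  by (rule continuous_on_tendsto_compose[OF \<eta>(1) grid_tendsto[OF T that]]) (use grid(1)[OF T that] that in auto)
qed

lemma approximated_restrict:
 fixes g :: "real \<Rightarrow> 'h::{real_inner,banach}"
 assumes a: "approximated T S B g s" and S: "subspace S" and A: "A \<in> sets lebesgue"
 shows "approximated T S (\<lambda>t. indicator A t * B t) (\<lambda>t. indicator A t *\<^sub>R g t) (\<lambda>n t. indicator A t *\<^sub>R s n t)"
 unfolding approximated_def
proof (intro conjI allI ballI)
 have ind: "simple_function (time_measure T) (indicator A :: real \<Rightarrow> real)"
 proof (rule simple_function_borel_measurable)
  show "(indicator A :: real \<Rightarrow> real) \<in> borel_measurable (time_measure T)"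
   by (rule measurable_restrict_space1[OF borel_measurable_indicator[OF A]])
  show "finite ((indicator A :: real \<Rightarrow> real) ` space (time_measure T))"
   by (rule finite_subset[of _ "{0, 1}"]) (auto simp: indicator_def)
 qed
 show "simple_function (time_measure T) (\<lambda>t. (indicator A t :: real) *\<^sub>R s n t)" for n
  by (rule simple_function_compose2[OF ind approximatedD(1)[OF a]])
 show "(\<lambda>t. (indicator A t :: real) *\<^sub>R s n t) ` space (time_measure T) \<subseteq> S" for n
  using approximatedD(2)[OF a] by (auto intro!: subspace_scale[OF S])
 show "AE t in time_measure T. (\<lambda>n. (indicator A t :: real) *\<^sub>R s n t) \<longlonglongrightarrow> indicator A t *\<^sub>R g t"
  using approximatedD(3)[OF a] by eventually_elim (intro tendsto_intros)
 show "norm ((indicator A t :: real) *\<^sub>R s n t) \<le> indicator A t * B t" if "t \<in> {0<..<T}" for n t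
  using approximatedD(4)[OF a that, of n] by (auto simp: indicator_def)
 show "integrable (time_measure T) (\<lambda>t. indicator A t * B t)"
 proof (rule Bochner_Integration.integrable_bound[OF approximatedD(5)[OF a]])
  show "(\<lambda>t. indicator A t * B t) \<in> borel_measurable (time_measure T)"
   by (rule borel_measurable_times[OF measurable_restrict_space1[OF borel_measurable_indicator[OF A]]
      borel_measurable_integrable[OF approximatedD(5)[OF a]]])
 qed (auto simp: indicator_def)
qed

section \<open>Integration by parts in time\<close>

lemma open_interval_integral:
 fixes c :: "real \<Rightarrow> real"
 assumes c: "continuous_on {a..b} c"
 shows "integrable (lebesgue_on {a<..<b}) c" "(LINT t|lebesgue_on {a<..<b}. c t) = integral {a..b} c"
proof -
 interpret finite_measure "lebesgue_on {a<..<b}" by (rule finite_measure_lebesgue_on) simp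
 obtain C where C: "C > 0" "\<And>t. t \<in> {a..b} \<Longrightarrow> norm (c t) \<le> C" using continuous_interval_bounded[OF c] by blast
 have m: "c \<in> borel_measurable (lebesgue_on {a<..<b})"
  by (rule continuous_imp_measurable_on_sets_lebesgue[OF continuous_on_subset[OF c]]) auto
 show i: "integrable (lebesgue_on {a<..<b}) c"
  by (rule integrable_const_bound[OF _ m, of C], rule AE_I2) (use C(2) in auto)
 have "(LINT t|lebesgue_on {a<..<b}. c t) = integral {a<..<b} c"
  by (rule lebesgue_integral_eq_integral[OF i]) simp
 also have "\<dots> = integral {a..b} c" by (simp add: integral_open_interval_real)
 finally show "(LINT t|lebesgue_on {a<..<b}. c t) = integral {a..b} c" .
qed

lemma time_measure_restrict:
 fixes c :: "real \<Rightarrow> real"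
 assumes "0 \<le> r"
 shows "(LINT t|time_measure T. indicator {r<..} t * c t) = (LINT t|lebesgue_on {r<..<T}. c t)"
proof -
 have "(LINT t|time_measure T. indicator {r<..} t * c t) = (LINT t|lebesgue. indicator {0<..<T} t *\<^sub>R (indicator {r<..} t * c t))"
  by (rule integral_restrict_space) simp
 also have "\<dots> = (LINT t|lebesgue. indicator {r<..<T} t *\<^sub>R c t)"
  by (rule Bochner_Integration.integral_cong) (use assms in \<open>auto simp: indicator_def\<close>)
 also have "\<dots> = (LINT t|lebesgue_on {r<..<T}. c t)"
  by (rule integral_restrict_space[symmetric]) simp
 finally show ?thesis .
qed

text \<open>Fubini's theorem for the function \<open>s(r) \<bullet> \<phi>'(t)\<close> on the set \<open>r < t\<close>.\<close>

lemma simple_by_parts: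
 fixes s \<phi> \<phi>' :: "real \<Rightarrow> 'h::{real_inner,banach}"
 assumes s: "simple_function (time_measure T) s"
  and der: "\<And>t. t \<in> {0..T} \<Longrightarrow> (\<phi> has_vector_derivative \<phi>' t) (at t within {0..T})"
  and cont: "continuous_on {0..T} \<phi>'" and end0: "\<phi> T = 0" and T: "0 < T"
 shows "(LINT t|time_measure T. simple_sum T (\<lambda>r. indicator {0<..<t} r *\<^sub>R s r) \<bullet> \<phi>' t) =
  - (LINT t|time_measure T. s t \<bullet> \<phi> t)"
proof -
 let ?M = "time_measure T"
 interpret M: finite_measure ?M by (rule time_measure_finite)
 interpret P: pair_sigma_finite ?M ?M ..
 interpret PM: finite_measure "?M \<Otimes>\<^sub>M ?M" by (rule finite_measure_pair_measure) (rule time_measure_finite)+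
 have fin: "finite (s ` space ?M)" and m: "\<And>y. y \<in> s ` space ?M \<Longrightarrow> s -` {y} \<inter> space ?M \<in> sets ?M"
  using s by (auto simp: simple_function_def)
 obtain C where C: "C > 0" "\<And>t. t \<in> {0..T} \<Longrightarrow> norm (\<phi>' t) \<le> C" using continuous_interval_bounded[OF cont] by blast
 define K where "K = (\<Sum>y\<in>s ` space ?M. norm y)"
 have K: "norm (s t) \<le> K" if "t \<in> space ?M" for t
  unfolding K_def by (rule member_le_sum) (use fin that in auto)
 define F where "F r t = indicator {r<..} t * (s r \<bullet> \<phi>' t)" for r t
 have Fm: "case_prod F \<in> borel_measurable (?M \<Otimes>\<^sub>M ?M)"
 proof -
  have cm[measurable]: "(\<lambda>t. y \<bullet> \<phi>' t) \<in> borel_measurable ?M" for y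
  proof -
   have "continuous_on {0<..<T} (\<lambda>t. y \<bullet> \<phi>' t)"
    by (intro continuous_intros continuous_on_subset[OF cont]) auto
   then show ?thesis by (rule continuous_imp_measurable_on_sets_lebesgue) simp
  qed
  have id[measurable]: "(\<lambda>t. t) \<in> borel_measurable ?M"
   by (rule continuous_imp_measurable_on_sets_lebesgue) (auto intro: continuous_intros)
  have [measurable]: "s \<in> measurable ?M (count_space (s ` space ?M))"
   unfolding measurable_count_space_eq2[OF fin] using m by blast
  have "(\<lambda>x. (\<lambda>y x. (if fst x < snd x then 1 else 0) * (y \<bullet> \<phi>' (snd x))) (s (fst x)) x) \<in> borel_measurable (?M \<Otimes>\<^sub>M ?M)"
  proof (rule measurable_compose_countable'[where I="s ` space ?M" and g="\<lambda>x. s (fst x)" and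
     f="\<lambda>y x. (if fst x < snd x then 1 else 0) * (y \<bullet> \<phi>' (snd x))"])
   fix y
   have [measurable]: "(\<lambda>x. fst x) \<in> borel_measurable (?M \<Otimes>\<^sub>M ?M)" "(\<lambda>x. snd x) \<in> borel_measurable (?M \<Otimes>\<^sub>M ?M)"
    "(\<lambda>x. y \<bullet> \<phi>' (snd x)) \<in> borel_measurable (?M \<Otimes>\<^sub>M ?M)"
    by (rule measurable_compose[OF measurable_fst id] measurable_compose[OF measurable_snd id]
      measurable_compose[OF measurable_snd cm])+
   show "(\<lambda>x. (if fst x < snd x then 1 else 0) * (y \<bullet> \<phi>' (snd x))) \<in> borel_measurable (?M \<Otimes>\<^sub>M ?M)"
    by measurable
  qed (measurable, use fin in \<open>simp add: countable_finite\<close>)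
  moreover have "case_prod F = (\<lambda>x. (\<lambda>y x. (if fst x < snd x then 1 else 0) * (y \<bullet> \<phi>' (snd x))) (s (fst x)) x)"
   by (auto simp: F_def fun_eq_iff)
  ultimately show ?thesis by (simp only:)
 qed
 have Fi: "integrable (?M \<Otimes>\<^sub>M ?M) (case_prod F)"
 proof (rule PM.integrable_const_bound[OF _ Fm, of "K * C"], rule AE_I2)
  fix x assume "x \<in> space (?M \<Otimes>\<^sub>M ?M)"
  then obtain r t where x: "x = (r, t)" "r \<in> space ?M" "t \<in> {0..T}" by (auto simp: space_pair_measure)
  have "\<bar>F r t\<bar> \<le> \<bar>s r \<bullet> \<phi>' t\<bar>" by (auto simp: F_def indicator_def)
  also have "\<dots> \<le> norm (s r) * norm (\<phi>' t)" by (rule Cauchy_Schwarz_ineq2)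
  also have "\<dots> \<le> K * C" by (rule mult_mono[OF K[OF x(2)] C(2)[OF x(3)] order_trans[OF norm_ge_zero K[OF x(2)]] norm_ge_zero])
  finally show "norm (case_prod F x) \<le> K * C" by (simp add: x)
 qed
 have ind: "simple_function ?M (\<lambda>r. (indicator {0<..<t} r :: real) *\<^sub>R s r)" for t
 proof -
  have "simple_function ?M (indicator {0<..<t} :: real \<Rightarrow> real)"
  proof (rule simple_function_borel_measurable)
   show "(indicator {0<..<t} :: real \<Rightarrow> real) \<in> borel_measurable ?M"
    by (rule measurable_restrict_space1[OF borel_measurable_indicator]) simp
   show "finite ((indicator {0<..<t} :: real \<Rightarrow> real) ` space ?M)"
    by (rule finite_subset[of _ "{0, 1}"]) (auto simp: indicator_def)
  qed
  then show ?thesis by (rule simple_function_compose2[OF _ s])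
 qed
 have "(LINT t|?M. simple_sum T (\<lambda>r. indicator {0<..<t} r *\<^sub>R s r) \<bullet> \<phi>' t) = (LINT t|?M. LINT r|?M. F r t)"
  unfolding simple_sum_inner[OF ind]
  by (intro Bochner_Integration.integral_cong refl) (auto simp: F_def indicator_def)
 also have "\<dots> = (LINT r|?M. LINT t|?M. F r t)" by (rule P.Fubini_integral[OF Fi])
 also have "\<dots> = (LINT r|?M. - (s r \<bullet> \<phi> r))"
 proof (rule Bochner_Integration.integral_cong[OF refl])
  fix r assume "r \<in> space ?M"
  then have r: "0 \<le> r" "r \<le> T" by auto
  have c: "continuous_on {r..T} (\<lambda>t. s r \<bullet> \<phi>' t)"
   by (intro continuous_intros continuous_on_subset[OF cont]) (use r in auto)
  have "((\<lambda>t. s r \<bullet> \<phi>' t) has_integral (s r \<bullet> \<phi> T - s r \<bullet> \<phi> r)) {r..T}"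
  proof (rule fundamental_theorem_of_calculus[OF r(2)])
   fix t assume t: "t \<in> {r..T}"
   have "(\<phi> has_vector_derivative \<phi>' t) (at t within {r..T})"
    by (rule has_vector_derivative_within_subset[OF der]) (use t r in auto)
   then show "((\<lambda>t. s r \<bullet> \<phi> t) has_vector_derivative s r \<bullet> \<phi>' t) (at t within {r..T})"
    by (rule bounded_linear.has_vector_derivative[OF bounded_linear_inner_right])
  qed
  then have "integral {r..T} (\<lambda>t. s r \<bullet> \<phi>' t) = - (s r \<bullet> \<phi> r)" using end0 by (simp add: integral_unique)
  then show "(LINT t|?M. F r t) = - (s r \<bullet> \<phi> r)"
   unfolding F_def time_measure_restrict[OF r(1)] open_interval_integral(2)[OF c] .
 qed
 finally show ?thesis by simp
qed

lemma simple_approximated: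
 assumes a: "approximated T S B g s" shows "approximated T S B (s n) (\<lambda>_. s n)"
 using a unfolding approximated_def by auto

lemma simple_time_integral:
 assumes a: "approximated T S B g (\<lambda>_. s)" shows "time_integral T g = simple_sum T s"
 using time_integral(2)[OF a] by (simp add: LIMSEQ_const_iff)

definition primitive :: "real \<Rightarrow> (real \<Rightarrow> 'h::real_inner) \<Rightarrow> real \<Rightarrow> 'h" where
 "primitive T g t = time_integral T (\<lambda>r. indicator {0<..<t} r *\<^sub>R g r)"

lemma approximated_nonneg: "approximated T S B g s \<Longrightarrow> t \<in> {0<..<T} \<Longrightarrow> 0 \<le> B t"
 using approximatedD(4) norm_ge_zero order_trans by blast

lemma primitive_bound:
 fixes g :: "real \<Rightarrow> 'h::{real_inner,banach}"
 assumes a: "approximated T S B g s" and S: "subspace S"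
 shows "norm (primitive T g t) \<le> (LINT t|time_measure T. B t)"
proof -
 have r: "approximated T S (\<lambda>r. indicator {0<..<t} r * B r) (\<lambda>r. indicator {0<..<t} r *\<^sub>R g r) (\<lambda>n r. indicator {0<..<t} r *\<^sub>R s n r)"
  by (rule approximated_restrict[OF a S]) simp
 have "norm (primitive T g t) \<le> (LINT r|time_measure T. indicator {0<..<t} r * B r)"
  unfolding primitive_def by (rule time_integral(3)[OF r])
 also have "\<dots> \<le> (LINT t|time_measure T. B t)"
  by (rule integral_mono_AE[OF approximatedD(5)[OF r] approximatedD(5)[OF a]], rule AE_timeI)
    (use approximated_nonneg[OF a] in \<open>auto simp: indicator_def\<close>)
 finally show ?thesis .
qed

lemma primitive_inner:
 fixes g :: "real \<Rightarrow> 'h::{real_inner,banach}"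
 assumes a: "approximated T S B g s" and S: "subspace S"
 shows "primitive T g t \<bullet> \<psi> = (LINT r|time_measure T. indicator {0<..<t} r * (g r \<bullet> \<psi>))"
proof -
 have r: "approximated T S (\<lambda>r. indicator {0<..<t} r * B r) (\<lambda>r. indicator {0<..<t} r *\<^sub>R g r) (\<lambda>n r. indicator {0<..<t} r *\<^sub>R s n r)"
  by (rule approximated_restrict[OF a S]) simp
 show ?thesis unfolding primitive_def time_integral(1)[OF r] by simp
qed

text \<open>The increment between two times is bounded by the integral of \<open>B\<close> in between.\<close>

lemma primitive_continuous:
 fixes g :: "real \<Rightarrow> 'h::{real_inner,banach}"
 assumes a: "approximated T S B g s" and S: "subspace S"
 shows "continuous_on {0..T} (primitive T g)"
 unfolding continuous_on_sequentially comp_def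
proof (intro allI ballI impI)
 fix t r assume "r \<in> {0..T}" and "(\<forall>n. t n \<in> {0..T}) \<and> t \<longlonglongrightarrow> r"
 then have t: "t \<longlonglongrightarrow> r" by blast
 define d where "d n q = \<bar>indicator {0<..<t n} q - indicator {0<..<r} q\<bar> * B q" for n q
 have B: "integrable (time_measure T) B" by (rule approximatedD(5)[OF a])
 have bd: "AE q in time_measure T. norm (d n q) \<le> B q" for n
  by (rule AE_timeI) (use approximated_nonneg[OF a] in \<open>auto simp: d_def indicator_def\<close>)
 have dm: "d n \<in> borel_measurable (time_measure T)" for n
  unfolding d_def using borel_measurable_integrable[OF B]
  by (intro borel_measurable_times borel_measurable_abs borel_measurable_diff
    measurable_restrict_space1[OF borel_measurable_indicator]) auto
 have lim: "AE q in time_measure T. (\<lambda>n. d n q) \<longlonglongrightarrow> 0"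
 proof -
  have "AE q in lebesgue. q \<notin> {r}" by (rule AE_not_in) (simp add: negligible_iff_null_sets[symmetric])
  then have "AE q in time_measure T. q \<noteq> r" by (subst AE_restrict_space_iff) (auto elim!: eventually_mono)
  then show ?thesis
  proof eventually_elim
   case (elim q)
   have "\<forall>\<^sub>F n in sequentially. q < t n \<longleftrightarrow> q < r"
   proof (cases "q < r")
    case True
    then show ?thesis using order_tendstoD(1)[OF t] by (auto elim!: eventually_mono)
   next
    case False
    with elim have "r < q" by simp
    from order_tendstoD(2)[OF t this] show ?thesis by eventually_elim (use False in auto)
   qed
   then have "\<forall>\<^sub>F n in sequentially. d n q = 0" by eventually_elim (simp add: d_def indicator_def)
   then show ?case by (rule tendsto_eventually)
  qed
 qed
 note dc = integral_dominated_convergence[OF _ dm B lim bd] integrable_dominated_convergence2[OF _ dm B lim bd]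
 have le: "norm (primitive T g (t n) - primitive T g r) \<le> (LINT q|time_measure T. d n q)" for n
 proof (rule norm_le_of_inner_bound)
  show "0 \<le> (LINT q|time_measure T. d n q)"
   by (rule integral_nonneg_AE, rule AE_timeI) (use approximated_nonneg[OF a] in \<open>simp add: d_def\<close>)
  fix \<psi> :: 'h
  have gi: "integrable (time_measure T) (\<lambda>q. indicator {0<..<t} q * (g q \<bullet> \<psi>))" for t
   using approximated_inner(1)[OF approximated_restrict[OF a S, of "{0<..<t}"] continuous_on_const[of _ \<psi>]] by simp
  have "(primitive T g (t n) - primitive T g r) \<bullet> \<psi> =
    (LINT q|time_measure T. indicator {0<..<t n} q * (g q \<bullet> \<psi>) - indicator {0<..<r} q * (g q \<bullet> \<psi>))"
   by (simp add: inner_diff_left primitive_inner[OF a S] gi)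
  also have "\<dots> \<le> (LINT q|time_measure T. d n q * norm \<psi>)"
  proof (rule integral_mono_AE)
   show "AE q in time_measure T. indicator {0<..<t n} q * (g q \<bullet> \<psi>) - indicator {0<..<r} q * (g q \<bullet> \<psi>) \<le> d n q * norm \<psi>"
    using approximated_bound[OF a]
   proof eventually_elim
    case (elim q)
    have "\<bar>g q \<bullet> \<psi>\<bar> \<le> B q * norm \<psi>"
     using Cauchy_Schwarz_ineq2[of "g q" \<psi>] mult_right_mono[OF elim norm_ge_zero[of \<psi>]] by linarith
    then show ?case by (auto simp: d_def indicator_def)
   qed
  qed (use gi dc(2) in auto)
  finally show "(primitive T g (t n) - primitive T g r) \<bullet> \<psi> \<le> (LINT q|time_measure T. d n q) * norm \<psi>" by simp
 qed
 have "(\<lambda>n. LINT q|time_measure T. d n q) \<longlonglongrightarrow> 0" using dc(1) by simp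
 then have "(\<lambda>n. norm (primitive T g (t n) - primitive T g r)) \<longlonglongrightarrow> 0"
  by (rule tendsto_sandwich[OF _ _ tendsto_const, rotated 2]) (use le in auto)
 then show "(\<lambda>n. primitive T g (t n)) \<longlonglongrightarrow> primitive T g r" by (simp add: tendsto_norm_zero_iff LIM_zero_iff)
qed

lemma vector_derivative_imp_continuous_on:
 "(\<And>t. t \<in> S \<Longrightarrow> (f has_vector_derivative f' t) (at t within S)) \<Longrightarrow> continuous_on S f"
 unfolding continuous_on_eq_continuous_within using has_vector_derivative_continuous by blast

text \<open>Both sides pass to the limit in dominated approximations by simple curves.\<close>

lemma primitive_by_parts:
 fixes g \<phi> \<phi>' :: "real \<Rightarrow> 'h::{real_inner,banach}"
 assumes a: "approximated T S B g s" and S: "subspace S"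
  and der: "\<And>t. t \<in> {0..T} \<Longrightarrow> (\<phi> has_vector_derivative \<phi>' t) (at t within {0..T})"
  and cont: "continuous_on {0..T} \<phi>'" and end0: "\<phi> T = 0" and T: "0 < T"
 shows "(LINT t|time_measure T. primitive T g t \<bullet> \<phi>' t) = - (LINT t|time_measure T. g t \<bullet> \<phi> t)"
proof -
 have c\<phi>: "continuous_on {0..T} \<phi>" using der by (rule vector_derivative_imp_continuous_on)
 obtain C where C: "C > 0" "\<And>t. t \<in> {0..T} \<Longrightarrow> norm (\<phi>' t) \<le> C" using continuous_interval_bounded[OF cont] by blast
 define D where "D = (LINT t|time_measure T. B t)"
 have pr: "primitive T (s n) t = simple_sum T (\<lambda>r. indicator {0<..<t} r *\<^sub>R s n r)" for n t
  unfolding primitive_def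
  by (rule simple_time_integral[OF approximated_restrict[OF simple_approximated[OF a] S]]) simp
 have lim: "(\<lambda>n. LINT t|time_measure T. primitive T (s n) t \<bullet> \<phi>' t) \<longlonglongrightarrow> (LINT t|time_measure T. primitive T g t \<bullet> \<phi>' t)"
 proof (rule integral_dominated_convergence)
  have meas: "(\<lambda>t. primitive T f t \<bullet> \<phi>' t) \<in> borel_measurable (time_measure T)"
   if "approximated T S B f r" for f r
  proof -
   have "continuous_on {0..T} (\<lambda>t. primitive T f t \<bullet> \<phi>' t)"
    by (intro continuous_on_inner primitive_continuous[OF that S] cont)
   then show ?thesis using open_interval_integral(1) by blast
  qed
  show "(\<lambda>t. primitive T g t \<bullet> \<phi>' t) \<in> borel_measurable (time_measure T)" by (rule meas[OF a])
  show "(\<lambda>t. primitive T (s n) t \<bullet> \<phi>' t) \<in> borel_measurable (time_measure T)" for n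
   by (rule meas[OF simple_approximated[OF a]])
  show "integrable (time_measure T) (\<lambda>t. D * C)" by (rule finite_measure.integrable_const[OF time_measure_finite])
  show "AE t in time_measure T. (\<lambda>n. primitive T (s n) t \<bullet> \<phi>' t) \<longlonglongrightarrow> primitive T g t \<bullet> \<phi>' t"
  proof (rule AE_timeI)
   fix t :: real
   have "(\<lambda>n. primitive T (s n) t) \<longlonglongrightarrow> primitive T g t"
    unfolding pr unfolding primitive_def
    by (rule time_integral(2)[OF approximated_restrict[OF a S]]) simp
   then show "(\<lambda>n. primitive T (s n) t \<bullet> \<phi>' t) \<longlonglongrightarrow> primitive T g t \<bullet> \<phi>' t" by (intro tendsto_intros)
  qed
  show "AE t in time_measure T. norm (primitive T (s n) t \<bullet> \<phi>' t) \<le> D * C" for n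
  proof (rule AE_timeI)
   fix t assume t: "t \<in> {0<..<T}"
   have "norm (primitive T (s n) t \<bullet> \<phi>' t) \<le> norm (primitive T (s n) t) * norm (\<phi>' t)" by (simp add: Cauchy_Schwarz_ineq2)
   also have "\<dots> \<le> D * C"
    using primitive_bound[OF simple_approximated[OF a] S, of n t] C(2)[of t] t norm_ge_zero[of "primitive T (s n) t"]
    unfolding D_def by (intro mult_mono order_trans[OF norm_ge_zero primitive_bound[OF simple_approximated[OF a] S, of n t]]) auto
   finally show "norm (primitive T (s n) t \<bullet> \<phi>' t) \<le> D * C" .
  qed
 qed
 have eq: "(LINT t|time_measure T. primitive T (s n) t \<bullet> \<phi>' t) = - (LINT t|time_measure T. s n t \<bullet> \<phi> t)" for n
  unfolding pr by (rule simple_by_parts[OF approximatedD(1)[OF a] der cont end0 T])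
 show ?thesis
 proof (rule LIMSEQ_unique[OF lim])
  show "(\<lambda>n. LINT t|time_measure T. primitive T (s n) t \<bullet> \<phi>' t) \<longlonglongrightarrow> - (LINT t|time_measure T. g t \<bullet> \<phi> t)"
   unfolding eq by (intro tendsto_minus approximated_inner(3)[OF a c\<phi>])
 qed
qed

text \<open>
 The primitive of \<open>g\<close> need not be differentiable and is treated by Fubini's theorem; the remaining part
 of \<open>v\<close> is continuously differentiable.
\<close>

theorem curve_by_parts:
 fixes g \<phi> \<phi>' R v :: "real \<Rightarrow> 'h::{real_inner,banach}"
 assumes a: "approximated T S B g s" and S: "subspace S"
  and R: "continuous_on {0..T} R"
  and v: "\<And>t. t \<in> {0..T} \<Longrightarrow> v t = v0 + primitive T g t + integral {0..t} R"
  and der: "\<And>t. t \<in> {0..T} \<Longrightarrow> (\<phi> has_vector_derivative \<phi>' t) (at t within {0..T})"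
  and cont: "continuous_on {0..T} \<phi>'" and end0: "\<phi> T = 0" and T: "0 < T"
 shows "(LINT t|time_measure T. v t \<bullet> \<phi>' t) =
  - (v0 \<bullet> \<phi> 0) - (LINT t|time_measure T. R t \<bullet> \<phi> t) - (LINT t|time_measure T. g t \<bullet> \<phi> t)"
proof -
 have c\<phi>: "continuous_on {0..T} \<phi>" using der by (rule vector_derivative_imp_continuous_on)
 define v1 where "v1 t = v0 + integral {0..t} R" for t
 have d1: "(v1 has_vector_derivative R t) (at t within {0..T})" if "t \<in> {0..T}" for t
  unfolding v1_def using integral_has_vector_derivative[OF R that]
  by (auto intro!: derivative_eq_intros)
 have c1: "continuous_on {0..T} v1" using d1 by (rule vector_derivative_imp_continuous_on)
 have cA: "continuous_on {0..T} (\<lambda>t. v1 t \<bullet> \<phi>' t)" and cB: "continuous_on {0..T} (\<lambda>t. R t \<bullet> \<phi> t)"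
  by (intro continuous_on_inner c1 cont R c\<phi>)+
 have cP: "continuous_on {0..T} (\<lambda>t. primitive T g t \<bullet> \<phi>' t)"
  by (intro continuous_on_inner primitive_continuous[OF a S] cont)
 have "((\<lambda>t. v1 t \<bullet> \<phi>' t + R t \<bullet> \<phi> t) has_integral (v1 T \<bullet> \<phi> T - v1 0 \<bullet> \<phi> 0)) {0..T}"
 proof (rule fundamental_theorem_of_calculus)
  fix t assume t: "t \<in> {0..T}"
  show "((\<lambda>t. v1 t \<bullet> \<phi> t) has_vector_derivative v1 t \<bullet> \<phi>' t + R t \<bullet> \<phi> t) (at t within {0..T})"
   by (rule bounded_bilinear.has_vector_derivative[OF bounded_bilinear_inner d1[OF t] der[OF t]])
 qed (use T in simp)
 then have "integral {0..T} (\<lambda>t. v1 t \<bullet> \<phi>' t + R t \<bullet> \<phi> t) = - (v0 \<bullet> \<phi> 0)"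
  using end0 by (simp add: integral_unique v1_def)
 then have "(LINT t|time_measure T. v1 t \<bullet> \<phi>' t + R t \<bullet> \<phi> t) = - (v0 \<bullet> \<phi> 0)"
  using open_interval_integral(2)[OF continuous_on_add[OF cA cB]] by simp
 then have s1: "(LINT t|time_measure T. v1 t \<bullet> \<phi>' t) + (LINT t|time_measure T. R t \<bullet> \<phi> t) = - (v0 \<bullet> \<phi> 0)"
  using Bochner_Integration.integral_add[OF open_interval_integral(1)[OF cA] open_interval_integral(1)[OF cB]] by simp
 have "(LINT t|time_measure T. v t \<bullet> \<phi>' t) = (LINT t|time_measure T. v1 t \<bullet> \<phi>' t + primitive T g t \<bullet> \<phi>' t)"
  by (rule Bochner_Integration.integral_cong[OF refl]) (auto simp: v v1_def inner_add_left)
 also have "\<dots> = (LINT t|time_measure T. v1 t \<bullet> \<phi>' t) + (LINT t|time_measure T. primitive T g t \<bullet> \<phi>' t)"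
  by (rule Bochner_Integration.integral_add[OF open_interval_integral(1)[OF cA] open_interval_integral(1)[OF cP]])
 also have "(LINT t|time_measure T. primitive T g t \<bullet> \<phi>' t) = - (LINT t|time_measure T. g t \<bullet> \<phi> t)"
  by (rule primitive_by_parts[OF a S der cont end0 T])
 finally show ?thesis using s1 by linarith
qed

section \<open>Bochner spaces over the Voigt space\<close>

context voigt_domain
begin

lemma emb_sum:
 assumes "finite F" "\<And>y. y \<in> F \<Longrightarrow> u y \<in> W1p_space 2 \<Omega>"
 shows "(\<lambda>x. \<Sum>y\<in>F. c y *\<^sub>R u y x) \<in> W1p_space 2 \<Omega>" "emb (\<lambda>x. \<Sum>y\<in>F. c y *\<^sub>R u y x) = (\<Sum>y\<in>F. c y *\<^sub>R emb (u y))"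
proof -
 have "(\<lambda>x. \<Sum>y\<in>F. c y *\<^sub>R u y x) \<in> W1p_space 2 \<Omega> \<and> emb (\<lambda>x. \<Sum>y\<in>F. c y *\<^sub>R u y x) = (\<Sum>y\<in>F. c y *\<^sub>R emb (u y))"
  using assms
 proof (induction F rule: finite_induct)
  case empty
  show ?case
   using W1p_scaleR[OF test_W1p[OF solenoidal_testD[OF zero_solenoidal_test]], of 0] test_W1p[OF solenoidal_testD[OF zero_solenoidal_test]] by simp
 next
  case (insert y F)
  then have IH: "(\<lambda>x. \<Sum>y\<in>F. c y *\<^sub>R u y x) \<in> W1p_space 2 \<Omega>" "emb (\<lambda>x. \<Sum>y\<in>F. c y *\<^sub>R u y x) = (\<Sum>y\<in>F. c y *\<^sub>R emb (u y))"
   and uy: "u y \<in> W1p_space 2 \<Omega>" by auto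
  show ?case using W1p_lincomb[OF uy IH(1), of "c y" 1] insert.hyps IH(2) by simp
 qed
 then show "(\<lambda>x. \<Sum>y\<in>F. c y *\<^sub>R u y x) \<in> W1p_space 2 \<Omega>" "emb (\<lambda>x. \<Sum>y\<in>F. c y *\<^sub>R u y x) = (\<Sum>y\<in>F. c y *\<^sub>R emb (u y))" by auto
qed

text \<open>
 The common property of \<open>V_norm\<close> and \<open>W1p_norm p\<close> from which strong measurability follows.
\<close>

definition seminorm_le :: "((real^'n \<Rightarrow> real^'n) \<Rightarrow> real) \<Rightarrow> real \<Rightarrow> bool" where
 "seminorm_le N K \<longleftrightarrow> (\<forall>u\<in>W1p_space 2 \<Omega>. 0 \<le> N u \<and> N u \<le> K * norm (emb u))"

lemma seminorm_le_V_norm: "seminorm_le (V_norm \<Omega>) (1 / rk)"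
 unfolding seminorm_le_def using norm_bounds(2) by (auto simp: V_norm_def Lp_norm_nonneg)

lemma seminorm_le_W1p_norm: "0 < p \<Longrightarrow> p \<le> 2 \<Longrightarrow> seminorm_le (W1p_norm p \<Omega>) (W1p_const p)"
 unfolding seminorm_le_def using W1p_norm_le_emb(2) by (auto simp: W1p_norm_def)

lemma seminorm_diff:
 assumes N: "seminorm_le N K" and u: "u \<in> W1p_space 2 \<Omega>" and h: "h \<in> Vhat"
 shows "0 \<le> N (\<lambda>x. vel h x - u x)" "N (\<lambda>x. vel h x - u x) \<le> K * norm (h - emb u)"
proof -
 note W = W1p_diff[OF vel_W1p[OF Vhat_grad[OF h]] u]
 show "0 \<le> N (\<lambda>x. vel h x - u x)" "N (\<lambda>x. vel h x - u x) \<le> K * norm (h - emb u)"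
  using N W(1) unfolding seminorm_le_def W(2)[unfolded emb_vel[OF Vhat_grad[OF h]], symmetric] by auto
qed

text \<open>
 A curve of functions is represented by a curve in \<open>Vhat\<close> up to a null set of times.  Its simple
 approximants in the function space are the velocity fields of those in \<open>Vhat\<close>.
\<close>

definition represents :: "real \<Rightarrow> (real \<Rightarrow> 'n pair_L2) \<Rightarrow> (real \<Rightarrow> real^'n \<Rightarrow> real^'n) \<Rightarrow> bool" where
 "represents T g u \<longleftrightarrow> (AE t in time_measure T. u t \<in> W1p_space 2 \<Omega> \<and> emb (u t) = g t)"

lemma simple_into_vel:
 assumes a: "approximated T Vhat B g s" and p: "0 < p" "p \<le> 2"
 shows "simple_into (time_measure T) (Vp_space p \<Omega>) (\<lambda>t. vel (s n t))"
 unfolding simple_into_def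
proof
 show "simple_function (time_measure T) (\<lambda>t. vel (s n t))"
  using simple_function_compose[OF approximatedD(1)[OF a], of vel] by (simp add: o_def)
 show "(\<lambda>t. vel (s n t)) ` space (time_measure T) \<subseteq> Vp_space p \<Omega>"
  using approximatedD(2)[OF a] by (auto intro!: vel_Vp_space p)
qed

lemma strongly_measurable_represents:
 assumes a: "approximated T Vhat B g s" and r: "represents T g u" and p: "0 < p" "p \<le> 2"
  and N: "seminorm_le N K"
 shows "strongly_measurable (time_measure T) (Vp_space p \<Omega>) N u"
 unfolding strongly_measurable_def
proof (intro conjI exI allI)
 show "AE t in time_measure T. u t \<in> Vp_space p \<Omega>"
  using r[unfolded represents_def] approximated_closed[OF a V.cl]
  by eventually_elim (auto intro!: Vp_space_of_emb p)
 show "simple_into (time_measure T) (Vp_space p \<Omega>) (\<lambda>t. vel (s n t))" for n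
  by (rule simple_into_vel[OF a p])
 show "AE t in time_measure T. (\<lambda>n. N (\<lambda>x. vel (s n t) x - u t x)) \<longlonglongrightarrow> 0"
  using r[unfolded represents_def] approximatedD(3)[OF a] AE_time_space
 proof eventually_elim
  case (elim t)
  then have u: "u t \<in> W1p_space 2 \<Omega>" and e: "emb (u t) = g t" by auto
  have "(\<lambda>n. K * norm (s n t - g t)) \<longlonglongrightarrow> K * norm (g t - g t)" by (intro tendsto_intros elim)
  then have z: "(\<lambda>n. K * norm (s n t - g t)) \<longlonglongrightarrow> 0" by simp
  show ?case
   by (rule tendsto_sandwich[OF _ _ tendsto_const z])
     (use seminorm_diff[OF N u approximatedD(2)[OF a elim(3)]] in \<open>auto simp: e\<close>)
 qed
qed

text \<open>
 As \<open>vel\<close> is injective on \<open>Vhat\<close>, the integral of a simple function with values in the function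
 space corresponds to the same sum of vectors of \<open>Vhat\<close>.
\<close>

lemma has_integral_represents:
 assumes a: "approximated T Vhat B g s" and r: "represents T g u"
 shows "has_integral_into (time_measure T) (V_space \<Omega>) (V_norm \<Omega>) u (vel (time_integral T g))"
 unfolding has_integral_into_def
proof (intro conjI exI allI)
 let ?M = "time_measure T" and ?I = "time_integral T g"
 note N = seminorm_le_V_norm
 have I: "?I \<in> Vhat" by (rule time_integral(4)[OF a subspace_Vhat V.cl])
 show "strongly_measurable ?M (V_space \<Omega>) (V_norm \<Omega>) u"
  by (rule strongly_measurable_represents[OF a r _ _ N]) auto
 show "vel ?I \<in> V_space \<Omega>" by (rule vel_Vp_space[OF I]) auto
 show "simple_into ?M (V_space \<Omega>) (\<lambda>t. vel (s n t))" for n by (rule simple_into_vel[OF a]) auto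
 show "(\<lambda>n. \<integral>\<^sup>+t. ennreal (V_norm \<Omega> (\<lambda>x. vel (s n t) x - u t x)) \<partial>?M) \<longlonglongrightarrow> 0"
 proof (rule tendsto_sandwich[OF _ _ tendsto_const])
  note mean = approximated_mean[OF a]
  have "(\<lambda>n. ennreal (1 / rk * (LINT t|?M. norm (s n t - g t)))) \<longlonglongrightarrow> ennreal (1 / rk * 0)"
   by (intro tendsto_intros mean)
  then show "(\<lambda>n. ennreal (1 / rk * (LINT t|?M. norm (s n t - g t)))) \<longlonglongrightarrow> 0" by simp
  show "\<forall>\<^sub>F n in sequentially. (\<integral>\<^sup>+t. ennreal (V_norm \<Omega> (\<lambda>x. vel (s n t) x - u t x)) \<partial>?M)
    \<le> ennreal (1 / rk * (LINT t|?M. norm (s n t - g t)))"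
  proof (intro always_eventually allI)
   fix n
   have "(\<integral>\<^sup>+t. ennreal (V_norm \<Omega> (\<lambda>x. vel (s n t) x - u t x)) \<partial>?M) \<le> (\<integral>\<^sup>+t. ennreal (1 / rk * norm (s n t - g t)) \<partial>?M)"
   proof (rule nn_integral_mono_AE)
    show "AE t in ?M. ennreal (V_norm \<Omega> (\<lambda>x. vel (s n t) x - u t x)) \<le> ennreal (1 / rk * norm (s n t - g t))"
     using r[unfolded represents_def] AE_time_space
    proof eventually_elim
     case (elim t)
     then have u: "u t \<in> W1p_space 2 \<Omega>" and e: "emb (u t) = g t" by auto
     show ?case using seminorm_diff(2)[OF N u approximatedD(2)[OF a elim(2)], of n] unfolding e by (rule ennreal_leI)
    qed
   qed
   also have "\<dots> = ennreal (LINT t|?M. 1 / rk * norm (s n t - g t))"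
    by (rule nn_integral_eq_integral[OF integrable_mult_right[OF mean(2)]]) (use rk in auto)
   also have "\<dots> = ennreal (1 / rk * (LINT t|?M. norm (s n t - g t)))" by simp
   finally show "(\<integral>\<^sup>+t. ennreal (V_norm \<Omega> (\<lambda>x. vel (s n t) x - u t x)) \<partial>?M)
    \<le> ennreal (1 / rk * (LINT t|?M. norm (s n t - g t)))" .
  qed
 qed auto
 show "(\<lambda>n. V_norm \<Omega> (\<lambda>x. simple_integral_into ?M (\<lambda>t. vel (s n t)) x - vel ?I x)) \<longlonglongrightarrow> 0"
 proof -
  have sm: "simple_integral_into ?M (\<lambda>t. vel (s n t)) \<in> W1p_space 2 \<Omega>"
   "emb (simple_integral_into ?M (\<lambda>t. vel (s n t))) = simple_sum T (s n)" for n
  proof -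
   let ?F = "s n ` space ?M"
   have fin: "finite ?F" using approximatedD(1)[OF a, of n] by (simp add: simple_function_def)
   have V: "y \<in> Vhat" if "y \<in> ?F" for y using approximatedD(2)[OF a] that by auto
   have inj: "vel y = vel z \<longleftrightarrow> y = z" if "y \<in> Vhat" "z \<in> Vhat" for y z
    by (metis emb_vel[OF Vhat_grad[OF that(1)]] emb_vel[OF Vhat_grad[OF that(2)]])
   have eq: "simple_integral_into ?M (\<lambda>t. vel (s n t)) =
     (\<lambda>x. \<Sum>y\<in>?F. measure ?M {t \<in> space ?M. s n t = y} *\<^sub>R vel y x)"
   proof
    fix x
    have "simple_integral_into ?M (\<lambda>t. vel (s n t)) x =
      (\<Sum>f\<in>vel ` ?F. measure ?M {t \<in> space ?M. vel (s n t) = f} *\<^sub>R f x)"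
     by (simp add: simple_integral_into_def image_image)
    also have "\<dots> = (\<Sum>y\<in>?F. measure ?M {t \<in> space ?M. vel (s n t) = vel y} *\<^sub>R vel y x)"
     by (rule sum.reindex_cong[OF _ refl refl]) (use inj[OF V V] in \<open>simp add: inj_on_def\<close>)
    also have "\<dots> = (\<Sum>y\<in>?F. measure ?M {t \<in> space ?M. s n t = y} *\<^sub>R vel y x)"
    proof (rule sum.cong[OF refl])
     fix y assume y: "y \<in> ?F"
     have "{t \<in> space ?M. vel (s n t) = vel y} = {t \<in> space ?M. s n t = y}"
      using inj[OF V V] y by blast
     then show "measure ?M {t \<in> space ?M. vel (s n t) = vel y} *\<^sub>R vel y x = measure ?M {t \<in> space ?M. s n t = y} *\<^sub>R vel y x" by simp
    qed
    finally show "simple_integral_into ?M (\<lambda>t. vel (s n t)) x = (\<Sum>y\<in>?F. measure ?M {t \<in> space ?M. s n t = y} *\<^sub>R vel y x)" .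
   qed
   note E = emb_sum[OF fin, of vel "\<lambda>y. measure ?M {t \<in> space ?M. s n t = y}", OF vel_W1p[OF Vhat_grad[OF V]]]
   show "simple_integral_into ?M (\<lambda>t. vel (s n t)) \<in> W1p_space 2 \<Omega>" unfolding eq by (rule E(1))
   have "emb (simple_integral_into ?M (\<lambda>t. vel (s n t))) = (\<Sum>y\<in>?F. measure ?M {t \<in> space ?M. s n t = y} *\<^sub>R emb (vel y))"
    unfolding eq by (rule E(2))
   also have "\<dots> = simple_sum T (s n)" unfolding simple_sum_def
    by (rule sum.cong[OF refl]) (simp only: emb_vel[OF Vhat_grad[OF V]])
   finally show "emb (simple_integral_into ?M (\<lambda>t. vel (s n t))) = simple_sum T (s n)" .
  qed
  have bd: "0 \<le> V_norm \<Omega> (\<lambda>x. simple_integral_into ?M (\<lambda>t. vel (s n t)) x - vel ?I x)"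
   "V_norm \<Omega> (\<lambda>x. simple_integral_into ?M (\<lambda>t. vel (s n t)) x - vel ?I x) \<le> 1 / rk * norm (simple_sum T (s n) - ?I)" for n
  proof -
   note W = W1p_diff[OF sm(1)[of n] vel_W1p[OF Vhat_grad[OF I]]]
   show "0 \<le> V_norm \<Omega> (\<lambda>x. simple_integral_into ?M (\<lambda>t. vel (s n t)) x - vel ?I x)" by (simp add: V_norm_def Lp_norm_nonneg)
   show "V_norm \<Omega> (\<lambda>x. simple_integral_into ?M (\<lambda>t. vel (s n t)) x - vel ?I x) \<le> 1 / rk * norm (simple_sum T (s n) - ?I)"
    using N W(1) unfolding seminorm_le_def W(2)[unfolded sm(2) emb_vel[OF Vhat_grad[OF I]], symmetric] by blast
  qed
  have "(\<lambda>n. 1 / rk * norm (simple_sum T (s n) - ?I)) \<longlonglongrightarrow> 1 / rk * norm (?I - ?I)"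
   by (intro tendsto_intros time_integral(2)[OF a])
  then have z: "(\<lambda>n. 1 / rk * norm (simple_sum T (s n) - ?I)) \<longlonglongrightarrow> 0" by simp
  show ?thesis by (rule tendsto_sandwich[OF _ _ tendsto_const z]) (use bd in auto)
 qed
qed

lemma represents_vel: "approximated T Vhat B g s \<Longrightarrow> represents T g (\<lambda>t. vel (g t))"
 unfolding represents_def using approximated_closed[OF _ V.cl, of T B g s]
 by (auto intro: vel_W1p Vhat_grad emb_vel elim!: eventually_mono)

lemma represents_scale_vel:
 assumes "approximated T Vhat B g s" shows "represents T (\<lambda>t. c t *\<^sub>R g t) (\<lambda>t x. c t *\<^sub>R vel (g t) x)"
 unfolding represents_def using approximated_closed[OF assms V.cl]
proof eventually_elim
 case (elim t)
 show ?case using W1p_scaleR[OF vel_W1p[OF Vhat_grad[OF elim]], of "c t"] by (simp add: emb_vel Vhat_grad elim)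
qed

text \<open>
 The difference of the two integrals in the definition of the weak time derivative is tested
 against every vector of the Hilbert space by integration by parts.
\<close>

theorem weak_time_derivative_vel:
 fixes g R v :: "real \<Rightarrow> 'n pair_L2"
 assumes T: "0 < T" and a: "approximated T Vhat B g s"
  and R: "continuous_on {0..T} R" "\<And>t. t \<in> {0..T} \<Longrightarrow> R t \<in> Vhat"
  and vV: "\<And>t. t \<in> {0..T} \<Longrightarrow> v t \<in> Vhat" and cv: "continuous_on {0..T} v"
  and v: "\<And>t. t \<in> {0..T} \<Longrightarrow> v t = v0 + primitive T g t + integral {0..t} R"
 shows "is_weak_time_derivative T (V_space \<Omega>) (V_norm \<Omega>) (\<lambda>t. vel (v t)) (\<lambda>t. vel (R t + g t))"
 unfolding is_weak_time_derivative_def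
proof (intro allI impI)
 fix \<eta> :: "real \<Rightarrow> real" assume \<eta>: "test_function {0<..<T} \<eta>"
 have sm: "smooth \<eta>" using \<eta> by (simp add: test_function_def)
 have d\<eta>: "(\<eta> has_field_derivative deriv \<eta> t) (at t)" for t
  using smooth_has_derivative[OF sm, of t]
  by (metis DERIV_deriv_iff_real_differentiable differentiable_def)
 have "deriv \<eta> t = frechet_derivative \<eta> (at t) 1" for t
 proof -
  have "(\<eta> has_derivative (\<lambda>h. deriv \<eta> t * h)) (at t)" using d\<eta>[of t] by (simp add: has_field_derivative_def)
  from fun_cong[OF frechet_derivative_at[OF this], of 1] show ?thesis by simp
 qed
 then have "deriv \<eta> = (\<lambda>t. frechet_derivative \<eta> (at t) 1)" by blast
 then have cd: "continuous_on UNIV (deriv \<eta>)" using smooth_continuous_derivative[OF sm, of 1] by simp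
 have c\<eta>: "continuous_on UNIV \<eta>" by (rule smooth_continuous[OF sm])
 have supp: "\<eta> t = 0" if "t \<notin> {0<..<T}" for t
  using \<eta> that closure_subset[of "{x. \<eta> x \<noteq> 0}"] unfolding test_function_def by blast
 obtain Cv where Cv: "\<And>t. t \<in> {0..T} \<Longrightarrow> norm (v t) \<le> Cv" using continuous_interval_bounded[OF cv] by blast
 obtain CR where CR: "\<And>t. t \<in> {0..T} \<Longrightarrow> norm (R t) \<le> CR" using continuous_interval_bounded[OF R(1)] by blast
 obtain C1 where C1: "\<And>t. t \<in> {0..T} \<Longrightarrow> norm (deriv \<eta> t) \<le> C1"
  using continuous_interval_bounded[OF continuous_on_subset[OF cd]] by blast
 obtain C2 where C2: "\<And>t. t \<in> {0..T} \<Longrightarrow> norm (\<eta> t) \<le> C2"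
  using continuous_interval_bounded[OF continuous_on_subset[OF c\<eta>]] by blast
 note av = approximated_continuous[OF T cv vV Cv]
 note aR = approximated_continuous[OF T R CR]
 note aw = approximated_add[OF aR a subspace_Vhat]
 have a1: "\<exists>B s. approximated T Vhat B (\<lambda>t. deriv \<eta> t *\<^sub>R v t) s"
  by (rule exI, rule exI, rule approximated_scale_continuous[OF T av subspace_Vhat continuous_on_subset[OF cd] C1[unfolded real_norm_def]]) auto
 have a2: "\<exists>B s. approximated T Vhat B (\<lambda>t. (- \<eta> t) *\<^sub>R (R t + g t)) s"
  by (rule exI, rule exI, rule approximated_scale_continuous[OF T aw subspace_Vhat, of "\<lambda>t. - \<eta> t" C2])
    (use C2 in \<open>auto intro!: continuous_intros continuous_on_subset[OF c\<eta>]\<close>)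
 obtain B1 s1 where a1: "approximated T Vhat B1 (\<lambda>t. deriv \<eta> t *\<^sub>R v t) s1" using a1 by blast
 obtain B2 s2 where a2: "approximated T Vhat B2 (\<lambda>t. (- \<eta> t) *\<^sub>R (R t + g t)) s2" using a2 by blast
 have parts: "time_integral T (\<lambda>t. deriv \<eta> t *\<^sub>R v t) \<bullet> \<psi> = time_integral T (\<lambda>t. (- \<eta> t) *\<^sub>R (R t + g t)) \<bullet> \<psi>" for \<psi>
 proof -
  have "(LINT t|time_measure T. v t \<bullet> (deriv \<eta> t *\<^sub>R \<psi>)) =
    - (v0 \<bullet> (\<eta> 0 *\<^sub>R \<psi>)) - (LINT t|time_measure T. R t \<bullet> (\<eta> t *\<^sub>R \<psi>)) - (LINT t|time_measure T. g t \<bullet> (\<eta> t *\<^sub>R \<psi>))"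
  proof (rule curve_by_parts[OF a subspace_Vhat R(1) v _ _ _ T])
   show "((\<lambda>t. \<eta> t *\<^sub>R \<psi>) has_vector_derivative deriv \<eta> t *\<^sub>R \<psi>) (at t within {0..T})" for t
    using has_vector_derivative_scaleR[OF has_field_derivative_at_within[OF d\<eta>[of t]] has_vector_derivative_const[of \<psi>]] by simp
   show "continuous_on {0..T} (\<lambda>t. deriv \<eta> t *\<^sub>R \<psi>)" by (intro continuous_intros continuous_on_subset[OF cd]) auto
   show "\<eta> T *\<^sub>R \<psi> = 0" using supp by simp
  qed
  moreover have "continuous_on {0..T} (\<lambda>t. \<eta> t *\<^sub>R \<psi>)" by (intro continuous_intros continuous_on_subset[OF c\<eta>]) auto
  from approximated_inner(1)[OF aR this] approximated_inner(1)[OF a this]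
  have "(LINT t|time_measure T. R t \<bullet> (\<eta> t *\<^sub>R \<psi>)) + (LINT t|time_measure T. g t \<bullet> (\<eta> t *\<^sub>R \<psi>)) =
    (LINT t|time_measure T. R t \<bullet> (\<eta> t *\<^sub>R \<psi>) + g t \<bullet> (\<eta> t *\<^sub>R \<psi>))" by (rule Bochner_Integration.integral_add[symmetric])
  moreover have "\<dots> = - (LINT t|time_measure T. ((- \<eta> t) *\<^sub>R (R t + g t)) \<bullet> \<psi>)"
   unfolding Bochner_Integration.integral_minus[symmetric]
   by (rule Bochner_Integration.integral_cong[OF refl]) (simp add: inner_add_left algebra_simps)
  moreover have "(LINT t|time_measure T. v t \<bullet> (deriv \<eta> t *\<^sub>R \<psi>)) = (LINT t|time_measure T. (deriv \<eta> t *\<^sub>R v t) \<bullet> \<psi>)"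
   by simp
  ultimately show ?thesis unfolding time_integral(1)[OF a1] time_integral(1)[OF a2] using supp[of 0] by simp
 qed
 have eq: "time_integral T (\<lambda>t. deriv \<eta> t *\<^sub>R v t) = time_integral T (\<lambda>t. (- \<eta> t) *\<^sub>R (R t + g t))"
 proof -
  let ?d = "time_integral T (\<lambda>t. deriv \<eta> t *\<^sub>R v t) - time_integral T (\<lambda>t. (- \<eta> t) *\<^sub>R (R t + g t))"
  have "?d \<bullet> ?d = 0" unfolding inner_diff_left parts by simp
  then show ?thesis by simp
 qed
 show "\<exists>I. has_integral_into (time_measure T) (V_space \<Omega>) (V_norm \<Omega>) (\<lambda>t x. deriv \<eta> t *\<^sub>R vel (v t) x) I \<and>
   has_integral_into (time_measure T) (V_space \<Omega>) (V_norm \<Omega>) (\<lambda>t x. - (\<eta> t *\<^sub>R vel (R t + g t) x)) I"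
  using has_integral_represents[OF a1 represents_scale_vel[OF av]]
   has_integral_represents[OF a2 represents_scale_vel[OF aw]] unfolding eq by auto
qed

end

section \<open>Space-time test fields as curves in the Voigt space\<close>

lemma smooth_compose_linear:
 "bounded_linear L \<Longrightarrow> smooth f \<Longrightarrow> smooth (\<lambda>x. f (L x + c))"
 by (simp add: smooth_def Ck_compose_linear)

lemma smooth_derivative: "smooth f \<Longrightarrow> smooth (\<lambda>x. frechet_derivative f (at x) u)"
 unfolding smooth_def using Ck_derivative by blast

lemma smooth_derivative_scaleR:
 assumes "smooth F" shows "frechet_derivative F (at z) (h *\<^sub>R u) = h *\<^sub>R frechet_derivative F (at z) u"
 by (rule linear_scale[OF has_derivative_linear[OF smooth_has_derivative[OF assms]]])

lemma smooth_slice: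
 fixes F :: "real \<times> 'a::euclidean_space \<Rightarrow> 'b::real_normed_vector"
 assumes "smooth F"
 shows "smooth (\<lambda>x. F (t, x))"
  and "frechet_derivative (\<lambda>x. F (t, x)) (at x) u = frechet_derivative F (at (t, x)) (0, u)"
  and "((\<lambda>t. F (t, x)) has_vector_derivative frechet_derivative F (at (t, x)) (1, 0)) (at t within S)"
proof -
 have L: "bounded_linear (\<lambda>x::'a. (0::real, x))" by (intro bounded_linear_intros)
 show "smooth (\<lambda>x. F (t, x))" using smooth_compose_linear[OF L assms, of "(t, 0)"] by simp
 have d: "((\<lambda>x. (t, x)) has_derivative (\<lambda>u. (0, u))) (at x)" by (auto intro!: derivative_eq_intros)
 show "frechet_derivative (\<lambda>x. F (t, x)) (at x) u = frechet_derivative F (at (t, x)) (0, u)"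
  by (rule fun_cong[OF frechet_derivative_at[OF has_derivative_compose[OF d smooth_has_derivative[OF assms]], symmetric]])
 have "((\<lambda>t. (t, x)) has_derivative (\<lambda>h. (h, 0))) (at t within S)" by (auto intro!: derivative_eq_intros)
 from has_derivative_compose[OF this smooth_has_derivative[OF assms]]
 have "((\<lambda>t. F (t, x)) has_derivative (\<lambda>h. frechet_derivative F (at (t, x)) (h, 0))) (at t within S)" .
 moreover have eq: "frechet_derivative F (at (t, x)) (h, 0) = h *\<^sub>R frechet_derivative F (at (t, x)) (1, 0)" for h
  using smooth_derivative_scaleR[OF assms, of "(t, x)" h "(1, 0)"] by simp
 ultimately show "((\<lambda>t. F (t, x)) has_vector_derivative frechet_derivative F (at (t, x)) (1, 0)) (at t within S)"
  unfolding has_vector_derivative_def eq[symmetric] by (simp only:)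
qed

text \<open>
 Mixed partial derivatives commute: differentiate \<open>F(t, x + s e) - F(a, x + s e)\<close>, the integral of
 the time derivative, in \<open>s\<close> under the integral sign.
\<close>

lemma mixed_derivative:
 fixes F :: "real \<times> 'a::euclidean_space \<Rightarrow> 'b::euclidean_space"
 assumes F: "smooth F"
 defines "Ft \<equiv> \<lambda>z. frechet_derivative F (at z) (1, 0)"
 shows "((\<lambda>t. frechet_derivative F (at (t, x)) (0, e)) has_vector_derivative frechet_derivative Ft (at (t, x)) (0, e)) (at t)"
proof -
 let ?De = "\<lambda>G z. frechet_derivative G (at z) (0, e)"
 have Ft: "smooth Ft" unfolding Ft_def by (rule smooth_derivative[OF F])
 have dir: "((\<lambda>s. G (t, x + s *\<^sub>R e)) has_vector_derivative ?De G (t, x + s *\<^sub>R e)) (at s)"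
  if G: "smooth G" for G :: "real \<times> 'a \<Rightarrow> 'b" and t s
 proof -
  have "((\<lambda>s. (t, x + s *\<^sub>R e)) has_derivative (\<lambda>h. (0, h *\<^sub>R e))) (at s)" by (auto intro!: derivative_eq_intros)
  from has_derivative_compose[OF this smooth_has_derivative[OF G]]
  have "((\<lambda>s. G (t, x + s *\<^sub>R e)) has_derivative (\<lambda>h. frechet_derivative G (at (t, x + s *\<^sub>R e)) (0, h *\<^sub>R e))) (at s)" .
  moreover have eq: "frechet_derivative G (at z) (0, h *\<^sub>R e) = h *\<^sub>R ?De G z" for h z
   using smooth_derivative_scaleR[OF G, of z h "(0, e)"] by simp
  ultimately show ?thesis unfolding has_vector_derivative_def eq[symmetric] by (simp only:)
 qed
 have cont: "continuous_on UNIV (?De Ft)" by (rule smooth_continuous_derivative[OF Ft])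
 define a where "a = t - 1"
 have int: "?De F (r, x) = ?De F (a, x) + integral {a..r} (\<lambda>q. ?De Ft (q, x))" if r: "a \<le> r" for r
 proof -
  have "((\<lambda>q. Ft (q, x + s *\<^sub>R e)) has_integral F (r, x + s *\<^sub>R e) - F (a, x + s *\<^sub>R e)) {a..r}" for s
   unfolding Ft_def by (rule fundamental_theorem_of_calculus[OF r]) (rule smooth_slice(3)[OF F])
  then have i: "(\<lambda>q. Ft (q, x + s *\<^sub>R e)) integrable_on {a..r}"
   and eq: "integral {a..r} (\<lambda>q. Ft (q, x + s *\<^sub>R e)) = F (r, x + s *\<^sub>R e) - F (a, x + s *\<^sub>R e)" for s
   by (auto simp: integral_unique intro: has_integral_integrable)
  have "((\<lambda>s. integral (cbox a r) (\<lambda>q. Ft (q, x + s *\<^sub>R e))) has_vector_derivative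
    integral (cbox a r) (\<lambda>q. ?De Ft (q, x + 0 *\<^sub>R e))) (at 0 within UNIV)"
  proof (rule leibniz_rule_vector_derivative[where f="\<lambda>s q. Ft (q, x + s *\<^sub>R e)" and fx="\<lambda>s q. ?De Ft (q, x + s *\<^sub>R e)"])
   show "continuous_on (UNIV \<times> cbox a r) (\<lambda>(s, q). ?De Ft (q, x + s *\<^sub>R e))"
    unfolding split_def by (rule continuous_on_compose2[OF cont]) (auto intro!: continuous_intros)
  qed (use dir[OF Ft] i in \<open>auto\<close>)
  then have "((\<lambda>s. F (r, x + s *\<^sub>R e) - F (a, x + s *\<^sub>R e)) has_vector_derivative integral {a..r} (\<lambda>q. ?De Ft (q, x))) (at 0)"
   by (simp add: eq)
  moreover have "((\<lambda>s. F (r, x + s *\<^sub>R e) - F (a, x + s *\<^sub>R e)) has_vector_derivative ?De F (r, x + 0 *\<^sub>R e) - ?De F (a, x + 0 *\<^sub>R e)) (at 0)"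
   by (intro has_vector_derivative_diff dir F)
  ultimately have "integral {a..r} (\<lambda>q. ?De Ft (q, x)) = ?De F (r, x + 0 *\<^sub>R e) - ?De F (a, x + 0 *\<^sub>R e)"
   by (rule vector_derivative_unique_at)
  then show ?thesis by simp
 qed
 have "continuous_on {a..t + 1} (\<lambda>q. ?De Ft (q, x))"
  by (rule continuous_on_compose2[OF cont]) (auto intro!: continuous_intros)
 then have "((\<lambda>r. integral {a..r} (\<lambda>q. ?De Ft (q, x))) has_vector_derivative ?De Ft (t, x)) (at t within {a..t + 1})"
  by (rule integral_has_vector_derivative) (simp add: a_def)
 from has_vector_derivative_add[OF has_vector_derivative_const[of "?De F (a, x)"] this]
 have "((\<lambda>r. ?De F (a, x) + integral {a..r} (\<lambda>q. ?De Ft (q, x))) has_vector_derivative ?De Ft (t, x)) (at t within {a..t + 1})"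
  by simp
 then have "((\<lambda>r. ?De F (r, x)) has_vector_derivative ?De Ft (t, x)) (at t within {a..t + 1})"
  by (rule has_vector_derivative_transform[rotated 2]) (simp add: a_def, rule int, simp)
 moreover have "at t within {a..t + 1} = at t" by (rule at_within_Icc_at) (auto simp: a_def)
 ultimately show ?thesis by (simp only:)
qed

definition matrix_column :: "'n::finite \<Rightarrow> real^'n \<Rightarrow> real^'n^'n" where
 "matrix_column j y = (\<chi> i k. if k = j then y $ i else 0)"

lemma bounded_linear_matrix_column: "bounded_linear (matrix_column j)"
 by (subst linear_conv_bounded_linear[symmetric])
   (auto intro!: linearI simp: matrix_column_def vec_eq_iff)

text \<open>
 With the Jacobian as a sum of bounded linear images of directional derivatives, continuity and
 derivatives in time carry over from these.
\<close>

lemma jacobian_columns: "jacobian f (at x) = (\<Sum>j\<in>UNIV. matrix_column j (frechet_derivative f (at x) (axis j 1)))"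
 for f :: "real^'n \<Rightarrow> real^'n"
 by (simp add: vec_eq_iff jacobian_nth matrix_column_def)

context voigt_domain
begin

text \<open>
 The field and its derivatives are supported in one compact subset of \<open>\<Omega>\<close> for all times, so that
 the classical time derivative is also the derivative in \<open>L\<^sup>2\<close>.
\<close>

lemma spacetime_test_curve:
 fixes \<phi> :: "real \<Rightarrow> real^'n \<Rightarrow> real^'n"
 assumes \<phi>: "\<phi> \<in> spacetime_test \<Omega> T" and T: "0 < T"
 shows "t \<in> {0..T} \<Longrightarrow> \<phi> t \<in> solenoidal_test \<Omega>" "emb (\<phi> T) = 0"
  and "t \<in> {0..T} \<Longrightarrow> test_function \<Omega> (time_deriv \<phi> t)"
  and "t \<in> {0..T} \<Longrightarrow> ((\<lambda>t. emb (\<phi> t)) has_vector_derivative emb (time_deriv \<phi> t)) (at t within {0..T})"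
  and "continuous_on {0..T} (\<lambda>t. emb (time_deriv \<phi> t))"
  and "continuous_on {0..T} (\<lambda>t. pair_of (time_deriv \<phi> t) (\<lambda>x. 0))"
proof -
 define F where "F = (\<lambda>(t, x). \<phi> t x)"
 define Ft where "Ft = (\<lambda>z. frechet_derivative F (at z) (1, 0))"
 define C where "C = closure {(t, x). 0 \<le> t \<and> \<phi> t x \<noteq> 0}"
 define K where "K = snd ` C"
 have F: "smooth F" and C: "compact C" "C \<subseteq> {0..<T} \<times> \<Omega>"
  and div: "\<And>t x. t \<in> {0..<T} \<Longrightarrow> x \<in> \<Omega> \<Longrightarrow> divergence (\<phi> t) x = 0"
  using \<phi> by (auto simp: spacetime_test_def F_def C_def)
 have Ft: "smooth Ft" unfolding Ft_def by (rule smooth_derivative[OF F])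
 have \<phi>F: "\<phi> t = (\<lambda>x. F (t, x))" for t by (simp add: F_def)
 have K: "compact K" "K \<subseteq> \<Omega>"
  unfolding K_def using C by (auto intro!: compact_continuous_image continuous_on_snd continuous_on_id)
 have inC: "(t, x) \<in> C" if "0 \<le> t" "F (t, x) \<noteq> 0" for t x
  unfolding C_def by (rule subsetD[OF closure_subset]) (use that in \<open>simp add: F_def\<close>)
 have outF: "F (t, x) = 0" if "0 \<le> t" "x \<notin> K" for t x
  using inC[OF that(1), of x] that(2) unfolding K_def by force
 have FT: "F (T, x) = 0" for x using inC[of T x] C T by fastforce
 have tdF: "time_deriv \<phi> t = (\<lambda>x. Ft (t, x))" for t
 proof
  fix x show "time_deriv \<phi> t x = Ft (t, x)"
   unfolding time_deriv_def \<phi>F Ft_def by (rule vector_derivative_at[OF smooth_slice(3)[OF F]])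
 qed
 have outFt: "Ft (t, x) = 0" if t: "0 \<le> t" and x: "x \<notin> K" for t x
 proof -
  have d1: "((\<lambda>s. F (s, x)) has_vector_derivative Ft (t, x)) (at t within cbox t (t + 1))"
   unfolding Ft_def by (rule smooth_slice(3)[OF F])
  have "((\<lambda>s. 0) has_vector_derivative Ft (t, x)) (at t within cbox t (t + 1))"
   by (rule has_vector_derivative_transform[OF _ _ d1]) (use outF x t in auto)
  from vector_derivative_unique_within_closed_interval[OF _ _ this has_vector_derivative_const]
  show ?thesis by simp
 qed
 have test: "test_function \<Omega> f" if s: "smooth f" and o: "\<And>x. x \<notin> K \<Longrightarrow> f x = 0" for f :: "real^'n \<Rightarrow> real^'n"
 proof -
  have sub: "closure {x. f x \<noteq> 0} \<subseteq> K"
   by (rule closure_minimal[OF _ compact_imp_closed[OF K(1)]]) (use o in blast)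
  have "compact (closure {x. f x \<noteq> 0})"
   by (rule compact_closure[THEN iffD2, OF bounded_subset[OF compact_imp_bounded[OF K(1)]]]) (use o in blast)
  then show ?thesis unfolding test_function_def using s sub K by blast
 qed
 have outD: "frechet_derivative f (at x) u = 0"
  if s: "smooth f" and o: "\<And>x. x \<notin> K \<Longrightarrow> f x = 0" and x: "x \<notin> K" for f :: "real^'n \<Rightarrow> real^'n" and x u
 proof (rule derivative_zero_outside_support[OF s])
  have "closure {x. f x \<noteq> 0} \<subseteq> K"
   by (rule closure_minimal[OF _ compact_imp_closed[OF K(1)]]) (use o in blast)
  then show "x \<notin> closure {x. f x \<noteq> 0}" using x by blast
 qed
 have t\<phi>: "test_function \<Omega> (\<phi> t)" if "t \<in> {0..T}" for t
  unfolding \<phi>F by (rule test[OF smooth_slice(1)[OF F]]) (use that outF in auto)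
 show ttd: "test_function \<Omega> (time_deriv \<phi> t)" if "t \<in> {0..T}" for t
  unfolding tdF by (rule test[OF smooth_slice(1)[OF Ft]]) (use that outFt in auto)
 have zT: "\<phi> T = (\<lambda>x. 0)" using FT by (simp add: \<phi>F)
 show "\<phi> t \<in> solenoidal_test \<Omega>" if "t \<in> {0..T}" for t
 proof (cases "t = T")
  case True
  then show ?thesis using zero_solenoidal_test zT by simp
 next
  case False
  then show ?thesis using t\<phi>[OF that] div[of t] that unfolding solenoidal_test_def by auto
 qed
 show "emb (\<phi> T) = 0" unfolding zT
  using W1p_scaleR(2)[OF test_W1p[OF solenoidal_testD[OF zero_solenoidal_test]], of 0] by simp
 define jac where "jac G t x = (\<Sum>j\<in>UNIV. matrix_column j (frechet_derivative G (at (t, x)) (0, axis j 1)))"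
  for G :: "real \<times> (real^'n) \<Rightarrow> real^'n" and t x
 have jac: "jacobian (\<lambda>x. G (t, x)) (at x) = jac G t x" if "smooth G" for G t x
  unfolding jacobian_columns jac_def by (simp add: smooth_slice(2)[OF that])
 have cjac: "continuous_on S (\<lambda>(t, x). jac G t x)" if "smooth G" for G S
  unfolding jac_def split_def
  by (intro continuous_on_sum bounded_linear.continuous_on[OF bounded_linear_matrix_column])
    (use continuous_on_subset[OF smooth_continuous_derivative[OF that]] in simp)
 have cG: "continuous_on S (\<lambda>(t, x). G (t, x))" if "smooth G" for G :: "real \<times> (real^'n) \<Rightarrow> real^'n" and S
  using smooth_continuous[OF that] by (simp add: split_def)
 have outjac: "jac G t x = 0" if "smooth G" "\<And>x. x \<notin> K \<Longrightarrow> G (t, x) = 0" "x \<notin> K" for G t x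
  using outD[OF smooth_slice(1)[OF that(1)] that(2,3)]
  by (simp add: jac_def smooth_slice(2)[OF that(1)] bounded_linear.linear[OF bounded_linear_matrix_column] linear_0)
 define a where "a t x = (F (t, x), rk *\<^sub>R jac F t x)" for t x
 define b where "b t x = (Ft (t, x), rk *\<^sub>R jac Ft t x)" for t x
 define b0 where "b0 t x = (Ft (t, x), 0 :: real^'n^'n)" for t x
 have zx: "zext \<Omega> g = g" if "\<And>x. x \<notin> K \<Longrightarrow> g x = 0" for g :: "real^'n \<Rightarrow> 'b::real_vector"
  using K(2) that by (auto simp: zext_def indicator_def fun_eq_iff)
 have ea: "emb (\<phi> t) = L2_of (a t)" if t: "t \<in> {0..T}" for t
 proof -
  have o1: "zext \<Omega> (\<lambda>x. F (t, x)) = (\<lambda>x. F (t, x))" by (rule zx) (use outF t in auto)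
  have o2: "zext \<Omega> (\<lambda>x. rk *\<^sub>R jac F t x) = (\<lambda>x. rk *\<^sub>R jac F t x)" by (rule zx) (use outjac[OF F] outF t in auto)
  show ?thesis
   unfolding emb_test[OF t\<phi>[OF t]] unfolding \<phi>F jac[OF F] pair_of_def o1 o2 a_def[abs_def] ..
 qed
 have eb: "emb (time_deriv \<phi> t) = L2_of (b t)" "pair_of (time_deriv \<phi> t) (\<lambda>x. 0) = L2_of (b0 t)" if t: "t \<in> {0..T}" for t
 proof -
  have o1: "zext \<Omega> (\<lambda>x. Ft (t, x)) = (\<lambda>x. Ft (t, x))" by (rule zx) (use outFt t in auto)
  have o2: "zext \<Omega> (\<lambda>x. rk *\<^sub>R jac Ft t x) = (\<lambda>x. rk *\<^sub>R jac Ft t x)" by (rule zx) (use outjac[OF Ft] outFt t in auto)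
  have o3: "zext \<Omega> (\<lambda>x. 0) = (\<lambda>x. 0 :: real^'n^'n)" by (rule zx) auto
  show "emb (time_deriv \<phi> t) = L2_of (b t)"
   unfolding emb_test[OF ttd[OF t]] unfolding tdF jac[OF Ft] pair_of_def o1 o2 b_def[abs_def] ..
  show "pair_of (time_deriv \<phi> t) (\<lambda>x. 0) = L2_of (b0 t)"
   unfolding tdF pair_of_def o1 o3 b0_def[abs_def] ..
 qed
 have ca: "continuous_on ({0..T} \<times> UNIV) (\<lambda>(t, x). a t x)"
  and cb: "continuous_on ({0..T} \<times> UNIV) (\<lambda>(t, x). b t x)"
  and cb0: "continuous_on ({0..T} \<times> UNIV) (\<lambda>(t, x). b0 t x)"
  using cG[OF F] cG[OF Ft] cjac[OF F] cjac[OF Ft] unfolding a_def b_def b0_def split_def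
  by (intro continuous_intros; simp)+
 have oa: "a t x = 0" and ob: "b t x = 0" and ob0: "b0 t x = 0" if "t \<in> {0..T}" "x \<notin> K" for t x
  using that outF[of t] outFt[of t] outjac[OF F, of t x] outjac[OF Ft, of t x]
  by (auto simp: a_def b_def b0_def zero_prod_def)
 have der: "((\<lambda>t. a t x) has_vector_derivative b t x) (at t within {0..T})" for t x
 proof -
  have "((\<lambda>t. jac F t x) has_vector_derivative jac Ft t x) (at t within {0..T})"
   unfolding jac_def Ft_def
   by (intro has_vector_derivative_sum bounded_linear.has_vector_derivative[OF bounded_linear_matrix_column]
      has_vector_derivative_at_within[OF mixed_derivative[OF F]])
  then have "((\<lambda>t. rk *\<^sub>R jac F t x) has_vector_derivative rk *\<^sub>R jac Ft t x) (at t within {0..T})"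
   by (rule bounded_linear.has_vector_derivative[OF bounded_linear_scaleR_right])
  moreover have "((\<lambda>t. F (t, x)) has_vector_derivative Ft (t, x)) (at t within {0..T})"
   unfolding Ft_def by (rule smooth_slice(3)[OF F])
  ultimately show ?thesis unfolding a_def b_def by (intro has_vector_derivative_Pair)
 qed
 show "continuous_on {0..T} (\<lambda>t. emb (time_deriv \<phi> t))"
  by (rule continuous_on_eq[OF L2_curve_continuous[OF ca cb K(1) oa ob]]) (simp_all add: eb)
 show "continuous_on {0..T} (\<lambda>t. pair_of (time_deriv \<phi> t) (\<lambda>x. 0))"
  by (rule continuous_on_eq[OF L2_curve_continuous[OF ca cb0 K(1) oa ob0]]) (simp_all add: eb)
 show "((\<lambda>t. emb (\<phi> t)) has_vector_derivative emb (time_deriv \<phi> t)) (at t within {0..T})" if t: "t \<in> {0..T}" for t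
  unfolding eb(1)[OF t]
  by (rule has_vector_derivative_transform[OF t _ L2_curve_derivative[OF ca cb K(1) oa ob der t]]) (simp add: ea)
qed

end

section \<open>Continuity of power integrals\<close>

lemma powr_diff_le:
 fixes x y :: real
 assumes q: "1 < q" "q \<le> 2" and x: "0 \<le> x" and y: "0 \<le> y"
 shows "\<bar>x powr q - y powr q\<bar> \<le> \<bar>x - y\<bar> * (2 + x + y)"
proof -
 have main: "\<bar>x powr q - y powr q\<bar> \<le> \<bar>x - y\<bar> * (2 + x + y)" if "0 \<le> y" "y \<le> x" for x y :: real
 proof -
  have le1: "z powr (q - 1) \<le> 1 + z" if "0 \<le> z" for z :: real
   using powr_le_one_add[of "q - 1" 1 z] q that by simp
  have pq: "z powr q = z * z powr (q - 1)" if "0 \<le> z" for z :: real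
   using powr_mult_base[OF that, of "q - 1"] by simp
  have cross: "y * x powr (q - 1) \<le> x * y powr (q - 1)"
  proof (cases "y = 0")
   case False
   with that have y: "0 < y" and xy: "1 \<le> x / y" by auto
   have "(x / y) powr (q - 1) \<le> (x / y) powr 1" by (rule powr_mono) (use q xy in auto)
   then have "x powr (q - 1) / y powr (q - 1) \<le> x / y" using that y by (simp add: powr_divide)
   then show ?thesis using y by (simp add: field_simps)
  qed (use that q in simp)
  have nn: "0 \<le> x powr q - y powr q" using powr_mono2[of q y x] that q by simp
  have "x powr q - y powr q = x * x powr (q - 1) - y * y powr (q - 1)" using pq[of x] pq[of y] that by simp
  also have "\<dots> \<le> (x - y) * (x powr (q - 1) + y powr (q - 1))" using cross by (simp add: algebra_simps)
  also have "\<dots> \<le> (x - y) * ((1 + x) + (1 + y))" by (intro mult_left_mono add_mono le1) (use that in auto)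
  finally show ?thesis using nn that by (simp add: add.assoc)
 qed
 show ?thesis
 proof (cases "y \<le> x")
  case True
  then show ?thesis by (rule main[OF y])
 next
  case False
  then show ?thesis using main[OF x, of y] by (simp add: abs_minus_commute add_ac)
 qed
qed

definition norm_field :: "('a::euclidean_space, 'b::euclidean_space) L2 \<Rightarrow> ('a, real) L2" where
 "norm_field h = L2_of (\<lambda>x. norm (rep h x))"

lemma sq_int_norm_rep: "sq_int (\<lambda>x. norm (rep h x))"
 using sq_int_rep[of h] by (simp add: sq_int_def)

lemma norm_norm_field: "norm (norm_field h) = norm h"
proof (rule power2_eq_imp_eq)
 show "(norm (norm_field h))\<^sup>2 = (norm h)\<^sup>2"
  unfolding norm_field_def by (subst L2_of_norm_sq[OF sq_int_norm_rep]) (simp add: L2_norm_sq)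
qed auto

text \<open>
 The pointwise bound is integrated by the Cauchy--Schwarz inequality.  With this continuity, powers
 of norms of a strongly measurable curve are measurable in time.
\<close>

lemma power_integral_continuous:
 fixes L :: "'b::euclidean_space \<Rightarrow> 'c::euclidean_space" and \<Omega> :: "'a::euclidean_space set"
 assumes \<Omega>: "\<Omega> \<in> lmeasurable" and q: "1 < q" "q \<le> 2"
  and L: "bounded_linear L" "\<And>y. norm (L y) \<le> k * norm y" "0 \<le> k"
 shows "continuous_on UNIV (\<lambda>h. LINT x|lebesgue_on \<Omega>. norm (L (rep h x)) powr q)"
proof -
 have \<Omega>s: "\<Omega> \<in> sets lebesgue" using \<Omega> by auto
 interpret L: bounded_linear L by fact
 have Lm: "(\<lambda>x. L (rep h x)) \<in> borel_measurable lebesgue" for h :: "('a, 'b) L2"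
  by (rule borel_measurable_continuous_on[OF linear_continuous_on[OF L(1)]]) simp
 have i: "integrable (lebesgue_on \<Omega>) (\<lambda>x. norm (L (rep h x)) powr q)" for h :: "('a, 'b) L2"
 proof -
  have "sq_int (zext \<Omega> (\<lambda>x. L (rep h x)))"
  proof (rule sq_int_bound[where g="\<lambda>x. k\<^sup>2 * (norm (rep h x))\<^sup>2"])
   show "zext \<Omega> (\<lambda>x. L (rep h x)) \<in> borel_measurable lebesgue"
    unfolding zext_measurable_iff[OF \<Omega>s] by (rule measurable_restrict_space1[OF Lm])
   show "integrable lebesgue (\<lambda>x. k\<^sup>2 * (norm (rep h x))\<^sup>2)" by (intro integrable_mult_right sq_intD) simp
   have "(norm (L (rep h x)))\<^sup>2 \<le> k\<^sup>2 * (norm (rep h x))\<^sup>2" for x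
    unfolding power_mult_distrib[symmetric] by (rule power_mono[OF L(2) norm_ge_zero])
   then show "AE x in lebesgue. (norm (zext \<Omega> (\<lambda>x. L (rep h x)) x))\<^sup>2 \<le> k\<^sup>2 * (norm (rep h x))\<^sup>2"
    by (intro AE_I2) (auto simp: zext_def indicator_def)
  qed
  then have "(\<lambda>x. L (rep h x)) \<in> Lp_space 2 \<Omega>" by (simp add: sq_int_zext_iff \<Omega>s)
  from Lp_space_nested(1)[OF \<Omega> _ q(2) this] show ?thesis using q by (simp add: Lp_space_def)
 qed
 define o1 :: "('a, real) L2" where "o1 = L2_of (indicator \<Omega>)"
 note sqo = sq_int_indicator[OF \<Omega>]
 define A where "A h = (LINT x|lebesgue_on \<Omega>. norm (L (rep h x)) powr q)" for h :: "('a, 'b) L2"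
 have bound: "\<bar>A h - A g\<bar> \<le> k * norm (h - g) * (2 * norm o1 + k * norm h + k * norm g)" for h g
 proof -
  let ?n = "\<lambda>h x. norm (rep h x)"
  let ?F = "\<lambda>x. k * ?n (h - g) x * (2 * indicator \<Omega> x + k * ?n h x + k * ?n g x)"
  have prod: "integrable lebesgue (\<lambda>x. u x * w x)" "(LINT x|lebesgue. u x * w x) = L2_of u \<bullet> L2_of w"
   if "sq_int u" "sq_int w" for u w :: "'a \<Rightarrow> real"
   using integrable_inner_sq_int[OF that] L2_of_inner[OF that] by simp_all
  note P = prod[OF sq_int_norm_rep[of "h - g"] sqo] prod[OF sq_int_norm_rep[of "h - g"] sq_int_norm_rep[of h]]
   prod[OF sq_int_norm_rep[of "h - g"] sq_int_norm_rep[of g]]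
  have F: "?F = (\<lambda>x. 2 * k * (?n (h - g) x * indicator \<Omega> x) + k\<^sup>2 * (?n (h - g) x * ?n h x) + k\<^sup>2 * (?n (h - g) x * ?n g x))"
   by (auto simp: fun_eq_iff algebra_simps power2_eq_square)
  have iF: "integrable lebesgue ?F"
   unfolding F by (intro Bochner_Integration.integrable_add integrable_mult_right P)
  let ?z = "zext \<Omega> (\<lambda>x. norm (L (rep h x)) powr q - norm (L (rep g x)) powr q)"
  have iz: "integrable lebesgue ?z"
   unfolding integrable_zext_iff[OF \<Omega>s] by (rule Bochner_Integration.integrable_diff[OF i i])
  have "A h - A g = (LINT x|lebesgue. ?z x)"
   unfolding A_def Bochner_Integration.integral_diff[OF i i, symmetric] integral_zext[OF \<Omega>s] ..
  also have "\<bar>\<dots>\<bar> \<le> (LINT x|lebesgue. \<bar>?z x\<bar>)" by (rule integral_abs_bound)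
  also have "\<dots> \<le> (LINT x|lebesgue. ?F x)"
  proof (rule integral_mono_AE[OF integrable_abs[OF iz] iF])
   show "AE x in lebesgue. \<bar>?z x\<bar> \<le> ?F x"
    using rep_diff[of h g]
   proof eventually_elim
    case (elim x)
    let ?a = "norm (L (rep h x))" and ?b = "norm (L (rep g x))"
    have "\<bar>?a - ?b\<bar> \<le> norm (L (rep (h - g) x))" unfolding elim L.diff by (rule norm_triangle_ineq3)
    also have "\<dots> \<le> k * ?n (h - g) x" by (rule L(2))
    finally have d: "\<bar>?a - ?b\<bar> \<le> k * ?n (h - g) x" .
    have "\<bar>?a powr q - ?b powr q\<bar> \<le> \<bar>?a - ?b\<bar> * (2 + ?a + ?b)" by (rule powr_diff_le[OF q]) auto
    also have "\<dots> \<le> (k * ?n (h - g) x) * (2 + k * ?n h x + k * ?n g x)"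
     by (intro mult_mono d add_mono L(2) order_refl) (use L(3) in auto)
    finally have "\<bar>?a powr q - ?b powr q\<bar> \<le> k * ?n (h - g) x * (2 + k * ?n h x + k * ?n g x)" .
    moreover have "0 \<le> k * ?n (h - g) x * (0 + k * ?n h x + k * ?n g x)" using L(3) by simp
    ultimately show ?case by (cases "x \<in> \<Omega>") simp_all
   qed
  qed
  also have "\<dots> = 2 * k * (norm_field (h - g) \<bullet> o1) + k\<^sup>2 * (norm_field (h - g) \<bullet> norm_field h) + k\<^sup>2 * (norm_field (h - g) \<bullet> norm_field g)"
   unfolding F norm_field_def o1_def P(2,4,6)[symmetric]
   by (simp add: P Bochner_Integration.integral_add integrable_mult_right)
  also have "\<dots> \<le> 2 * k * (norm (h - g) * norm o1) + k\<^sup>2 * (norm (h - g) * norm h) + k\<^sup>2 * (norm (h - g) * norm g)"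
   using L(3) norm_cauchy_schwarz[of "norm_field (h - g)" o1] norm_cauchy_schwarz[of "norm_field (h - g)" "norm_field h"]
    norm_cauchy_schwarz[of "norm_field (h - g)" "norm_field g"]
   unfolding norm_norm_field by (intro add_mono mult_left_mono) auto
  also have "\<dots> = k * norm (h - g) * (2 * norm o1 + k * norm h + k * norm g)"
   by (simp add: algebra_simps power2_eq_square)
  finally show ?thesis .
 qed
 have "continuous_on UNIV A"
  unfolding continuous_on_def
 proof
  fix h :: "('a, 'b) L2"
  have "((\<lambda>g. k * norm (g - h) * (2 * norm o1 + k * norm g + k * norm h)) \<longlongrightarrow>
    k * norm (h - h) * (2 * norm o1 + k * norm h + k * norm h)) (at h)"
   by (intro tendsto_intros)
  then have z: "((\<lambda>g. k * norm (g - h) * (2 * norm o1 + k * norm g + k * norm h)) \<longlongrightarrow> 0) (at h)" by simp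
  have "((\<lambda>g. \<bar>A g - A h\<bar>) \<longlongrightarrow> 0) (at h)"
   by (rule tendsto_sandwich[OF _ _ tendsto_const z]) (use bound in \<open>auto intro!: always_eventually\<close>)
  then show "(A \<longlongrightarrow> A h) (at h)" by (simp add: tendsto_rabs_zero_iff LIM_zero_iff)
 qed
 then show ?thesis unfolding A_def[abs_def] .
qed

lemma Lp_space_diff:
 fixes f g :: "'a::euclidean_space \<Rightarrow> 'b::euclidean_space"
 assumes q: "0 < q" and f: "f \<in> Lp_space q \<Omega>" and g: "g \<in> Lp_space q \<Omega>"
 shows "(\<lambda>x. f x - g x) \<in> Lp_space q \<Omega>"
proof -
 have m: "f \<in> borel_measurable (lebesgue_on \<Omega>)" "g \<in> borel_measurable (lebesgue_on \<Omega>)"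
  and i: "integrable (lebesgue_on \<Omega>) (\<lambda>x. norm (f x) powr q)" "integrable (lebesgue_on \<Omega>) (\<lambda>x. norm (g x) powr q)"
  using f g by (auto simp: Lp_space_def)
 have pt: "norm (a - b) powr q \<le> 2 powr q * (norm a powr q + norm b powr q)" for a b :: 'b
 proof -
  have "norm (a - b) \<le> 2 * max (norm a) (norm b)" using norm_triangle_ineq4[of a b] by linarith
  then have "norm (a - b) powr q \<le> (2 * max (norm a) (norm b)) powr q" using q by (intro powr_mono2) auto
  also have "\<dots> = 2 powr q * max (norm a) (norm b) powr q" by (simp add: powr_mult)
  also have "\<dots> \<le> 2 powr q * (norm a powr q + norm b powr q)" by (intro mult_left_mono) (auto simp: max_def)
  finally show ?thesis .
 qed
 have md: "(\<lambda>x. f x - g x) \<in> borel_measurable (lebesgue_on \<Omega>)" using m by simp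
 have "integrable (lebesgue_on \<Omega>) (\<lambda>x. norm (f x - g x) powr q)"
  by (rule Bochner_Integration.integrable_bound[where f="\<lambda>x. 2 powr q * (norm (f x) powr q + norm (g x) powr q)"])
    (use i md pt in auto)
 then show ?thesis using md by (simp add: Lp_space_def)
qed

section \<open>The forcing term\<close>

context voigt_domain
begin

lemma norm_pair_of_velocity:
 assumes "2 \<le> r" "u \<in> Lp_space r \<Omega>"
 shows "u \<in> Lp_space 2 \<Omega>" "norm (pair_of u (\<lambda>x. 0)) \<le> sqrt (measure lebesgue \<Omega> + 1) * Lp_norm r \<Omega> u"
proof -
 note N = Lp_space_nested[OF Omega_lmeasurable _ assms(1,2)]
 show u: "u \<in> Lp_space 2 \<Omega>" by (rule N) simp
 have "(norm (pair_of u (\<lambda>x. 0)))\<^sup>2 = (Lp_norm 2 \<Omega> u)\<^sup>2 + (Lp_norm 2 \<Omega> (\<lambda>x. 0 :: real^'n^'n))\<^sup>2"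
  by (rule norm_pair_of_sq[OF u Lp_space_zero])
 also have "\<dots> = (LINT x|lebesgue_on \<Omega>. norm (u x) powr 2)" by (simp add: Lp_norm_def powr_half_sqrt)
 also have "\<dots> \<le> (measure lebesgue \<Omega> + 1) * (Lp_norm r \<Omega> u)\<^sup>2"
  using N(2) by (simp add: powr_2_eq Lp_norm_nonneg)
 also have "\<dots> = (sqrt (measure lebesgue \<Omega> + 1) * Lp_norm r \<Omega> u)\<^sup>2"
  by (simp add: power_mult_distrib)
 finally show "norm (pair_of u (\<lambda>x. 0)) \<le> sqrt (measure lebesgue \<Omega> + 1) * Lp_norm r \<Omega> u"
  by (rule power2_le_imp_le) (simp add: Lp_norm_nonneg)
qed

text \<open>
 The projection of a force \<open>f\<close> to \<open>Vhat\<close> is a curve that can be integrated in time.  Approximants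
 that are larger than the bound \<open>B\<close> are cut off, which makes the approximation dominated.
\<close>

lemma forcing_approximated:
 fixes f :: "real \<Rightarrow> real^'n \<Rightarrow> real^'n"
 assumes f: "f \<in> Bochner_Lp r T (Lp_space r \<Omega>) (Lp_norm r \<Omega>)" and r: "2 \<le> r"
 defines "g \<equiv> \<lambda>t. proj Vhat (pair_of (f t) (\<lambda>x. 0))"
 obtains B s where "approximated T Vhat B g s" "integrable (time_measure T) (\<lambda>t. (B t)\<^sup>2)"
  "AE t in time_measure T. f t \<in> Lp_space 2 \<Omega>"
proof -
 let ?M = "time_measure T"
 interpret finite_measure ?M by (rule time_measure_finite)
 define c where "c = sqrt (measure lebesgue \<Omega> + 1)"
 have c: "0 \<le> c" by (simp add: c_def)
 obtain s where s: "\<And>n. simple_into ?M (Lp_space r \<Omega>) (s n)"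
   "AE t in ?M. (\<lambda>n. Lp_norm r \<Omega> (\<lambda>x. s n t x - f t x)) \<longlonglongrightarrow> 0"
  and fr: "AE t in ?M. f t \<in> Lp_space r \<Omega>"
  and i: "integrable ?M (\<lambda>t. Lp_norm r \<Omega> (f t) powr r)"
  using f unfolding Bochner_Lp_def strongly_measurable_def by blast
 define N where "N t = Lp_norm r \<Omega> (f t)" for t
 have N0: "0 \<le> N t" for t by (simp add: N_def Lp_norm_nonneg)
 have Nm: "N \<in> borel_measurable ?M"
 proof -
  have "(\<lambda>t. (N t powr r) powr (1 / r)) \<in> borel_measurable ?M"
   using borel_measurable_integrable[OF i] unfolding N_def[symmetric] by measurable
  then show ?thesis using r N0 by (simp add: powr_powr)
 qed
 have Npow: "integrable ?M (\<lambda>t. N t powr q)" if q: "0 < q" "q \<le> 2" for q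
 proof (rule Bochner_Integration.integrable_bound[where f="\<lambda>t. 1 + N t powr r"])
  show "integrable ?M (\<lambda>t. 1 + N t powr r)" using i unfolding N_def[symmetric] by simp
  show "(\<lambda>t. N t powr q) \<in> borel_measurable ?M" using Nm by measurable
  show "AE t in ?M. norm (N t powr q) \<le> norm (1 + N t powr r)"
   using powr_le_one_add[of q r, OF q(1) _ N0] q r by (intro AE_I2) auto
 qed
 have N1: "integrable ?M N" using Npow[of 1] N0 by simp
 have N2: "integrable ?M (\<lambda>t. (N t)\<^sup>2)" using Npow[of 2] N0 by (simp add: powr_2_eq)
 \<comment> \<open>the summand 1 makes the bound strict, so that approximants obey it eventually\<close>
 define B where "B t = c * N t + 1" for t
 have B1: "integrable ?M B" unfolding B_def using N1 by simp
 have "(\<lambda>t. (B t)\<^sup>2) = (\<lambda>t. c\<^sup>2 * (N t)\<^sup>2 + 2 * c * N t + 1)"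
  by (auto simp: B_def power2_eq_square algebra_simps)
 then have B2: "integrable ?M (\<lambda>t. (B t)\<^sup>2)" using N1 N2 by simp
 define \<sigma> where "\<sigma> n t = proj Vhat (pair_of (s n t) (\<lambda>x. 0))" for n t
 define \<tau> where "\<tau> n t = (if norm (\<sigma> n t) \<le> B t then \<sigma> n t else 0)" for n t
 have f2: "AE t in ?M. f t \<in> Lp_space 2 \<Omega>"
  using fr by eventually_elim (rule norm_pair_of_velocity(1)[OF r])
 have "approximated T Vhat B g \<tau>"
  unfolding approximated_def
 proof (intro conjI allI ballI)
  fix n
  have \<sigma>s: "simple_function ?M (\<sigma> n)"
   unfolding \<sigma>_def using simple_function_compose[of ?M "s n" "\<lambda>u. proj Vhat (pair_of u (\<lambda>x. 0))"] s(1)[of n]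
   by (simp add: simple_into_def o_def)
  show "simple_function ?M (\<tau> n)"
  proof -
   have fin: "finite (\<sigma> n ` space ?M)" and sm: "\<sigma> n -` {y} \<inter> space ?M \<in> sets ?M" for y
    by (rule simple_functionD[OF \<sigma>s])+
   have sub: "\<tau> n ` space ?M \<subseteq> insert 0 (\<sigma> n ` space ?M)" by (auto simp: \<tau>_def)
   have Bm: "B \<in> borel_measurable ?M" using B1 by simp
   have "(\<tau> n) -` {y} \<inter> space ?M \<in> sets ?M" for y
   proof -
    have "{t \<in> space ?M. norm (\<sigma> n t) \<le> B t} \<in> sets ?M"
    proof -
     have "simple_function ?M (\<lambda>t. norm (\<sigma> n t))"
      using simple_function_compose[OF \<sigma>s, of norm] by (simp add: o_def)
     from borel_measurable_le[OF borel_measurable_simple_function[OF this] Bm] show ?thesis .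
    qed
    moreover have "(\<tau> n) -` {y} \<inter> space ?M =
      ((\<sigma> n -` {y} \<inter> space ?M) \<inter> {t \<in> space ?M. norm (\<sigma> n t) \<le> B t}) \<union>
      (if y = 0 then space ?M - {t \<in> space ?M. norm (\<sigma> n t) \<le> B t} else {})"
     by (auto simp: \<tau>_def split: if_splits)
    ultimately show ?thesis using sm[of y] by auto
   qed
   then show ?thesis unfolding simple_function_def using finite_subset[OF sub] fin by auto
  qed
  show "\<tau> n ` space ?M \<subseteq> Vhat" by (auto simp: \<tau>_def \<sigma>_def subspace_0[OF subspace_Vhat])
  show "norm (\<tau> n t) \<le> B t" if "t \<in> {0<..<T}" for t using c N0[of t] by (auto simp: \<tau>_def B_def)
 next
  show "AE t in ?M. (\<lambda>n. \<tau> n t) \<longlonglongrightarrow> g t"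
   using s(2) fr AE_time_space
  proof eventually_elim
   case (elim t)
   have sr: "s n t \<in> Lp_space r \<Omega>" for n using s(1)[of n] elim(3) by (auto simp: simple_into_def)
   have r0: "0 < r" using r by simp
   have le: "norm (\<sigma> n t - g t) \<le> c * Lp_norm r \<Omega> (\<lambda>x. s n t x - f t x)" for n
   proof -
    have d: "(\<lambda>x. s n t x - f t x) \<in> Lp_space r \<Omega>" by (rule Lp_space_diff[OF r0 sr elim(2)])
    note s2 = norm_pair_of_velocity(1)[OF r sr] and f2 = norm_pair_of_velocity(1)[OF r elim(2)]
     and d2 = norm_pair_of_velocity(1)[OF r d]
    have "pair_of (s n t) (\<lambda>x. 0) = pair_of (\<lambda>x. (s n t x - f t x) + f t x) (\<lambda>x. 0 + 0)" by simp
    also have "\<dots> = pair_of (\<lambda>x. s n t x - f t x) (\<lambda>x. 0) + pair_of (f t) (\<lambda>x. 0)"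
     by (rule pair_of_add[OF d2 Lp_space_zero f2 Lp_space_zero])
    finally have eq: "pair_of (s n t) (\<lambda>x. 0) - pair_of (f t) (\<lambda>x. 0) = pair_of (\<lambda>x. s n t x - f t x) (\<lambda>x. 0)" by simp
    have eq2: "\<sigma> n t - g t = proj Vhat (pair_of (\<lambda>x. s n t x - f t x) (\<lambda>x. 0))"
     unfolding \<sigma>_def g_def linear_diff[OF V.proj_linear, symmetric] eq ..
    show ?thesis
     unfolding eq2 c_def by (rule order_trans[OF V.proj_norm_le norm_pair_of_velocity(2)[OF r d]])
   qed
   have z: "(\<lambda>n. c * Lp_norm r \<Omega> (\<lambda>x. s n t x - f t x)) \<longlonglongrightarrow> 0"
    using tendsto_mult[OF tendsto_const[of c] elim(1)] by simp
   have "(\<lambda>n. norm (\<sigma> n t - g t)) \<longlonglongrightarrow> 0"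
    by (rule tendsto_sandwich[OF _ _ tendsto_const z]) (use le in \<open>auto intro!: always_eventually\<close>)
   then have lim: "(\<lambda>n. \<sigma> n t) \<longlonglongrightarrow> g t" by (simp add: tendsto_norm_zero_iff LIM_zero_iff)
   have "norm (g t) \<le> c * N t"
    using V.proj_norm_le[of "pair_of (f t) (\<lambda>x. 0)"] norm_pair_of_velocity(2)[OF r elim(2)]
    unfolding g_def c_def N_def by linarith
   then have "norm (g t) < B t" by (simp add: B_def)
   then have "\<forall>\<^sub>F n in sequentially. norm (\<sigma> n t) < B t" by (rule order_tendstoD(2)[OF tendsto_norm[OF lim]])
   then have "\<forall>\<^sub>F n in sequentially. \<sigma> n t = \<tau> n t" by eventually_elim (simp add: \<tau>_def)
   then show ?case by (rule Lim_transform_eventually[OF lim])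
  qed
  show "integrable ?M B" by (rule B1)
 qed
 then show thesis using that B2 f2 by blast
qed

end

section \<open>The weak solution\<close>

context voigt_domain
begin

lemma vel_power_continuous:
 assumes "1 < q" "q \<le> 2"
 shows "continuous_on UNIV (\<lambda>h. LINT x|lebesgue_on \<Omega>. norm (vel h x) powr q)"
 unfolding vel_def
 by (rule power_integral_continuous[OF Omega_lmeasurable assms bounded_linear_fst, of 1])
   (use norm_fst_le in \<open>auto simp: norm_Pair real_le_lsqrt\<close>)

lemma grd_power_continuous:
 assumes q: "1 < q" "q \<le> 2"
 shows "continuous_on Vhat (\<lambda>h. LINT x|lebesgue_on \<Omega>. norm (weak_gradient \<Omega> (vel h) x) powr q)"
proof (rule continuous_on_eq)
 have L: "bounded_linear (\<lambda>y::(real^'n) \<times> (real^'n^'n). (1 / rk) *\<^sub>R snd y)"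
  by (intro bounded_linear_intros)
 have "norm ((1 / rk) *\<^sub>R snd y) \<le> 1 / rk * norm y" for y :: "(real^'n) \<times> (real^'n^'n)"
  using rk norm_snd_le[of "snd y" "fst y"] by (simp add: divide_right_mono)
 then show "continuous_on Vhat (\<lambda>h. LINT x|lebesgue_on \<Omega>. norm (grd h x) powr q)"
  unfolding grd_def
  by (intro continuous_on_subset[OF power_integral_continuous[OF Omega_lmeasurable q L, of "1 / rk"]]) (use rk in auto)
 fix h assume h: "h \<in> Vhat"
 show "(LINT x|lebesgue_on \<Omega>. norm (grd h x) powr q) = (LINT x|lebesgue_on \<Omega>. norm (weak_gradient \<Omega> (vel h) x) powr q)"
 proof (rule integral_cong_AE)
  have m[measurable]: "grd h \<in> borel_measurable (lebesgue_on \<Omega>)"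
    "weak_gradient \<Omega> (vel h) \<in> borel_measurable (lebesgue_on \<Omega>)"
   using grd_Lp[of h] W1pD(2)[OF vel_W1p[OF Vhat_grad[OF h]]] by (auto simp: Lp_space_def)
  show "(\<lambda>x. norm (grd h x) powr q) \<in> borel_measurable (lebesgue_on \<Omega>)" by measurable
  show "(\<lambda>x. norm (weak_gradient \<Omega> (vel h) x) powr q) \<in> borel_measurable (lebesgue_on \<Omega>)" by measurable
  show "AE x in lebesgue_on \<Omega>. norm (grd h x) powr q = norm (weak_gradient \<Omega> (vel h) x) powr q"
   using weak_gradient_vel[OF Vhat_grad[OF h]] by eventually_elim simp
 qed
qed

lemma Lp_norm_powr: "0 < q \<Longrightarrow> Lp_norm q \<Omega> u powr q = (LINT x|lebesgue_on \<Omega>. norm (u x) powr q)"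
 by (simp add: Lp_norm_def powr_powr)

lemma V_norm_power_continuous: "continuous_on Vhat (\<lambda>h. V_norm \<Omega> (vel h) powr 2)"
 unfolding V_norm_def using grd_power_continuous[of 2] by (simp add: Lp_norm_powr)

lemma W1p_norm_power_continuous:
 assumes q: "1 < q" "q \<le> 2" shows "continuous_on Vhat (\<lambda>h. W1p_norm q \<Omega> (vel h) powr q)"
proof -
 have "W1p_norm q \<Omega> (vel h) powr q =
   (LINT x|lebesgue_on \<Omega>. norm (vel h x) powr q) + (LINT x|lebesgue_on \<Omega>. norm (weak_gradient \<Omega> (vel h) x) powr q)" for h
  using q by (simp add: W1p_norm_def powr_powr Lp_norm_powr)
 then show ?thesis
  using continuous_on_subset[OF vel_power_continuous[OF q]] grd_power_continuous[OF q]
  by (simp add: continuous_on_add)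
qed

lemma inner_pair_of_velocity:
 assumes h: "h \<in> Vhat" and u: "u \<in> Lp_space 2 \<Omega>"
 shows "h \<bullet> pair_of u (\<lambda>x. 0) = (LINT x|lebesgue_on \<Omega>. vel h x \<bullet> u x)"
proof -
 have "pair_of (vel h) (\<lambda>x. rk *\<^sub>R grd h x) \<bullet> pair_of u (\<lambda>x. 0) = (LINT x|lebesgue_on \<Omega>. vel h x \<bullet> u x)"
  by (subst inner_pair_of) (auto intro: vel_Lp Lp_space_scaleR grd_Lp u Lp_space_zero)
 then show ?thesis using Vhat_grad[OF h] by (simp add: grad_space_def pair_of_vel_grd)
qed

lemma inner_emb_test:
 assumes u: "u \<in> W1p_space 2 \<Omega>" and \<psi>: "test_function \<Omega> \<psi>"
 shows "emb u \<bullet> emb \<psi> = (LINT x|lebesgue_on \<Omega>. u x \<bullet> \<psi> x) +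
  \<kappa> * (LINT x|lebesgue_on \<Omega>. weak_gradient \<Omega> u x \<bullet> jacobian \<psi> (at x))"
proof -
 have "emb u \<bullet> emb \<psi> = (LINT x|lebesgue_on \<Omega>. u x \<bullet> \<psi> x) +
   (LINT x|lebesgue_on \<Omega>. (rk *\<^sub>R weak_gradient \<Omega> u x) \<bullet> (rk *\<^sub>R jacobian \<psi> (at x)))"
  unfolding emb_test[OF \<psi>] unfolding emb_def
  by (intro inner_pair_of W1pD[OF u] Lp_space_scaleR test_is_weak_gradient[OF \<psi>])
 also have "(LINT x|lebesgue_on \<Omega>. (rk *\<^sub>R weak_gradient \<Omega> u x) \<bullet> (rk *\<^sub>R jacobian \<psi> (at x))) =
   \<kappa> * (LINT x|lebesgue_on \<Omega>. weak_gradient \<Omega> u x \<bullet> jacobian \<psi> (at x))"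
  using rk(2) by (simp add: mult.assoc[symmetric])
 finally show ?thesis .
qed

lemma grd_emb_test:
 assumes \<psi>: "test_function \<Omega> \<psi>"
 shows "AE x in lebesgue_on \<Omega>. grd (emb \<psi>) x = jacobian \<psi> (at x)"
proof -
 have "AE x in lebesgue_on \<Omega>. rk *\<^sub>R grd (emb \<psi>) x = rk *\<^sub>R jacobian \<psi> (at x)"
  unfolding emb_test[OF \<psi>] by (intro vel_pair_of(2) test_is_weak_gradient[OF \<psi>] Lp_space_scaleR)
 then show ?thesis
 proof eventually_elim
  case (elim x)
  then show ?case using rk(1) by simp
 qed
qed

lemma emb_solenoidal: "\<psi> \<in> solenoidal_test \<Omega> \<Longrightarrow> emb \<psi> \<in> Vhat"
 unfolding Vhat_def by (intro subsetD[OF closure_subset]) auto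

end

context voigt4
begin

lemma inner_flux_test:
 assumes A: "A \<in> Lp_space 2 \<Omega>" and \<psi>: "\<psi> \<in> solenoidal_test \<Omega>"
 shows "flux A \<bullet> emb \<psi> = (LINT x|lebesgue_on \<Omega>. A x \<bullet> jacobian \<psi> (at x))"
proof -
 note t = solenoidal_testD[OF \<psi>]
 have "flux A \<bullet> emb \<psi> = (LINT x|lebesgue_on \<Omega>. A x \<bullet> grd (emb \<psi>) x)"
  by (rule inner_flux[OF A Vhat_grad[OF emb_solenoidal[OF \<psi>]]])
 also have "\<dots> = (LINT x|lebesgue_on \<Omega>. A x \<bullet> jacobian \<psi> (at x))"
 proof (rule integral_cong_AE)
  show "(\<lambda>x. A x \<bullet> grd (emb \<psi>) x) \<in> borel_measurable (lebesgue_on \<Omega>)"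
   using A grd_Lp[of "emb \<psi>"] unfolding Lp_space_def by (auto intro: borel_measurable_inner)
  show "(\<lambda>x. A x \<bullet> jacobian \<psi> (at x)) \<in> borel_measurable (lebesgue_on \<Omega>)"
   using A test_is_weak_gradient(2)[OF t] unfolding Lp_space_def by (auto intro: borel_measurable_inner)
  show "AE x in lebesgue_on \<Omega>. A x \<bullet> grd (emb \<psi>) x = A x \<bullet> jacobian \<psi> (at x)"
   using grd_emb_test[OF t] by eventually_elim simp
 qed
 finally show ?thesis .
qed

lemma rhs_continuous: "continuous_on S rhs"
proof -
 have "isCont rhs h" for h
 proof -
  have "continuous_on (ball 0 (norm h + 1)) rhs"
   using uniformly_continuous_imp_continuous[OF rhs_uniformly_continuous[of "norm h + 1"]]
   by (rule continuous_on_subset) auto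
  then show ?thesis by (auto simp: continuous_on_eq_continuous_at)
 qed
 then show ?thesis by (simp add: continuous_at_imp_continuous_on)
qed

lemma inner_visc_test:
 assumes h: "h \<in> Vhat" and \<psi>: "\<psi> \<in> solenoidal_test \<Omega>"
 shows "visc h \<bullet> emb \<psi> =
  (LINT x|lebesgue_on \<Omega>. stress p (sym_part (weak_gradient \<Omega> (vel h) x)) \<bullet> sym_part (jacobian \<psi> (at x)))"
proof -
 have ae: "AE x in lebesgue_on \<Omega>. stress p (sym_part (weak_gradient \<Omega> (vel h) x)) = stress p (sym_part (grd h x))"
  using weak_gradient_vel[OF Vhat_grad[OF h]] by eventually_elim simp
 have L: "(\<lambda>x. stress p (sym_part (weak_gradient \<Omega> (vel h) x))) \<in> Lp_space 2 \<Omega>"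
  by (rule Lp_space_cong[OF stress_Lp ae])
 have "visc h = flux (\<lambda>x. stress p (sym_part (weak_gradient \<Omega> (vel h) x)))"
  unfolding visc_def by (rule flux_cong[OF stress_Lp L]) (use ae in \<open>auto elim: eventually_mono\<close>)
 then show ?thesis by (simp add: inner_flux_test[OF L \<psi>] stress_inner_sym_part)
qed

lemma rhs_inner_test:
 assumes h: "h \<in> Vhat" and \<psi>: "\<psi> \<in> solenoidal_test \<Omega>"
 shows "rhs h \<bullet> emb \<psi> = conv h h \<bullet> emb \<psi> - \<nu> * (visc h \<bullet> emb \<psi>)"
 by (simp add: rhs_inner V.proj_id h emb_solenoidal[OF \<psi>] inner_diff_left)

text \<open>
 The integral identity of the weak formulation is the scalar product of the evolution equation
 with the curve of the test field, integrated by parts in time.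
\<close>

lemma weak_formulation:
 fixes f :: "real \<Rightarrow> real^4 \<Rightarrow> real^4" and V :: "real \<Rightarrow> 4 pair_L2"
 assumes T: "0 < T" and v0: "v0 \<in> V_space \<Omega>"
  and a: "approximated T Vhat B g s" and g: "g = (\<lambda>t. proj Vhat (pair_of (f t) (\<lambda>x. 0)))"
  and f2: "AE t in time_measure T. f t \<in> Lp_space 2 \<Omega>"
  and cV: "continuous_on {0..T} V" and VV: "\<And>t. t \<in> {0..T} \<Longrightarrow> V t \<in> Vhat"
  and V: "\<And>t. t \<in> {0..T} \<Longrightarrow> V t = emb v0 + primitive T g t + integral {0..t} (\<lambda>s. rhs (V s))"
  and \<phi>: "\<phi> \<in> spacetime_test \<Omega> T"
 shows "- (LINT t|time_measure T. LINT x|lebesgue_on \<Omega>. vel (V t) x \<bullet> time_deriv \<phi> t x)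
    - \<kappa> * (LINT t|time_measure T. LINT x|lebesgue_on \<Omega>.
         weak_gradient \<Omega> (vel (V t)) x \<bullet> jacobian (time_deriv \<phi> t) (at x))
    + \<nu> * (LINT t|time_measure T. LINT x|lebesgue_on \<Omega>.
         stress p (sym_part (weak_gradient \<Omega> (vel (V t)) x)) \<bullet> sym_part (jacobian (\<phi> t) (at x)))
    = (LINT x|lebesgue_on \<Omega>. v0 x \<bullet> \<phi> 0 x)
    + \<kappa> * (LINT x|lebesgue_on \<Omega>. weak_gradient \<Omega> v0 x \<bullet> jacobian (\<phi> 0) (at x))
    + (LINT t|time_measure T. LINT x|lebesgue_on \<Omega>. f t x \<bullet> \<phi> t x)
    + (LINT t|time_measure T. LINT x|lebesgue_on \<Omega>.
       tensor (vel (V t) x) (vel (V t) x) \<bullet> jacobian (\<phi> t) (at x))"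
proof -
 let ?M = "time_measure T" and ?\<phi> = "\<lambda>t. emb (\<phi> t)" and ?\<phi>' = "\<lambda>t. emb (time_deriv \<phi> t)"
 let ?q = "\<lambda>t. pair_of (time_deriv \<phi> t) (\<lambda>x. 0)"
 note C = spacetime_test_curve[OF \<phi> T]
 have c\<phi>: "continuous_on {0..T} ?\<phi>" using C(4) by (rule vector_derivative_imp_continuous_on)
 have cR: "continuous_on {0..T} (\<lambda>t. rhs (V t))"
  by (rule continuous_on_compose2[OF rhs_continuous[of UNIV] cV]) auto
 have V0: "V 0 = emb v0 + primitive T g 0" using V[of 0] T by simp
 have parts: "(LINT t|?M. V t \<bullet> ?\<phi>' t) =
   - (emb v0 \<bullet> ?\<phi> 0) - (LINT t|?M. rhs (V t) \<bullet> ?\<phi> t) - (LINT t|?M. g t \<bullet> ?\<phi> t)"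
  by (rule curve_by_parts[OF a subspace_Vhat cR V C(4,5,2) T])
 have cc: "integrable ?M (\<lambda>t. u t \<bullet> w t)" if "continuous_on {0..T} u" "continuous_on {0..T} w" for u w :: "real \<Rightarrow> 4 pair_L2"
  by (rule open_interval_integral(1)[OF continuous_on_inner[OF that]])
 let ?I1 = "\<lambda>t. LINT x|lebesgue_on \<Omega>. vel (V t) x \<bullet> time_deriv \<phi> t x"
 let ?I2 = "\<lambda>t. LINT x|lebesgue_on \<Omega>. weak_gradient \<Omega> (vel (V t)) x \<bullet> jacobian (time_deriv \<phi> t) (at x)"
 let ?I3 = "\<lambda>t. LINT x|lebesgue_on \<Omega>. stress p (sym_part (weak_gradient \<Omega> (vel (V t)) x)) \<bullet> sym_part (jacobian (\<phi> t) (at x))"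
 let ?I4 = "\<lambda>t. LINT x|lebesgue_on \<Omega>. tensor (vel (V t) x) (vel (V t) x) \<bullet> jacobian (\<phi> t) (at x)"
 have e1: "V t \<bullet> ?q t = ?I1 t" and e12: "V t \<bullet> ?\<phi>' t = ?I1 t + \<kappa> * ?I2 t" if t: "t \<in> {0..T}" for t
 proof -
  show "V t \<bullet> ?q t = ?I1 t" by (rule inner_pair_of_velocity[OF VV[OF t] test_is_weak_gradient(1)[OF C(3)[OF t]]])
  show "V t \<bullet> ?\<phi>' t = ?I1 t + \<kappa> * ?I2 t"
   using inner_emb_test[OF vel_W1p[OF Vhat_grad[OF VV[OF t]]] C(3)[OF t]]
   unfolding emb_vel[OF Vhat_grad[OF VV[OF t]]] .
 qed
 have e34: "rhs (V t) \<bullet> ?\<phi> t = ?I4 t - \<nu> * ?I3 t" and e4: "conv (V t) (V t) \<bullet> ?\<phi> t = ?I4 t" if t: "t \<in> {0..T}" for t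
 proof -
  show e4: "conv (V t) (V t) \<bullet> ?\<phi> t = ?I4 t"
   unfolding conv_def by (rule inner_flux_test[OF conv_bound(1)[OF VV[OF t] VV[OF t]] C(1)[OF t]])
  show "rhs (V t) \<bullet> ?\<phi> t = ?I4 t - \<nu> * ?I3 t"
   unfolding rhs_inner_test[OF VV[OF t] C(1)[OF t]] e4 inner_visc_test[OF VV[OF t] C(1)[OF t]] ..
 qed
 have s12: "(LINT t|?M. V t \<bullet> ?\<phi>' t) = (LINT t|?M. ?I1 t) + \<kappa> * (LINT t|?M. ?I2 t)"
 proof -
  have i1: "integrable ?M (\<lambda>t. V t \<bullet> ?q t)" and i: "integrable ?M (\<lambda>t. V t \<bullet> ?\<phi>' t)"
   by (rule cc[OF cV C(6)], rule cc[OF cV C(5)])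
  have "(LINT t|?M. V t \<bullet> ?\<phi>' t) - (LINT t|?M. V t \<bullet> ?q t) = (LINT t|?M. V t \<bullet> ?\<phi>' t - V t \<bullet> ?q t)"
   by (rule Bochner_Integration.integral_diff[OF i i1, symmetric])
  also have "\<dots> = (LINT t|?M. \<kappa> * ?I2 t)"
   by (rule Bochner_Integration.integral_cong[OF refl]) (simp add: e1 e12)
  also have "(LINT t|?M. V t \<bullet> ?q t) = (LINT t|?M. ?I1 t)"
   by (rule Bochner_Integration.integral_cong[OF refl]) (simp add: e1)
  finally show ?thesis by simp
 qed
 have s34: "(LINT t|?M. rhs (V t) \<bullet> ?\<phi> t) = (LINT t|?M. ?I4 t) - \<nu> * (LINT t|?M. ?I3 t)"
 proof -
  have i4: "integrable ?M (\<lambda>t. conv (V t) (V t) \<bullet> ?\<phi> t)" and i: "integrable ?M (\<lambda>t. rhs (V t) \<bullet> ?\<phi> t)"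
   by (rule cc[OF continuous_on_compose2[OF conv_continuous cV] c\<phi>]) (use VV cc[OF cR c\<phi>] in auto)
  have "(LINT t|?M. conv (V t) (V t) \<bullet> ?\<phi> t) - (LINT t|?M. rhs (V t) \<bullet> ?\<phi> t) =
    (LINT t|?M. conv (V t) (V t) \<bullet> ?\<phi> t - rhs (V t) \<bullet> ?\<phi> t)"
   by (rule Bochner_Integration.integral_diff[OF i4 i, symmetric])
  also have "\<dots> = (LINT t|?M. \<nu> * ?I3 t)"
   by (rule Bochner_Integration.integral_cong[OF refl]) (simp add: e4 e34)
  also have "(LINT t|?M. conv (V t) (V t) \<bullet> ?\<phi> t) = (LINT t|?M. ?I4 t)"
   by (rule Bochner_Integration.integral_cong[OF refl]) (simp add: e4)
  finally show ?thesis by simp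
 qed
 have sf: "(LINT t|?M. g t \<bullet> ?\<phi> t) = (LINT t|?M. LINT x|lebesgue_on \<Omega>. f t x \<bullet> \<phi> t x)"
 proof -
  have ae: "AE t in ?M. g t \<bullet> ?\<phi> t = (LINT x|lebesgue_on \<Omega>. f t x \<bullet> \<phi> t x)"
   using f2 AE_time_space
  proof eventually_elim
   case (elim t)
   then have t: "t \<in> {0..T}" by simp
   note S = C(1)[OF t] and td = solenoidal_testD[OF C(1)[OF t]]
   have "g t \<bullet> ?\<phi> t = pair_of (f t) (\<lambda>x. 0) \<bullet> ?\<phi> t"
    unfolding g by (rule V.proj_inner[OF emb_solenoidal[OF S]])
   also have "\<dots> = (LINT x|lebesgue_on \<Omega>. f t x \<bullet> \<phi> t x)"
    unfolding emb_test[OF td]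
    by (subst inner_pair_of) (auto intro: elim Lp_space_zero Lp_space_scaleR test_is_weak_gradient[OF td])
   finally show ?case .
  qed
  have m: "(\<lambda>t. g t \<bullet> ?\<phi> t) \<in> borel_measurable ?M" using approximated_inner(1)[OF a c\<phi>] by simp
  show ?thesis
   by (rule integral_cong_AE[OF m _ ae])
     (rule borel_measurable_lebesgue_on_AE[OF _ m], simp, use ae in \<open>auto elim: eventually_mono\<close>)
 qed
 have s0: "emb v0 \<bullet> ?\<phi> 0 = (LINT x|lebesgue_on \<Omega>. v0 x \<bullet> \<phi> 0 x)
    + \<kappa> * (LINT x|lebesgue_on \<Omega>. weak_gradient \<Omega> v0 x \<bullet> jacobian (\<phi> 0) (at x))"
  by (rule inner_emb_test[OF emb_V_space(1)[OF v0] solenoidal_testD[OF C(1)]]) (use T in simp)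
 show ?thesis using parts unfolding s12 s34 sf s0 by linarith
qed

lemma primitive_in_Vhat:
 fixes g :: "real \<Rightarrow> 4 pair_L2"
 assumes a: "approximated T Vhat B g s" shows "primitive T g t \<in> Vhat"
 unfolding primitive_def
 by (rule time_integral(4)[OF approximated_restrict[OF a subspace_Vhat] subspace_Vhat V.cl]) simp

lemma integral_in_Vhat:
 fixes R :: "real \<Rightarrow> 4 pair_L2"
 assumes "continuous_on {a..b} R" "\<And>t. t \<in> {a..b} \<Longrightarrow> R t \<in> Vhat"
 shows "integral {a..b} R \<in> Vhat"
proof -
 have "integral {a..b} R = integral {a..b} (proj Vhat \<circ> R)"
  by (rule integral_cong) (simp add: V.proj_id assms(2))
 also have "\<dots> = proj Vhat (integral {a..b} R)"
  by (rule integral_linear[OF integrable_continuous_real[OF assms(1)] V.proj_bounded_linear])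
 finally show ?thesis by (metis V.proj_in)
qed

text \<open>
 The solution is the velocity field of the solution \<open>V\<close> of the integrated equation in \<open>Vhat\<close>, and
 its time derivative is that of \<open>rhs (V t) + g t\<close>.
\<close>

theorem weak_solution_exists:
 fixes f :: "real \<Rightarrow> real^4 \<Rightarrow> real^4"
 assumes T: "0 < T" and v0: "v0 \<in> V_space \<Omega>"
  and f: "f \<in> Bochner_Lp r T (Lp_space r \<Omega>) (Lp_norm r \<Omega>)" and r: "2 \<le> r"
 shows "\<exists>v. weak_solution \<Omega> T \<nu> \<kappa> p f v0 v \<and> v \<in> continuous_into T (V_space \<Omega>) (V_norm \<Omega>)"
proof -
 let ?M = "time_measure T"
 interpret finite_measure ?M by (rule time_measure_finite)
 define g where "g = (\<lambda>t. proj Vhat (pair_of (f t) (\<lambda>x. 0)))"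
 obtain B s where a: "approximated T Vhat B g s" and B2: "integrable ?M (\<lambda>t. (B t)\<^sup>2)"
  and f2: "AE t in ?M. f t \<in> Lp_space 2 \<Omega>"
  using forcing_approximated[OF f r] unfolding g_def by blast
 note ev0 = emb_V_space[OF v0]
 have "continuous_on {0..T} (\<lambda>t. emb v0 + primitive T g t)"
  by (intro continuous_on_add continuous_on_const primitive_continuous[OF a subspace_Vhat])
 from voigt_ode[OF this T] obtain V where cV: "continuous_on {0..T} V"
  and V: "\<And>t. t \<in> {0..T} \<Longrightarrow> V t = emb v0 + primitive T g t + integral {0..t} (\<lambda>s. rhs (V s))" by blast
 have cR: "continuous_on S (\<lambda>t. rhs (V t))" if "S \<subseteq> {0..T}" for S
  by (rule continuous_on_compose2[OF rhs_continuous[of UNIV] continuous_on_subset[OF cV that]]) auto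
 have VV: "V t \<in> Vhat" if t: "t \<in> {0..T}" for t
  unfolding V[OF t]
  by (intro subspace_add[OF subspace_Vhat] ev0 primitive_in_Vhat[OF a] integral_in_Vhat cR rhs_in) (use t in auto)
 obtain CV where CV: "CV > 0" "\<And>t. t \<in> {0..T} \<Longrightarrow> norm (V t) \<le> CV" using continuous_interval_bounded[OF cV] by blast
 obtain CR where CR: "CR > 0" "\<And>t. t \<in> {0..T} \<Longrightarrow> norm (rhs (V t)) \<le> CR"
  using continuous_interval_bounded[OF cR[OF order_refl]] by blast
 note aV = approximated_continuous[OF T cV VV CV(2)]
 have aR: "approximated T Vhat (\<lambda>t. CR) (\<lambda>t. rhs (V t)) (\<lambda>n t. rhs (V (grid T n t)))"
  by (rule approximated_continuous[OF T cR[OF order_refl] rhs_in CR(2)])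
 note aW = approximated_add[OF aR a subspace_Vhat]
 define v where "v t = vel (V t)" for t
 define w where "w = (\<lambda>t. vel (rhs (V t) + g t))"
 have p2: "0 < p" "p \<le> 2" using p by auto
 have vW: "v t \<in> W1p_space 2 \<Omega>" if "t \<in> {0..T}" for t unfolding v_def by (rule vel_W1p[OF Vhat_grad[OF VV[OF that]]])
 have vsm: "strongly_measurable ?M (Vp_space q \<Omega>) N v" if "seminorm_le N K" "0 < q" "q \<le> 2" for N K q
  unfolding v_def[abs_def] by (rule strongly_measurable_represents[OF aV represents_vel[OF aV] that(2,3,1)])
 have Linf: "v \<in> Bochner_Linf T (V_space \<Omega>) (V_norm \<Omega>)"
  unfolding Bochner_Linf_def mem_Collect_eq
 proof (intro conjI exI[of _ "CV / sqrt \<kappa>"] AE_timeI)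
  show "strongly_measurable ?M (V_space \<Omega>) (V_norm \<Omega>) v" by (rule vsm[OF seminorm_le_V_norm]) auto
  fix t assume "t \<in> {0<..<T}"
  then have t: "t \<in> {0..T}" by simp
  have "V_norm \<Omega> (v t) \<le> norm (V t) / sqrt \<kappa>"
   using norm_bounds(2)[OF vW[OF t]] unfolding v_def emb_vel[OF Vhat_grad[OF VV[OF t]]] .
  also have "\<dots> \<le> CV / sqrt \<kappa>" using CV(2)[OF t] kappa_pos by (intro divide_right_mono) auto
  finally show "V_norm \<Omega> (v t) \<le> CV / sqrt \<kappa>" .
 qed
 have Lp: "v \<in> Bochner_Lp p T (Vp_space p \<Omega>) (W1p_norm p \<Omega>)"
  unfolding Bochner_Lp_def mem_Collect_eq
 proof
  show "strongly_measurable ?M (Vp_space p \<Omega>) (W1p_norm p \<Omega>) v" by (rule vsm[OF seminorm_le_W1p_norm[OF p2] p2])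
  have "continuous_on {0..T} (\<lambda>t. W1p_norm p \<Omega> (v t) powr p)"
   unfolding v_def by (rule continuous_on_compose2[OF W1p_norm_power_continuous[OF p(1) p2(2)] cV]) (use VV in auto)
  then show "integrable ?M (\<lambda>t. W1p_norm p \<Omega> (v t) powr p)" by (rule open_interval_integral(1))
 qed
 have wL: "w \<in> Bochner_Lp 2 T (V_space \<Omega>) (V_norm \<Omega>)"
  unfolding Bochner_Lp_def mem_Collect_eq
 proof
  show "strongly_measurable ?M (V_space \<Omega>) (V_norm \<Omega>) w"
   unfolding w_def by (rule strongly_measurable_represents[OF aW represents_vel[OF aW] _ _ seminorm_le_V_norm]) auto
  show "integrable ?M (\<lambda>t. V_norm \<Omega> (w t) powr 2)"
  proof (rule Bochner_Integration.integrable_bound[where f="\<lambda>t. 2 / \<kappa> * (CR\<^sup>2 + (B t)\<^sup>2)"])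
   show "integrable ?M (\<lambda>t. 2 / \<kappa> * (CR\<^sup>2 + (B t)\<^sup>2))" using B2 by simp
   show "(\<lambda>t. V_norm \<Omega> (w t) powr 2) \<in> borel_measurable ?M"
    unfolding w_def by (rule approximated_compose_measurable[OF aW V.cl V_norm_power_continuous])
   show "AE t in ?M. norm (V_norm \<Omega> (w t) powr 2) \<le> norm (2 / \<kappa> * (CR\<^sup>2 + (B t)\<^sup>2))"
    using approximated_bound[OF aW] approximated_closed[OF aW V.cl]
   proof eventually_elim
    case (elim t)
    have N0: "0 \<le> V_norm \<Omega> (w t)" by (simp add: V_norm_def Lp_norm_nonneg)
    have "V_norm \<Omega> (w t) \<le> norm (rhs (V t) + g t) / sqrt \<kappa>"
     using norm_bounds(2)[OF vel_W1p[OF Vhat_grad[OF elim(2)]]] unfolding w_def emb_vel[OF Vhat_grad[OF elim(2)]] .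
    also have "\<dots> \<le> (CR + B t) / sqrt \<kappa>" using elim(1) kappa_pos by (intro divide_right_mono) auto
    finally have "(V_norm \<Omega> (w t))\<^sup>2 \<le> ((CR + B t) / sqrt \<kappa>)\<^sup>2" using N0 by (rule power_mono)
    also have "\<dots> = (CR + B t)\<^sup>2 / \<kappa>" using kappa_pos by (simp add: power_divide)
    also have "\<dots> \<le> (2 * (CR\<^sup>2 + (B t)\<^sup>2)) / \<kappa>"
     using kappa_pos sum_squares_bound[of CR "B t"] by (intro divide_right_mono) (auto simp: power2_sum)
    finally show ?case using N0 kappa_pos by (simp add: powr_2_eq)
   qed
  qed
 qed
 have deriv: "is_weak_time_derivative T (V_space \<Omega>) (V_norm \<Omega>) v w"
  unfolding v_def[abs_def] w_def by (rule weak_time_derivative_vel[OF T a cR[OF order_refl] rhs_in VV cV V])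
 have V0: "V 0 = emb v0"
 proof -
  have "primitive T g 0 \<bullet> primitive T g 0 = 0" unfolding primitive_inner[OF a subspace_Vhat] by simp
  then show ?thesis using V[of 0] T by simp
 qed
 have init: "((\<lambda>t. LINT x|lebesgue_on \<Omega>. v t x \<bullet> \<psi> x) \<longlongrightarrow> (LINT x|lebesgue_on \<Omega>. v0 x \<bullet> \<psi> x)) (at_right 0)"
  if \<psi>: "\<psi> \<in> solenoidal_test \<Omega>" for \<psi>
 proof -
  let ?\<psi> = "pair_of \<psi> (\<lambda>x. 0)"
  have L: "\<psi> \<in> Lp_space 2 \<Omega>" by (rule test_is_weak_gradient(1)[OF solenoidal_testD[OF \<psi>]])
  have "((\<lambda>t. V t \<bullet> ?\<psi>) \<longlongrightarrow> V 0 \<bullet> ?\<psi>) (at 0 within {0..T})"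
   using cV T by (intro tendsto_intros) (auto simp: continuous_on_def)
  moreover have "V 0 \<bullet> ?\<psi> = (LINT x|lebesgue_on \<Omega>. v0 x \<bullet> \<psi> x)"
   unfolding V0 emb_def
   by (subst inner_pair_of) (auto intro: W1pD[OF ev0(1)] Lp_space_scaleR L Lp_space_zero)
  ultimately have "((\<lambda>t. V t \<bullet> ?\<psi>) \<longlongrightarrow> (LINT x|lebesgue_on \<Omega>. v0 x \<bullet> \<psi> x)) (at_right 0)"
   by (simp add: at_within_Icc_at_right T)
  moreover have "\<forall>\<^sub>F t in at_right 0. V t \<bullet> ?\<psi> = (LINT x|lebesgue_on \<Omega>. v t x \<bullet> \<psi> x)"
   unfolding eventually_at_right_field v_def
   by (intro exI[of _ T] conjI allI impI inner_pair_of_velocity VV L) (use T in auto)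
  ultimately show ?thesis by (rule Lim_transform_eventually)
 qed
 have cont: "v \<in> continuous_into T (V_space \<Omega>) (V_norm \<Omega>)"
  unfolding continuous_into_def mem_Collect_eq
 proof (intro ballI conjI)
  fix t assume t: "t \<in> {0..T}"
  show "v t \<in> V_space \<Omega>" unfolding v_def by (rule vel_Vp_space[OF VV[OF t]]) auto
  have "((\<lambda>r. 1 / sqrt \<kappa> * norm (V r - V t)) \<longlongrightarrow> 1 / sqrt \<kappa> * norm (V t - V t)) (at t within {0..T})"
   using cV t by (intro tendsto_intros) (auto simp: continuous_on_def)
  then have z: "((\<lambda>r. 1 / sqrt \<kappa> * norm (V r - V t)) \<longlongrightarrow> 0) (at t within {0..T})" by simp
  have le: "0 \<le> V_norm \<Omega> (\<lambda>x. v r x - v t x)" "V_norm \<Omega> (\<lambda>x. v r x - v t x) \<le> 1 / sqrt \<kappa> * norm (V r - V t)"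
   if "r \<in> {0..T}" for r
   using seminorm_diff[OF seminorm_le_V_norm vW[OF t] VV[OF that]] unfolding v_def emb_vel[OF Vhat_grad[OF VV[OF t]]] .
  show "((\<lambda>r. V_norm \<Omega> (\<lambda>x. v r x - v t x)) \<longlongrightarrow> 0) (at t within {0..T})"
  proof (rule tendsto_sandwich[OF _ _ tendsto_const z])
   show "\<forall>\<^sub>F r in at t within {0..T}. 0 \<le> V_norm \<Omega> (\<lambda>x. v r x - v t x)"
    unfolding eventually_at_filter by (rule always_eventually) (use le in blast)
   show "\<forall>\<^sub>F r in at t within {0..T}. V_norm \<Omega> (\<lambda>x. v r x - v t x) \<le> 1 / sqrt \<kappa> * norm (V r - V t)"
    unfolding eventually_at_filter by (rule always_eventually) (use le in blast)
  qed
 qed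
 have "weak_solution \<Omega> T \<nu> \<kappa> p f v0 v"
  unfolding weak_solution_def
 proof (intro conjI ballI)
  show "\<exists>w\<in>Bochner_Lp 2 T (V_space \<Omega>) (V_norm \<Omega>). is_weak_time_derivative T (V_space \<Omega>) (V_norm \<Omega>) v w"
   using deriv wL by blast
 qed (rule Linf Lp init weak_formulation[OF T v0 a g_def f2 cV VV V, folded v_def] | assumption)+
 with cont show ?thesis by blast
qed

end

theorem theorem3p3:
 fixes \<Omega> :: "(real^4) set"
  and T \<nu> \<kappa> p p' :: real
  and v0 :: "real^4 \<Rightarrow> real^4"
  and f :: "real \<Rightarrow> real^4 \<Rightarrow> real^4"
 assumes "0 < T" and "0 < \<nu>" and "0 < \<kappa>"
  and "bounded_C2_domain \<Omega>"
  and "4 / 3 < p" and "p < 2"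
  and "p' = p / (p - 1)"
  and "v0 \<in> V_space \<Omega> \<inter> Vp_space p \<Omega>"
  and "f \<in> Bochner_Lp p' T (Lp_space p' \<Omega>) (Lp_norm p' \<Omega>)"
 shows "\<exists>v. weak_solution \<Omega> T \<nu> \<kappa> p f v0 v \<and>
       v \<in> continuous_into T (V_space \<Omega>) (V_norm \<Omega>) \<and>
       v \<in> Bochner_Lp p T (Vp_space p \<Omega>) (W1p_norm p \<Omega>)"
proof -
 interpret voigt4 \<Omega> \<kappa> \<nu> p
  by unfold_locales (use assms in \<open>auto simp: bounded_C2_domain_def\<close>)
 have "2 \<le> p'" using assms by (simp add: pos_le_divide_eq)
 then obtain v where v: "weak_solution \<Omega> T \<nu> \<kappa> p f v0 v" "v \<in> continuous_into T (V_space \<Omega>) (V_norm \<Omega>)"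
  using weak_solution_exists[OF assms(1) _ assms(9)] assms(8) by blast
 moreover have "v \<in> Bochner_Lp p T (Vp_space p \<Omega>) (W1p_norm p \<Omega>)"
  using v(1) by (simp add: weak_solution_def)
 ultimately show ?thesis by blast
qed

end
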